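(* Let $p_1,p_2,q_1,q_2,p,q\in(0,\infty]$, $\tau\in[0,1]$, $m,m_1,m_2\in\mathscr{P}(\mathbb{R}^{2d})$. For $\tau\in(0,1)$ denote $\widetilde m(\zeta_1,\zeta_2)=m((1-\tau)\zeta_1,\tau\zeta_2)$ and $\widetilde{m_2}(z_1,z_2)=m_2\big(\tfrac{1-\tau}{\tau}z_1,\tfrac{\tau}{1-\tau}z_2\big)$. Then $$W_\tau:\mathcal{M}^{p_1,q_1}_{m_1}(\mathbb{R}^d)\times\mathcal{M}^{p_2,q_2}_{m_2}(\mathbb{R}^d)\longrightarrow W(\mathscr{F}L^p,L^q_m)(\mathbb{R}^{2d})$$ if and only if there is $C>0$ such that for all sequences $\vec a=(a_{k_1,k_2})$, $\vec b=(b_{k_1,k_2})$ indexed by $\mathbb{Z}^d\times\mathbb{Z}^d$: $$\|(a_{k_1,k_2}b_{n_1-k_1,n_2-k_2})\|_{l^{p,q}_{1\otimes\widetilde m}}\le C\|\vec a\|_{l^{p_1,q_1}_{m_1}(\mathbb{Z}^{2d})}\|\vec b\|_{l^{p_2,q_2}_{\widetilde{m_2}}(\mathbb{Z}^{2d})}\qquad\text{if }\tau\in(0,1),$$ $$\|(a_{n_1,k_1}b_{k_2,n_2})\|_{l^{p,q}_{1\otimes m}}\le C\|\vec a\|_{l^{p_1,q_1}_{m_1}(\mathbb{Z}^{2d})}\|\vec b\|_{l^{p_2,q_2}_{m_2}(\mathbb{Z}^{2d})}\qquad\text{if }\tau=0,$$ $$\|(a_{n_1,k_1}b_{k_2,n_2})\|_{l^{p,q}_{1\otimes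 m}}\le C\|\vec b\|_{l^{p_1,q_1}_{m_1}(\mathbb{Z}^{2d})}\|\vec a\|_{l^{p_2,q_2}_{m_2}(\mathbb{Z}^{2d})}\qquad\text{if }\tau=1.$$ Here each left-hand norm is the $l^p$ quasi-norm over $(k_1,k_2)\in\mathbb{Z}^{2d}$ (inner) followed by the $l^q$ quasi-norm over $(n_1,n_2)\in\mathbb{Z}^{2d}$ (outer) with weight $\widetilde m(n_1,n_2)$ (respectively $m(n_1,n_2)$). In particular, for $p<\infty$ the condition for $\tau\in(0,1)$ is equivalent to $$l^{p_1/p,q_1/p}_{m_1^p}(\mathbb{Z}^{2d})\ast l^{p_2/p,q_2/p}_{\widetilde{m_2}^p}(\mathbb{Z}^{2d})\subset l^{q/p,q/p}_{\widetilde m^p}(\mathbb{Z}^{2d}).$$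
   Context: $\tau$-Wigner distribution: for $f_1,f_2\in L^2(\mathbb{R}^d)$, $W_\tau(f_1,f_2)(x,\xi)=\int_{\mathbb{R}^d}f_1(x+\tau t)\overline{f_2(x-(1-\tau)t)}e^{-2\pi i\xi\cdot t}\,dt$. Weights: a function $v$ is submultiplicative if $v(z+w)\le v(z)v(w)$; $m$ is $v$-moderate if $m(z+w)\le Cv(z)m(w)$ for all $z,w$. $\mathscr{P}(\mathbb{R}^{n})$ is the set of non-negative (measurable) functions on $\mathbb{R}^n$ that are $v$-moderate for some submultiplicative $v$ of polynomial growth. Function spaces: for $f\in\mathcal{S}'(\mathbb{R}^n)$ and a fixed nonzero $\phi\in\mathcal{S}(\mathbb{R}^n)$, $V_\phi f(x,\xi)=\langle f,M_\xi T_x\phi\rangle$ with $T_xg(t)=g(t-x)$, $M_\xi g(t)=e^{2\pi it\cdot\xi}g(t)$. $M^{p,q}_m(\mathbb{R}^n)$ is the set of $f\in\mathcal{S}'(\mathbb{R}^n)$ with $\|f\|_{M^{p,q}_m}=\big(\int(\int|V_\phi f(x,\xi)|^pm(x,\xi)^pdx)^{q/p}d\xi\big)^{1/q}<\infty$ (usual modification if $p$ or $q$ is $\infty$; different $\phi$ give equivalent quasi-norms). $\mathcal{M}^{p,q}_m(\mathbb{R}^n)$ is the closure of $\mathcal{S}(\mathbb{R}^n)$ in $M^{p,q}_m(\mathbb{R}^n)$. The Wiener amalgam space $W(\mathscr{F}L^p,L^q_m)(\mathbb{R}^{2d})=\mathscr{F}M^{p,q}_{1\otimes m}(\mathbb{R}^{2d})$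 is the set of $F\in\mathcal{S}'(\mathbb{R}^{2d})$ with $\|F\|=\|\mathscr{F}^{-1}F\|_{M^{p,q}_{1\otimes m}}$, i.e. (up to equivalence) $\big(\int_{\mathbb{R}^{2d}}(\int_{\mathbb{R}^{2d}}|V_\Phi F(\zeta,-z)|^pdz)^{q/p}m(\zeta)^qd\zeta\big)^{1/q}<\infty$ for a nonzero $\Phi\in\mathcal{S}(\mathbb{R}^{2d})$, where $(1\otimes m)(z,\zeta)=m(\zeta)$. Boundedness notation: $W_\tau:\mathcal{M}^{p_1,q_1}_{m_1}\times\mathcal{M}^{p_2,q_2}_{m_2}\to X$ means there is $C>0$ with $\|W_\tau(f_1,f_2)\|_X\le C\|f_1\|_{M^{p_1,q_1}_{m_1}}\|f_2\|_{M^{p_2,q_2}_{m_2}}$ for all $f_1,f_2\in\mathcal{S}(\mathbb{R}^d)$. Discrete spaces: $\|\vec a\|_{l^{p,q}_m(\mathbb{Z}^{2d})}=\big(\sum_{n\in\mathbb{Z}^d}(\sum_{k\in\mathbb{Z}^d}|a_{k,n}|^pm(k,n)^p)^{q/p}\big)^{1/q}$ (usual modifications). $X\ast Y\subset Z$ means there is $C>0$ with $\|\vec a\ast\vec b\|_Z\le C\|\vec a\|_X\|\vec b\|_Y$ for all $\vec a\in X,\vec b\in Y$, where $(\vec a\ast\vec b)_n=\sum_ka_kb_{n-k}$ (the series converging absolutely).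
   Formalization: The final convolution equivalence is stated for m not identically zero; for m = 0 it fails (m_1 = m_2 = 1, all p_i, q_i infinite, p = 1: the inequality is trivial but a∗b need not converge absolutely for a = b = 1). *)

theory Defs
  imports "HOL-Analysis.Analysis"
begin

section \<open>Schwartz functions and functionals on them\<close>

primrec iter_pderiv :: "'a::euclidean_space list \<Rightarrow> ('a \<Rightarrow> complex) \<Rightarrow> 'a \<Rightarrow> complex" where
  "iter_pderiv [] f = f"
| "iter_pderiv (b # bs) f = (\<lambda>x. frechet_derivative (iter_pderiv bs f) (at x) b)"

text \<open>Lists of basis vectors play the role of multi-indices. Asking every iterated partial
  derivative to be (Frechet) differentiable everywhere is smoothness.\<close>

definition schwartz :: "('a::euclidean_space \<Rightarrow> complex) \<Rightarrow> bool" where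
  "schwartz f \<longleftrightarrow> (\<forall>bs. set bs \<subseteq> Basis \<longrightarrow>
     (\<forall>x. iter_pderiv bs f differentiable (at x)) \<and>
     (\<forall>N::nat. bounded (range (\<lambda>x. (1 + norm x) ^ N *\<^sub>R iter_pderiv bs f x))))"

text \<open>A tempered distribution is a (continuous, complex linear) functional on Schwartz functions;
  it is represented by a functional on all functions of which only the values at
  Schwartz functions matter. The functional itself is bilinear in (distribution, test function);
  the bracket extending the \<open>L\<^sup>2\<close> inner product is conjugate linear in the test function.\<close>

type_synonym 'a functional = "('a \<Rightarrow> complex) \<Rightarrow> complex"

definition functional_of :: "('a::euclidean_space \<Rightarrow> complex) \<Rightarrow> 'a functional" where
  "functional_of f = (\<lambda>g. \<integral>x. f x * g x \<partial>lborel)"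

definition bracket :: "'a functional \<Rightarrow> ('a \<Rightarrow> complex) \<Rightarrow> complex" where
  "bracket u g = u (\<lambda>x. cnj (g x))"

definition inv_fourier :: "('a::euclidean_space \<Rightarrow> complex) \<Rightarrow> 'a \<Rightarrow> complex" where
  "inv_fourier f = (\<lambda>x. \<integral>\<xi>. f \<xi> * cis (2 * pi * (x \<bullet> \<xi>)) \<partial>lborel)"

definition inv_fourier_functional :: "'a::euclidean_space functional \<Rightarrow> 'a functional" where
  "inv_fourier_functional u = (\<lambda>g. u (inv_fourier g))"

section \<open>Short-time Fourier transform and \<tau>-Wigner distribution\<close>

definition translation :: "'a::euclidean_space \<Rightarrow> ('a \<Rightarrow> complex) \<Rightarrow> 'a \<Rightarrow> complex" where
  "translation x g = (\<lambda>t. g (t - x))"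

definition modulation :: "'a::euclidean_space \<Rightarrow> ('a \<Rightarrow> complex) \<Rightarrow> 'a \<Rightarrow> complex" where
  "modulation \<xi> g = (\<lambda>t. cis (2 * pi * (t \<bullet> \<xi>)) * g t)"

definition stft :: "('a::euclidean_space \<Rightarrow> complex) \<Rightarrow> 'a functional \<Rightarrow> 'a \<Rightarrow> 'a \<Rightarrow> complex" where
  "stft \<phi> u x \<xi> = bracket u (modulation \<xi> (translation x \<phi>))"

definition wigner ::
  "real \<Rightarrow> ('a::euclidean_space \<Rightarrow> complex) \<Rightarrow> ('a \<Rightarrow> complex) \<Rightarrow> 'a \<times> 'a \<Rightarrow> complex" where
  "wigner \<tau> f1 f2 = (\<lambda>(x, \<xi>). \<integral>t. f1 (x + \<tau> *\<^sub>R t) * cnj (f2 (x - (1 - \<tau>) *\<^sub>R t))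
     * cis (- 2 * pi * (\<xi> \<bullet> t)) \<partial>lborel)"

section \<open>Weights\<close>

definition submultiplicative :: "('a::real_vector \<Rightarrow> real) \<Rightarrow> bool" where
  "submultiplicative v \<longleftrightarrow> (\<forall>z w. v (z + w) \<le> v z * v w)"

definition moderate :: "('a::real_vector \<Rightarrow> real) \<Rightarrow> ('a \<Rightarrow> real) \<Rightarrow> bool" where
  "moderate v m \<longleftrightarrow> (\<exists>C>0. \<forall>z w. m (z + w) \<le> C * v z * m w)"

definition polynomial_growth :: "('a::real_normed_vector \<Rightarrow> real) \<Rightarrow> bool" where
  "polynomial_growth v \<longleftrightarrow> (\<exists>K. \<exists>N::nat. \<forall>z. v z \<le> K * (1 + norm z) ^ N)"

definition poly_moderate_weights :: "('a::euclidean_space \<Rightarrow> real) set" where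
  "poly_moderate_weights = {m. m \<in> borel_measurable lebesgue \<and> (\<forall>z. 0 \<le> m z) \<and>
     (\<exists>v. (\<forall>z. 0 \<le> v z) \<and> submultiplicative v \<and> polynomial_growth v \<and> moderate v m)}"

definition one_tensor :: "('b \<Rightarrow> real) \<Rightarrow> 'a \<times> 'b \<Rightarrow> real" where
  "one_tensor m = (\<lambda>(z, \<zeta>). m \<zeta>)"

definition dilate_weight ::
  "real \<Rightarrow> real \<Rightarrow> ('a::real_vector \<times> 'a \<Rightarrow> real) \<Rightarrow> 'a \<times> 'a \<Rightarrow> real" where
  "dilate_weight s t m = (\<lambda>(z1, z2). m (s *\<^sub>R z1, t *\<^sub>R z2))"

definition weight_power :: "('a \<Rightarrow> real) \<Rightarrow> ennreal \<Rightarrow> 'a \<Rightarrow> real" where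
  "weight_power m p = (\<lambda>z. m z powr enn2real p)"

section \<open>Mixed quasi-norms\<close>

text \<open>Exponents range over \<open>(0, \<infinity>]\<close> and norms take values in \<open>[0, \<infinity>]\<close>.
  For \<open>p = \<infinity>\<close> this is the essential supremum, and the plain supremum
  over a counting measure.\<close>

definition ennpowr :: "ennreal \<Rightarrow> real \<Rightarrow> ennreal" where
  "ennpowr x r = (if x = \<infinity> then \<infinity> else ennreal (enn2real x powr r))"

definition Lp_norm :: "ennreal \<Rightarrow> 'a measure \<Rightarrow> ('a \<Rightarrow> ennreal) \<Rightarrow> ennreal" where
  "Lp_norm p M f =
     (if p = \<infinity> then Inf {c. AE x in M. f x \<le> c}
      else ennpowr (\<integral>\<^sup>+x. ennpowr (f x) (enn2real p) \<partial>M) (1 / enn2real p))"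

definition mixed_norm ::
  "ennreal \<Rightarrow> ennreal \<Rightarrow> 'a measure \<Rightarrow> 'b measure \<Rightarrow> ('a \<times> 'b \<Rightarrow> ennreal) \<Rightarrow> ennreal" where
  "mixed_norm p q M N F = Lp_norm q N (\<lambda>y. Lp_norm p M (\<lambda>x. F (x, y)))"

definition modulation_norm ::
  "('a::euclidean_space \<Rightarrow> complex) \<Rightarrow> ennreal \<Rightarrow> ennreal \<Rightarrow> ('a \<times> 'a \<Rightarrow> real) \<Rightarrow> 'a functional \<Rightarrow> ennreal" where
  "modulation_norm \<phi> p q m u =
     mixed_norm p q lborel lborel (\<lambda>(x, \<xi>). ennreal (cmod (stft \<phi> u x \<xi>) * m (x, \<xi>)))"

text \<open>The quasi-norm of \<open>W(FL\<^sup>p, L\<^sup>q\<^sub>m) = F M\<^sup>p\<^sup>,\<^sup>q\<close> with weight \<open>1 \<otimes> m\<close>.\<close>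

definition amalgam_norm ::
  "('a::euclidean_space \<Rightarrow> complex) \<Rightarrow> ennreal \<Rightarrow> ennreal \<Rightarrow> ('a \<Rightarrow> real) \<Rightarrow> 'a functional \<Rightarrow> ennreal" where
  "amalgam_norm \<Phi> p q m U = modulation_norm \<Phi> p q (one_tensor m) (inv_fourier_functional U)"

text \<open>Boundedness of \<open>W\<^sub>\<tau>\<close> on (closures of) Schwartz functions; \<open>N1\<close>, \<open>N2\<close>, \<open>NX\<close> are the quasi-norms
  of the two domain spaces and of the target space.\<close>

definition wigner_bounded ::
  "real \<Rightarrow> ('a::euclidean_space functional \<Rightarrow> ennreal) \<Rightarrow> ('a functional \<Rightarrow> ennreal) \<Rightarrow>
   (('a \<times> 'a) functional \<Rightarrow> ennreal) \<Rightarrow> bool" where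
  "wigner_bounded \<tau> N1 N2 NX \<longleftrightarrow>
     (\<exists>C::real. C > 0 \<and> (\<forall>f1 f2. schwartz f1 \<longrightarrow> schwartz f2 \<longrightarrow>
        NX (functional_of (wigner \<tau> f1 f2))
          \<le> ennreal C * N1 (functional_of f1) * N2 (functional_of f2)))"

section \<open>Sequence spaces\<close>

definition lattice_point :: "(int ^ 'd) \<times> (int ^ 'd) \<Rightarrow> (real ^ 'd) \<times> (real ^ 'd)" where
  "lattice_point = (\<lambda>(k, n). ((\<chi> i. real_of_int (k $ i)), (\<chi> i. real_of_int (n $ i))))"

text \<open>The weight \<open>w\<close> is already restricted to the index set; for a weight \<open>m\<close> on
  \<open>R\<^sup>2\<^sup>d\<close> take \<open>m \<circ> lattice_point\<close>.\<close>

definition lpq_norm ::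
  "ennreal \<Rightarrow> ennreal \<Rightarrow> ('k \<times> 'n \<Rightarrow> real) \<Rightarrow> ('k \<times> 'n \<Rightarrow> complex) \<Rightarrow> ennreal" where
  "lpq_norm p q w a =
     mixed_norm p q (count_space UNIV) (count_space UNIV) (\<lambda>i. ennreal (cmod (a i) * w i))"

definition seq_conv :: "('g::ab_group_add \<Rightarrow> complex) \<Rightarrow> ('g \<Rightarrow> complex) \<Rightarrow> 'g \<Rightarrow> complex" where
  "seq_conv a b n = (\<Sum>\<^sub>\<infinity>k. a k * b (n - k))"

definition conv_embeds ::
  "(('g::ab_group_add \<Rightarrow> complex) \<Rightarrow> ennreal) \<Rightarrow> (('g \<Rightarrow> complex) \<Rightarrow> ennreal) \<Rightarrow>
   (('g \<Rightarrow> complex) \<Rightarrow> ennreal) \<Rightarrow> bool" where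
  "conv_embeds NX NY NZ \<longleftrightarrow>
     (\<exists>C::real. C > 0 \<and> (\<forall>a b. NX a < \<infinity> \<longrightarrow> NY b < \<infinity> \<longrightarrow>
        (\<forall>n. (\<lambda>k. cmod (a k * b (n - k))) summable_on UNIV) \<and>
        NZ (seq_conv a b) \<le> ennreal C * NX a * NY b))"

end

theory Submission
  imports Defs "HOL-Probability.Probability"
begin

text \<open>The inverse Fourier transform of \<open>W\<^sub>\<tau>(f\<^sub>1, f\<^sub>2)\<close> is an ambiguity function, and with the ambiguity
  function of \<open>\<phi>\<close> as window the modulus of its short-time Fourier transform is a product
  \<open>\<bar>V\<^sub>\<phi> f\<^sub>1\<bar> \<cdot> \<bar>V\<^sub>\<phi> f\<^sub>2\<bar>\<close> evaluated at two linear images of the time-frequency variable. The reproducing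
  formula controls \<open>\<bar>V\<^sub>\<phi> f\<bar>\<close> by its own Peetre maximal function, so that all modulation quasi-norms
  are equivalent to weighted quasi-norms of lattice samples, for all exponents in \<open>(0, \<infinity>]\<close> and without any
  convexity. Sampling the product then shows that the discrete inequality implies boundedness.
  Conversely, for a finitely supported sequence, a sum of time-frequency shifts of \<open>\<phi>\<close> over a
  sparse lattice, with slowly varying coefficients dominating the sequence, is a Schwartz function
  whose transform is comparable to the sequence near each node; inserting two such functions yields the
  discrete inequality, which extends to all sequences by monotone convergence. For \<open>0 < \<tau> < 1\<close>
  the two linear images become \<open>k\<close> and \<open>n - k\<close> in suitable coordinates, for \<open>\<tau> \<in> {0, 1}\<close>
  they permute the coordinates.\<close>

section \<open>Mixed quasi-norms\<close>

text \<open>For exponents below 1 neither Young's inequality nor the triangle inequality is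
  available, so an integral such as the reproducing formula cannot be estimated directly in the
  target norm. Suprema can: the p-th power of a supremum is at most the sum of the p-th powers for
  every p > 0, so a supremum of lattice translates is harmless once the discount decays fast enough.
  This is why integrals are first bounded by a maximal function, and the maximal function by lattice
  values. Bounding it by point samples is an absorption argument: nearby values differ by at most
  half the maximal function, which is finite for the functions in question. With the ambiguity
  window the factorisation is exact, with no integral left over; the given amalgam window is reached
  by a change of window. Regularity is the second obstacle: transforms of ambiguity functions are
  needed, and the class \<open>tame\<close> allows this without differentiating them. The decay of
  the Wigner distribution comes from integration by parts, and Fourier inversion transports
  it.\<close>

lemma ennpowr_ennreal: "0 \<le> x \<Longrightarrow> ennpowr (ennreal x) r = ennreal (x powr r)"
  by (simp add: ennpowr_def)

lemma ennpowr_top [simp]: "ennpowr \<top> r = \<top>"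
  by (simp add: ennpowr_def)

lemma ennpowr_0 [simp]: "ennpowr 0 r = 0"
  by (simp add: ennpowr_def)

lemma ennpowr_eq_0_iff [simp]: "ennpowr x r = 0 \<longleftrightarrow> x = 0"
  by (cases x) (auto simp: ennpowr_ennreal)

lemma ennpowr_less_top [simp]: "ennpowr x r < \<top> \<longleftrightarrow> x < \<top>"
  by (cases x) (auto simp: ennpowr_ennreal)

lemma ennpowr_mono: "0 \<le> r \<Longrightarrow> x \<le> y \<Longrightarrow> ennpowr x r \<le> ennpowr y r"
  by (cases x; cases y) (auto simp: ennpowr_ennreal ennreal_le_iff powr_mono2 top_unique)

lemma ennpowr_mult: "ennpowr (x * y) r = ennpowr x r * ennpowr y r"
proof (cases "x = \<top> \<or> y = \<top>")
  case True
  then show ?thesis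
    by (cases "x = 0"; cases "y = 0") (auto simp: ennreal_mult_top ennreal_top_mult ennreal_mult_eq_top_iff)
next
  case False
  then obtain a b where "x = ennreal a" "0 \<le> a" "y = ennreal b" "0 \<le> b"
    by (cases x; cases y) auto
  then show ?thesis
    by (simp add: ennreal_mult'[symmetric] ennpowr_ennreal powr_mult)
qed

lemma ennpowr_ennpowr: "ennpowr (ennpowr x r) s = ennpowr x (r * s)"
  by (cases x) (auto simp: ennpowr_ennreal powr_powr)

lemma ennpowr_1 [simp]: "ennpowr x 1 = x"
  by (cases x) (auto simp: ennpowr_ennreal)

lemma ennpowr_le_iff:
  assumes "0 < r"
  shows "ennpowr x r \<le> y \<longleftrightarrow> x \<le> ennpowr y (1 / r)"
proof
  assume "ennpowr x r \<le> y"
  from ennpowr_mono[OF _ this, of "1 / r"] assms show "x \<le> ennpowr y (1 / r)"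
    by (simp add: ennpowr_ennpowr)
next
  assume "x \<le> ennpowr y (1 / r)"
  from ennpowr_mono[OF _ this, of r] assms show "ennpowr x r \<le> y"
    by (simp add: ennpowr_ennpowr)
qed

lemma ennpowr_SUP:
  assumes "0 < r"
  shows "ennpowr (SUP i\<in>I. f i) r = (SUP i\<in>I. ennpowr (f i) r)"
proof (rule antisym)
  show "ennpowr (SUP i\<in>I. f i) r \<le> (SUP i\<in>I. ennpowr (f i) r)"
    unfolding ennpowr_le_iff[OF assms]
    by (rule SUP_least) (subst ennpowr_le_iff[OF assms, symmetric], rule SUP_upper)
  show "(SUP i\<in>I. ennpowr (f i) r) \<le> ennpowr (SUP i\<in>I. f i) r"
    using assms by (intro SUP_least ennpowr_mono SUP_upper) auto
qed

lemma exponent_pos: "0 < p \<Longrightarrow> p \<noteq> \<top> \<Longrightarrow> 0 < enn2real (p :: ennreal)"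
  by (simp add: enn2real_positive_iff top.not_eq_extremum)

lemma Lp_norm_mono:
  assumes "0 < p" "\<And>x. x \<in> space M \<Longrightarrow> f x \<le> g x"
  shows "Lp_norm p M f \<le> Lp_norm p M g"
proof (cases "p = \<top>")
  case True
  have "{c. AE x in M. g x \<le> c} \<subseteq> {c. AE x in M. f x \<le> c}"
  proof (intro Collect_mono impI)
    fix c assume "AE x in M. g x \<le> c"
    then show "AE x in M. f x \<le> c"
      by (rule AE_mp) (use assms(2) in \<open>auto intro!: AE_I2 intro: order_trans\<close>)
  qed
  with True show ?thesis
    by (simp add: Lp_norm_def Inf_superset_mono)
next
  case False
  then show ?thesis
    using assms exponent_pos[OF assms(1)] unfolding Lp_norm_def
    by (auto intro!: ennpowr_mono nn_integral_mono)
qed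

lemma Lp_norm_top_count_space: "Lp_norm \<top> (count_space A) f = (SUP x\<in>A. f x)"
  unfolding Lp_norm_def
  by (auto simp: AE_count_space intro!: antisym Inf_lower Inf_greatest SUP_upper SUP_least)

lemma Lp_norm_count_space:
  "p \<noteq> \<top> \<Longrightarrow> Lp_norm p (count_space A) f =
     ennpowr (\<integral>\<^sup>+x. ennpowr (f x) (enn2real p) \<partial>count_space A) (1 / enn2real p)"
  by (simp add: Lp_norm_def)

lemma Lp_norm_cmult:
  assumes "0 < p"
  shows "Lp_norm p (count_space A) (\<lambda>x. c * f x) = c * Lp_norm p (count_space A) f"
proof (cases "p = \<top>")
  case True
  then show ?thesis
    by (simp add: Lp_norm_top_count_space SUP_mult_left_ennreal)
next
  case False
  then show ?thesis using exponent_pos[OF assms]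
    by (simp add: Lp_norm_count_space ennpowr_mult nn_integral_cmult ennpowr_ennpowr)
qed

lemma Lp_norm_distr:
  assumes "g \<in> borel_measurable N" and [measurable]: "T \<in> measurable M N" and "0 < p"
  shows "Lp_norm p (distr M N T) g = Lp_norm p M (\<lambda>x. g (T x))"
proof -
  note [measurable] = assms(1)
  have [measurable]: "(\<lambda>x. ennpowr (g x) r) \<in> borel_measurable N" for r
    unfolding ennpowr_def by measurable
  show ?thesis
    unfolding Lp_norm_def by (simp add: nn_integral_distr AE_distr_iff)
qed

text \<open>Counting preimages: each value of \<open>f\<close> is met at most \<open>c\<close>
  times, so the sum of p-th powers grows by at most the factor \<open>c\<close>. Linear maps
  followed by rounding are not injective on the lattice, hence the multiplicity.\<close>

lemma Lp_norm_reindex: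
  assumes p: "0 < p" and "countable A'" and \<kappa>: "\<And>x. x \<in> A \<Longrightarrow> \<kappa> x \<in> A'"
    and fibre: "\<And>y. y \<in> A' \<Longrightarrow> finite {x \<in> A. \<kappa> x = y} \<and> card {x \<in> A. \<kappa> x = y} \<le> c" and "0 < c"
  shows "Lp_norm p (count_space A) (\<lambda>x. f (\<kappa> x))
    \<le> ennpowr (of_nat c) (1 / enn2real p) * Lp_norm p (count_space A') f"
proof (cases "p = \<top>")
  case True
  \<comment> \<open>\<open>enn2real\<close> sends the infinite exponent to 0 and 1 / 0 is 0, so the
    constant of the statement becomes \<open>c\<close> to the power 0. This is 1 only for positive
    \<open>c\<close>, because \<open>0 powr 0\<close> is 0.\<close>
  have "ennpowr (of_nat c) 0 = 1"
    using \<open>0 < c\<close> by (simp add: ennreal_of_nat_eq_real_of_nat ennpowr_ennreal)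
  with True \<kappa> show ?thesis
    by (auto simp: Lp_norm_top_count_space intro!: SUP_least SUP_upper)
next
  case False
  define g where "g y = ennpowr (f y) (enn2real p)" for y
  have "(\<integral>\<^sup>+x. g (\<kappa> x) \<partial>count_space A)
      = (\<integral>\<^sup>+x. (\<integral>\<^sup>+y. g y * indicator {\<kappa> x} y \<partial>count_space A') \<partial>count_space A)"
  proof (rule nn_integral_cong)
    fix x assume "x \<in> space (count_space A)"
    then show "g (\<kappa> x) = (\<integral>\<^sup>+y. g y * indicator {\<kappa> x} y \<partial>count_space A')"
      using \<kappa> by (subst nn_integral_count_space'[where A = "{\<kappa> x}"]) auto
  qed
  also have "\<dots> = (\<integral>\<^sup>+y. (\<integral>\<^sup>+x. g y * indicator {\<kappa> x} y \<partial>count_space A) \<partial>count_space A')"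
    using assms(2) by (intro nn_integral_count_space_nn_integral) auto
  also have "\<dots> \<le> (\<integral>\<^sup>+y. of_nat c * g y \<partial>count_space A')"
  proof (rule nn_integral_mono)
    fix y assume "y \<in> space (count_space A')"
    then have y: "finite {x \<in> A. \<kappa> x = y}" "card {x \<in> A. \<kappa> x = y} \<le> c"
      using fibre by auto
    have "(\<integral>\<^sup>+x. g y * indicator {\<kappa> x} y \<partial>count_space A) = (\<Sum>x | x \<in> A \<and> \<kappa> x = y. g y * indicator {\<kappa> x} y)"
      using y by (intro nn_integral_count_space') (auto split: split_indicator)
    also have "\<dots> = of_nat (card {x \<in> A. \<kappa> x = y}) * g y"
      by simp
    also have "\<dots> \<le> of_nat c * g y"
      using y by (intro mult_right_mono) auto
    finally show "(\<integral>\<^sup>+x. g y * indicator {\<kappa> x} y \<partial>count_space A) \<le> of_nat c * g y" .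
  qed
  also have "\<dots> = of_nat c * (\<integral>\<^sup>+y. g y \<partial>count_space A')"
    by (simp add: nn_integral_cmult)
  finally show ?thesis
    using False exponent_pos[OF p] unfolding g_def
    by (simp add: Lp_norm_count_space flip: ennpowr_mult) (auto intro: ennpowr_mono)
qed

text \<open>The substitute for the triangle inequality: the p-th power of a supremum is at most the
  sum of the p-th powers, without any convexity. Exchanging the two sums brings in the p-th powers
  of the given norms.\<close>

lemma Lp_norm_SUP:
  assumes p: "0 < p" and J: "countable J" and "p \<noteq> \<top>"
    and w: "\<And>j. j \<in> J \<Longrightarrow> Lp_norm p (count_space A) (f j) \<le> w j * K"
    and S: "(\<integral>\<^sup>+j. ennpowr (w j) (enn2real p) \<partial>count_space J) \<le> S"
  shows "Lp_norm p (count_space A) (\<lambda>x. SUP j\<in>J. f j x) \<le> ennpowr S (1 / enn2real p) * K"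
proof -
  define r where "r = enn2real p"
  have r: "0 < r"
    using p assms(3) by (simp add: exponent_pos r_def)
  have "(\<integral>\<^sup>+x. ennpowr (SUP j\<in>J. f j x) r \<partial>count_space A)
      \<le> (\<integral>\<^sup>+x. (\<integral>\<^sup>+j. ennpowr (f j x) r \<partial>count_space J) \<partial>count_space A)"
    unfolding ennpowr_SUP[OF r]
    by (intro nn_integral_mono SUP_least) (rule nn_integral_ge_point)
  also have "\<dots> = (\<integral>\<^sup>+j. (\<integral>\<^sup>+x. ennpowr (f j x) r \<partial>count_space A) \<partial>count_space J)"
    using J by (intro nn_integral_count_space_nn_integral) auto
  also have "\<dots> \<le> (\<integral>\<^sup>+j. ennpowr (w j) r * ennpowr K r \<partial>count_space J)"
  proof (rule nn_integral_mono)
    fix j assume "j \<in> space (count_space J)"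
    then have "ennpowr (\<integral>\<^sup>+x. ennpowr (f j x) r \<partial>count_space A) (1 / r) \<le> w j * K"
      using w[of j] assms(3) by (simp add: Lp_norm_count_space r_def)
    then show "(\<integral>\<^sup>+x. ennpowr (f j x) r \<partial>count_space A) \<le> ennpowr (w j) r * ennpowr K r"
      using r by (subst (asm) ennpowr_le_iff) (auto simp: ennpowr_mult)
  qed
  also have "\<dots> = (\<integral>\<^sup>+j. ennpowr (w j) r \<partial>count_space J) * ennpowr K r"
    by (simp add: nn_integral_multc)
  also have "\<dots> \<le> S * ennpowr K r"
    using S by (intro mult_right_mono) (auto simp: r_def)
  finally have "ennpowr (\<integral>\<^sup>+x. ennpowr (SUP j\<in>J. f j x) r \<partial>count_space A) (1 / r)
      \<le> ennpowr (S * ennpowr K r) (1 / r)"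
    using r by (intro ennpowr_mono) auto
  then show ?thesis
    using r assms(3) by (simp add: Lp_norm_count_space r_def ennpowr_mult ennpowr_ennpowr)
qed

lemma mixed_norm_mono:
  assumes "0 < p" "0 < q" "\<And>x y. x \<in> space M \<Longrightarrow> y \<in> space N \<Longrightarrow> F (x, y) \<le> G (x, y)"
  shows "mixed_norm p q M N F \<le> mixed_norm p q M N G"
  unfolding mixed_norm_def using assms by (intro Lp_norm_mono) auto

lemma mixed_norm_cong:
  assumes "0 < p" "0 < q" "\<And>x y. x \<in> space M \<Longrightarrow> y \<in> space N \<Longrightarrow> F (x, y) = G (x, y)"
  shows "mixed_norm p q M N F = mixed_norm p q M N G"
  using assms by (intro antisym mixed_norm_mono) auto

lemma mixed_norm_cmult:
  assumes "0 < p" "0 < q"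
  shows "mixed_norm p q (count_space A) (count_space B) (\<lambda>z. c * F z)
    = c * mixed_norm p q (count_space A) (count_space B) F"
  unfolding mixed_norm_def using assms by (simp add: Lp_norm_cmult)

text \<open>The inner map may depend on the outer variable, because the inner norm is taken at fixed
  \<open>y\<close>: only the fibres of \<kappa> at fixed \<open>y\<close> have to be small. This
  admits shears, that is, block triangular changes of variables.\<close>

lemma mixed_norm_reindex:
  assumes p: "0 < p" "0 < q" and A': "countable A'" "countable B'"
    and \<kappa>: "\<And>x y. x \<in> A \<Longrightarrow> y \<in> B \<Longrightarrow> \<kappa> x y \<in> A'" and \<nu>: "\<And>y. y \<in> B \<Longrightarrow> \<nu> y \<in> B'"
    and fib\<kappa>: "\<And>y z. y \<in> B \<Longrightarrow> z \<in> A' \<Longrightarrow> finite {x \<in> A. \<kappa> x y = z} \<and> card {x \<in> A. \<kappa> x y = z} \<le> c"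
    and fib\<nu>: "\<And>z. z \<in> B' \<Longrightarrow> finite {y \<in> B. \<nu> y = z} \<and> card {y \<in> B. \<nu> y = z} \<le> c" and c: "0 < c"
  shows "mixed_norm p q (count_space A) (count_space B) (\<lambda>(x, y). f (\<kappa> x y, \<nu> y))
    \<le> ennpowr (of_nat c) (1 / enn2real p) * ennpowr (of_nat c) (1 / enn2real q)
       * mixed_norm p q (count_space A') (count_space B') f"
proof -
  let ?c = "\<lambda>p. ennpowr (of_nat c) (1 / enn2real p)"
  have "mixed_norm p q (count_space A) (count_space B) (\<lambda>(x, y). f (\<kappa> x y, \<nu> y))
     \<le> Lp_norm q (count_space B) (\<lambda>y. ?c p * Lp_norm p (count_space A') (\<lambda>x. f (x, \<nu> y)))"
    unfolding mixed_norm_def using assms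
    by (auto intro!: Lp_norm_mono Lp_norm_reindex[where f = "\<lambda>x. f (x, \<nu> y)" for y])
  also have "\<dots> \<le> ?c p * (?c q * Lp_norm q (count_space B') (\<lambda>y. Lp_norm p (count_space A') (\<lambda>x. f (x, y))))"
    using assms
    by (auto simp: Lp_norm_cmult intro!: mult_left_mono
        Lp_norm_reindex[where f = "\<lambda>y. Lp_norm p (count_space A') (\<lambda>x. f (x, y))"])
  finally show ?thesis
    by (simp add: mixed_norm_def mult.assoc)
qed

text \<open>Monotone convergence, also for the supremum norm and for exponents below 1. It later
  removes the restriction to finitely supported sequences.\<close>

lemma Lp_norm_incseq:
  assumes p: "0 < p" and "incseq f"
  shows "Lp_norm p (count_space A) (\<lambda>x. SUP i. f i x) = (SUP i. Lp_norm p (count_space A) (f i))"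
proof (cases "p = \<top>")
  case True
  then show ?thesis
    by (simp add: Lp_norm_top_count_space) (rule SUP_commute)
next
  case False
  have r: "0 < enn2real p" "0 < 1 / enn2real p"
    using exponent_pos[OF p False] by auto
  have "incseq (\<lambda>i x. ennpowr (f i x) (enn2real p))"
    using assms(2) r by (auto simp: mono_def le_fun_def intro!: ennpowr_mono)
  then show ?thesis
    using r by (simp add: Lp_norm_count_space[OF False] ennpowr_SUP nn_integral_monotone_convergence_SUP)
qed

lemma mixed_norm_incseq:
  assumes p: "0 < p" "0 < q" and "incseq f"
  shows "mixed_norm p q (count_space A) (count_space B) (\<lambda>z. SUP i. f i z)
    = (SUP i. mixed_norm p q (count_space A) (count_space B) (f i))"
proof -
  have *: "incseq (\<lambda>i x. f i (x, y))" for y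
    using assms(3) by (auto simp: mono_def le_fun_def)
  have "incseq (\<lambda>i y. Lp_norm p (count_space A) (\<lambda>x. f i (x, y)))"
    using p assms(3) by (auto simp: mono_def le_fun_def intro!: Lp_norm_mono)
  then show ?thesis
    unfolding mixed_norm_def using * p by (simp add: Lp_norm_incseq)
qed

section \<open>Polynomial decay and sampling on the integer lattice\<close>

definition decay :: "nat \<Rightarrow> 'a::real_normed_vector \<Rightarrow> real" where
  "decay N z = inverse ((1 + norm z) ^ N)"

lemma decay_pos [simp]: "0 < decay N z" "0 \<le> decay N z" "decay N z \<noteq> 0"
proof -
  show *: "0 < decay N z"
    unfolding decay_def by (simp add: add_pos_nonneg)
  show "0 \<le> decay N z" "decay N z \<noteq> 0"
    using * by linarith+
qed

lemma decay_0 [simp]: "decay N 0 = 1" "decay 0 z = 1"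
  by (simp_all add: decay_def)

lemma decay_minus [simp]: "decay N (- z) = decay N z"
  by (simp add: decay_def)

lemma decay_commute: "decay N (z - w) = decay N (w - z)"
  by (simp add: decay_def norm_minus_commute)

lemma decay_le_1 [simp]: "decay N z \<le> 1"
  by (simp add: decay_def inverse_le_1_iff)

lemma decay_add: "decay (M + N) z = decay M z * decay N z"
  by (simp add: decay_def power_add)

lemma decay_mult_power [simp]: "decay N z * (1 + norm z) ^ N = 1"
  using decay_pos[of N z] by (simp add: decay_def)

lemma decay_antimono: "M \<le> N \<Longrightarrow> decay N z \<le> decay M z"
  by (auto simp: decay_def add_pos_nonneg intro!: le_imp_inverse_le power_increasing)

lemma decay_mono_norm: "norm w \<le> norm z \<Longrightarrow> decay N z \<le> decay N w"
  by (auto simp: decay_def add_pos_nonneg intro!: le_imp_inverse_le power_mono)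

lemma decay_le_scaled:
  assumes "1 + norm w \<le> c * (1 + norm z)"
  shows "decay N z \<le> c ^ N * decay N w"
proof -
  have "(1 + norm w) ^ N \<le> (c * (1 + norm z)) ^ N"
    using assms by (intro power_mono) auto
  then have "(1 + norm w) ^ N * (decay N z * decay N w) \<le> c ^ N * (1 + norm z) ^ N * (decay N z * decay N w)"
    by (intro mult_right_mono) (auto simp: power_mult_distrib)
  moreover have "(1 + norm w) ^ N * (decay N z * decay N w) = decay N z * (decay N w * (1 + norm w) ^ N)"
    "c ^ N * (1 + norm z) ^ N * (decay N z * decay N w) = c ^ N * decay N w * (decay N z * (1 + norm z) ^ N)"
    by (simp_all only: mult_ac)
  ultimately show ?thesis
    by simp
qed

lemma one_plus_norm_add: "1 + norm (z + w) \<le> (1 + norm z) * (1 + norm w)"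
  using norm_triangle_ineq[of z w] by (simp add: algebra_simps) (meson add_left_mono le_add_same_cancel1 mult_nonneg_nonneg norm_ge_zero order_trans)

text \<open>Peetre's inequality in multiplicative form: \<open>1 + norm z\<close> is
  submultiplicative. Decay in two variables can thus be traded for decay in their sum.\<close>

lemma decay_mult_le: "decay N z * decay N w \<le> decay N (z + w)"
proof -
  have "decay N w \<le> (1 + norm z) ^ N * decay N (z + w)"
    using one_plus_norm_add[of z w] by (intro decay_le_scaled) auto
  then have "decay N z * decay N w \<le> decay N z * ((1 + norm z) ^ N * decay N (z + w))"
    by (rule mult_left_mono) simp
  then show ?thesis
    by (simp flip: mult.assoc)
qed

lemma decay_le_shift: "decay N z \<le> (1 + norm (z - w)) ^ N * decay N w"
  using one_plus_norm_add[of "w - z" z] by (intro decay_le_scaled) (auto simp: norm_minus_commute)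

lemma decay_linear_le:
  assumes "0 < c" "\<And>z. c * norm z \<le> norm (T z)"
  shows "decay N (T z) \<le> (1 + 1 / c) ^ N * decay N z"
proof (rule decay_le_scaled)
  have "norm z \<le> norm (T z) / c"
    using assms by (simp add: field_simps)
  also have "1 + norm (T z) / c \<le> (1 + 1 / c) * (1 + norm (T z))"
    using assms(1) by (simp add: algebra_simps)
  finally show "1 + norm z \<le> (1 + 1 / c) * (1 + norm (T z))" by simp
qed

lemma continuous_on_decay [continuous_intros]:
  "continuous_on A f \<Longrightarrow> continuous_on A (\<lambda>x. decay N (f x))"
  unfolding decay_def by (intro continuous_intros) (auto simp: add_nonneg_eq_0_iff)

lemma borel_measurable_decay [measurable]: "decay N \<in> borel_measurable borel"
  by (intro borel_measurable_continuous_onI continuous_intros)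

text \<open>Layering by the integer part k of the norm: on a layer the function is at most (k +
  1)^-(n + 2), while the ball of radius k + 1 has volume proportional to (k + 1)^n, so a convergent
  series of inverse squares remains.\<close>

lemma nn_integral_decay_finite:
  assumes "DIM('a) + 2 \<le> N"
  shows "(\<integral>\<^sup>+x. ennreal (decay N (x::'a::euclidean_space)) \<partial>lborel) < \<infinity>"
proof -
  define n where "n = DIM('a)"
  define c where "c = measure lborel (ball (0::'a) 1)"
  have le: "ennreal (decay N x) \<le> (\<Sum>k. ennreal (1 / (real k + 1) ^ (n + 2)) * indicator (ball 0 (real k + 1)) x)"
    for x :: 'a
  proof -
    define k where "k = nat \<lfloor>norm x\<rfloor>"
    have k: "real k \<le> norm x" "norm x < real k + 1"
      by (auto simp: k_def)
    have "decay N x \<le> decay (n + 2) x"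
      using assms by (intro decay_antimono) (auto simp: n_def)
    also have "\<dots> \<le> 1 / (real k + 1) ^ (n + 2)"
      unfolding decay_def inverse_eq_divide using k by (intro divide_left_mono power_mono mult_pos_pos zero_less_power) (auto simp: add_pos_nonneg)
    finally have "ennreal (decay N x) \<le> ennreal (1 / (real k + 1) ^ (n + 2)) * indicator (ball 0 (real k + 1)) x"
      using k by (auto intro: ennreal_leI)
    also have "\<dots> \<le> (\<Sum>j. ennreal (1 / (real j + 1) ^ (n + 2)) * indicator (ball 0 (real j + 1)) x)"
    proof -
      define g where "g j = ennreal (1 / (real j + 1) ^ (n + 2)) * indicator (ball 0 (real j + 1)) x" for j
      have "g k \<le> suminf g"
        using sum_le_suminf[of g "{k}"] by simp
      then show ?thesis
        by (simp only: g_def[abs_def])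
    qed
    finally show ?thesis .
  qed
  have "(\<integral>\<^sup>+x. ennreal (decay N (x::'a)) \<partial>lborel)
      \<le> (\<integral>\<^sup>+x. (\<Sum>k. ennreal (1 / (real k + 1) ^ (n + 2)) * indicator (ball 0 (real k + 1)) (x::'a)) \<partial>lborel)"
    by (rule nn_integral_mono) (rule le)
  also have "\<dots> = (\<Sum>k. \<integral>\<^sup>+x. ennreal (1 / (real k + 1) ^ (n + 2)) * indicator (ball 0 (real k + 1)) (x::'a) \<partial>lborel)"
    by (intro nn_integral_suminf borel_measurable_times_ennreal borel_measurable_const borel_measurable_indicator) auto
  also have "\<dots> = (\<Sum>k. ennreal (c * (1 / (real k + 1) ^ 2)))"
  proof (rule suminf_cong)
    fix k
    have "emeasure lborel (ball (0::'a) (real k + 1)) = ennreal (measure lborel (ball (0::'a) (real k + 1)))"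
      by (subst emeasure_eq_ennreal_measure) (use emeasure_lborel_ball_finite[of "0::'a" "real k + 1"] in \<open>auto simp: less_top\<close>)
    also have "\<dots> = ennreal ((real k + 1) ^ n * c)"
      unfolding n_def c_def by (subst content_ball_conv_unit_ball) auto
    finally have em: "emeasure lborel (ball (0::'a) (real k + 1)) = ennreal ((real k + 1) ^ n * c)" .
    have "(\<integral>\<^sup>+x. ennreal (1 / (real k + 1) ^ (n + 2)) * indicator (ball 0 (real k + 1)) (x::'a) \<partial>lborel)
      = ennreal (1 / (real k + 1) ^ (n + 2)) * emeasure lborel (ball (0::'a) (real k + 1))"
      by (rule nn_integral_cmult_indicator) simp
    also have "\<dots> = ennreal (1 / (real k + 1) ^ (n + 2) * ((real k + 1) ^ n * c))"
      unfolding em by (rule ennreal_mult[symmetric]) (auto simp: c_def)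
    also have "1 / (real k + 1) ^ (n + 2) * ((real k + 1) ^ n * c) = c * (1 / (real k + 1) ^ 2)"
    proof -
      have "1 / a ^ (n + 2) * (a ^ n * c) = c * (1 / a ^ 2)" if "0 < a" for a :: real
        using that by (simp add: power_add power2_eq_square field_simps)
      from this[of "real k + 1"] show ?thesis by simp
    qed
    finally show "(\<integral>\<^sup>+x. ennreal (1 / (real k + 1) ^ (n + 2)) * indicator (ball 0 (real k + 1)) (x::'a) \<partial>lborel)
      = ennreal (c * (1 / (real k + 1) ^ 2))" .
  qed
  also have "\<dots> < \<infinity>"
  proof -
    have "summable (\<lambda>k. c * (1 / (real k + 1) ^ 2))"
    proof -
      have "summable (\<lambda>k. inverse (real (Suc k) ^ 2))"
        using inverse_power_summable[of 2, where 'a = real] summable_Suc_iff[of "\<lambda>n. inverse (real n ^ 2)"]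
        by simp
      from summable_mult[OF this, of c] show ?thesis
        by (simp add: inverse_eq_divide add.commute)
    qed
    then show ?thesis
      by (simp add: suminf_ennreal2 c_def)
  qed
  finally show ?thesis .
qed

lemma integrable_decay:
  assumes "DIM('a) + 2 \<le> N"
  shows "integrable lborel (\<lambda>x::'a::euclidean_space. decay N x)"
  using nn_integral_decay_finite[OF assms] by (intro integrableI_bounded) auto

section \<open>The integer lattice, its cells and the norms of step functions\<close>

definition int_lattice :: "'a::euclidean_space set" where
  "int_lattice = {x. \<forall>b\<in>Basis. x \<bullet> b \<in> \<int>}"

definition lat_floor :: "'a::euclidean_space \<Rightarrow> 'a" where
  "lat_floor x = (\<Sum>b\<in>Basis. of_int \<lfloor>x \<bullet> b\<rfloor> *\<^sub>R b)"

lemma lat_floor_inner [simp]: "b \<in> Basis \<Longrightarrow> lat_floor x \<bullet> b = of_int \<lfloor>x \<bullet> b\<rfloor>"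
  by (simp add: lat_floor_def inner_sum_left_Basis)

lemma lat_floor_in_lattice [simp]: "lat_floor x \<in> int_lattice"
  by (simp add: int_lattice_def)

lemma lat_floor_lattice: "x \<in> int_lattice \<Longrightarrow> lat_floor x = x"
  by (auto simp: int_lattice_def euclidean_eq_iff[of "lat_floor x"] elim!: Ints_cases dest!: bspec)

lemma lat_floor_eq_iff:
  "j \<in> int_lattice \<Longrightarrow> lat_floor x = j \<longleftrightarrow> (\<forall>b\<in>Basis. j \<bullet> b \<le> x \<bullet> b \<and> x \<bullet> b < j \<bullet> b + 1)"
  unfolding euclidean_eq_iff[of "lat_floor x"] int_lattice_def
  by (intro ball_cong refl) (auto elim!: Ints_cases dest!: bspec simp: floor_eq_iff)

lemma lat_floor_Pair: "lat_floor (x, y) = (lat_floor x, lat_floor y)"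
  by (rule euclidean_eqI) (auto simp: Basis_prod_def)

lemma int_lattice_Times: "(int_lattice :: ('a::euclidean_space \<times> 'b::euclidean_space) set) = int_lattice \<times> int_lattice"
  by (auto simp: int_lattice_def Basis_prod_def ball_Un)

lemma int_lattice_diff: "x \<in> int_lattice \<Longrightarrow> y \<in> int_lattice \<Longrightarrow> x - y \<in> int_lattice"
  by (simp add: int_lattice_def inner_diff_left)

lemma int_lattice_norm_ge_1:
  assumes "x \<in> int_lattice" "x \<noteq> 0"
  shows "1 \<le> norm x"
proof -
  obtain b where b: "b \<in> Basis" "x \<bullet> b \<noteq> 0"
    using assms(2) euclidean_eq_iff[of x 0] by auto
  then have "x \<bullet> b \<in> \<int>"
    using assms(1) by (simp add: int_lattice_def)
  then have "1 \<le> \<bar>x \<bullet> b\<bar>"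
    using b by (intro Ints_nonzero_abs_ge1)
  also have "\<dots> \<le> norm x"
    using b by (simp add: Basis_le_norm)
  finally show ?thesis .
qed

lemma norm_diff_lat_floor: "norm (x - lat_floor (x::'a::euclidean_space)) \<le> DIM('a)"
proof -
  have "norm (x - lat_floor x) \<le> (\<Sum>b\<in>Basis. \<bar>(x - lat_floor x) \<bullet> b\<bar>)"
    by (rule norm_le_l1)
  also have "\<dots> \<le> (\<Sum>b\<in>(Basis::'a set). 1)"
    by (intro sum_mono) (auto simp: inner_diff_left abs_le_iff, linarith+)
  finally show ?thesis by simp
qed

lemma countable_int_lattice [simp]: "countable (int_lattice :: 'a::euclidean_space set)"
proof (rule countable_subset)
  show "(int_lattice :: 'a set) \<subseteq> (\<lambda>f. \<Sum>b\<in>Basis. f b *\<^sub>R b) ` (Basis \<rightarrow>\<^sub>E \<int>)"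
  proof
    fix x :: 'a assume "x \<in> int_lattice"
    then show "x \<in> (\<lambda>f. \<Sum>b\<in>Basis. f b *\<^sub>R b) ` (Basis \<rightarrow>\<^sub>E \<int>)"
      by (intro image_eqI[where x = "restrict (\<lambda>b. x \<bullet> b) Basis"]) (auto simp: int_lattice_def euclidean_representation)
  qed
  show "countable ((\<lambda>f. \<Sum>b\<in>Basis. f b *\<^sub>R b) ` ((Basis::'a set) \<rightarrow>\<^sub>E \<int>))"
    by (intro countable_image countable_PiE) (auto simp: Ints_def)
qed

lemma finite_int_lattice_cball: "finite (int_lattice \<inter> cball 0 r :: 'a::euclidean_space set)"
proof (rule finite_subset)
  show "int_lattice \<inter> cball (0::'a) r \<subseteq> (\<lambda>f. \<Sum>b\<in>Basis. f b *\<^sub>R b) ` (Basis \<rightarrow>\<^sub>E {k \<in> \<int>. \<bar>k\<bar> \<le> r})"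
  proof
    fix x :: 'a assume "x \<in> int_lattice \<inter> cball 0 r"
    then show "x \<in> (\<lambda>f. \<Sum>b\<in>Basis. f b *\<^sub>R b) ` (Basis \<rightarrow>\<^sub>E {k \<in> \<int>. \<bar>k\<bar> \<le> r})"
      by (intro image_eqI[where x = "restrict (\<lambda>b. x \<bullet> b) Basis"])
          (auto simp: int_lattice_def euclidean_representation intro: order_trans[OF Basis_le_norm])
  qed
  show "finite ((\<lambda>f. \<Sum>b\<in>Basis. f b *\<^sub>R b) ` ((Basis::'a set) \<rightarrow>\<^sub>E {k \<in> \<int>. \<bar>k\<bar> \<le> r}))"
    by (intro finite_imageI finite_PiE) (auto simp: finite_abs_int_segment)
qed

lemma measurable_lat_floor [measurable]: "lat_floor \<in> measurable borel (count_space int_lattice)"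
proof (subst measurable_count_space_eq_countable, rule countable_int_lattice, intro conjI ballI)
  show "lat_floor \<in> space borel \<rightarrow> int_lattice" by auto
  fix j :: 'a assume "j \<in> int_lattice"
  then have "lat_floor -` {j} \<inter> space borel = {x. \<forall>b\<in>Basis. j \<bullet> b \<le> x \<bullet> b \<and> x \<bullet> b < j \<bullet> b + 1}"
    by (auto simp: lat_floor_eq_iff)
  also have "\<dots> \<in> sets borel"
    by measurable
  finally show "lat_floor -` {j} \<inter> space borel \<in> sets borel" .
qed

lemma emeasure_lat_floor_cell:
  assumes j: "j \<in> int_lattice" and R: "0 < R"
  shows "emeasure lborel {x::'a::euclidean_space. lat_floor (R *\<^sub>R x) = j} = ennreal ((1 / R) ^ DIM('a))"
proof (rule antisym)
  let ?l = "(1 / R) *\<^sub>R j" and ?u = "(1 / R) *\<^sub>R (j + One)"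
  have prod: "(\<Prod>b\<in>Basis. (?u - ?l) \<bullet> b) = (1 / R) ^ DIM('a)"
    by (simp add: inner_diff_left inner_add_left diff_divide_distrib[symmetric])
  have le: "?l \<bullet> b \<le> ?u \<bullet> b" if "b \<in> Basis" for b
    using R that by (simp add: inner_add_left field_simps)
  have cell: "{x. lat_floor (R *\<^sub>R x) = j} = {x. \<forall>b\<in>Basis. j \<bullet> b \<le> R * (x \<bullet> b) \<and> R * (x \<bullet> b) < j \<bullet> b + 1}"
    using j by (simp add: lat_floor_eq_iff)
  have meas: "{x. lat_floor (R *\<^sub>R x) = j} \<in> sets borel"
    unfolding cell by measurable
  have "{x. lat_floor (R *\<^sub>R x) = j} \<subseteq> cbox ?l ?u"
    unfolding cell using R by (auto simp: mem_box inner_add_left field_simps less_imp_le)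
  then have "emeasure lborel {x. lat_floor (R *\<^sub>R x) = j} \<le> emeasure lborel (cbox ?l ?u)"
    by (intro emeasure_mono) auto
  also have "\<dots> = ennreal ((1 / R) ^ DIM('a))"
    by (subst emeasure_lborel_cbox[OF le]) (simp_all only: prod)
  finally show "emeasure lborel {x. lat_floor (R *\<^sub>R x) = j} \<le> ennreal ((1 / R) ^ DIM('a))" .
  have "box ?l ?u \<subseteq> {x. lat_floor (R *\<^sub>R x) = j}"
    unfolding cell using R by (auto simp: mem_box inner_add_left field_simps less_imp_le)
  then have "emeasure lborel (box ?l ?u) \<le> emeasure lborel {x. lat_floor (R *\<^sub>R x) = j}"
    using meas by (intro emeasure_mono) auto
  moreover have "emeasure lborel (box ?l ?u) = ennreal ((1 / R) ^ DIM('a))"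
    by (subst emeasure_lborel_box[OF le]) (simp_all only: prod)
  ultimately show "ennreal ((1 / R) ^ DIM('a)) \<le> emeasure lborel {x. lat_floor (R *\<^sub>R x) = j}"
    by simp
qed

text \<open>All cells of side \<open>1 / R\<close> have the same volume, so rounding carries
  Lebesgue measure to a multiple of counting measure. Norms of step functions thereby become lattice
  norms as equalities, for every exponent.\<close>

lemma distr_lat_floor:
  assumes R: "0 < R"
  shows "distr lborel (count_space int_lattice) (\<lambda>x::'a::euclidean_space. lat_floor (R *\<^sub>R x))
    = scale_measure (ennreal ((1 / R) ^ DIM('a))) (count_space int_lattice)"
proof (rule measure_eqI_countable[where A = int_lattice])
  have [measurable]: "(\<lambda>x::'a. lat_floor (R *\<^sub>R x)) \<in> measurable borel (count_space int_lattice)"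
    by measurable
  fix j :: 'a assume j: "j \<in> int_lattice"
  then have "emeasure (distr lborel (count_space int_lattice) (\<lambda>x::'a. lat_floor (R *\<^sub>R x))) {j}
      = emeasure lborel {x::'a. lat_floor (R *\<^sub>R x) = j}"
    by (subst emeasure_distr) (auto simp: vimage_def)
  then show "emeasure (distr lborel (count_space int_lattice) (\<lambda>x::'a. lat_floor (R *\<^sub>R x))) {j}
      = emeasure (scale_measure (ennreal ((1 / R) ^ DIM('a))) (count_space int_lattice)) {j}"
    using j by (simp add: emeasure_lat_floor_cell[OF j R])
qed auto

lemma Lp_norm_lat_floor:
  assumes p: "0 < p" and R: "0 < R"
  shows "Lp_norm p lborel (\<lambda>x::'a::euclidean_space. g (lat_floor (R *\<^sub>R x)))
    = ennpowr (ennreal ((1 / R) ^ DIM('a))) (1 / enn2real p) * Lp_norm p (count_space int_lattice) g"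
proof -
  let ?c = "ennreal ((1 / R) ^ DIM('a))"
  have "Lp_norm p lborel (\<lambda>x::'a. g (lat_floor (R *\<^sub>R x)))
    = Lp_norm p (scale_measure ?c (count_space int_lattice)) g"
    unfolding distr_lat_floor[OF R, symmetric] using p by (subst Lp_norm_distr) auto
  also have "\<dots> = ennpowr ?c (1 / enn2real p) * Lp_norm p (count_space int_lattice) g"
  proof (cases "p = \<top>")
    case True
    \<comment> \<open>Cells have positive volume, so only the empty set is null and the essential
      supremum is the supremum.\<close>
    have "(AE x in scale_measure ?c (count_space int_lattice). P x) \<longleftrightarrow> (\<forall>x\<in>int_lattice. P x)" for P :: "'a \<Rightarrow> bool"
    proof -
      have "null_sets (scale_measure ?c (count_space int_lattice)) = {{}::'a set}"
        using R by (auto simp: null_sets_def emeasure_count_space_eq_0)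
      then show ?thesis
        by (auto simp: eventually_ae_filter space_scale_measure)
    qed
    moreover have "ennpowr ?c 0 = 1"
      using R by (simp add: ennpowr_ennreal)
    ultimately show ?thesis
      using True by (simp add: Lp_norm_def AE_count_space)
  next
    case False
    then show ?thesis
      using exponent_pos[OF p] by (simp add: Lp_norm_def nn_integral_scale_measure ennpowr_mult)
  qed
  finally show ?thesis .
qed

text \<open>The sum is the integral of a step function, and rounding moves a point by at most the
  dimension, which changes the decay by a constant factor only.\<close>

lemma lattice_sum_decay_finite:
  assumes "DIM('a) + 2 \<le> N"
  shows "(\<integral>\<^sup>+j. ennreal (decay N (j::'a::euclidean_space)) \<partial>count_space int_lattice) < \<infinity>"
proof -
  have "(\<integral>\<^sup>+j. ennreal (decay N (j::'a)) \<partial>count_space int_lattice)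
     = (\<integral>\<^sup>+j. ennreal (decay N j) \<partial>distr lborel (count_space int_lattice) (\<lambda>x::'a. lat_floor (1 *\<^sub>R x)))"
    by (subst distr_lat_floor) (auto simp: nn_integral_scale_measure)
  also have "\<dots> = (\<integral>\<^sup>+x. ennreal (decay N (lat_floor (x::'a))) \<partial>lborel)"
    by (subst nn_integral_distr) auto
  also have "\<dots> \<le> (\<integral>\<^sup>+x. ennreal ((1 + DIM('a)) ^ N) * ennreal (decay N (x::'a)) \<partial>lborel)"
  proof (rule nn_integral_mono)
    fix x :: 'a
    have "decay N (lat_floor x) \<le> (1 + norm (lat_floor x - x)) ^ N * decay N x"
      by (rule decay_le_shift)
    also have "\<dots> \<le> (1 + DIM('a)) ^ N * decay N x"
      using norm_diff_lat_floor[of x] by (intro mult_right_mono) (auto simp: norm_minus_commute intro!: power_mono)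
    finally show "ennreal (decay N (lat_floor x)) \<le> ennreal ((1 + DIM('a)) ^ N) * ennreal (decay N x)"
      by (simp add: ennreal_mult'[symmetric] ennreal_leI)
  qed
  also have "\<dots> < \<infinity>"
    using nn_integral_decay_finite[OF assms] by (simp add: nn_integral_cmult ennreal_mult_less_top)
  finally show ?thesis .
qed

text \<open>No single order of decay serves all exponents: the p-th powers of the discounts must be
  summable over the lattice, so \<open>s\<close> has to grow as p tends to 0.\<close>

lemma Lp_norm_SUP_decay:
  assumes p: "0 < p"
  shows "\<exists>s C. 0 \<le> (C::real) \<and> (\<forall>(A::'i set) f K.
    (\<forall>j\<in>int_lattice :: 'a::euclidean_space set. Lp_norm p (count_space A) (f j) \<le> ennreal (decay s j) * K) \<longrightarrow>
    Lp_norm p (count_space A) (\<lambda>x. SUP j\<in>int_lattice. f j x) \<le> ennreal C * K)"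
proof (cases "p = \<top>")
  case True
  show ?thesis
  proof (rule exI[of _ 0], rule exI[of _ 1], intro conjI allI impI)
    fix A :: "'i set" and f :: "'a \<Rightarrow> 'i \<Rightarrow> ennreal" and K
    assume "\<forall>j\<in>int_lattice. Lp_norm p (count_space A) (f j) \<le> ennreal (decay 0 j) * K"
    then show "Lp_norm p (count_space A) (\<lambda>x. SUP j\<in>int_lattice. f j x) \<le> ennreal 1 * K"
      using True by (auto simp: Lp_norm_top_count_space SUP_le_iff)
  qed auto
next
  case False
  define r where "r = enn2real p"
  have r: "0 < r" unfolding r_def using exponent_pos[OF p False] .
  obtain s :: nat where s: "real (DIM('a) + 2) \<le> real s * r"
    using reals_Archimedean3[OF r] by (meson less_imp_le)
  define S where "S = (\<integral>\<^sup>+j. ennreal (decay (DIM('a) + 2) (j::'a)) \<partial>count_space int_lattice)"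
  have fin: "ennpowr S (1 / r) < \<top>"
    using lattice_sum_decay_finite[where 'a = 'a, OF order_refl] by (simp add: S_def)
  have le: "ennpowr (ennreal (decay s j)) r \<le> ennreal (decay (DIM('a) + 2) j)" for j :: 'a
  proof -
    have pos: "0 < 1 + norm j" by (simp add: add_pos_nonneg)
    have "decay s j powr r = (1 + norm j) powr (- (real s * r))"
      using pos by (simp add: decay_def powr_realpow[symmetric] powr_minus[symmetric] powr_powr)
    also have "\<dots> \<le> (1 + norm j) powr (- real (DIM('a) + 2))"
      using s by (intro powr_mono) auto
    also have "\<dots> = decay (DIM('a) + 2) j"
      using pos by (simp only: decay_def powr_minus powr_realpow)
    finally show ?thesis
      by (simp add: ennpowr_ennreal ennreal_leI)
  qed
  show ?thesis
  proof (intro exI[of _ s] exI[of _ "enn2real (ennpowr S (1 / r))"] conjI allI impI)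
    fix A :: "'i set" and f :: "'a \<Rightarrow> 'i \<Rightarrow> ennreal" and K
    assume "\<forall>j\<in>int_lattice. Lp_norm p (count_space A) (f j) \<le> ennreal (decay s j) * K"
    then have "Lp_norm p (count_space A) (\<lambda>x. SUP j\<in>int_lattice. f j x) \<le> ennpowr S (1 / r) * K"
      unfolding r_def S_def using le False p
      by (intro Lp_norm_SUP[where w = "\<lambda>j. ennreal (decay s j)"] nn_integral_mono) (auto simp: r_def)
    then show "Lp_norm p (count_space A) (\<lambda>x. SUP j\<in>int_lattice. f j x) \<le> ennreal (enn2real (ennpowr S (1 / r))) * K"
      using fin by (simp add: ennreal_enn2real)
  qed simp
qed

text \<open>The hypothesis bounds the full mixed norms of \<open>f j\<close>, not their inner norms
  at a fixed outer variable. The decay is therefore split: \<open>s1\<close> is spent on the inner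
  supremum, \<open>s2\<close> on the outer one.\<close>

lemma mixed_norm_SUP_decay:
  assumes p: "0 < p" "0 < q"
  shows "\<exists>s C. 0 \<le> (C::real) \<and> (\<forall>(A::'i set) (B::'j set) f K.
    (\<forall>j\<in>int_lattice :: 'a::euclidean_space set.
       mixed_norm p q (count_space A) (count_space B) (f j) \<le> ennreal (decay s j) * K) \<longrightarrow>
    mixed_norm p q (count_space A) (count_space B) (\<lambda>x. SUP j\<in>int_lattice. f j x) \<le> ennreal C * K)"
proof -
  obtain s1 C1 where 1: "0 \<le> (C1::real)" "\<And>(A::'i set) f K.
    (\<forall>j\<in>int_lattice :: 'a set. Lp_norm p (count_space A) (f j) \<le> ennreal (decay s1 j) * K) \<Longrightarrow>
    Lp_norm p (count_space A) (\<lambda>x. SUP j\<in>int_lattice. f j x) \<le> ennreal C1 * K"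
    using Lp_norm_SUP_decay[OF p(1)] by blast
  obtain s2 C2 where 2: "0 \<le> (C2::real)" "\<And>(A::'j set) f K.
    (\<forall>j\<in>int_lattice :: 'a set. Lp_norm q (count_space A) (f j) \<le> ennreal (decay s2 j) * K) \<Longrightarrow>
    Lp_norm q (count_space A) (\<lambda>x. SUP j\<in>int_lattice. f j x) \<le> ennreal C2 * K"
    using Lp_norm_SUP_decay[OF p(2)] by blast
  show ?thesis
  proof (intro exI[of _ "s1 + s2"] exI[of _ "C1 * C2"] conjI allI impI)
    show "0 \<le> C1 * C2" using 1(1) 2(1) by simp
    fix A :: "'i set" and B :: "'j set" and f :: "'a \<Rightarrow> 'i \<times> 'j \<Rightarrow> ennreal" and K
    assume f: "\<forall>j\<in>int_lattice. mixed_norm p q (count_space A) (count_space B) (f j) \<le> ennreal (decay (s1 + s2) j) * K"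
    \<comment> \<open>Rescaling by the inverse discount makes the inner hypothesis hold at every
      \<open>y\<close>, with the supremum of \<open>h j y\<close> over \<open>j\<close> as the
      bound.\<close>
    define h where "h j y = ennreal ((1 + norm j) ^ s1) * Lp_norm p (count_space A) (\<lambda>x. f j (x, y))" for j y
    have h: "Lp_norm p (count_space A) (\<lambda>x. f j (x, y)) = ennreal (decay s1 j) * h j y" for j y
      unfolding h_def by (simp flip: mult.assoc ennreal_mult')
    have "mixed_norm p q (count_space A) (count_space B) (\<lambda>x. SUP j\<in>int_lattice. f j x)
       \<le> Lp_norm q (count_space B) (\<lambda>y. ennreal C1 * (SUP j\<in>int_lattice. h j y))"
      unfolding mixed_norm_def
    proof (rule Lp_norm_mono[OF p(2)])
      fix y
      show "Lp_norm p (count_space A) (\<lambda>x. SUP j\<in>int_lattice. f j (x, y)) \<le> ennreal C1 * (SUP j\<in>int_lattice. h j y)"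
        by (rule 1(2)) (auto simp: h intro!: mult_left_mono SUP_upper)
    qed
    also have "\<dots> = ennreal C1 * Lp_norm q (count_space B) (\<lambda>y. SUP j\<in>int_lattice. h j y)"
      using p by (simp add: Lp_norm_cmult)
    also have "\<dots> \<le> ennreal C1 * (ennreal C2 * K)"
    proof (intro mult_left_mono 2(2) ballI)
      fix j :: 'a assume j: "j \<in> int_lattice"
      have "Lp_norm q (count_space B) (h j) = ennreal ((1 + norm j) ^ s1) * mixed_norm p q (count_space A) (count_space B) (f j)"
        unfolding h_def mixed_norm_def using p by (simp add: Lp_norm_cmult)
      also have "\<dots> \<le> ennreal ((1 + norm j) ^ s1) * (ennreal (decay (s1 + s2) j) * K)"
        using f j by (intro mult_left_mono) auto
      also have "\<dots> = ennreal (decay s1 j * (1 + norm j) ^ s1) * (ennreal (decay s2 j) * K)"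
        by (simp add: decay_add ennreal_mult' del: decay_mult_power) (simp only: mult_ac)
      finally show "Lp_norm q (count_space B) (h j) \<le> ennreal (decay s2 j) * K"
        by simp
    qed simp
    finally show "mixed_norm p q (count_space A) (count_space B) (\<lambda>x. SUP j\<in>int_lattice. f j x) \<le> ennreal (C1 * C2) * K"
      using 1(1) by (simp add: ennreal_mult' mult.assoc)
  qed
qed

section \<open>Moderate weights and the Peetre maximal function on lattices\<close>

text \<open>The degree is recorded apart from the constant because the threshold for the order of
  the maximal function may depend on the degree only. In the sampling argument the weight is
  contracted by a mesh that itself depends on this order, and the degree is what stays
  fixed.\<close>

definition moderate_degree :: "nat \<Rightarrow> ('a::real_normed_vector \<Rightarrow> real) \<Rightarrow> bool" where
  "moderate_degree N m \<longleftrightarrow> (\<forall>z. 0 \<le> m z) \<and> (\<exists>C\<ge>0. \<forall>z w. m z \<le> C * (1 + norm (z - w)) ^ N * m w)"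

definition poly_moderate :: "('a::real_normed_vector \<Rightarrow> real) \<Rightarrow> bool" where
  "poly_moderate m \<longleftrightarrow> (\<exists>N. moderate_degree N m)"

lemma poly_moderate_nonneg: "poly_moderate m \<Longrightarrow> 0 \<le> m z"
  by (auto simp: poly_moderate_def moderate_degree_def)

lemma poly_moderateE:
  assumes "poly_moderate m"
  obtains C N where "0 \<le> C" "\<And>z w. m z \<le> C * (1 + norm (z - w)) ^ N * m w"
  using assms by (auto simp: poly_moderate_def moderate_degree_def)

lemma poly_moderate_weights_imp: "m \<in> poly_moderate_weights \<Longrightarrow> poly_moderate m"
proof -
  assume m: "m \<in> poly_moderate_weights"
  then obtain v C K N where v: "\<And>z. 0 \<le> v z" "0 < C" "\<And>z w. m (z + w) \<le> C * v z * m w"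
    "\<And>z. v z \<le> K * (1 + norm z) ^ N" and nn: "\<And>z. 0 \<le> m z"
    by (auto simp: poly_moderate_weights_def moderate_def polynomial_growth_def)
  have K: "0 \<le> K"
    using order_trans[OF v(1) v(4)[of 0]] by simp
  have "m z \<le> C * K * (1 + norm (z - w)) ^ N * m w" for z w
  proof -
    have "m z \<le> C * v (z - w) * m w"
      using v(3)[of "z - w" w] by simp
    also have "\<dots> \<le> C * (K * (1 + norm (z - w)) ^ N) * m w"
      using v nn by (intro mult_right_mono mult_left_mono) auto
    finally show ?thesis by (simp add: mult.assoc)
  qed
  with nn v(2) K show ?thesis
    unfolding poly_moderate_def moderate_degree_def by (intro exI[of _ N] conjI allI exI[of _ "C * K"]) auto
qed

lemma poly_moderate_linear:
  fixes T :: "'a::euclidean_space \<Rightarrow> 'b::real_normed_vector"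
  assumes m: "poly_moderate m" and T: "linear T"
  shows "poly_moderate (\<lambda>z. m (T z))"
proof -
  obtain C N where C: "0 \<le> C" "\<And>z w. m z \<le> C * (1 + norm (z - w)) ^ N * m w"
    using poly_moderateE[OF m] by metis
  obtain B where B: "0 < B" "\<And>x. norm (T x) \<le> B * norm x"
    using linear_bounded_pos[OF T] by blast
  have "m (T z) \<le> (C * (1 + B) ^ N) * (1 + norm (z - w)) ^ N * m (T w)" for z w
  proof -
    have "m (T z) \<le> C * (1 + norm (T z - T w)) ^ N * m (T w)" by (rule C)
    also have "\<dots> \<le> C * ((1 + B) * (1 + norm (z - w))) ^ N * m (T w)"
    proof (intro mult_right_mono mult_left_mono power_mono C)
      have "norm (T z - T w) \<le> B * norm (z - w)"
        using B(2)[of "z - w"] by (simp add: linear_diff[OF T])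
      then show "1 + norm (T z - T w) \<le> (1 + B) * (1 + norm (z - w))"
        using B(1) by (simp add: algebra_simps) (smt (verit) norm_ge_zero)
    qed (auto simp: poly_moderate_nonneg[OF m])
    finally show ?thesis by (simp add: power_mult_distrib mult.assoc)
  qed
  then show ?thesis
    unfolding poly_moderate_def moderate_degree_def using C(1) B(1) poly_moderate_nonneg[OF m]
    by (intro exI[of _ N] conjI allI exI[of _ "C * (1 + B) ^ N"]) auto
qed

definition peetre :: "nat \<Rightarrow> ('a::real_normed_vector \<Rightarrow> ennreal) \<Rightarrow> 'a \<Rightarrow> ennreal" where
  "peetre N F z = (SUP w. F w * ennreal (decay N (z - w)))"

lemma peetre_upper: "F w * ennreal (decay N (z - w)) \<le> peetre N F z"
  unfolding peetre_def by (rule SUP_upper) simp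

lemma le_peetre: "F z \<le> peetre N F z"
  using peetre_upper[of F z N z] by simp

lemma peetre_least: "(\<And>w. F w * ennreal (decay N (z - w)) \<le> c) \<Longrightarrow> peetre N F z \<le> c"
  unfolding peetre_def by (rule SUP_least)

lemma peetre_mono: "(\<And>w. F w \<le> G w) \<Longrightarrow> peetre N F z \<le> peetre N G z"
  unfolding peetre_def by (intro SUP_mono' mult_right_mono) auto

lemma peetre_cmult: "peetre N (\<lambda>w. c * F w) z = c * peetre N F z"
  unfolding peetre_def by (simp add: SUP_mult_left_ennreal mult.assoc)

text \<open>Two discounts merge into one by submultiplicativity. Hence the maximal function varies
  at most polynomially, is determined up to constants by its lattice values, and is a fixed point of
  the operator.\<close>

lemma peetre_decay: "peetre N F w * ennreal (decay N (z - w)) \<le> peetre N F z"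
proof -
  have "peetre N F w * ennreal (decay N (z - w)) = (SUP u. F u * (ennreal (decay N (w - u)) * ennreal (decay N (z - w))))"
    unfolding peetre_def by (simp add: SUP_mult_right_ennreal mult.assoc)
  also have "\<dots> \<le> peetre N F z"
  proof (rule SUP_least)
    fix u
    have "decay N (w - u) * decay N (z - w) \<le> decay N (z - u)"
      using decay_mult_le[of N "w - u" "z - w"] by simp
    then have "F u * (ennreal (decay N (w - u)) * ennreal (decay N (z - w))) \<le> F u * ennreal (decay N (z - u))"
      by (intro mult_left_mono) (auto simp: ennreal_mult'[symmetric] ennreal_leI)
    also have "\<dots> \<le> peetre N F z" by (rule peetre_upper)
    finally show "F u * (ennreal (decay N (w - u)) * ennreal (decay N (z - w))) \<le> peetre N F z" .
  qed
  finally show ?thesis .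
qed

lemma peetre_slow: "peetre N F w \<le> ennreal ((1 + norm (z - w)) ^ N) * peetre N F z"
proof -
  have "peetre N F w = ennreal ((1 + norm (z - w)) ^ N) * (peetre N F w * ennreal (decay N (z - w)))"
    by (subst mult.left_commute, simp flip: ennreal_mult', subst mult.commute, simp)
  also have "\<dots> \<le> ennreal ((1 + norm (z - w)) ^ N) * peetre N F z"
    by (intro mult_left_mono peetre_decay) auto
  finally show ?thesis .
qed

lemma peetre_peetre: "peetre N (peetre N F) z = peetre N F z"
  by (intro antisym peetre_least peetre_decay le_peetre)

lemma peetre_finite:
  assumes "\<And>w. F w \<le> ennreal c"
  shows "peetre N F z < \<infinity>"
proof -
  have "peetre N F z \<le> ennreal c"
  proof (rule peetre_least)
    fix w
    have "F w * ennreal (decay N (z - w)) \<le> ennreal c * 1"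
      by (intro mult_mono assms) (auto simp: ennreal_leI)
    then show "F w * ennreal (decay N (z - w)) \<le> ennreal c" by simp
  qed
  then show ?thesis by (simp add: le_less_trans)
qed

definition lattice_norm ::
  "ennreal \<Rightarrow> ennreal \<Rightarrow> ('a::euclidean_space \<times> 'b::euclidean_space \<Rightarrow> real) \<Rightarrow> ('a \<times> 'b \<Rightarrow> ennreal) \<Rightarrow> ennreal" where
  "lattice_norm p q m F = mixed_norm p q (count_space int_lattice) (count_space int_lattice) (\<lambda>z. F z * ennreal (m z))"

lemma lattice_norm_mono:
  assumes "0 < p" "0 < q" "\<And>z. F z \<le> G z"
  shows "lattice_norm p q m F \<le> lattice_norm p q m G"
  unfolding lattice_norm_def using assms by (intro mixed_norm_mono mult_right_mono) auto

lemma lattice_norm_cmult: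
  assumes "0 < p" "0 < q"
  shows "lattice_norm p q m (\<lambda>z. c * F z) = c * lattice_norm p q m F"
  unfolding lattice_norm_def using assms by (simp add: mult.assoc mixed_norm_cmult)

lemma mixed_norm_translate:
  fixes a :: "'a::euclidean_space" and b :: "'b::euclidean_space"
  assumes p: "0 < p" "0 < q" and ab: "a \<in> int_lattice" "b \<in> int_lattice"
  shows "mixed_norm p q (count_space int_lattice) (count_space int_lattice) (\<lambda>z. F (z - (a, b)))
    \<le> mixed_norm p q (count_space int_lattice) (count_space int_lattice) F"
proof -
  have "mixed_norm p q (count_space int_lattice) (count_space int_lattice) (\<lambda>(x, y). F (x - a, y - b))
    \<le> ennpowr (of_nat 1) (1 / enn2real p) * ennpowr (of_nat 1) (1 / enn2real q)
      * mixed_norm p q (count_space int_lattice) (count_space int_lattice) F"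
  proof (rule mixed_norm_reindex[OF p, where c = 1])
    fix z :: 'a
    have "{x \<in> int_lattice. x - a = z} \<subseteq> {z + a}" by auto
    then show "finite {x \<in> int_lattice. x - a = z} \<and> card {x \<in> int_lattice. x - a = z} \<le> 1"
      using card_mono[of "{z + a}"] by (auto intro: finite_subset)
  next
    fix z :: 'b
    have "{x \<in> int_lattice. x - b = z} \<subseteq> {z + b}" by auto
    then show "finite {x \<in> int_lattice. x - b = z} \<and> card {x \<in> int_lattice. x - b = z} \<le> 1"
      using card_mono[of "{z + b}"] by (auto intro: finite_subset)
  qed (use ab in \<open>auto simp: int_lattice_diff\<close>)
  moreover have "ennpowr 1 r = 1" for r
    using ennpowr_ennreal[of 1 r] by simp
  ultimately show ?thesis
    by (simp add: case_prod_unfold minus_prod_def)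
qed

text \<open>At a lattice point the maximal function is a supremum of lattice translates of
  \<open>F\<close>. Of the decay of order \<open>N\<close>, the part \<open>N1\<close> pays for
  moving the weight along with the translate and the part \<open>s\<close> for the supremum over
  translates.\<close>

lemma lattice_norm_peetre_lattice:
  assumes p: "0 < p" "0 < q"
  shows "\<exists>N0. \<forall>N\<ge>N0. \<forall>m. moderate_degree N1 m \<longrightarrow> (\<exists>C\<ge>0. \<forall>F.
    lattice_norm p q (m :: 'a::euclidean_space \<times> 'b::euclidean_space \<Rightarrow> real) (peetre N (\<lambda>z. if z \<in> int_lattice then F z else 0))
      \<le> ennreal C * lattice_norm p q m F)"
proof -
  let ?mix = "mixed_norm p q (count_space (int_lattice :: 'a set)) (count_space (int_lattice :: 'b set))"
  obtain s C2 where C2: "0 \<le> C2" "\<And>f K. (\<forall>j\<in>int_lattice :: ('a \<times> 'b) set.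
       ?mix (f j) \<le> ennreal (decay s j) * K) \<Longrightarrow> ?mix (\<lambda>x. SUP j\<in>int_lattice. f j x) \<le> ennreal C2 * K"
    using mixed_norm_SUP_decay[OF p, where 'a = "'a \<times> 'b"] by blast
  show ?thesis
  proof (rule exI[of _ "s + N1"], intro allI impI)
    fix N :: nat and m :: "'a \<times> 'b \<Rightarrow> real"
    assume "s + N1 \<le> N" and "moderate_degree N1 m"
    then have m: "poly_moderate m"
      by (auto simp only: poly_moderate_def)
    obtain C1 where C1: "0 \<le> C1" "\<And>z w. m z \<le> C1 * (1 + norm (z - w)) ^ N1 * m w"
      using \<open>moderate_degree N1 m\<close> unfolding moderate_degree_def by blast
    obtain N' where N: "N = s + N' + N1"
      using \<open>s + N1 \<le> N\<close> by (metis add.commute add.left_commute le_Suc_ex)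
    show "\<exists>C\<ge>0. \<forall>F. lattice_norm p q m (peetre N (\<lambda>z. if z \<in> int_lattice then F z else 0))
      \<le> ennreal C * lattice_norm p q m F"
  proof (intro exI[of _ "C2 * C1"] conjI allI)
    show "0 \<le> C2 * C1" using C1 C2 by simp
    fix F :: "'a \<times> 'b \<Rightarrow> ennreal"
    define f where "f j z = ennreal (C1 * decay s j) * (F (z - j) * ennreal (m (z - j)))" for j z
    have "lattice_norm p q m (peetre N (\<lambda>z. if z \<in> int_lattice then F z else 0)) \<le> ?mix (\<lambda>x. SUP j\<in>int_lattice. f j x)"
      unfolding lattice_norm_def
    proof (rule mixed_norm_mono[OF p])
      fix x :: 'a and y :: 'b assume "x \<in> space (count_space int_lattice)" "y \<in> space (count_space int_lattice)"
      define z where "z = (x, y)"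
      then have z: "z \<in> int_lattice"
        using \<open>x \<in> _\<close> \<open>y \<in> _\<close> by (simp add: int_lattice_Times)
      show "peetre N (\<lambda>z. if z \<in> int_lattice then F z else 0) (x, y) * ennreal (m (x, y)) \<le> (SUP j\<in>int_lattice. f j (x, y))"
        unfolding z_def[symmetric] peetre_def SUP_mult_right_ennreal
      proof (rule SUP_least)
        fix w
        show "(if w \<in> int_lattice then F w else 0) * ennreal (decay N (z - w)) * ennreal (m z) \<le> (SUP j\<in>int_lattice. f j z)"
        proof (cases "w \<in> int_lattice")
          case True
          have "decay N (z - w) * m z \<le> decay N (z - w) * (C1 * (1 + norm (z - w)) ^ N1 * m w)"
            by (intro mult_left_mono C1) simp
          also have "\<dots> = C1 * decay s (z - w) * decay N' (z - w) * (decay N1 (z - w) * (1 + norm (z - w)) ^ N1) * m w"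
            by (simp add: N decay_add del: decay_mult_power)
          also have "\<dots> \<le> C1 * decay s (z - w) * 1 * 1 * m w"
            unfolding decay_mult_power
            using C1 poly_moderate_nonneg[OF m] by (intro mult_right_mono mult_left_mono) auto
          finally have "F w * ennreal (decay N (z - w) * m z) \<le> F w * ennreal (C1 * decay s (z - w) * m w)"
            by (intro mult_left_mono ennreal_leI) auto
          also have "\<dots> = f (z - w) z"
            using C1 poly_moderate_nonneg[OF m] by (simp add: f_def ennreal_mult' mult_ac)
          also have "\<dots> \<le> (SUP j\<in>int_lattice. f j z)"
            using z True by (intro SUP_upper int_lattice_diff)
          finally show ?thesis
            using True poly_moderate_nonneg[OF m] by (simp add: ennreal_mult' mult.assoc)
        qed simp
      qed
    qed
    also have "\<dots> \<le> ennreal C2 * (ennreal C1 * lattice_norm p q m F)"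
    proof (rule C2(2), rule ballI)
      fix j :: "'a \<times> 'b" assume "j \<in> int_lattice"
      then have j: "fst j \<in> int_lattice" "snd j \<in> int_lattice"
        by (auto simp: int_lattice_Times)
      have "?mix (f j) = ennreal (C1 * decay s j) * ?mix (\<lambda>z. F (z - j) * ennreal (m (z - j)))"
        unfolding f_def by (rule mixed_norm_cmult[OF p])
      also have "\<dots> \<le> ennreal (C1 * decay s j) * lattice_norm p q m F"
        unfolding lattice_norm_def
        using mixed_norm_translate[OF p j, of "\<lambda>z. F z * ennreal (m z)"] by (intro mult_left_mono) auto
      finally show "?mix (f j) \<le> ennreal (decay s j) * (ennreal C1 * lattice_norm p q m F)"
        using C1 by (simp add: ennreal_mult' mult_ac)
    qed
    finally show "lattice_norm p q m (peetre N (\<lambda>z. if z \<in> int_lattice then F z else 0))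
        \<le> ennreal (C2 * C1) * lattice_norm p q m F"
      using C2 by (simp add: ennreal_mult' mult.assoc)
  qed
  qed
qed

text \<open>Two points of one fibre have images within twice the rounding error, and
  \<open>T\<close> is bounded below, so their difference lies in a finite set \<open>S\<close> that
  depends neither on the shift nor on the cell. Uniformity in \<open>v\<close> is what a shear
  requires.\<close>

lemma lattice_fibre_bound:
  fixes T :: "'a::euclidean_space \<Rightarrow> 'b::euclidean_space"
  assumes T: "linear T" and inj: "\<And>x. T x = 0 \<Longrightarrow> x = 0"
  shows "\<exists>c::nat. \<forall>v y. finite {k \<in> int_lattice. lat_floor (T k + v) = y} \<and> card {k \<in> int_lattice. lat_floor (T k + v) = y} \<le> c"
proof -
  have "inj T"
    using T inj by (simp add: linear_injective_0)
  then obtain B where B: "0 < B" "\<And>x. B * norm x \<le> norm (T x)"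
    using linear_inj_bounded_below_pos[OF T] by blast
  define S where "S = int_lattice \<inter> cball (0::'a) (2 * DIM('b) / B)"
  have finS: "finite S" unfolding S_def by (rule finite_int_lattice_cball)
  have "finite {k \<in> int_lattice. lat_floor (T k + v) = y} \<and> card {k \<in> int_lattice. lat_floor (T k + v) = y} \<le> card S" for v y
  proof (cases "{k \<in> int_lattice. lat_floor (T k + v) = y} = {}")
    case False
    then obtain k0 where k0: "k0 \<in> int_lattice" "lat_floor (T k0 + v) = y" by auto
    have sub: "{k \<in> int_lattice. lat_floor (T k + v) = y} \<subseteq> (\<lambda>x. k0 + x) ` S"
    proof
      fix k assume "k \<in> {k \<in> int_lattice. lat_floor (T k + v) = y}"
      then have k: "k \<in> int_lattice" "lat_floor (T k + v) = y" by auto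
      have "B * norm (k - k0) \<le> norm ((T k + v - y) - (T k0 + v - y))"
        using B(2)[of "k - k0"] by (simp add: linear_diff[OF T])
      also have "\<dots> \<le> norm (T k + v - y) + norm (T k0 + v - y)"
        by (rule norm_triangle_ineq4)
      also have "\<dots> \<le> DIM('b) + DIM('b)"
        using norm_diff_lat_floor[of "T k + v"] norm_diff_lat_floor[of "T k0 + v"] k k0 by simp
      finally have "k - k0 \<in> S"
        using B(1) k k0 by (simp add: S_def int_lattice_diff field_simps)
      then show "k \<in> (\<lambda>x. k0 + x) ` S"
        by (intro image_eqI[of _ _ "k - k0"]) auto
    qed
    then have "card {k \<in> int_lattice. lat_floor (T k + v) = y} \<le> card ((\<lambda>x. k0 + x) ` S)"
      using finS by (intro card_mono) auto
    also have "\<dots> \<le> card S" by (rule card_image_le[OF finS])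
    finally show ?thesis
      using sub finS by (auto intro: finite_subset)
  next
    case True
    then show ?thesis
      by (simp only: card.empty finite.emptyI le0 simp_thms)
  qed
  then show ?thesis by blast
qed

text \<open>\<open>Y\<close> ignores the inner variable, and \<open>X\<close> at fixed outer
  variable is an injective linear map plus the shift \<open>X (0, y)\<close>. So the fibres are
  bounded uniformly and the mixed structure of the norm survives.\<close>

lemma mixed_norm_lat_floor_linear:
  fixes X :: "'c::euclidean_space \<times> 'd::euclidean_space \<Rightarrow> 'a::euclidean_space"
    and Y :: "'d \<Rightarrow> 'b::euclidean_space"
  assumes p: "0 < p" "0 < q" and X: "linear X" and Y: "linear Y"
    and injX: "\<And>x. X (x, 0) = 0 \<Longrightarrow> x = 0" and injY: "\<And>y. Y y = 0 \<Longrightarrow> y = 0"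
  shows "\<exists>C\<ge>0. \<forall>G. mixed_norm p q (count_space int_lattice) (count_space int_lattice) (\<lambda>(x, y). G (lat_floor (X (x, y)), lat_floor (Y y)))
    \<le> ennreal C * mixed_norm p q (count_space int_lattice) (count_space int_lattice) G"
proof -
  have XY: "X (x, y) = X (x, 0) + X (0, y)" for x y
    using linear_add[OF X, of "(x, 0)" "(0, y)"] by simp
  have linX: "linear (\<lambda>x. X (x, 0))"
    using linear_compose[OF _ X, of "\<lambda>x. (x, 0)"] by (simp add: o_def linear_iff)
  obtain c1 :: nat where c1: "\<And>v y. finite {k \<in> int_lattice. lat_floor (X (k, 0) + v) = y} \<and>
      card {k \<in> int_lattice. lat_floor (X (k, 0) + v) = y} \<le> c1"
    using lattice_fibre_bound[OF linX injX] by blast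
  obtain c2 :: nat where c2: "\<And>v y. finite {k \<in> int_lattice. lat_floor (Y k + v) = y} \<and>
      card {k \<in> int_lattice. lat_floor (Y k + v) = y} \<le> c2"
    using lattice_fibre_bound[OF Y injY] by blast
  define c where "c = c1 + c2 + 1"
  define D where "D = ennpowr (of_nat c) (1 / enn2real p) * ennpowr (of_nat c) (1 / enn2real q)"
  have D: "D = ennreal (enn2real D)"
    by (simp add: D_def ennreal_enn2real ennreal_mult_less_top of_nat_less_top)
  have "mixed_norm p q (count_space int_lattice) (count_space int_lattice) (\<lambda>(x, y). G (lat_floor (X (x, y)), lat_floor (Y y)))
    \<le> D * mixed_norm p q (count_space int_lattice) (count_space int_lattice) G" for G
    unfolding D_def
  proof (intro mixed_norm_reindex[OF p])
    fix y z
    have "{x \<in> int_lattice. lat_floor (X (x, y)) = z} = {x \<in> int_lattice. lat_floor (X (x, 0) + X (0, y)) = z}"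
      by (subst XY) simp
    then show "finite {x \<in> int_lattice. lat_floor (X (x, y)) = z} \<and> card {x \<in> int_lattice. lat_floor (X (x, y)) = z} \<le> c"
      using c1[of "X (0, y)" z] by (simp add: c_def)
  next
    fix z
    show "finite {x \<in> int_lattice. lat_floor (Y x) = z} \<and> card {x \<in> int_lattice. lat_floor (Y x) = z} \<le> c"
      using c2[of 0 z] by (simp add: c_def)
  qed (auto simp: c_def)
  then show ?thesis
    by (intro exI[of _ "enn2real D"]) (simp add: D[symmetric])
qed

text \<open>Rounding the image point costs only constants, since both the maximal function and the
  weight vary at most polynomially. What remains is a matter of counting fibres.\<close>

lemma mixed_norm_peetre_linear:
  fixes X :: "'c::euclidean_space \<times> 'd::euclidean_space \<Rightarrow> 'a::euclidean_space"
    and Y :: "'d \<Rightarrow> 'b::euclidean_space"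
  assumes p: "0 < p" "0 < q" and m: "poly_moderate m" and X: "linear X" and Y: "linear Y"
    and injX: "\<And>x. X (x, 0) = 0 \<Longrightarrow> x = 0" and injY: "\<And>y. Y y = 0 \<Longrightarrow> y = 0"
  shows "\<exists>C\<ge>0. \<forall>F. lattice_norm p q (\<lambda>(x, y). m (X (x, y), Y y)) (\<lambda>(x, y). peetre N F (X (x, y), Y y))
    \<le> ennreal C * lattice_norm p q m (peetre N F)"
proof -
  obtain C1 N1 where C1: "0 \<le> C1" "\<And>z w. m z \<le> C1 * (1 + norm (z - w)) ^ N1 * m w"
    using poly_moderateE[OF m] by metis
  obtain D where D: "0 \<le> D" "\<And>G. mixed_norm p q (count_space int_lattice) (count_space int_lattice) (\<lambda>(x, y). G (lat_floor (X (x, y)), lat_floor (Y y)))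
    \<le> ennreal D * mixed_norm p q (count_space int_lattice) (count_space int_lattice) G"
    using mixed_norm_lat_floor_linear[OF p X Y injX injY] by blast
  define r where "r = (1 + real DIM('a \<times> 'b))"
  have step: "peetre N F z * ennreal (m z) \<le> ennreal (C1 * r ^ (N + N1)) * (peetre N F (lat_floor z) * ennreal (m (lat_floor z)))"
    for F and z :: "'a \<times> 'b"
  proof -
    have n: "norm (z - lat_floor z) \<le> DIM('a \<times> 'b)" by (rule norm_diff_lat_floor)
    have "peetre N F z \<le> ennreal ((1 + norm (lat_floor z - z)) ^ N) * peetre N F (lat_floor z)"
      by (rule peetre_slow)
    also have "\<dots> \<le> ennreal (r ^ N) * peetre N F (lat_floor z)"
      using n unfolding r_def by (intro mult_right_mono ennreal_leI power_mono) (auto simp: norm_minus_commute)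
    finally have 1: "peetre N F z \<le> ennreal (r ^ N) * peetre N F (lat_floor z)" .
    have "m z \<le> C1 * (1 + norm (z - lat_floor z)) ^ N1 * m (lat_floor z)" by (rule C1)
    also have "\<dots> \<le> C1 * r ^ N1 * m (lat_floor z)"
      using n C1 poly_moderate_nonneg[OF m] unfolding r_def
      by (intro mult_right_mono mult_left_mono power_mono) auto
    finally have "ennreal (m z) \<le> ennreal (C1 * r ^ N1) * ennreal (m (lat_floor z))"
      using C1 poly_moderate_nonneg[OF m] by (simp add: ennreal_mult'[symmetric] r_def ennreal_leI)
    with 1 have "peetre N F z * ennreal (m z) \<le> (ennreal (r ^ N) * peetre N F (lat_floor z)) * (ennreal (C1 * r ^ N1) * ennreal (m (lat_floor z)))"
      by (intro mult_mono) auto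
    also have "\<dots> = ennreal (C1 * r ^ (N + N1)) * (peetre N F (lat_floor z) * ennreal (m (lat_floor z)))"
      using C1 by (simp add: power_add ennreal_mult' r_def mult_ac)
    finally show ?thesis .
  qed
  show ?thesis
  proof (intro exI[of _ "C1 * r ^ (N + N1) * D"] conjI allI)
    show "0 \<le> C1 * r ^ (N + N1) * D" using C1 D(1) by (simp add: r_def)
    fix F
    have "lattice_norm p q (\<lambda>(x, y). m (X (x, y), Y y)) (\<lambda>(x, y). peetre N F (X (x, y), Y y))
      \<le> mixed_norm p q (count_space int_lattice) (count_space int_lattice)
          (\<lambda>z. ennreal (C1 * r ^ (N + N1)) * (\<lambda>(x, y). (\<lambda>z. peetre N F z * ennreal (m z)) (lat_floor (X (x, y)), lat_floor (Y y))) z)"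
      unfolding lattice_norm_def
      by (intro mixed_norm_mono[OF p]) (use step in \<open>auto simp: lat_floor_Pair[symmetric]\<close>)
    also have "\<dots> = ennreal (C1 * r ^ (N + N1)) * mixed_norm p q (count_space int_lattice) (count_space int_lattice)
          (\<lambda>(x, y). (\<lambda>z. peetre N F z * ennreal (m z)) (lat_floor (X (x, y)), lat_floor (Y y)))"
      by (rule mixed_norm_cmult[OF p])
    also have "\<dots> \<le> ennreal (C1 * r ^ (N + N1)) * (ennreal D * lattice_norm p q m (peetre N F))"
      unfolding lattice_norm_def by (intro mult_left_mono D(2)) simp
    finally show "lattice_norm p q (\<lambda>(x, y). m (X (x, y), Y y)) (\<lambda>(x, y). peetre N F (X (x, y), Y y))
      \<le> ennreal (C1 * r ^ (N + N1) * D) * lattice_norm p q m (peetre N F)"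
      using C1 by (simp add: ennreal_mult' mult.assoc r_def)
  qed
qed

section \<open>Changes of variables, Fubini's theorem and norm bounds for Lebesgue integrals\<close>

lemma lborel_integrable_affine:
  fixes f :: "'a::euclidean_space \<Rightarrow> 'b::{banach, second_countable_topology}"
  assumes "integrable lborel f" "c \<noteq> 0"
  shows "integrable lborel (\<lambda>x. f (t + c *\<^sub>R x))"
proof -
  have [measurable]: "f \<in> borel_measurable borel"
    using assms(1) by (simp add: integrable_iff_bounded)
  have "integrable (density (distr lborel borel (\<lambda>x. t + c *\<^sub>R x)) (\<lambda>_. ennreal (\<bar>c\<bar> ^ DIM('a)))) f"
    using assms lborel_affine[OF assms(2), of t] by simp
  then have "integrable lborel (\<lambda>x. \<bar>c\<bar> ^ DIM('a) *\<^sub>R f (t + c *\<^sub>R x))"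
    by (subst (asm) integrable_density) (auto simp: integrable_distr_eq)
  from integrable_scaleR_right[OF this, of "inverse (\<bar>c\<bar> ^ DIM('a))"] show ?thesis
    using assms(2) by simp
qed

lemma lborel_integral_affine:
  fixes f :: "'a::euclidean_space \<Rightarrow> 'b::{banach, second_countable_topology}"
  assumes "f \<in> borel_measurable borel" "c \<noteq> 0"
  shows "(\<integral>x. f x \<partial>lborel) = \<bar>c\<bar> ^ DIM('a) *\<^sub>R (\<integral>x. f (t + c *\<^sub>R x) \<partial>lborel)"
proof -
  note [measurable] = assms(1)
  have "(\<integral>x. f x \<partial>lborel) = (\<integral>x. f x \<partial>density (distr lborel borel (\<lambda>x. t + c *\<^sub>R x)) (\<lambda>_. ennreal (\<bar>c\<bar> ^ DIM('a))))"
    using lborel_affine[OF assms(2), of t] by simp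
  also have "\<dots> = \<bar>c\<bar> ^ DIM('a) *\<^sub>R (\<integral>x. f (t + c *\<^sub>R x) \<partial>lborel)"
    by (subst integral_density) (auto simp: integral_distr)
  finally show ?thesis .
qed

lemma lborel_integral_translation:
  fixes f :: "'a::euclidean_space \<Rightarrow> 'b::{banach, second_countable_topology}"
  assumes "f \<in> borel_measurable borel"
  shows "(\<integral>x. f (x + t) \<partial>lborel) = (\<integral>x. f x \<partial>lborel)"
  using lborel_integral_affine[OF assms, of 1 t] by (simp add: add.commute)

lemma nn_integral_lborel_affine:
  fixes f :: "'a::euclidean_space \<Rightarrow> ennreal"
  assumes [measurable]: "f \<in> borel_measurable borel" and "c \<noteq> 0"
  shows "(\<integral>\<^sup>+x. f x \<partial>lborel) = ennreal (\<bar>c\<bar> ^ DIM('a)) * (\<integral>\<^sup>+x. f (t + c *\<^sub>R x) \<partial>lborel)"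
proof -
  have "(\<integral>\<^sup>+x. f x \<partial>lborel) = (\<integral>\<^sup>+x. f x \<partial>density (distr lborel borel (\<lambda>x. t + c *\<^sub>R x)) (\<lambda>_. ennreal (\<bar>c\<bar> ^ DIM('a))))"
    using lborel_affine[OF assms(2), of t] by simp
  also have "\<dots> = ennreal (\<bar>c\<bar> ^ DIM('a)) * (\<integral>\<^sup>+x. f (t + c *\<^sub>R x) \<partial>lborel)"
    by (subst nn_integral_density) (auto simp: nn_integral_distr nn_integral_cmult)
  finally show ?thesis .
qed

lemma lborel_integral_swap:
  fixes f :: "'a::euclidean_space \<times> 'b::euclidean_space \<Rightarrow> complex"
  assumes "integrable lborel f"
  shows "(\<integral>x. \<integral>y. f (x, y) \<partial>lborel \<partial>lborel) = (\<integral>y. \<integral>x. f (x, y) \<partial>lborel \<partial>lborel)"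
proof -
  have "integrable (lborel \<Otimes>\<^sub>M lborel) (case_prod (\<lambda>x y. f (x, y)))"
    using assms by (simp add: lborel_prod)
  from lborel_pair.Fubini_integral[OF this] show ?thesis by simp
qed

lemma lborel_integral_prod:
  fixes f :: "'a::euclidean_space \<times> 'b::euclidean_space \<Rightarrow> complex"
  assumes "integrable lborel f"
  shows "(\<integral>z. f z \<partial>lborel) = (\<integral>x. \<integral>y. f (x, y) \<partial>lborel \<partial>lborel)"
  using assms lborel_pair.integral_fst'[of f]
  by (simp add: lborel_prod)

lemma integrable_product:
  fixes f :: "'a::euclidean_space \<Rightarrow> complex" and g :: "'b::euclidean_space \<Rightarrow> complex"
  assumes "integrable lborel f" "integrable lborel g"
  shows "integrable lborel (\<lambda>z. f (fst z) * g (snd z))"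
proof -
  have [measurable]: "f \<in> borel_measurable borel" "g \<in> borel_measurable borel"
    using assms by (auto simp: integrable_iff_bounded)
  have "integrable (lborel \<Otimes>\<^sub>M lborel) (\<lambda>z. f (fst z) * g (snd z))"
  proof (rule lborel_pair.Fubini_integrable)
    show "integrable lborel (\<lambda>x. \<integral>y. norm (f (fst (x, y)) * g (snd (x, y))) \<partial>lborel)"
      using assms by (simp add: norm_mult)
    show "AE x in lborel. integrable lborel (\<lambda>y. f (fst (x, y)) * g (snd (x, y)))"
      using assms by simp
  qed measurable
  then show ?thesis by (simp add: lborel_prod)
qed

text \<open>A non-integrable function has Bochner integral 0, so the bound survives that case. Norms
  of iterated integrals can then be estimated before anything is known about integrability of the
  slices.\<close>

lemma norm_integral_le_nn_integral:
  fixes f :: "'a \<Rightarrow> 'b::{banach, second_countable_topology}"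
  shows "ennreal (norm (integral\<^sup>L M f)) \<le> (\<integral>\<^sup>+x. ennreal (norm (f x)) \<partial>M)"
  by (cases "integrable M f") (auto simp: integral_norm_bound_ennreal not_integrable_integral_eq)

lemma cmod_integral_le:
  fixes f :: "'a \<Rightarrow> complex"
  assumes "integrable M g" "\<And>x. cmod (f x) \<le> g x"
  shows "cmod (integral\<^sup>L M f) \<le> integral\<^sup>L M g"
proof (cases "integrable M f")
  case True
  have "cmod (integral\<^sup>L M f) \<le> (\<integral>x. cmod (f x) \<partial>M)"
    by (rule integral_norm_bound)
  also have "\<dots> \<le> integral\<^sup>L M g"
    using True assms by (intro integral_mono) auto
  finally show ?thesis .
next
  case False
  have "0 \<le> g x" for x
    using order_trans[OF norm_ge_zero assms(2)] .
  then show ?thesis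
    using False by (simp add: not_integrable_integral_eq)
qed

section \<open>Fourier inversion\<close>

lemma borel_measurable_cis [measurable]: "cis \<in> borel_measurable borel"
  by (intro borel_measurable_continuous_onI continuous_intros)

definition gauss :: "'a::euclidean_space \<Rightarrow> real" where
  "gauss x = (\<Prod>b\<in>Basis. std_normal_density (x \<bullet> b))"

text \<open>The factor by which the Fourier transform with phase \<open>y \<bullet> x\<close>
  multiplies \<open>gauss\<close>; it is also the reciprocal of \<open>gauss 0\<close>.\<close>

definition gauss_const :: "'a::euclidean_space itself \<Rightarrow> real" where
  "gauss_const _ = sqrt (2 * pi) ^ DIM('a)"

lemma cis_sum: "cis (sum f A) = (\<Prod>x\<in>A. cis (f x))"
  by (induction A rule: infinite_finite_induct) (auto simp: cis_mult[symmetric])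

lemma
  fixes f :: "'a::euclidean_space \<Rightarrow> real \<Rightarrow> complex"
  assumes f: "\<And>b. b \<in> Basis \<Longrightarrow> integrable lborel (f b)"
  shows integrable_lborel_prod: "integrable lborel (\<lambda>x. \<Prod>b\<in>Basis. f b (x \<bullet> b))"
    and integral_lborel_prod: "(\<integral>x. (\<Prod>b\<in>Basis. f b (x \<bullet> b)) \<partial>lborel) = (\<Prod>b\<in>Basis. \<integral>t. f b t \<partial>lborel)"
proof -
  interpret product_sigma_finite "\<lambda>_::'a. lborel :: real measure" ..
  have meas: "\<And>b. b \<in> Basis \<Longrightarrow> f b \<in> borel_measurable borel"
    using f by (auto simp: integrable_iff_bounded)
  have m: "(\<lambda>x::'a. \<Prod>b\<in>Basis. f b (x \<bullet> b)) \<in> borel_measurable borel"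
  proof (rule borel_measurable_prod)
    fix b :: 'a assume "b \<in> Basis"
    then show "(\<lambda>x::'a. f b (x \<bullet> b)) \<in> borel_measurable borel"
      by (intro measurable_compose[OF _ meas]) auto
  qed
  have T: "(\<lambda>f. \<Sum>b\<in>Basis. f b *\<^sub>R b) \<in> measurable (\<Pi>\<^sub>M b\<in>(Basis::'a set). lborel) borel"
    by measurable
  have eq: "(\<Prod>b\<in>Basis. f b ((\<Sum>b\<in>Basis. x b *\<^sub>R b) \<bullet> b)) = (\<Prod>b\<in>Basis. f b (x b))" for x
    by (intro prod.cong) (auto simp: inner_sum_left_Basis)
  show "integrable lborel (\<lambda>x. \<Prod>b\<in>Basis. f b (x \<bullet> b))"
    by (subst lborel_eq, subst integrable_distr_eq[OF T m], unfold eq)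
       (rule product_integrable_prod, auto simp: f)
  show "(\<integral>x. (\<Prod>b\<in>Basis. f b (x \<bullet> b)) \<partial>lborel) = (\<Prod>b\<in>Basis. \<integral>t. f b t \<partial>lborel)"
    by (subst lborel_eq, subst integral_distr[OF T m], unfold eq)
       (rule product_integral_prod, auto simp: f)
qed

lemma std_normal_fourier:
  "(\<integral>t. of_real (std_normal_density t) * cis (s * t) \<partial>lborel) = of_real (sqrt (2 * pi) * std_normal_density s)"
proof -
  have "(\<integral>t. of_real (std_normal_density t) * cis (s * t) \<partial>lborel) = char std_normal_distribution s"
    unfolding char_def
    by (subst integral_density) (auto simp: scaleR_conv_of_real cis_conv_exp)
  also have "\<dots> = of_real (exp (- (s\<^sup>2) / 2))"
    by (simp only: char_std_normal_distribution)
  also have "\<dots> = of_real (sqrt (2 * pi) * std_normal_density s)"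
    by (simp add: std_normal_density_def)
  finally show ?thesis .
qed

lemma gauss_fourier:
  fixes y :: "'a::euclidean_space"
  shows "integrable lborel (\<lambda>x. of_real (gauss x) * cis (y \<bullet> x))"
    and "(\<integral>x. of_real (gauss x) * cis (y \<bullet> x) \<partial>lborel) = of_real (gauss_const TYPE('a) * gauss y)"
proof -
  have eq: "of_real (gauss x) * cis (y \<bullet> x) = (\<Prod>b\<in>Basis. of_real (std_normal_density (x \<bullet> b)) * cis ((y \<bullet> b) * (x \<bullet> b)))"
    for x :: 'a
    by (simp add: gauss_def prod.distrib cis_sum[symmetric] euclidean_inner[of y x])
  have int: "integrable lborel (\<lambda>t. of_real (std_normal_density t) * cis (s * t))" for s
    by (rule Bochner_Integration.integrable_bound[OF integrable_normal_density[of 1 0]]) (auto simp: norm_mult)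
  show "integrable lborel (\<lambda>x. of_real (gauss x) * cis (y \<bullet> x))"
    unfolding eq by (rule integrable_lborel_prod) (rule int)
  have "(\<integral>x. of_real (gauss x) * cis (y \<bullet> x) \<partial>lborel)
    = (\<Prod>b\<in>Basis. of_real (sqrt (2 * pi) * std_normal_density (y \<bullet> b)))"
    unfolding eq
    by (subst integral_lborel_prod[of "\<lambda>b t. of_real (std_normal_density t) * cis ((y \<bullet> b) * t)"])
       (auto simp: int std_normal_fourier)
  also have "\<dots> = of_real (gauss_const TYPE('a) * gauss y)"
    by (simp add: gauss_const_def gauss_def prod.distrib)
  finally show "(\<integral>x. of_real (gauss x) * cis (y \<bullet> x) \<partial>lborel) = of_real (gauss_const TYPE('a) * gauss y)" .
qed

lemma gauss_nonneg [simp]: "0 \<le> gauss x"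
  by (simp add: gauss_def prod_nonneg)

lemma gauss_const_pos: "0 < gauss_const TYPE('a::euclidean_space)"
  by (simp add: gauss_const_def)

lemma gauss_const_gauss: "gauss_const TYPE('a) * gauss (x::'a::euclidean_space) = (\<Prod>b\<in>Basis. exp (- (x \<bullet> b)\<^sup>2 / 2))"
proof -
  have "gauss_const TYPE('a) * gauss x = (\<Prod>b\<in>Basis. sqrt (2 * pi) * std_normal_density (x \<bullet> b))"
    by (simp add: gauss_const_def gauss_def prod.distrib)
  then show ?thesis by (simp add: std_normal_density_def)
qed

lemma gauss_0: "gauss_const TYPE('a) * gauss (0::'a::euclidean_space) = 1"
  by (simp add: gauss_const_gauss)

lemma gauss_le_1: "gauss_const TYPE('a) * gauss (x::'a::euclidean_space) \<le> 1"
  unfolding gauss_const_gauss by (intro prod_le_1) auto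

lemma continuous_on_gauss [continuous_intros]: "continuous_on A f \<Longrightarrow> continuous_on A (\<lambda>x. gauss (f x))"
  unfolding gauss_def std_normal_density_def by (intro continuous_intros) auto

lemma borel_measurable_gauss [measurable]: "gauss \<in> borel_measurable borel"
  by (intro borel_measurable_continuous_onI continuous_intros)

lemma integrable_gauss: "integrable lborel (\<lambda>x::'a::euclidean_space. complex_of_real (gauss x))"
  using gauss_fourier(1)[of "0::'a"] by simp

lemma integral_gauss: "(\<integral>x. gauss (x::'a::euclidean_space) \<partial>lborel) = 1"
proof -
  have "complex_of_real (\<integral>x. gauss (x::'a) \<partial>lborel) = 1"
    using gauss_fourier(2)[of "0::'a"] by (simp add: gauss_0 flip: of_real_mult)
  then show ?thesis by (simp only: of_real_eq_1_iff)
qed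

text \<open>Gaussian regularisation: the inserted Gaussian factor makes Fubini's theorem applicable,
  the inner integral becomes a Gaussian concentrated at \<open>t\<close>, and both forms of the
  regularised integral converge as \<epsilon> tends to 0. The reflection in the statement replaces a
  separate forward transform.\<close>

lemma fourier_inversion:
  fixes u :: "'a::euclidean_space \<Rightarrow> complex"
  assumes cont: "continuous_on UNIV u" and bd: "\<And>x. cmod (u x) \<le> B"
    and u: "integrable lborel u" and v: "integrable lborel (inv_fourier u)"
  shows "inv_fourier (inv_fourier u) (- t) = u t"
proof -
  define c where "c = gauss_const TYPE('a)"
  have c: "0 < c" unfolding c_def by (rule gauss_const_pos)
  have c2: "c * c = (2 * pi) ^ DIM('a)"
  proof -
    have "c * c = (sqrt (2 * pi) * sqrt (2 * pi)) ^ DIM('a)"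
      by (simp only: c_def gauss_const_def power_mult_distrib)
    then show ?thesis by simp
  qed
  have [measurable]: "u \<in> borel_measurable borel" "inv_fourier u \<in> borel_measurable borel"
    using u v by (auto simp: integrable_iff_bounded)
  \<comment> \<open>With the factor \<open>c\<close> the regulariser has value 1 at the origin, so
    its limit is the unregularised integral.\<close>
  define I where "I \<epsilon> = (\<integral>\<xi>. inv_fourier u \<xi> * cis (- 2 * pi * (t \<bullet> \<xi>)) * of_real (c * gauss (\<epsilon> *\<^sub>R \<xi>)) \<partial>lborel)" for \<epsilon> :: real
  have I_eq: "I \<epsilon> = (\<integral>y. u (t + (\<epsilon> / (2 * pi)) *\<^sub>R y) * of_real (gauss y) \<partial>lborel)" if \<epsilon>: "0 < \<epsilon>" for \<epsilon>
  proof -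
    define F where "F z = (u (fst z) * of_real (c * gauss (\<epsilon> *\<^sub>R snd z))) * cis (2 * pi * ((fst z - t) \<bullet> snd z))" for z :: "'a \<times> 'a"
    have g\<epsilon>: "integrable lborel (\<lambda>\<xi>::'a. of_real (c * gauss (\<epsilon> *\<^sub>R \<xi>)) :: complex)"
      unfolding of_real_mult
      by (rule integrable_mult_right) (use lborel_integrable_affine[OF integrable_gauss, of \<epsilon> 0] \<epsilon> in simp)
    have F: "integrable lborel F"
    proof (rule Bochner_Integration.integrable_bound[OF integrable_product[OF u g\<epsilon>]])
      have "continuous_on UNIV F"
        unfolding F_def by (intro continuous_intros continuous_on_compose2[OF cont]) auto
      then show "F \<in> borel_measurable lborel"
        by (simp add: borel_measurable_continuous_onI)
    qed (auto simp: F_def norm_mult)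
    have "I \<epsilon> = (\<integral>\<xi>. \<integral>s. F (s, \<xi>) \<partial>lborel \<partial>lborel)"
      unfolding I_def
    proof (rule Bochner_Integration.integral_cong[OF refl])
      fix \<xi>
      have "inv_fourier u \<xi> * cis (- 2 * pi * (t \<bullet> \<xi>)) * of_real (c * gauss (\<epsilon> *\<^sub>R \<xi>))
        = (\<integral>s. u s * cis (2 * pi * (\<xi> \<bullet> s)) * cis (- 2 * pi * (t \<bullet> \<xi>)) * of_real (c * gauss (\<epsilon> *\<^sub>R \<xi>)) \<partial>lborel)"
        unfolding inv_fourier_def by simp
      also have "\<dots> = (\<integral>s. F (s, \<xi>) \<partial>lborel)"
        by (intro Bochner_Integration.integral_cong refl)
           (simp add: F_def mult.assoc cis_mult inner_diff_left inner_commute algebra_simps)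
      finally show "inv_fourier u \<xi> * cis (- 2 * pi * (t \<bullet> \<xi>)) * of_real (c * gauss (\<epsilon> *\<^sub>R \<xi>)) = (\<integral>s. F (s, \<xi>) \<partial>lborel)" .
    qed
    also have "\<dots> = (\<integral>s. \<integral>\<xi>. F (s, \<xi>) \<partial>lborel \<partial>lborel)"
      by (rule lborel_integral_swap[OF F, symmetric])
    also have "\<dots> = (\<integral>s. u s * of_real (c * c / \<epsilon> ^ DIM('a) * gauss ((2 * pi / \<epsilon>) *\<^sub>R (s - t))) \<partial>lborel)"
    proof (rule Bochner_Integration.integral_cong[OF refl])
      fix s
      have "(\<integral>\<xi>. F (s, \<xi>) \<partial>lborel) = u s * of_real c * (\<integral>\<xi>. of_real (gauss (\<epsilon> *\<^sub>R \<xi>)) * cis (2 * pi * ((s - t) \<bullet> \<xi>)) \<partial>lborel)"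
        unfolding F_def by (simp add: mult.assoc)
      also have "(\<integral>\<xi>. of_real (gauss (\<epsilon> *\<^sub>R \<xi>)) * cis (2 * pi * ((s - t) \<bullet> \<xi>)) \<partial>lborel)
          = \<bar>1 / \<epsilon>\<bar> ^ DIM('a) *\<^sub>R (\<integral>\<eta>. of_real (gauss \<eta>) * cis (((2 * pi / \<epsilon>) *\<^sub>R (s - t)) \<bullet> \<eta>) \<partial>lborel)"
        using \<epsilon> by (subst lborel_integral_affine[where t = 0 and c = "1 / \<epsilon>"]) auto
      also have "\<dots> = of_real (c / \<epsilon> ^ DIM('a) * gauss ((2 * pi / \<epsilon>) *\<^sub>R (s - t)))"
        unfolding gauss_fourier(2) using \<epsilon> by (simp add: scaleR_conv_of_real c_def power_divide)
      finally show "(\<integral>\<xi>. F (s, \<xi>) \<partial>lborel) = u s * of_real (c * c / \<epsilon> ^ DIM('a) * gauss ((2 * pi / \<epsilon>) *\<^sub>R (s - t)))"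
        by simp
    qed
    \<comment> \<open>The substitution \<open>s = t + (\<epsilon> / (2 * pi)) *\<^sub>R y\<close>
      normalises the Gaussian; by \<open>c2\<close> the Jacobian cancels all constants.\<close>
    also have "\<dots> = \<bar>\<epsilon> / (2 * pi)\<bar> ^ DIM('a) *\<^sub>R
        (\<integral>y. u (t + (\<epsilon> / (2 * pi)) *\<^sub>R y) * of_real (c * c / \<epsilon> ^ DIM('a) * gauss y) \<partial>lborel)"
      using \<epsilon> by (subst lborel_integral_affine[where t = t and c = "\<epsilon> / (2 * pi)"]) auto
    also have "\<dots> = \<bar>\<epsilon> / (2 * pi)\<bar> ^ DIM('a) *\<^sub>R (of_real (c * c / \<epsilon> ^ DIM('a)) *
        (\<integral>y. u (t + (\<epsilon> / (2 * pi)) *\<^sub>R y) * of_real (gauss y) \<partial>lborel))"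
      by (subst integral_mult_right_zero[symmetric]) (simp only: of_real_mult mult_ac)
    also have "\<dots> = (\<integral>y. u (t + (\<epsilon> / (2 * pi)) *\<^sub>R y) * of_real (gauss y) \<partial>lborel)"
      using \<epsilon> by (simp add: scaleR_conv_of_real c2 power_divide)
    finally show ?thesis .
  qed
  define \<epsilon> where "\<epsilon> n = inverse (real (Suc n))" for n
  have \<epsilon>: "\<epsilon> \<longlonglongrightarrow> 0" "\<And>n. 0 < \<epsilon> n"
    unfolding \<epsilon>_def using LIMSEQ_inverse_real_of_nat by auto
  have "(\<lambda>n. I (\<epsilon> n)) \<longlonglongrightarrow> (\<integral>\<xi>. inv_fourier u \<xi> * cis (- 2 * pi * (t \<bullet> \<xi>)) * of_real (c * gauss (0 *\<^sub>R \<xi>)) \<partial>lborel)"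
    unfolding I_def
  proof (rule integral_dominated_convergence)
    show "integrable lborel (\<lambda>\<xi>. cmod (inv_fourier u \<xi>))" using v by simp
    have "continuous_on UNIV (\<lambda>x::'a. complex_of_real (c * gauss x))"
      by (intro continuous_intros)
    then have *: "isCont (\<lambda>x::'a. complex_of_real (c * gauss x)) x" for x
      by (simp add: continuous_on_eq_continuous_at)
    show "AE \<xi> in lborel. (\<lambda>n. inv_fourier u \<xi> * cis (- 2 * pi * (t \<bullet> \<xi>)) * of_real (c * gauss (\<epsilon> n *\<^sub>R \<xi>)))
        \<longlonglongrightarrow> inv_fourier u \<xi> * cis (- 2 * pi * (t \<bullet> \<xi>)) * of_real (c * gauss (0 *\<^sub>R \<xi>))"
      by (intro AE_I2 tendsto_mult_left isCont_tendsto_compose[OF *] tendsto_scaleR tendsto_const \<epsilon>)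
    show "AE \<xi> in lborel. cmod (inv_fourier u \<xi> * cis (- 2 * pi * (t \<bullet> \<xi>)) * of_real (c * gauss (\<epsilon> n *\<^sub>R \<xi>))) \<le> cmod (inv_fourier u \<xi>)" for n
      using c gauss_le_1[where 'a = 'a] by (intro AE_I2) (auto simp: norm_mult c_def intro!: mult_left_le)
  qed measurable
  moreover have "(\<lambda>n. I (\<epsilon> n)) \<longlonglongrightarrow> (\<integral>y. u (t + (0 / (2 * pi)) *\<^sub>R y) * of_real (gauss y) \<partial>lborel)"
    unfolding I_eq[OF \<epsilon>(2)]
  proof (rule integral_dominated_convergence)
    show "integrable lborel (\<lambda>y::'a. B * cmod (of_real (gauss y)))"
      using integrable_norm[OF integrable_gauss[where 'a = 'a]] by simp
    have *: "isCont u x" for x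
      using cont by (simp add: continuous_on_eq_continuous_at)
    show "AE y in lborel. (\<lambda>n. u (t + (\<epsilon> n / (2 * pi)) *\<^sub>R y) * of_real (gauss y)) \<longlonglongrightarrow> u (t + (0 / (2 * pi)) *\<^sub>R y) * of_real (gauss y)"
      by (intro AE_I2 tendsto_mult_right isCont_tendsto_compose[OF *] tendsto_add tendsto_scaleR tendsto_divide tendsto_const \<epsilon>) auto
    show "AE y in lborel. cmod (u (t + (\<epsilon> n / (2 * pi)) *\<^sub>R y) * of_real (gauss y)) \<le> B * cmod (of_real (gauss y))" for n
      by (intro AE_I2) (auto simp: norm_mult intro!: mult_right_mono bd)
  qed measurable
  ultimately have "(\<integral>\<xi>. inv_fourier u \<xi> * cis (- 2 * pi * (t \<bullet> \<xi>)) * of_real (c * gauss (0 *\<^sub>R \<xi>)) \<partial>lborel)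
      = (\<integral>y. u (t + (0 / (2 * pi)) *\<^sub>R y) * of_real (gauss y) \<partial>lborel)"
    by (rule LIMSEQ_unique)
  then show ?thesis
    by (simp add: inv_fourier_def[of "inv_fourier u"] c_def gauss_0 integral_gauss flip: of_real_mult)
qed

section \<open>The short-time Fourier transform of rapidly decaying functions\<close>

definition stf :: "('a::euclidean_space \<Rightarrow> complex) \<Rightarrow> ('a \<Rightarrow> complex) \<Rightarrow> 'a \<times> 'a \<Rightarrow> complex" where
  "stf \<phi> f z = (\<integral>t. f t * cnj (\<phi> (t - fst z)) * cis (- 2 * pi * (t \<bullet> snd z)) \<partial>lborel)"

definition rapid :: "('a::real_normed_vector \<Rightarrow> complex) \<Rightarrow> bool" where
  "rapid f \<longleftrightarrow> (\<forall>N. \<exists>C. \<forall>x. cmod (f x) \<le> C * decay N x)"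

text \<open>The working class for estimates of transforms. It contains the Schwartz functions, and
  for ambiguity functions it can be verified from continuity and decay, without differentiating
  them.\<close>

definition tame :: "('a::euclidean_space \<Rightarrow> complex) \<Rightarrow> bool" where
  "tame f \<longleftrightarrow> continuous_on UNIV f \<and> rapid f \<and> rapid (inv_fourier f)"

definition energy :: "('a::euclidean_space \<Rightarrow> complex) \<Rightarrow> real" where
  "energy \<phi> = (\<integral>t. (cmod (\<phi> t))\<^sup>2 \<partial>lborel)"

lemma stft_functional_of: "stft \<phi> (functional_of f) x \<xi> = stf \<phi> f (x, \<xi>)"
  by (simp add: stft_def bracket_def functional_of_def modulation_def translation_def stf_def cis_cnj mult_ac)

lemma cnj_cis: "cnj (cis x) = cis (- x)"
  by (simp add: cis_cnj)

lemma borel_measurable_cnj [measurable]: "cnj \<in> borel_measurable borel"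
  by (intro borel_measurable_continuous_onI continuous_intros)

lemma rapidE:
  assumes "rapid f"
  obtains C where "0 \<le> C" "\<And>x. cmod (f x) \<le> C * decay N x"
proof -
  obtain C where C: "\<And>x. cmod (f x) \<le> C * decay N x"
    using assms unfolding rapid_def by metis
  from order_trans[OF norm_ge_zero C[of 0]] have "0 \<le> C" by simp
  with C show ?thesis using that by blast
qed

lemma rapid_bounded:
  assumes "rapid f"
  obtains C where "0 \<le> C" "\<And>x. cmod (f x) \<le> C"
proof -
  obtain C where "0 \<le> C" "\<And>x. cmod (f x) \<le> C * decay 0 x"
    using rapidE[OF assms] by blast
  then show ?thesis using that by simp
qed

lemma tame_measurable [measurable_dest]: "tame f \<Longrightarrow> f \<in> borel_measurable borel"
  by (simp add: tame_def borel_measurable_continuous_onI)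

lemma tame_rapid: "tame f \<Longrightarrow> rapid f"
  by (simp add: tame_def)

lemma tame_continuous: "tame f \<Longrightarrow> continuous_on UNIV f"
  by (simp add: tame_def)

lemma integrable_of_decay:
  fixes f :: "'a::euclidean_space \<Rightarrow> complex"
  assumes "f \<in> borel_measurable borel" "\<And>x. cmod (f x) \<le> C * decay (DIM('a) + 2) x"
  shows "integrable lborel f"
  by (rule Bochner_Integration.integrable_bound[of _ "\<lambda>x. C * decay (DIM('a) + 2) x"])
     (use assms in \<open>auto intro!: integrable_mult_right integrable_decay order_trans[OF _ abs_ge_self]\<close>)

lemma rapid_integrable:
  assumes "rapid f" "f \<in> borel_measurable borel"
  shows "integrable lborel f"
  using rapidE[OF assms(1)] integrable_of_decay[OF assms(2)] by metis

lemma measurable_inv_fourier [measurable]: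
  assumes [measurable]: "f \<in> borel_measurable borel"
  shows "inv_fourier f \<in> borel_measurable borel"
  unfolding inv_fourier_def
  by (rule lborel.borel_measurable_lebesgue_integral) measurable

lemma tame_inversion:
  assumes "tame f"
  shows "f t = (\<integral>\<eta>. inv_fourier f \<eta> * cis (- 2 * pi * (t \<bullet> \<eta>)) \<partial>lborel)"
proof -
  have f: "continuous_on UNIV f" "rapid f" "rapid (inv_fourier f)" and [measurable]: "f \<in> borel_measurable borel"
    using assms by (auto simp: tame_def borel_measurable_continuous_onI)
  obtain B where "\<And>x. cmod (f x) \<le> B" using rapid_bounded[OF f(2)] by blast
  from fourier_inversion[OF f(1) this rapid_integrable rapid_integrable, of t] f
  show ?thesis by (simp add: inv_fourier_def[of "inv_fourier f"])
qed

lemma measurable_stf [measurable]: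
  assumes [measurable]: "f \<in> borel_measurable borel" "\<phi> \<in> borel_measurable borel"
  shows "stf \<phi> f \<in> borel_measurable borel"
proof -
  have "(\<lambda>z. stf \<phi> f z) \<in> borel_measurable (borel \<Otimes>\<^sub>M borel)"
    unfolding stf_def by (rule lborel.borel_measurable_lebesgue_integral) measurable
  then show ?thesis by (simp add: borel_prod)
qed

text \<open>Decay \<open>N\<close> of \<open>f\<close> at \<open>t\<close> and of the window at
  \<open>t - x\<close> combine to decay \<open>N\<close> at \<open>x\<close>; the remaining
  \<open>M\<close> orders of \<open>f\<close> make the integral converge.\<close>

lemma stf_decay_position:
  assumes "tame f" "tame \<phi>"
  shows "\<exists>C\<ge>0. \<forall>z. cmod (stf \<phi> f z) \<le> C * decay N (fst z)"
proof -
  define M where "M = DIM('a) + 2"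
  obtain C1 where C1: "0 \<le> C1" "\<And>x. cmod (f x) \<le> C1 * decay (N + M) x"
    using rapidE[OF tame_rapid[OF assms(1)]] by blast
  obtain C2 where C2: "0 \<le> C2" "\<And>x. cmod (\<phi> x) \<le> C2 * decay N x"
    using rapidE[OF tame_rapid[OF assms(2)]] by blast
  have "cmod (stf \<phi> f z) \<le> (C1 * C2 * (\<integral>t. decay M (t::'a) \<partial>lborel)) * decay N (fst z)" for z
  proof -
    have "cmod (stf \<phi> f z) \<le> (\<integral>t. (C1 * C2 * decay N (fst z)) * decay M (t::'a) \<partial>lborel)"
      unfolding stf_def
    proof (rule cmod_integral_le)
      show "integrable lborel (\<lambda>t::'a. C1 * C2 * decay N (fst z) * decay M t)"
        by (intro integrable_mult_right integrable_decay) (simp add: M_def)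
      fix t
      have "cmod (f t * cnj (\<phi> (t - fst z)) * cis (- 2 * pi * (t \<bullet> snd z))) = cmod (f t) * cmod (\<phi> (t - fst z))"
        by (simp add: norm_mult)
      also have "\<dots> \<le> (C1 * decay (N + M) t) * (C2 * decay N (t - fst z))"
        using C1 C2 by (intro mult_mono) auto
      also have "\<dots> = C1 * C2 * decay M t * (decay N t * decay N (fst z - t))"
        by (simp add: decay_add decay_commute[of N t])
      also have "\<dots> \<le> C1 * C2 * decay M t * decay N (fst z)"
        using C1 C2 decay_mult_le[of N t "fst z - t"] by (intro mult_left_mono) auto
      finally show "cmod (f t * cnj (\<phi> (t - fst z)) * cis (- 2 * pi * (t \<bullet> snd z))) \<le> C1 * C2 * decay N (fst z) * decay M t"
        by (simp add: mult_ac)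
    qed
    then show ?thesis by (simp add: mult_ac)
  qed
  moreover have "0 \<le> C1 * C2 * (\<integral>t. decay M (t::'a) \<partial>lborel)"
    using C1 C2 by simp
  ultimately show ?thesis by blast
qed

text \<open>Inserting Fourier inversion of \<open>f\<close> and exchanging the integrals shows that,
  up to phases, frequency plays the role of position for the inverse Fourier transforms. The
  position argument then repeats on that side.\<close>

lemma stf_decay_frequency:
  assumes f: "tame f" and \<phi>: "tame \<phi>"
  shows "\<exists>C\<ge>0. \<forall>z. cmod (stf \<phi> f z) \<le> C * decay N (snd z)"
proof -
  note [measurable] = tame_measurable[OF f] tame_measurable[OF \<phi>]
  define M where "M = DIM('a) + 2"
  have rf: "rapid (inv_fourier f)" and r\<phi>: "rapid (inv_fourier \<phi>)"
    using assms by (auto simp: tame_def)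
  obtain C1 where C1: "0 \<le> C1" "\<And>x. cmod (inv_fourier f x) \<le> C1 * decay (N + M) x"
    using rapidE[OF rf] by blast
  obtain C2 where C2: "0 \<le> C2" "\<And>x. cmod (inv_fourier \<phi> x) \<le> C2 * decay N x"
    using rapidE[OF r\<phi>] by blast
  have intf: "integrable lborel (inv_fourier f)"
    by (rule rapid_integrable[OF rf]) measurable
  have i\<phi>: "integrable lborel \<phi>"
    by (rule rapid_integrable[OF tame_rapid[OF \<phi>]]) measurable
  have "cmod (stf \<phi> f z) \<le> (C1 * C2 * (\<integral>t. decay M (t::'a) \<partial>lborel)) * decay N (snd z)" for z
  proof -
    obtain x \<xi> where z: "z = (x, \<xi>)" by (cases z)
    define F where "F p = (cnj (\<phi> (fst p - x)) * inv_fourier f (snd p)) * cis (- 2 * pi * (fst p \<bullet> (\<xi> + snd p)))" for p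
    have "integrable lborel (\<lambda>t. cnj (\<phi> (t - x)))"
      using lborel_integrable_affine[OF i\<phi>, of 1 "- x"] by simp
    from integrable_product[OF this intf] have F: "integrable lborel F"
    proof (rule Bochner_Integration.integrable_bound)
      have [measurable]: "inv_fourier f \<in> borel_measurable borel" by measurable
      have "F \<in> borel_measurable (borel \<Otimes>\<^sub>M borel)"
        unfolding F_def by measurable
      then show "F \<in> borel_measurable lborel" by (simp add: borel_prod)
    qed (auto simp: F_def norm_mult)
    have "stf \<phi> f z = (\<integral>t. \<integral>\<eta>. F (t, \<eta>) \<partial>lborel \<partial>lborel)"
      unfolding stf_def z fst_conv snd_conv
    proof (rule Bochner_Integration.integral_cong[OF refl])
      fix t
      have "f t * cnj (\<phi> (t - x)) * cis (- 2 * pi * (t \<bullet> \<xi>))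
        = (\<integral>\<eta>. inv_fourier f \<eta> * cis (- 2 * pi * (t \<bullet> \<eta>)) * (cnj (\<phi> (t - x)) * cis (- 2 * pi * (t \<bullet> \<xi>))) \<partial>lborel)"
        by (subst tame_inversion[OF f, of t]) simp
      also have "\<dots> = (\<integral>\<eta>. F (t, \<eta>) \<partial>lborel)"
      proof (rule Bochner_Integration.integral_cong[OF refl])
        fix \<eta>
        have "cis (- 2 * pi * (t \<bullet> (\<xi> + \<eta>))) = cis (- 2 * pi * (t \<bullet> \<eta>)) * cis (- 2 * pi * (t \<bullet> \<xi>))"
          unfolding cis_mult by (rule arg_cong[where f = cis]) (simp add: inner_add_right algebra_simps)
        then show "inv_fourier f \<eta> * cis (- 2 * pi * (t \<bullet> \<eta>)) * (cnj (\<phi> (t - x)) * cis (- 2 * pi * (t \<bullet> \<xi>))) = F (t, \<eta>)"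
          by (simp only: F_def fst_conv snd_conv mult_ac)
      qed
      finally show "f t * cnj (\<phi> (t - x)) * cis (- 2 * pi * (t \<bullet> \<xi>)) = (\<integral>\<eta>. F (t, \<eta>) \<partial>lborel)" .
    qed
    also have "\<dots> = (\<integral>\<eta>. \<integral>t. F (t, \<eta>) \<partial>lborel \<partial>lborel)"
      by (rule lborel_integral_swap[OF F])
    also have "cmod \<dots> \<le> (\<integral>\<eta>. (C1 * C2 * decay N \<xi>) * decay M (\<eta>::'a) \<partial>lborel)"
    proof (rule cmod_integral_le)
      show "integrable lborel (\<lambda>t::'a. C1 * C2 * decay N \<xi> * decay M t)"
        by (intro integrable_mult_right integrable_decay) (simp add: M_def)
      fix \<eta>
      have "(\<integral>t. F (t, \<eta>) \<partial>lborel) = inv_fourier f \<eta> * (\<integral>t. cnj (\<phi> (t - x)) * cis (- 2 * pi * (t \<bullet> (\<xi> + \<eta>))) \<partial>lborel)"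
        unfolding F_def by (simp add: mult_ac)
      also have "(\<integral>t. cnj (\<phi> (t - x)) * cis (- 2 * pi * (t \<bullet> (\<xi> + \<eta>))) \<partial>lborel)
        = (\<integral>t. cnj (\<phi> t * cis (2 * pi * ((\<xi> + \<eta>) \<bullet> t))) * cis (- 2 * pi * (x \<bullet> (\<xi> + \<eta>))) \<partial>lborel)"
        by (subst lborel_integral_affine[where c = 1 and t = x])
           (auto intro!: Bochner_Integration.integral_cong simp: cnj_cis cis_mult inner_add_left inner_commute algebra_simps)
      also have "\<dots> = cnj (inv_fourier \<phi> (\<xi> + \<eta>)) * cis (- 2 * pi * (x \<bullet> (\<xi> + \<eta>)))"
        unfolding inv_fourier_def by (simp only: integral_mult_left_zero Bochner_Integration.integral_cnj)
      finally have "cmod (\<integral>t. F (t, \<eta>) \<partial>lborel) = cmod (inv_fourier f \<eta>) * cmod (inv_fourier \<phi> (\<xi> + \<eta>))"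
        by (simp add: norm_mult)
      also have "\<dots> \<le> (C1 * decay (N + M) \<eta>) * (C2 * decay N (\<xi> + \<eta>))"
        using C1 C2 by (intro mult_mono) auto
      also have "\<dots> = C1 * C2 * decay M \<eta> * (decay N (\<xi> + \<eta>) * decay N (- \<eta>))"
        by (simp add: decay_add)
      also have "\<dots> \<le> C1 * C2 * decay M \<eta> * decay N \<xi>"
        using C1 C2 decay_mult_le[of N "\<xi> + \<eta>" "- \<eta>"] by (intro mult_left_mono) auto
      finally show "cmod (\<integral>t. F (t, \<eta>) \<partial>lborel) \<le> C1 * C2 * decay N \<xi> * decay M \<eta>"
        by (simp add: mult_ac)
    qed
    finally show ?thesis by (simp add: z mult_ac)
  qed
  moreover have "0 \<le> C1 * C2 * (\<integral>t. decay M (t::'a) \<partial>lborel)"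
    using C1 C2 by simp
  ultimately show ?thesis by blast
qed

lemma decay_Pair: "decay N (fst z) * decay N (snd z) \<le> decay N z"
proof -
  have "decay N (fst z, 0 :: 'b) * decay N (0 :: 'a, snd z) \<le> decay N z"
    using decay_mult_le[of N "(fst z, 0 :: 'b)" "(0 :: 'a, snd z)"] by simp
  then show ?thesis by (simp add: decay_def norm_Pair)
qed

text \<open>Each variable alone gives decay of order \<open>2 * N\<close>; the geometric mean of the
  two bounds gives order \<open>N\<close> in both variables jointly.\<close>

lemma rapid_stf:
  assumes "tame f" "tame \<phi>"
  shows "rapid (stf \<phi> f)"
  unfolding rapid_def
proof
  fix N
  obtain C1 where C1: "0 \<le> C1" "\<And>z. cmod (stf \<phi> f z) \<le> C1 * decay (2 * N) (fst z)"
    using stf_decay_position[OF assms] by blast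
  obtain C2 where C2: "0 \<le> C2" "\<And>z. cmod (stf \<phi> f z) \<le> C2 * decay (2 * N) (snd z)"
    using stf_decay_frequency[OF assms] by blast
  have "cmod (stf \<phi> f z) \<le> (C1 + C2) * decay N z" for z
  proof -
    let ?C = "C1 + C2"
    have "cmod (stf \<phi> f z) * cmod (stf \<phi> f z) \<le> (?C * decay (2 * N) (fst z)) * (?C * decay (2 * N) (snd z))"
    proof (rule mult_mono)
      show "cmod (stf \<phi> f z) \<le> ?C * decay (2 * N) (fst z)"
        by (rule order_trans[OF C1(2)], rule mult_right_mono) (use C2(1) in simp_all)
      show "cmod (stf \<phi> f z) \<le> ?C * decay (2 * N) (snd z)"
        by (rule order_trans[OF C2(2)], rule mult_right_mono) (use C1(1) in simp_all)
    qed (use C1(1) C2(1) in simp_all)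
    also have "\<dots> = (?C * (decay N (fst z) * decay N (snd z)))\<^sup>2"
      unfolding mult_2 decay_add power2_eq_square by (simp add: mult_ac)
    finally have "(cmod (stf \<phi> f z))\<^sup>2 \<le> (?C * (decay N (fst z) * decay N (snd z)))\<^sup>2"
      by (simp add: power2_eq_square)
    then have "cmod (stf \<phi> f z) \<le> ?C * (decay N (fst z) * decay N (snd z))"
      by (rule power2_le_imp_le) (use C1(1) C2(1) in simp)
    also have "\<dots> \<le> ?C * decay N z"
      by (rule mult_left_mono[OF decay_Pair]) (use C1(1) C2(1) in simp)
    finally show ?thesis .
  qed
  then show "\<exists>C. \<forall>z. cmod (stf \<phi> f z) \<le> C * decay N z" by blast
qed

lemma stf_eq_inner: "stf \<psi> f z = (\<integral>t. f t * cnj (modulation (snd z) (translation (fst z) \<psi>) t) \<partial>lborel)"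
  by (simp add: stf_def modulation_def translation_def cnj_cis mult_ac)

text \<open>Covariance: a time-frequency shift of the function translates the transform up to a
  phase, and exchanging function and window reflects it. The modulus removes the phase.\<close>

lemma cmod_stf_shifted:
  assumes [measurable]: "\<psi> \<in> borel_measurable borel" "\<phi> \<in> borel_measurable borel"
  shows "cmod (stf \<phi> (modulation (snd z) (translation (fst z) \<psi>)) y) = cmod (stf \<psi> \<phi> (z - y))"
proof -
  obtain x \<xi> x' \<xi>' where z: "z = (x, \<xi>)" "y = (x', \<xi>')" by (cases z, cases y)
  have "cnj (stf \<phi> (modulation (snd z) (translation (fst z) \<psi>)) y)
    = (\<integral>t. cnj (modulation \<xi> (translation x \<psi>) t * cnj (\<phi> (t - x')) * cis (- 2 * pi * (t \<bullet> \<xi>'))) \<partial>lborel)"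
    unfolding stf_def z fst_conv snd_conv by (rule Bochner_Integration.integral_cnj[symmetric])
  also have "\<dots> = (\<integral>t. \<phi> (t - x') * cnj (\<psi> (t - x)) * cis (- 2 * pi * (t \<bullet> (\<xi> - \<xi>'))) \<partial>lborel)"
  proof (rule Bochner_Integration.integral_cong[OF refl])
    fix t
    have "cnj (cis (2 * pi * (t \<bullet> \<xi>))) * cnj (cis (- 2 * pi * (t \<bullet> \<xi>'))) = cis (- 2 * pi * (t \<bullet> (\<xi> - \<xi>')))"
      unfolding cnj_cis cis_mult by (rule arg_cong[where f = cis]) (simp add: inner_diff_right algebra_simps)
    moreover have "A * Q * P * B = P * Q * C" if "A * B = C" for A B C P Q :: complex
      using that by (auto simp: mult_ac)
    ultimately show "cnj (modulation \<xi> (translation x \<psi>) t * cnj (\<phi> (t - x')) * cis (- 2 * pi * (t \<bullet> \<xi>')))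
      = \<phi> (t - x') * cnj (\<psi> (t - x)) * cis (- 2 * pi * (t \<bullet> (\<xi> - \<xi>')))"
      unfolding modulation_def translation_def complex_cnj_mult complex_cnj_cnj by blast
  qed
  also have "\<dots> = (\<integral>t. \<phi> t * cnj (\<psi> (t + x' - x)) * cis (- 2 * pi * ((t + x') \<bullet> (\<xi> - \<xi>'))) \<partial>lborel)"
    by (subst lborel_integral_affine[where c = 1 and t = x']) (auto simp: add.commute)
  also have "\<dots> = (\<integral>t. cis (- 2 * pi * (x' \<bullet> (\<xi> - \<xi>'))) * (\<phi> t * cnj (\<psi> (t - (x - x'))) * cis (- 2 * pi * (t \<bullet> (\<xi> - \<xi>')))) \<partial>lborel)"
  proof (rule Bochner_Integration.integral_cong[OF refl])
    fix t
    have "cis (- 2 * pi * ((t + x') \<bullet> (\<xi> - \<xi>'))) = cis (- 2 * pi * (x' \<bullet> (\<xi> - \<xi>'))) * cis (- 2 * pi * (t \<bullet> (\<xi> - \<xi>')))"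
      unfolding cis_mult by (rule arg_cong[where f = cis]) (simp add: inner_add_left algebra_simps)
    moreover have "t + x' - x = t - (x - x')" by simp
    ultimately show "\<phi> t * cnj (\<psi> (t + x' - x)) * cis (- 2 * pi * ((t + x') \<bullet> (\<xi> - \<xi>')))
      = cis (- 2 * pi * (x' \<bullet> (\<xi> - \<xi>'))) * (\<phi> t * cnj (\<psi> (t - (x - x'))) * cis (- 2 * pi * (t \<bullet> (\<xi> - \<xi>'))))"
      by (simp only: mult_ac)
  qed
  also have "\<dots> = cis (- 2 * pi * (x' \<bullet> (\<xi> - \<xi>'))) * stf \<psi> \<phi> (z - y)"
    unfolding stf_def by (simp add: z)
  finally have "cmod (cnj (stf \<phi> (modulation (snd z) (translation (fst z) \<psi>)) y)) = cmod (stf \<psi> \<phi> (z - y))"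
    by (simp add: norm_mult)
  then show ?thesis by simp
qed

text \<open>A comparison of the transform at two nearby points thereby becomes a comparison of two
  windows at one point, the form in which the sampling estimate is proved.\<close>

lemma cmod_stf_window_shift:
  "cmod (stf (modulation \<eta> (translation h \<phi>)) f z) = cmod (stf \<phi> f (z + (h, \<eta>)))"
proof -
  have "stf (modulation \<eta> (translation h \<phi>)) f z
    = (\<integral>t. cis (2 * pi * (fst z \<bullet> \<eta>)) * (f t * cnj (\<phi> (t - fst (z + (h, \<eta>)))) * cis (- 2 * pi * (t \<bullet> snd (z + (h, \<eta>))))) \<partial>lborel)"
    unfolding stf_def
  proof (rule Bochner_Integration.integral_cong[OF refl])
    fix t
    have "cnj (cis (2 * pi * ((t - fst z) \<bullet> \<eta>))) * cis (- 2 * pi * (t \<bullet> snd z))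
      = cis (2 * pi * (fst z \<bullet> \<eta>)) * cis (- 2 * pi * (t \<bullet> snd (z + (h, \<eta>))))"
      unfolding cnj_cis cis_mult by (rule arg_cong[where f = cis]) (simp add: inner_diff_left inner_add_right algebra_simps)
    moreover have eq: "t - fst (z + (h, \<eta>)) = t - fst z - h" by simp
    moreover have "F * (A * P) * B = C * (F * P * D)" if "A * B = C * D" for A B C D F P :: complex
      using that by (metis mult.assoc mult.left_commute)
    ultimately show "f t * cnj (modulation \<eta> (translation h \<phi>) (t - fst z)) * cis (- 2 * pi * (t \<bullet> snd z))
      = cis (2 * pi * (fst z \<bullet> \<eta>)) * (f t * cnj (\<phi> (t - fst (z + (h, \<eta>)))) * cis (- 2 * pi * (t \<bullet> snd (z + (h, \<eta>)))))"
      unfolding modulation_def translation_def complex_cnj_mult eq by blast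
  qed
  also have "\<dots> = cis (2 * pi * (fst z \<bullet> \<eta>)) * stf \<phi> f (z + (h, \<eta>))"
    unfolding stf_def by simp
  finally show ?thesis by (simp add: norm_mult)
qed

lemma continuous_modulation_translation:
  assumes "continuous_on UNIV \<psi>"
  shows "continuous_on UNIV (modulation \<eta> (translation h \<psi>))"
  unfolding modulation_def translation_def
  by (intro continuous_intros continuous_on_compose2[OF assms]) auto

lemma rapid_modulation_translation:
  assumes "rapid \<psi>"
  shows "rapid (modulation \<eta> (translation h \<psi>))"
  unfolding rapid_def
proof
  fix N
  obtain C where C: "0 \<le> C" "\<And>x. cmod (\<psi> x) \<le> C * decay N x"
    using rapidE[OF assms] by blast
  have "cmod (modulation \<eta> (translation h \<psi>) x) \<le> (C * (1 + norm h) ^ N) * decay N x" for x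
  proof -
    have "cmod (modulation \<eta> (translation h \<psi>) x) \<le> C * decay N (x - h)"
      using C by (simp add: modulation_def translation_def norm_mult)
    also have "\<dots> \<le> C * ((1 + norm h) ^ N * decay N x)"
      using decay_le_shift[of N "x - h" x] C by (intro mult_left_mono) auto
    finally show ?thesis by (simp add: mult.assoc)
  qed
  then show "\<exists>C. \<forall>x. cmod (modulation \<eta> (translation h \<psi>) x) \<le> C * decay N x" by blast
qed

lemma rapid_mult_bounded:
  assumes "rapid f" "\<And>x. cmod (g x) \<le> B"
  shows "rapid (\<lambda>x. f x * g x)"
  unfolding rapid_def
proof
  fix N
  obtain C where C: "0 \<le> C" "\<And>x. cmod (f x) \<le> C * decay N x"
    using rapidE[OF assms(1)] by blast
  have "cmod (f x * g x) \<le> (C * B) * decay N x" for x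
    using mult_mono[OF C(2) assms(2), of x x] C by (simp add: norm_mult mult_ac)
  then show "\<exists>C. \<forall>x. cmod (f x * g x) \<le> C * decay N x" by blast
qed

text \<open>Inversion on each time slice gives the orthogonality relation of the short-time Fourier transform;
  only \<open>f\<close> and the window need to be regular, \<open>g\<close> is an arbitrary rapidly decaying function.\<close>

lemma stf_orthogonality:
  assumes f: "tame f" and \<phi>: "tame \<phi>" and g: "continuous_on UNIV g" "rapid g"
  shows "(\<integral>x. \<integral>\<xi>. stf \<phi> f (x, \<xi>) * cnj (stf \<phi> g (x, \<xi>)) \<partial>lborel \<partial>lborel)
    = of_real (energy \<phi>) * (\<integral>t. f t * cnj (g t) \<partial>lborel)"
proof -
  have gm [measurable]: "g \<in> borel_measurable borel"
    using g by (simp add: borel_measurable_continuous_onI)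
  note [measurable] = tame_measurable[OF f] tame_measurable[OF \<phi>]
  obtain B\<phi> where B\<phi>: "0 \<le> B\<phi>" "\<And>x. cmod (\<phi> x) \<le> B\<phi>" using rapid_bounded[OF tame_rapid[OF \<phi>]] by blast
  obtain Bf where Bf: "0 \<le> Bf" "\<And>x. cmod (f x) \<le> Bf" using rapid_bounded[OF tame_rapid[OF f]] by blast
  obtain Bg where Bg: "0 \<le> Bg" "\<And>x. cmod (g x) \<le> Bg" using rapid_bounded[OF g(2)] by blast
  have ig: "integrable lborel g" by (rule rapid_integrable[OF g(2)]) measurable
  have slice: "(\<integral>\<xi>. stf \<phi> f (x, \<xi>) * cnj (stf \<phi> g (x, \<xi>)) \<partial>lborel)
      = (\<integral>t. f t * cnj (g t) * of_real ((cmod (\<phi> (t - x)))\<^sup>2) \<partial>lborel)" for x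
  proof -
    define u where "u t = f t * cnj (\<phi> (t - x))" for t
    have cu: "continuous_on UNIV u"
      unfolding u_def
      by (intro continuous_intros continuous_on_compose2[OF tame_continuous[OF \<phi>]] tame_continuous[OF f]) auto
    have [measurable]: "u \<in> borel_measurable borel" using cu by (simp add: borel_measurable_continuous_onI)
    have ru: "rapid u"
      unfolding u_def by (rule rapid_mult_bounded[OF tame_rapid[OF f]]) (use B\<phi> in auto)
    have hat: "inv_fourier u (- \<xi>) = stf \<phi> f (x, \<xi>)" for \<xi>
      unfolding inv_fourier_def stf_def u_def by (simp add: inner_commute)
    then have hat': "inv_fourier u \<xi> = stf \<phi> f (x, - \<xi>)" for \<xi>
      using hat[of "- \<xi>"] by simp
    have "rapid (inv_fourier u)"
      unfolding rapid_def
    proof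
      fix N
      obtain C where C: "0 \<le> C" "\<And>z. cmod (stf \<phi> f z) \<le> C * decay N (snd z)"
        using stf_decay_frequency[OF f \<phi>] by blast
      then show "\<exists>C. \<forall>\<xi>. cmod (inv_fourier u \<xi>) \<le> C * decay N \<xi>"
        unfolding hat' by (metis decay_minus snd_conv)
    qed
    with cu ru have u: "tame u" by (simp add: tame_def)
    have iu: "integrable lborel (inv_fourier u)"
      by (rule rapid_integrable) (use u in \<open>auto simp: tame_def\<close>)
    have istf: "integrable lborel (\<lambda>\<xi>. stf \<phi> f (x, \<xi>))"
      using lborel_integrable_affine[OF iu, of "- 1" 0] by (simp add: hat)
    define F where "F p = (stf \<phi> f (x, fst p) * (cnj (g (snd p)) * \<phi> (snd p - x))) * cis (2 * pi * (snd p \<bullet> fst p))" for p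
    have "integrable lborel (\<lambda>t. cnj (g t) * \<phi> (t - x))"
      by (rule Bochner_Integration.integrable_bound[OF integrable_mult_right[OF integrable_norm[OF ig], of B\<phi>]])
         (use B\<phi> in \<open>auto simp: norm_mult mult.commute[of _ "cmod (g _)"] intro!: mult_left_mono\<close>)
    from integrable_product[OF istf this] have F: "integrable lborel F"
    proof (rule Bochner_Integration.integrable_bound)
      have [measurable]: "stf \<phi> f \<in> borel_measurable (borel \<Otimes>\<^sub>M borel)" by (simp add: borel_prod)
      have "F \<in> borel_measurable (borel \<Otimes>\<^sub>M borel)"
        unfolding F_def by measurable
      then show "F \<in> borel_measurable lborel" by (simp add: borel_prod)
    qed (auto simp: F_def norm_mult)
    have "(\<integral>\<xi>. stf \<phi> f (x, \<xi>) * cnj (stf \<phi> g (x, \<xi>)) \<partial>lborel) = (\<integral>\<xi>. \<integral>t. F (\<xi>, t) \<partial>lborel \<partial>lborel)"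
    proof (rule Bochner_Integration.integral_cong[OF refl])
      fix \<xi>
      have "stf \<phi> f (x, \<xi>) * cnj (stf \<phi> g (x, \<xi>))
        = (\<integral>t. stf \<phi> f (x, \<xi>) * cnj (g t * cnj (\<phi> (t - x)) * cis (- 2 * pi * (t \<bullet> \<xi>))) \<partial>lborel)"
        by (subst integral_mult_right_zero, subst Bochner_Integration.integral_cnj) (simp only: stf_def fst_conv snd_conv)
      also have "\<dots> = (\<integral>t. F (\<xi>, t) \<partial>lborel)"
        by (intro Bochner_Integration.integral_cong refl) (simp add: F_def cnj_cis mult_ac)
      finally show "stf \<phi> f (x, \<xi>) * cnj (stf \<phi> g (x, \<xi>)) = (\<integral>t. F (\<xi>, t) \<partial>lborel)" .
    qed
    also have "\<dots> = (\<integral>t. \<integral>\<xi>. F (\<xi>, t) \<partial>lborel \<partial>lborel)"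
      by (rule lborel_integral_swap[OF F])
    also have "\<dots> = (\<integral>t. f t * cnj (g t) * of_real ((cmod (\<phi> (t - x)))\<^sup>2) \<partial>lborel)"
    proof (rule Bochner_Integration.integral_cong[OF refl])
      fix t
      have "(\<integral>\<xi>. F (\<xi>, t) \<partial>lborel) = (cnj (g t) * \<phi> (t - x)) * (\<integral>\<xi>. stf \<phi> f (x, \<xi>) * cis (2 * pi * (t \<bullet> \<xi>)) \<partial>lborel)"
        unfolding F_def by (simp add: mult_ac)
      also have "(\<integral>\<xi>. stf \<phi> f (x, \<xi>) * cis (2 * pi * (t \<bullet> \<xi>)) \<partial>lborel) = (\<integral>\<xi>. inv_fourier u \<xi> * cis (- 2 * pi * (t \<bullet> \<xi>)) \<partial>lborel)"
        by (subst lborel_integral_affine[where c = "- 1" and t = 0]) (auto simp: hat')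
      also have "\<dots> = u t" by (rule tame_inversion[OF u, symmetric])
      finally show "(\<integral>\<xi>. F (\<xi>, t) \<partial>lborel) = f t * cnj (g t) * of_real ((cmod (\<phi> (t - x)))\<^sup>2)"
        by (simp only: u_def complex_norm_square) (simp add: mult_ac)
    qed
    finally show ?thesis .
  qed
  \<comment> \<open>For integrability on the product space, \<open>f\<close> supplies decay of order
    \<open>2 * M\<close> in \<open>t\<close>; half of it, together with the decay of \<phi> at
    \<open>t - x\<close>, becomes decay in \<open>x\<close>.\<close>
  define G where "G p = f (snd p) * cnj (g (snd p)) * of_real ((cmod (\<phi> (snd p - fst p)))\<^sup>2)" for p
  have G: "integrable lborel G"
  proof -
    define M where "M = DIM('a \<times> 'a) + 2"
    obtain C1 where C1: "0 \<le> C1" "\<And>x. cmod (f x) \<le> C1 * decay (M + M) x"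
      using rapidE[OF tame_rapid[OF f]] by blast
    obtain C2 where C2: "0 \<le> C2" "\<And>x. cmod (\<phi> x) \<le> C2 * decay M x"
      using rapidE[OF tame_rapid[OF \<phi>]] by blast
    have "cmod (G p) \<le> (C1 * Bg * (C2 * B\<phi>)) * decay M p" for p
    proof -
      have "cmod (G p) = cmod (f (snd p)) * cmod (g (snd p)) * (cmod (\<phi> (snd p - fst p)) * cmod (\<phi> (snd p - fst p)))"
        by (simp add: G_def norm_mult power2_eq_square)
      also have "\<dots> \<le> (C1 * decay (M + M) (snd p)) * Bg * ((C2 * decay M (snd p - fst p)) * B\<phi>)"
        using C1 C2 Bg B\<phi> by (intro mult_mono) auto
      also have "\<dots> = (C1 * Bg * (C2 * B\<phi>)) * decay M (snd p) * (decay M (snd p) * decay M (fst p - snd p))"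
        by (simp add: decay_add decay_commute[of M "snd p"] mult_ac)
      also have "\<dots> \<le> (C1 * Bg * (C2 * B\<phi>)) * decay M (snd p) * decay M (fst p)"
        using decay_mult_le[of M "snd p" "fst p - snd p"] C1 C2 Bg B\<phi> by (intro mult_left_mono) auto
      also have "\<dots> \<le> (C1 * Bg * (C2 * B\<phi>)) * decay M p"
        using decay_Pair[of M p] C1 C2 Bg B\<phi> by (simp add: mult.assoc mult.commute[of "decay M (snd p)"] mult_left_mono)
      finally show ?thesis .
    qed
    moreover have "G \<in> borel_measurable (borel \<Otimes>\<^sub>M borel)"
      unfolding G_def by measurable
    then have "G \<in> borel_measurable borel" by (simp add: borel_prod)
    ultimately show ?thesis
      unfolding M_def by (intro integrable_of_decay)
  qed
  have "(\<integral>x. \<integral>\<xi>. stf \<phi> f (x, \<xi>) * cnj (stf \<phi> g (x, \<xi>)) \<partial>lborel \<partial>lborel) = (\<integral>x. \<integral>t. G (x, t) \<partial>lborel \<partial>lborel)"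
    by (simp add: slice G_def)
  also have "\<dots> = (\<integral>t. \<integral>x. G (x, t) \<partial>lborel \<partial>lborel)"
    by (rule lborel_integral_swap[OF G])
  also have "\<dots> = (\<integral>t. of_real (energy \<phi>) * (f t * cnj (g t)) \<partial>lborel)"
  proof (rule Bochner_Integration.integral_cong[OF refl])
    fix t
    have "(\<integral>x. G (x, t) \<partial>lborel) = f t * cnj (g t) * of_real (\<integral>x. (cmod (\<phi> (t - x)))\<^sup>2 \<partial>lborel)"
      unfolding G_def by (simp flip: integral_complex_of_real)
    also have "(\<integral>x. (cmod (\<phi> (t - x)))\<^sup>2 \<partial>lborel) = energy \<phi>"
      unfolding energy_def by (subst lborel_integral_affine[where c = "- 1" and t = t]) auto
    finally show "(\<integral>x. G (x, t) \<partial>lborel) = of_real (energy \<phi>) * (f t * cnj (g t))" by simp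
  qed
  finally show ?thesis by simp
qed

text \<open>If the energy vanished, \<phi> would be zero almost everywhere; by continuity its zero
  set is closed, hence the whole space.\<close>

lemma energy_pos:
  assumes \<phi>: "tame \<phi>" and "\<phi> \<noteq> (\<lambda>_. 0)"
  shows "0 < energy \<phi>"
proof -
  note [measurable] = tame_measurable[OF \<phi>]
  obtain B where B: "0 \<le> B" "\<And>x. cmod (\<phi> x) \<le> B" using rapid_bounded[OF tame_rapid[OF \<phi>]] by blast
  have i\<phi>: "integrable lborel \<phi>" by (rule rapid_integrable[OF tame_rapid[OF \<phi>]]) measurable
  have int: "integrable lborel (\<lambda>t. (cmod (\<phi> t))\<^sup>2)"
    by (rule Bochner_Integration.integrable_bound[OF integrable_mult_right[OF integrable_norm[OF i\<phi>], of B]])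
       (use B in \<open>auto simp: power2_eq_square intro!: mult_right_mono\<close>)
  have "energy \<phi> \<noteq> 0"
  proof
    assume "energy \<phi> = 0"
    then have "AE t in lborel. (cmod (\<phi> t))\<^sup>2 = 0"
      using int by (simp add: energy_def integral_nonneg_eq_0_iff_AE)
    then have "AE t in lborel. t \<in> {t. \<phi> t = 0}" by simp
    then have ae: "AE t in lebesgue. t \<in> {t. \<phi> t = 0}" by (rule AE_completion)
    have "closed {t. \<phi> t = 0}"
      using tame_continuous[OF \<phi>] by (intro closed_Collect_eq continuous_intros) auto
    from mem_closed_if_AE_lebesgue[OF this ae] have "\<phi> t = 0" for t by simp
    with assms(2) show False by auto
  qed
  moreover have "0 \<le> energy \<phi>" by (simp add: energy_def)
  ultimately show ?thesis by simp
qed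

text \<open>The reproducing formula: orthogonality against the shifted window \<open>g\<close>
  writes \<open>stf \<psi> f z\<close> as an integral of \<open>stf \<phi> f\<close> with a kernel
  of modulus \<open>cmod (stf \<psi> \<phi> (z - y))\<close>. The first \<open>N\<close> orders of
  its decay form the maximal function, the others make the integral finite. The constant is linear
  in \<open>H\<close>, because sampling uses the estimate with small \<open>H\<close>.\<close>

lemma stf_le_peetre:
  fixes f :: "'a::euclidean_space \<Rightarrow> complex"
  assumes f: "tame f" and \<phi>: "tame \<phi>" "\<phi> \<noteq> (\<lambda>_. 0)" and \<psi>: "continuous_on UNIV \<psi>" "rapid \<psi>"
    and H: "0 \<le> H" "\<And>y. cmod (stf \<psi> \<phi> y) \<le> H * decay (N + (DIM('a \<times> 'a) + 2)) y"
  shows "ennreal (cmod (stf \<psi> f z)) \<le>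
    ennreal (H * (\<integral>y. decay (DIM('a \<times> 'a) + 2) (y::'a\<times>'a) \<partial>lborel) / energy \<phi>) * peetre N (\<lambda>w. ennreal (cmod (stf \<phi> f w))) z"
proof -
  define M where "M = DIM('a \<times> 'a) + 2"
  define P where "P = peetre N (\<lambda>w. ennreal (cmod (stf \<phi> f w))) z"
  define g where "g = modulation (snd z) (translation (fst z) \<psi>)"
  have E: "0 < energy \<phi>" by (rule energy_pos[OF \<phi>])
  have g: "continuous_on UNIV g" "rapid g"
    unfolding g_def using \<psi> by (auto intro: continuous_modulation_translation rapid_modulation_translation)
  have [measurable]: "g \<in> borel_measurable borel" "\<psi> \<in> borel_measurable borel"
    using g \<psi> by (auto simp: borel_measurable_continuous_onI)
  note [measurable] = tame_measurable[OF f] tame_measurable[OF \<phi>(1)]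
  have meas [measurable]: "(\<lambda>y. cmod (stf \<phi> f y * cnj (stf \<phi> g y))) \<in> borel_measurable borel"
    by measurable
  have "ennreal (energy \<phi>) * ennreal (cmod (stf \<psi> f z))
      = ennreal (cmod (\<integral>x. \<integral>\<xi>. stf \<phi> f (x, \<xi>) * cnj (stf \<phi> g (x, \<xi>)) \<partial>lborel \<partial>lborel))"
    unfolding stf_orthogonality[OF f \<phi>(1) g] using E
    by (simp add: norm_mult ennreal_mult' g_def flip: stf_eq_inner)
  also have "\<dots> \<le> (\<integral>\<^sup>+x. ennreal (cmod (\<integral>\<xi>. stf \<phi> f (x, \<xi>) * cnj (stf \<phi> g (x, \<xi>)) \<partial>lborel)) \<partial>lborel)"
    by (rule norm_integral_le_nn_integral)
  also have "\<dots> \<le> (\<integral>\<^sup>+x. \<integral>\<^sup>+\<xi>. ennreal (cmod (stf \<phi> f (x, \<xi>) * cnj (stf \<phi> g (x, \<xi>)))) \<partial>lborel \<partial>lborel)"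
    by (intro nn_integral_mono norm_integral_le_nn_integral)
  also have "\<dots> = (\<integral>\<^sup>+y. ennreal (cmod (stf \<phi> f y * cnj (stf \<phi> g y))) \<partial>(lborel \<Otimes>\<^sub>M lborel))"
    by (subst lborel.nn_integral_fst) (auto simp: lborel_prod)
  also have "\<dots> = (\<integral>\<^sup>+y. ennreal (cmod (stf \<phi> f y * cnj (stf \<phi> g y))) \<partial>lborel)"
    by (simp add: lborel_prod)
  also have "\<dots> \<le> (\<integral>\<^sup>+y. P * ennreal H * ennreal (decay M (z - y)) \<partial>lborel)"
  proof (rule nn_integral_mono)
    fix y
    have "cmod (stf \<phi> g y) \<le> H * decay (N + M) (z - y)"
      unfolding g_def using H by (subst cmod_stf_shifted) (auto simp: M_def)
    then have "ennreal (cmod (stf \<phi> f y * cnj (stf \<phi> g y))) \<le> ennreal (cmod (stf \<phi> f y) * (H * decay (N + M) (z - y)))"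
      by (intro ennreal_leI) (auto simp: norm_mult intro!: mult_left_mono)
    also have "\<dots> = (ennreal (cmod (stf \<phi> f y)) * ennreal (decay N (z - y))) * ennreal H * ennreal (decay M (z - y))"
      using H by (simp add: ennreal_mult' decay_add mult_ac)
    also have "\<dots> \<le> P * ennreal H * ennreal (decay M (z - y))"
      unfolding P_def by (intro mult_right_mono peetre_upper[of "\<lambda>w. ennreal (cmod (stf \<phi> f w))"]) auto
    finally show "ennreal (cmod (stf \<phi> f y * cnj (stf \<phi> g y))) \<le> P * ennreal H * ennreal (decay M (z - y))" .
  qed
  also have "\<dots> = P * ennreal H * (\<integral>\<^sup>+y. ennreal (decay M (z - y)) \<partial>lborel)"
    by (rule nn_integral_cmult) measurable
  also have "(\<integral>\<^sup>+y. ennreal (decay M (z - y)) \<partial>lborel) = (\<integral>\<^sup>+y. ennreal (decay M (y::'a\<times>'a)) \<partial>lborel)"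
    by (subst nn_integral_lborel_affine[where c = "- 1" and t = z]) auto
  also have "\<dots> = ennreal (\<integral>y. decay M (y::'a\<times>'a) \<partial>lborel)"
    by (rule nn_integral_eq_integral) (auto simp: M_def intro: integrable_decay)
  finally have "ennreal (1 / energy \<phi>) * (ennreal (energy \<phi>) * ennreal (cmod (stf \<psi> f z)))
    \<le> ennreal (1 / energy \<phi>) * (P * ennreal H * ennreal (\<integral>y. decay M (y::'a\<times>'a) \<partial>lborel))"
    by (rule mult_left_mono) simp
  moreover have "ennreal (1 / energy \<phi>) * (ennreal (energy \<phi>) * ennreal (cmod (stf \<psi> f z))) = ennreal (cmod (stf \<psi> f z))"
    using E by (simp flip: ennreal_mult')
  moreover have "ennreal (1 / energy \<phi>) * (P * ennreal H * ennreal (\<integral>y. decay M (y::'a\<times>'a) \<partial>lborel))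
     = ennreal (H * (\<integral>y. decay M (y::'a\<times>'a) \<partial>lborel) / energy \<phi>) * P"
    using E H by (simp add: ennreal_mult' divide_inverse mult_ac)
  ultimately show ?thesis by (simp add: P_def M_def)
qed

section \<open>Change of window and sampling\<close>

definition stf_abs :: "('a::euclidean_space \<Rightarrow> complex) \<Rightarrow> ('a \<Rightarrow> complex) \<Rightarrow> 'a \<times> 'a \<Rightarrow> ennreal" where
  "stf_abs \<phi> f z = ennreal (cmod (stf \<phi> f z))"

text \<open>The maximal function of a maximal function of the same order is that function again, so
  a pointwise bound by a maximal function passes to maximal functions without loss of order.\<close>

lemma peetre_stf_window_change:
  assumes \<phi>: "tame \<phi>" "\<phi> \<noteq> (\<lambda>_. 0)" and \<psi>: "tame \<psi>"
  shows "\<exists>K\<ge>0. \<forall>f. tame f \<longrightarrow> (\<forall>z. peetre N (stf_abs \<psi> f) z \<le> ennreal K * peetre N (stf_abs \<phi> f) z)"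
proof -
  obtain H where H: "0 \<le> H" "\<And>y. cmod (stf \<psi> \<phi> y) \<le> H * decay (N + (DIM('a \<times> 'a) + 2)) y"
    using rapidE[OF rapid_stf[OF \<phi>(1) \<psi>]] by blast
  define K where "K = H * (\<integral>y. decay (DIM('a \<times> 'a) + 2) (y :: 'a \<times> 'a) \<partial>lborel) / energy \<phi>"
  have "0 \<le> K"
    using H(1) energy_pos[OF \<phi>] by (simp add: K_def)
  moreover have "peetre N (stf_abs \<psi> f) z \<le> ennreal K * peetre N (stf_abs \<phi> f) z" if f: "tame f" for f z
  proof -
    have "peetre N (stf_abs \<psi> f) z \<le> peetre N (\<lambda>w. ennreal K * peetre N (stf_abs \<phi> f) w) z"
      using stf_le_peetre[OF f \<phi> tame_continuous[OF \<psi>] tame_rapid[OF \<psi>] H]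
      by (intro peetre_mono) (simp add: stf_abs_def[abs_def] K_def)
    then show ?thesis
      by (simp add: peetre_cmult peetre_peetre)
  qed
  ultimately show ?thesis by blast
qed

lemma cmod_cis_diff: "cmod (cis a - cis b) \<le> \<bar>a - b\<bar>"
proof -
  have 1: "cis a - cis b = cis b * (cis (a - b) - 1)"
    unfolding right_diff_distrib cis_mult by simp
  have 2: "cmod (cis (a - b) - 1) = cmod (iexp (a - b) - 1)"
    by (simp only: cis_conv_exp)
  have 3: "cmod (iexp (a - b) - 1) \<le> \<bar>a - b\<bar>"
    using iexp_approx1[of "a - b" 0] by simp
  show ?thesis unfolding 1 norm_mult norm_cis using 2 3 by linarith
qed

text \<open>By inversion an increment of \<phi> is an integral of phase differences, each at most
  \<open>2 * pi * (norm h * norm \<eta>)\<close>; one extra order of decay absorbs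
  \<open>norm \<eta>\<close>.\<close>

lemma tame_lipschitz:
  assumes "tame \<phi>"
  shows "\<exists>C\<ge>0. \<forall>t h. cmod (\<phi> t - \<phi> (t - h)) \<le> C * norm h"
proof -
  note [measurable] = tame_measurable[OF assms]
  define M where "M = DIM('a) + 2"
  have r: "rapid (inv_fourier \<phi>)" using assms by (simp add: tame_def)
  obtain C1 where C1: "0 \<le> C1" "\<And>x. cmod (inv_fourier \<phi> x) \<le> C1 * decay (M + 1) x"
    using rapidE[OF r] by blast
  have int: "integrable lborel (inv_fourier \<phi>)"
    by (rule rapid_integrable[OF r]) measurable
  have inti: "integrable lborel (\<lambda>\<eta>. inv_fourier \<phi> \<eta> * cis (- 2 * pi * (t \<bullet> \<eta>)))" for t
  proof -
    have [measurable]: "inv_fourier \<phi> \<in> borel_measurable borel" by measurable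
    show ?thesis
      by (rule Bochner_Integration.integrable_bound[OF integrable_norm[OF int]]) (auto simp: norm_mult)
  qed
  have "cmod (\<phi> t - \<phi> (t - h)) \<le> (2 * pi * C1 * (\<integral>\<eta>. decay M (\<eta>::'a) \<partial>lborel)) * norm h" for t h
  proof -
    have "\<phi> t - \<phi> (t - h) = (\<integral>\<eta>. inv_fourier \<phi> \<eta> * cis (- 2 * pi * (t \<bullet> \<eta>)) \<partial>lborel)
      - (\<integral>\<eta>. inv_fourier \<phi> \<eta> * cis (- 2 * pi * ((t - h) \<bullet> \<eta>)) \<partial>lborel)"
      by (simp only: tame_inversion[OF assms, symmetric])
    also have "\<dots> = (\<integral>\<eta>. inv_fourier \<phi> \<eta> * cis (- 2 * pi * (t \<bullet> \<eta>)) - inv_fourier \<phi> \<eta> * cis (- 2 * pi * ((t - h) \<bullet> \<eta>)) \<partial>lborel)"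
      by (rule Bochner_Integration.integral_diff[symmetric]) (rule inti)+
    also have "cmod \<dots> \<le> (\<integral>\<eta>. (2 * pi * C1 * norm h) * decay M (\<eta>::'a) \<partial>lborel)"
    proof (rule cmod_integral_le)
      show "integrable lborel (\<lambda>\<eta>::'a. 2 * pi * C1 * norm h * decay M \<eta>)"
        by (intro integrable_mult_right integrable_decay) (simp add: M_def)
      fix \<eta> :: 'a
      have "inv_fourier \<phi> \<eta> * cis (- 2 * pi * (t \<bullet> \<eta>)) - inv_fourier \<phi> \<eta> * cis (- 2 * pi * ((t - h) \<bullet> \<eta>))
         = inv_fourier \<phi> \<eta> * (cis (- 2 * pi * (t \<bullet> \<eta>)) - cis (- 2 * pi * ((t - h) \<bullet> \<eta>)))"
        by (simp only: right_diff_distrib)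
      then have "cmod (inv_fourier \<phi> \<eta> * cis (- 2 * pi * (t \<bullet> \<eta>)) - inv_fourier \<phi> \<eta> * cis (- 2 * pi * ((t - h) \<bullet> \<eta>)))
         = cmod (inv_fourier \<phi> \<eta>) * cmod (cis (- 2 * pi * (t \<bullet> \<eta>)) - cis (- 2 * pi * ((t - h) \<bullet> \<eta>)))"
        by (simp only: norm_mult)
      also have "\<dots> \<le> (C1 * decay (M + 1) \<eta>) * (2 * pi * (norm h * norm \<eta>))"
      proof (rule mult_mono[OF C1(2)])
        have "cmod (cis (- 2 * pi * (t \<bullet> \<eta>)) - cis (- 2 * pi * ((t - h) \<bullet> \<eta>))) \<le> \<bar>- 2 * pi * (t \<bullet> \<eta>) - - 2 * pi * ((t - h) \<bullet> \<eta>)\<bar>"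
          by (rule cmod_cis_diff)
        also have "\<dots> = 2 * pi * \<bar>h \<bullet> \<eta>\<bar>"
          by (simp add: inner_diff_left right_diff_distrib abs_mult)
        also have "\<dots> \<le> 2 * pi * (norm h * norm \<eta>)"
          by (intro mult_left_mono Cauchy_Schwarz_ineq2) simp
        finally show "cmod (cis (- 2 * pi * (t \<bullet> \<eta>)) - cis (- 2 * pi * ((t - h) \<bullet> \<eta>))) \<le> 2 * pi * (norm h * norm \<eta>)" .
      qed (use C1(1) in auto)
      also have "\<dots> = 2 * pi * C1 * norm h * decay M \<eta> * (decay 1 \<eta> * norm \<eta>)"
        by (simp only: decay_add mult_ac)
      also have "\<dots> \<le> 2 * pi * C1 * norm h * decay M \<eta> * 1"
      proof (rule mult_left_mono)
        show "decay 1 \<eta> * norm \<eta> \<le> 1"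
          by (simp add: decay_def field_simps add_pos_nonneg)
      qed (use C1(1) in auto)
      finally show "cmod (inv_fourier \<phi> \<eta> * cis (- 2 * pi * (t \<bullet> \<eta>)) - inv_fourier \<phi> \<eta> * cis (- 2 * pi * ((t - h) \<bullet> \<eta>)))
          \<le> 2 * pi * C1 * norm h * decay M \<eta>" by simp
    qed
    finally show ?thesis by (simp add: mult_ac)
  qed
  moreover have "0 \<le> 2 * pi * C1 * (\<integral>\<eta>. decay M (\<eta>::'a) \<partial>lborel)"
    using C1(1) by simp
  ultimately show ?thesis by blast
qed

lemma stf_window_diff:
  assumes f: "tame f" and \<phi>: "continuous_on UNIV \<phi>" "rapid \<phi>" and \<sigma>: "continuous_on UNIV \<sigma>" "rapid \<sigma>"
  shows "stf (\<lambda>t. \<phi> t - \<sigma> t) f z = stf \<phi> f z - stf \<sigma> f z"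
proof -
  note [measurable] = tame_measurable[OF f]
  have i: "integrable lborel (\<lambda>t. f t * cnj (\<psi> (t - fst z)) * cis (- 2 * pi * (t \<bullet> snd z)))"
    if c: "continuous_on UNIV \<psi>" and r: "rapid \<psi>" for \<psi>
  proof -
    obtain B where B: "0 \<le> B" "\<And>x. cmod (\<psi> x) \<le> B" using rapid_bounded[OF r] by blast
    have [measurable]: "\<psi> \<in> borel_measurable borel" using c by (simp add: borel_measurable_continuous_onI)
    have "rapid (\<lambda>t. f t * (cnj (\<psi> (t - fst z)) * cis (- 2 * pi * (t \<bullet> snd z))))"
      by (rule rapid_mult_bounded[OF tame_rapid[OF f], of _ B]) (simp add: norm_mult B(2))
    from rapid_integrable[OF this] show ?thesis by (simp add: mult.assoc)
  qed
  show ?thesis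
    unfolding stf_def Bochner_Integration.integral_diff[OF i[OF \<phi>] i[OF \<sigma>], symmetric]
    by (intro Bochner_Integration.integral_cong refl) (simp add: algebra_simps)
qed

text \<open>Interpolating the uniform smallness of \<open>\<phi> - M\<^sub>\<eta> T\<^sub>h \<phi>\<close> with the decay of its transform gives
  smallness with decay.\<close>

lemma stf_window_increment:
  fixes \<phi> :: "'a::euclidean_space \<Rightarrow> complex"
  assumes \<phi>: "tame \<phi>"
  shows "\<exists>K\<ge>0. \<forall>h \<eta> y. norm (h, \<eta>) \<le> 1 \<longrightarrow>
    cmod (stf (\<lambda>t. \<phi> t - modulation \<eta> (translation h \<phi>) t) \<phi> y) \<le> K * sqrt (norm (h, \<eta>)) * decay L y"
proof -
  note [measurable] = tame_measurable[OF \<phi>]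
  obtain C1 where C1: "0 \<le> C1" "\<And>t h. cmod (\<phi> t - \<phi> (t - h)) \<le> C1 * norm h"
    using tame_lipschitz[OF \<phi>] by blast
  obtain C2 where C2: "0 \<le> C2" "\<And>x. cmod (\<phi> x) \<le> C2 * decay 1 x"
    using rapidE[OF tame_rapid[OF \<phi>]] by blast
  obtain C3 where C3: "0 \<le> C3" "\<And>y. cmod (stf \<phi> \<phi> y) \<le> C3 * decay (L + L) y"
    using rapidE[OF rapid_stf[OF \<phi> \<phi>]] by blast
  have i\<phi>: "integrable lborel \<phi>"
    by (rule rapid_integrable[OF tame_rapid[OF \<phi>]]) measurable
  define I where "I = (\<integral>t. cmod (\<phi> t) \<partial>lborel)"
  have I: "0 \<le> I" by (simp add: I_def)
  define A where "A = (C1 + 2 * pi * C2) * I"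
  define D where "D = C3 * (1 + 2 ^ (L + L))"
  have AD: "0 \<le> A" "0 \<le> D" using C1(1) C2(1) C3(1) I by (simp_all add: A_def D_def)
  have main: "cmod (stf (\<lambda>t. \<phi> t - modulation \<eta> (translation h \<phi>) t) \<phi> y) \<le> sqrt (A * D) * sqrt (norm (h, \<eta>)) * decay L y"
    if small: "norm (h, \<eta>) \<le> 1" for h \<eta> y
  proof -
    define \<psi> where "\<psi> t = \<phi> t - modulation \<eta> (translation h \<phi>) t" for t
    have nh: "norm h \<le> norm (h, \<eta>)" "norm \<eta> \<le> norm (h, \<eta>)"
      by (simp_all add: norm_Pair)
    have \<psi>: "cmod (\<psi> t) \<le> (C1 + 2 * pi * C2) * norm (h, \<eta>)" for t
    proof -
      \<comment> \<open>Translation and modulation are separated. The modulation part grows like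
        \<open>norm t\<close>, which one order of decay of \<phi> compensates.\<close>
      have "\<psi> t = (\<phi> t - \<phi> (t - h)) * cis (2 * pi * (t \<bullet> \<eta>)) + (cis 0 - cis (2 * pi * (t \<bullet> \<eta>))) * \<phi> t"
        by (simp add: \<psi>_def modulation_def translation_def algebra_simps)
      also have "cmod \<dots> \<le> cmod (\<phi> t - \<phi> (t - h)) + cmod (cis 0 - cis (2 * pi * (t \<bullet> \<eta>))) * cmod (\<phi> t)"
        by (rule norm_triangle_le) (simp only: norm_mult norm_cis mult_1_right order_refl)
      also have "\<dots> \<le> C1 * norm h + (2 * pi * (norm t * norm \<eta>)) * (C2 * decay 1 t)"
      proof (intro add_mono mult_mono C1(2) C2(2))
        have "cmod (cis 0 - cis (2 * pi * (t \<bullet> \<eta>))) \<le> \<bar>0 - 2 * pi * (t \<bullet> \<eta>)\<bar>"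
          by (rule cmod_cis_diff)
        also have "\<dots> = 2 * pi * \<bar>t \<bullet> \<eta>\<bar>" by (simp add: abs_mult)
        also have "\<dots> \<le> 2 * pi * (norm t * norm \<eta>)"
          by (intro mult_left_mono Cauchy_Schwarz_ineq2) simp
        finally show "cmod (cis 0 - cis (2 * pi * (t \<bullet> \<eta>))) \<le> 2 * pi * (norm t * norm \<eta>)" .
      qed auto
      also have "\<dots> = C1 * norm h + 2 * pi * C2 * norm \<eta> * (norm t * decay 1 t)" by (simp only: mult_ac)
      also have "\<dots> \<le> C1 * norm (h, \<eta>) + 2 * pi * C2 * norm (h, \<eta>) * 1"
      proof (intro add_mono mult_mono)
        show "norm t * decay 1 t \<le> 1"
          by (simp add: decay_def field_simps add_pos_nonneg)
      qed (use nh C1(1) C2(1) in auto)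
      finally show ?thesis by (simp add: algebra_simps)
    qed
    have sup: "cmod (stf \<psi> \<phi> y) \<le> A * norm (h, \<eta>)"
    proof -
      have "cmod (stf \<psi> \<phi> y) \<le> (\<integral>t. ((C1 + 2 * pi * C2) * norm (h, \<eta>)) * cmod (\<phi> t) \<partial>lborel)"
        unfolding stf_def
      proof (rule cmod_integral_le)
        show "integrable lborel (\<lambda>t. (C1 + 2 * pi * C2) * norm (h, \<eta>) * cmod (\<phi> t))"
          using i\<phi> by simp
        fix t
        have "cmod (\<phi> t * cnj (\<psi> (t - fst y)) * cis (- 2 * pi * (t \<bullet> snd y))) = cmod (\<psi> (t - fst y)) * cmod (\<phi> t)"
          by (simp add: norm_mult)
        also have "\<dots> \<le> (C1 + 2 * pi * C2) * norm (h, \<eta>) * cmod (\<phi> t)"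
          by (intro mult_right_mono \<psi>) simp
        finally show "cmod (\<phi> t * cnj (\<psi> (t - fst y)) * cis (- 2 * pi * (t \<bullet> snd y))) \<le> (C1 + 2 * pi * C2) * norm (h, \<eta>) * cmod (\<phi> t)" .
      qed
      then show ?thesis by (simp add: A_def I_def mult_ac)
    qed
    have dec: "cmod (stf \<psi> \<phi> y) \<le> D * decay (L + L) y"
    proof -
      have "stf \<psi> \<phi> y = stf \<phi> \<phi> y - stf (modulation \<eta> (translation h \<phi>)) \<phi> y"
        unfolding \<psi>_def using tame_continuous[OF \<phi>] tame_rapid[OF \<phi>]
        by (intro stf_window_diff \<phi> continuous_modulation_translation rapid_modulation_translation)
      then have "cmod (stf \<psi> \<phi> y) \<le> cmod (stf \<phi> \<phi> y) + cmod (stf (modulation \<eta> (translation h \<phi>)) \<phi> y)"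
        by (simp only: norm_triangle_ineq4)
      also have "\<dots> \<le> C3 * decay (L + L) y + C3 * decay (L + L) (y + (h, \<eta>))"
        unfolding cmod_stf_window_shift by (intro add_mono C3(2))
      also have "\<dots> \<le> C3 * decay (L + L) y + C3 * (2 ^ (L + L) * decay (L + L) y)"
      proof (intro add_mono mult_left_mono order_refl C3(1))
        have "decay (L + L) (y + (h, \<eta>)) \<le> (1 + norm (h, \<eta>)) ^ (L + L) * decay (L + L) y"
          using decay_le_shift[of "L + L" "y + (h, \<eta>)" y] by simp
        also have "\<dots> \<le> 2 ^ (L + L) * decay (L + L) y"
          using small by (intro mult_right_mono power_mono) auto
        finally show "decay (L + L) (y + (h, \<eta>)) \<le> 2 ^ (L + L) * decay (L + L) y" .
      qed
      finally show ?thesis by (simp add: D_def algebra_simps)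
    qed
    \<comment> \<open>One factor is taken small, the other with twice the decay; the square root
      keeps half of each.\<close>
    have "cmod (stf \<psi> \<phi> y) * cmod (stf \<psi> \<phi> y) \<le> (A * norm (h, \<eta>)) * (D * decay (L + L) y)"
      by (rule mult_mono[OF sup dec]) (use AD in auto)
    also have "\<dots> = (A * D) * norm (h, \<eta>) * (decay L y * decay L y)" by (simp only: decay_add mult_ac)
    also have "\<dots> = (sqrt (A * D) * sqrt (norm (h, \<eta>)) * decay L y)\<^sup>2"
      using AD by (simp add: power_mult_distrib power2_eq_square[of "decay L y"])
    finally have "(cmod (stf \<psi> \<phi> y))\<^sup>2 \<le> (sqrt (A * D) * sqrt (norm (h, \<eta>)) * decay L y)\<^sup>2"
      by (simp only: power2_eq_square[of "cmod (stf \<psi> \<phi> y)"])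
    then have "cmod (stf \<psi> \<phi> y) \<le> sqrt (A * D) * sqrt (norm (h, \<eta>)) * decay L y"
      by (rule power2_le_imp_le) (use AD in simp)
    then show ?thesis by (simp only: \<psi>_def[abs_def])
  qed
  then show ?thesis
    using AD by (intro exI[of _ "sqrt (A * D)"]) simp
qed

lemma peetre_stf_finite:
  assumes f: "tame f" and \<phi>: "tame \<phi>"
  shows "peetre N (stf_abs \<phi> f) z < \<infinity>"
proof -
  obtain B where "\<And>z. cmod (stf \<phi> f z) \<le> B"
    using rapid_bounded[OF rapid_stf[OF f \<phi>]] by blast
  then show ?thesis
    by (intro peetre_finite[of _ B]) (simp add: stf_abs_def ennreal_leI)
qed

text \<open>A value at \<open>w\<close> is compared with the value at a node \<open>y\<close>: the
  difference is a transform with a window increment, at most half the maximal function once the mesh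
  is fine. So the maximal function \<open>P\<close> is at most \<open>2 ^ N\<close> times the
  sampled one plus \<open>P / 2\<close>, and finiteness of \<open>P\<close> permits absorption. The
  mesh depends on the window and \<open>N\<close>, not on \<open>f\<close>.\<close>

lemma stf_sampling:
  fixes \<phi> :: "'a::euclidean_space \<Rightarrow> complex"
  assumes \<phi>: "tame \<phi>" "\<phi> \<noteq> (\<lambda>_. 0)"
  shows "\<exists>\<delta>>0. \<forall>f Y. tame f \<longrightarrow> (\<forall>w. \<exists>y\<in>Y. norm (y - w) \<le> \<delta>) \<longrightarrow>
    (\<forall>z. peetre N (stf_abs \<phi> f) z \<le> ennreal (2 ^ (N + 1)) * (SUP y\<in>Y. stf_abs \<phi> f y * ennreal (decay N (z - y))))"
proof -
  define M where "M = DIM('a \<times> 'a) + 2"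
  obtain K where K: "0 \<le> K" "\<And>h \<eta> y. norm (h, \<eta>) \<le> 1 \<Longrightarrow>
    cmod (stf (\<lambda>t. \<phi> t - modulation \<eta> (translation h \<phi>) t) \<phi> y) \<le> K * sqrt (norm (h, \<eta>)) * decay (N + M) y"
    using stf_window_increment[OF \<phi>(1), of "N + M"] by blast
  define S where "S = (\<integral>y. decay M (y :: 'a \<times> 'a) \<partial>lborel)"
  have S: "0 \<le> S" by (simp add: S_def)
  have E: "0 < energy \<phi>" by (rule energy_pos[OF \<phi>])
  \<comment> \<open>\<delta> is the inverse square of \<open>Q\<close> since a window increment is
    only of the size of the square root of its shift. With this \<open>Q\<close> the constant in
    \<open>half\<close> is at most 1/2, and the added 1 keeps \<delta> at most 1.\<close>
  define Q where "Q = 2 * (K * S / energy \<phi>) + 1"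
  have Q: "1 \<le> Q" using K(1) S E by (simp add: Q_def)
  define \<delta> where "\<delta> = 1 / Q\<^sup>2"
  have \<delta>: "0 < \<delta>" "\<delta> \<le> 1" "sqrt \<delta> = 1 / Q"
    using Q by (simp_all add: \<delta>_def real_sqrt_divide power_le_one_iff field_simps one_le_power)
  have half: "K * sqrt \<delta> * S / energy \<phi> \<le> 1 / 2"
  proof -
    define x where "x = K * S / energy \<phi>"
    have "0 \<le> x" using K(1) S E by (simp add: x_def)
    then have "x / Q \<le> 1 / 2" unfolding Q_def x_def[symmetric] by (simp add: field_simps)
    then show ?thesis unfolding \<delta>(3) x_def by (simp add: mult_ac)
  qed
  have "peetre N (stf_abs \<phi> f) z \<le> ennreal (2 ^ (N + 1)) * (SUP y\<in>Y. stf_abs \<phi> f y * ennreal (decay N (z - y)))"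
    if f: "tame f" and dense: "\<forall>w. \<exists>y\<in>Y. norm (y - w) \<le> \<delta>" for f Y z
  proof -
    define F where "F = stf_abs \<phi> f"
    define P where "P = peetre N F z"
    define X where "X = (SUP y\<in>Y. F y * ennreal (decay N (z - y)))"
    have P_fin: "P < \<top>" unfolding P_def F_def using peetre_stf_finite[OF f \<phi>(1)] by simp
    have "P \<le> ennreal (2 ^ N) * X + ennreal (1 / 2) * P"
      unfolding P_def
    proof (rule peetre_least)
      fix w
      obtain y where y: "y \<in> Y" "norm (y - w) \<le> \<delta>" using dense by blast
      obtain h \<eta> where d: "y - w = (h, \<eta>)" by (cases "y - w")
      have yw: "y = w + (h, \<eta>)" using d by (simp add: algebra_simps)
      have n: "norm (h, \<eta>) \<le> \<delta>" using y(2) d by simp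
      define \<psi> where "\<psi> t = \<phi> t - modulation \<eta> (translation h \<phi>) t" for t
      have c\<psi>: "continuous_on UNIV \<psi>"
        unfolding \<psi>_def by (intro continuous_intros tame_continuous[OF \<phi>(1)] continuous_modulation_translation)
      have r\<psi>: "rapid \<psi>"
        unfolding rapid_def
      proof
        fix L
        obtain C1 where C1: "\<And>x. cmod (\<phi> x) \<le> C1 * decay L x"
          using rapidE[OF tame_rapid[OF \<phi>(1)]] by blast
        obtain C2 where C2: "\<And>x. cmod (modulation \<eta> (translation h \<phi>) x) \<le> C2 * decay L x"
          using rapidE[OF rapid_modulation_translation[OF tame_rapid[OF \<phi>(1)]]] by blast
        have "cmod (\<psi> x) \<le> (C1 + C2) * decay L x" for x
          unfolding \<psi>_def distrib_right by (rule order_trans[OF norm_triangle_ineq4 add_mono[OF C1 C2]])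
        then show "\<exists>C. \<forall>x. cmod (\<psi> x) \<le> C * decay L x" by blast
      qed
      have H: "cmod (stf \<psi> \<phi> y) \<le> (K * sqrt \<delta>) * decay (N + (DIM('a \<times> 'a) + 2)) y" for y
      proof -
        have "cmod (stf \<psi> \<phi> y) \<le> K * sqrt (norm (h, \<eta>)) * decay (N + M) y"
          unfolding \<psi>_def[abs_def] using n \<delta>(2) by (intro K(2)) simp
        also have "\<dots> \<le> K * sqrt \<delta> * decay (N + M) y"
          using n K(1) by (intro mult_right_mono mult_left_mono) auto
        finally show ?thesis by (simp only: M_def)
      qed
      have "ennreal (cmod (stf \<psi> f w)) \<le> ennreal (K * sqrt \<delta> * S / energy \<phi>) * peetre N F w"
        unfolding S_def M_def F_def stf_abs_def[abs_def]
        using K(1) \<delta>(1) by (intro stf_le_peetre[OF f \<phi> c\<psi> r\<psi> _ H]) simp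
      also have "\<dots> \<le> ennreal (1 / 2) * peetre N F w"
        by (intro mult_right_mono ennreal_leI half) simp
      finally have 1: "ennreal (cmod (stf \<psi> f w)) \<le> ennreal (1 / 2) * peetre N F w" .
      have "stf \<psi> f w = stf \<phi> f w - stf (modulation \<eta> (translation h \<phi>)) f w"
        unfolding \<psi>_def using tame_continuous[OF \<phi>(1)] tame_rapid[OF \<phi>(1)]
        by (intro stf_window_diff f continuous_modulation_translation rapid_modulation_translation)
      then have "stf \<phi> f w = stf (modulation \<eta> (translation h \<phi>)) f w + stf \<psi> f w" by simp
      then have "cmod (stf \<phi> f w) \<le> cmod (stf \<phi> f y) + cmod (stf \<psi> f w)"
        unfolding yw cmod_stf_window_shift[symmetric] by (simp only: norm_triangle_ineq)
      then have "F w \<le> ennreal (cmod (stf \<phi> f y) + cmod (stf \<psi> f w))"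
        unfolding F_def stf_abs_def by (rule ennreal_leI)
      also have "\<dots> = F y + ennreal (cmod (stf \<psi> f w))"
        by (simp add: F_def stf_abs_def)
      also have "\<dots> \<le> F y + ennreal (1 / 2) * peetre N F w"
        by (intro add_left_mono 1)
      finally have "F w * ennreal (decay N (z - w)) \<le> (F y + ennreal (1 / 2) * peetre N F w) * ennreal (decay N (z - w))"
        by (rule mult_right_mono) simp
      also have "\<dots> = F y * ennreal (decay N (z - w)) + ennreal (1 / 2) * (peetre N F w * ennreal (decay N (z - w)))"
        by (simp add: distrib_right mult.assoc)
      also have "\<dots> \<le> ennreal (2 ^ N) * X + ennreal (1 / 2) * peetre N F z"
      proof (intro add_mono mult_left_mono peetre_decay)
        \<comment> \<open>Moving the discount from \<open>w\<close> to the node costs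
          \<open>2 ^ N\<close>, because the node is at distance at most 1.\<close>
        have "decay N (z - w) \<le> 2 ^ N * decay N (z - y)"
        proof (rule decay_le_scaled)
          have "norm (z - y) \<le> norm (z - w) + norm (y - w)"
            using norm_triangle_ineq4[of "z - w" "y - w"] by simp
          then show "1 + norm (z - y) \<le> 2 * (1 + norm (z - w))"
            using y(2) \<delta>(2) norm_ge_zero[of "z - w"] by argo
        qed
        then have "F y * ennreal (decay N (z - w)) \<le> F y * ennreal (2 ^ N * decay N (z - y))"
          by (intro mult_left_mono ennreal_leI) auto
        also have "\<dots> = ennreal (2 ^ N) * (F y * ennreal (decay N (z - y)))"
          by (simp add: ennreal_mult' mult_ac)
        also have "\<dots> \<le> ennreal (2 ^ N) * X"
          unfolding X_def using y(1) by (intro mult_left_mono SUP_upper) auto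
        finally show "F y * ennreal (decay N (z - w)) \<le> ennreal (2 ^ N) * X" .
      qed simp
      finally show "F w * ennreal (decay N (z - w)) \<le> ennreal (2 ^ N) * X + ennreal (1 / 2) * peetre N F z" .
    qed
    then have le: "P \<le> ennreal (2 ^ N) * X + ennreal (1 / 2) * P" .
    \<comment> \<open>Absorbing half of \<open>P\<close> is a subtraction and is carried out in the
      reals, which \<open>P_fin\<close> justifies.\<close>
    have "P \<le> ennreal 2 * (ennreal (2 ^ N) * X)"
    proof (cases "X = \<top>")
      case True
      then show ?thesis by (simp add: ennreal_mult_top)
    next
      case False
      then obtain x where x: "X = ennreal x" "0 \<le> x" by (cases X) auto
      obtain p where p: "P = ennreal p" "0 \<le> p" using P_fin by (cases P) auto
      have "ennreal (2 ^ N) * ennreal x = ennreal (2 ^ N * x)" "ennreal (1 / 2) * ennreal p = ennreal (1 / 2 * p)"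
        by (rule ennreal_mult'[symmetric], simp)+
      then have "ennreal p \<le> ennreal (2 ^ N * x) + ennreal (1 / 2 * p)"
        using le unfolding x(1) p(1) by simp
      also have "\<dots> = ennreal (2 ^ N * x + 1 / 2 * p)"
        by (rule ennreal_plus[symmetric]) (use x p in auto)
      finally have "ennreal p \<le> ennreal (2 ^ N * x + 1 / 2 * p)" .
      then have "p \<le> 2 ^ N * x + 1 / 2 * p"
        using x p by (subst (asm) ennreal_le_iff) auto
      then have "ennreal p \<le> ennreal (2 * (2 ^ N * x))" by (intro ennreal_leI) simp
      also have "\<dots> = ennreal 2 * (ennreal (2 ^ N) * ennreal x)"
        by (subst ennreal_mult', simp)+ (rule refl)
      finally show ?thesis by (simp only: x(1) p(1))
    qed
    also have "\<dots> = ennreal (2 ^ (N + 1)) * X"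
      by (simp add: ennreal_mult' mult.assoc[symmetric])
    finally show ?thesis by (simp only: P_def X_def F_def)
  qed
  with \<delta>(1) show ?thesis by blast
qed

section \<open>Discretization of the modulation space quasi-norms\<close>

text \<open>A sum is at most twice the maximum, and the maximum is a supremum over a two-element
  index set, so \<open>Lp_norm_SUP\<close> yields a quasi-triangle inequality for every finite
  exponent.\<close>

lemma Lp_norm_add:
  assumes p: "0 < p"
  shows "\<exists>C\<ge>0. \<forall>(A::'i set) f g. Lp_norm p (count_space A) (\<lambda>x. f x + g x)
    \<le> ennreal C * (Lp_norm p (count_space A) f + Lp_norm p (count_space A) g)"
proof (cases "p = \<top>")
  case True
  have "Lp_norm p (count_space A) (\<lambda>x. f x + g x) \<le> ennreal 1 * (Lp_norm p (count_space A) f + Lp_norm p (count_space A) g)"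
    for A :: "'i set" and f g
    using True by (auto simp: Lp_norm_top_count_space intro!: SUP_least add_mono SUP_upper)
  then show ?thesis by (intro exI[of _ 1]) auto
next
  case False
  define c where "c = ennpowr 2 (1 / enn2real p)"
  have c: "c < \<top>"
    by (simp add: c_def)
  have "Lp_norm p (count_space A) (\<lambda>x. f x + g x) \<le> ennreal (2 * enn2real c) * (Lp_norm p (count_space A) f + Lp_norm p (count_space A) g)"
    for A :: "'i set" and f g
  proof -
    let ?K = "Lp_norm p (count_space A) f + Lp_norm p (count_space A) g"
    have "Lp_norm p (count_space A) (\<lambda>x. f x + g x) \<le> Lp_norm p (count_space A) (\<lambda>x. 2 * (SUP j\<in>UNIV. (if j then f x else g x)))"
    proof (rule Lp_norm_mono[OF p])
      fix x
      have "f x \<le> (SUP j\<in>UNIV. (if j then f x else g x))"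
        by (rule SUP_upper2[of True]) auto
      moreover have "g x \<le> (SUP j\<in>UNIV. (if j then f x else g x))"
        by (rule SUP_upper2[of False]) auto
      ultimately have "f x + g x \<le> (SUP j\<in>UNIV. (if j then f x else g x)) + (SUP j\<in>UNIV. (if j then f x else g x))"
        by (rule add_mono)
      then show "f x + g x \<le> 2 * (SUP j\<in>UNIV. (if j then f x else g x))"
        by (simp add: mult_2)
    qed
    also have "\<dots> = 2 * Lp_norm p (count_space A) (\<lambda>x. SUP j\<in>UNIV. (if j then f x else g x))"
      by (rule Lp_norm_cmult[OF p])
    also have "\<dots> \<le> 2 * (c * ?K)"
      unfolding c_def
    proof (intro mult_left_mono Lp_norm_SUP[where w = "\<lambda>_. 1"])
      fix j show "Lp_norm p (count_space A) (\<lambda>x. if j then f x else g x) \<le> 1 * ?K"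
        by (cases j) auto
      have "ennpowr 1 r = 1" for r using ennpowr_ennreal[of 1 r] by simp
      then show "(\<integral>\<^sup>+j. ennpowr 1 (enn2real p) \<partial>count_space (UNIV :: bool set)) \<le> 2"
        by (simp add: nn_integral_count_space_finite UNIV_bool)
    qed (use p False in auto)
    also have "\<dots> = ennreal (2 * enn2real c) * ?K"
      using c by (simp add: ennreal_mult' ennreal_enn2real mult.assoc)
    finally show ?thesis .
  qed
  then show ?thesis by (intro exI[of _ "2 * enn2real c"]) auto
qed

text \<open>The decaying function is the supremum of its point masses, to which the estimate for
  suprema of decaying families applies.\<close>

lemma Lp_norm_decay_finite:
  assumes p: "0 < p"
  shows "\<exists>s. Lp_norm p (count_space int_lattice) (\<lambda>k::'a::euclidean_space. ennreal (decay s k)) < \<top>"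
proof -
  obtain s C where C: "\<And>(A::'a set) f K.
    (\<forall>j\<in>int_lattice :: 'a set. Lp_norm p (count_space A) (f j) \<le> ennreal (decay s j) * K) \<Longrightarrow>
    Lp_norm p (count_space A) (\<lambda>x. SUP j\<in>int_lattice. f j x) \<le> ennreal C * K"
    using Lp_norm_SUP_decay[OF p] by blast
  have delta: "Lp_norm p (count_space int_lattice) (\<lambda>x::'a. indicator {j} x) \<le> 1" for j
  proof (cases "p = \<top>")
    case True
    then show ?thesis by (auto simp: Lp_norm_top_count_space SUP_le_iff split: split_indicator)
  next
    case False
    have "ennpowr 1 r = 1" for r using ennpowr_ennreal[of 1 r] by simp
    then have "(\<integral>\<^sup>+x. ennpowr (indicator {j} x) (enn2real p) \<partial>count_space (int_lattice :: 'a set))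
        = (\<integral>\<^sup>+x. indicator {j} x \<partial>count_space (int_lattice :: 'a set))"
      by (intro nn_integral_cong) (auto split: split_indicator)
    also have "\<dots> \<le> 1"
    proof (cases "j \<in> int_lattice")
      case True
      then show ?thesis by (subst nn_integral_indicator) auto
    next
      case False
      then have "(\<integral>\<^sup>+x. indicator {j} x \<partial>count_space (int_lattice :: 'a set)) = (\<integral>\<^sup>+x. 0 \<partial>count_space (int_lattice :: 'a set))"
        by (intro nn_integral_cong) (auto split: split_indicator)
      then show ?thesis by simp
    qed
    finally have "ennpowr (\<integral>\<^sup>+x. ennpowr (indicator {j} x) (enn2real p) \<partial>count_space (int_lattice :: 'a set)) (1 / enn2real p)
      \<le> ennpowr 1 (1 / enn2real p)"
      by (intro ennpowr_mono) auto
    then show ?thesis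
      using False \<open>\<And>r. ennpowr 1 r = 1\<close> by (simp add: Lp_norm_count_space)
  qed
  have "Lp_norm p (count_space int_lattice) (\<lambda>k::'a. ennreal (decay s k))
      \<le> Lp_norm p (count_space int_lattice) (\<lambda>k::'a. SUP j\<in>int_lattice. ennreal (decay s j) * indicator {j} k)"
  proof (rule Lp_norm_mono[OF p])
    fix k :: 'a assume "k \<in> space (count_space int_lattice)"
    then show "ennreal (decay s k) \<le> (SUP j\<in>int_lattice. ennreal (decay s j) * indicator {j} k)"
      by (intro SUP_upper2[of k]) auto
  qed
  also have "\<dots> \<le> ennreal C * 1"
    by (intro C ballI) (simp only: Lp_norm_cmult[OF p], intro mult_left_mono delta, simp)
  finally show ?thesis
    by (intro exI[of _ s]) (auto intro: le_less_trans)
qed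

text \<open>The comparison with integrals goes through infima over cells, so that no measurability of \<open>G\<close> or
  of its partial norms is needed: the step functions of infima are measurable and lie below.\<close>

lemma mixed_norm_cell_samples:
  assumes p: "0 < p" "0 < q" and R: "0 < R"
  shows "\<exists>C\<ge>0. \<forall>(G :: 'a::euclidean_space \<times> 'b::euclidean_space \<Rightarrow> ennreal) \<epsilon>. 0 < \<epsilon> \<longrightarrow>
    (\<exists>\<xi>. (\<forall>k\<in>int_lattice. lat_floor (R *\<^sub>R \<xi> k) = k) \<and>
      mixed_norm p q (count_space int_lattice) (count_space int_lattice)
        (\<lambda>(j, k). INF x\<in>{x. lat_floor (R *\<^sub>R x) = j}. G (x, \<xi> k))
      \<le> ennreal C * (mixed_norm p q lborel lborel G + ennreal \<epsilon>))"
proof -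
  define cp where "cp = ennpowr (ennreal ((1 / R) ^ DIM('a))) (1 / enn2real p)"
  define cq where "cq = ennpowr (ennreal ((1 / R) ^ DIM('b))) (1 / enn2real q)"
  have cell: "{x. lat_floor (R *\<^sub>R x) = j} \<noteq> {}" if "j \<in> int_lattice" for j :: "'z::euclidean_space"
    using that R lat_floor_lattice[OF that] by (auto intro!: exI[of _ "(1 / R) *\<^sub>R j"])
  have inv: "\<exists>c\<ge>0. \<forall>X. X \<le> ennreal c * (ennpowr (ennreal ((1 / R) ^ n)) r * X)" for n r
  proof (intro exI[of _ "1 / ((1 / R) ^ n) powr r"] conjI allI)
    fix X
    have "ennreal (1 / ((1 / R) ^ n) powr r) * (ennpowr (ennreal ((1 / R) ^ n)) r * X)
        = ennreal (1 / ((1 / R) ^ n) powr r * ((1 / R) ^ n) powr r) * X"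
      using R by (simp only: ennpowr_ennreal[OF zero_le_power] divide_nonneg_nonneg less_imp_le zero_le_one)
                 (simp add: ennpowr_ennreal mult.assoc[symmetric] ennreal_mult'[symmetric])
    then show "X \<le> ennreal (1 / ((1 / R) ^ n) powr r) * (ennpowr (ennreal ((1 / R) ^ n)) r * X)"
      using R by simp
  qed simp
  obtain dp where dp: "0 \<le> dp" "\<And>X. X \<le> ennreal dp * (cp * X)" using inv unfolding cp_def by metis
  obtain dq where dq: "0 \<le> dq" "\<And>X. X \<le> ennreal dq * (cq * X)" using inv unfolding cq_def by metis
  obtain D where D: "0 \<le> D" "\<And>(A::'b set) f g. Lp_norm q (count_space A) (\<lambda>x. f x + g x)
    \<le> ennreal D * (Lp_norm q (count_space A) f + Lp_norm q (count_space A) g)"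
    using Lp_norm_add[OF p(2)] by blast
  obtain s where s: "Lp_norm q (count_space int_lattice) (\<lambda>k::'b. ennreal (decay s k)) < \<top>"
    using Lp_norm_decay_finite[OF p(2)] by blast
  define S where "S = enn2real (Lp_norm q (count_space int_lattice) (\<lambda>k::'b. ennreal (decay s k)))"
  have S: "Lp_norm q (count_space int_lattice) (\<lambda>k::'b. ennreal (decay s k)) = ennreal S" "0 \<le> S"
    using s by (simp_all add: S_def ennreal_enn2real)
  show ?thesis
  proof (intro exI[of _ "dp * D * (2 * dq + S)"] conjI allI impI)
    show "0 \<le> dp * D * (2 * dq + S)" using dp dq D S by simp
    fix G :: "'a \<times> 'b \<Rightarrow> ennreal" and \<epsilon> :: real assume \<epsilon>: "0 < \<epsilon>"
    define h where "h y = Lp_norm p lborel (\<lambda>x. G (x, y))" for y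
    define c where "c k = (INF y\<in>{y. lat_floor (R *\<^sub>R y) = k}. h y)" for k
    \<comment> \<open>A point of nearly minimal inner norm in each outer cell. The additive error
      keeps the comparison strict when \<open>c k\<close> is 0, and the factor
      \<open>decay s k\<close> makes its outer norm a finite multiple of \<epsilon>. If
      \<open>c k\<close> is infinite, any point of the cell will do.\<close>
    have "\<exists>y. lat_floor (R *\<^sub>R y) = k \<and> h y \<le> 2 * c k + ennreal (\<epsilon> * decay s k)" if k: "k \<in> int_lattice" for k
    proof (cases "c k = \<top>")
      case True
      then show ?thesis using cell[OF k] by (auto simp: ennreal_mult_top)
    next
      case False
      then obtain r where r: "c k = ennreal r" "0 \<le> r" by (cases "c k") auto
      have "ennreal r < ennreal (2 * r + \<epsilon> * decay s k)"
        using r \<epsilon> by (intro ennreal_lessI) (auto intro!: add_nonneg_pos)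
      also have "\<dots> = 2 * c k + ennreal (\<epsilon> * decay s k)"
        using r \<epsilon> by (simp add: ennreal_mult')
      finally have "c k < 2 * c k + ennreal (\<epsilon> * decay s k)" using r by simp
      then show ?thesis
        unfolding c_def INF_less_iff by (auto intro: less_imp_le)
    qed
    then obtain \<xi> where \<xi>: "\<And>k. k \<in> int_lattice \<Longrightarrow> lat_floor (R *\<^sub>R \<xi> k) = k"
      "\<And>k. k \<in> int_lattice \<Longrightarrow> h (\<xi> k) \<le> 2 * c k + ennreal (\<epsilon> * decay s k)"
      by metis
    have inner: "Lp_norm p (count_space int_lattice) (\<lambda>j. INF x\<in>{x. lat_floor (R *\<^sub>R x) = j}. G (x, y)) \<le> ennreal dp * h y" for y
    proof -
      have "cp * Lp_norm p (count_space int_lattice) (\<lambda>j. INF x\<in>{x. lat_floor (R *\<^sub>R x) = j}. G (x, y))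
        = Lp_norm p lborel (\<lambda>x'. INF x\<in>{x. lat_floor (R *\<^sub>R x) = lat_floor (R *\<^sub>R x')}. G (x, y))"
        unfolding cp_def by (rule Lp_norm_lat_floor[OF p(1) R, symmetric])
      also have "\<dots> \<le> h y"
        unfolding h_def by (intro Lp_norm_mono p INF_lower) simp
      finally show ?thesis
        using dp by (meson mult_left_mono order_trans zero_le)
    qed
    have outer: "Lp_norm q (count_space int_lattice) c \<le> ennreal dq * mixed_norm p q lborel lborel G"
    proof -
      have "cq * Lp_norm q (count_space int_lattice) c = Lp_norm q lborel (\<lambda>y. c (lat_floor (R *\<^sub>R y)))"
        unfolding cq_def by (rule Lp_norm_lat_floor[OF p(2) R, symmetric])
      also have "\<dots> \<le> mixed_norm p q lborel lborel G"
        unfolding mixed_norm_def c_def h_def[symmetric] by (intro Lp_norm_mono p INF_lower) simp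
      finally show ?thesis
        using dq by (meson mult_left_mono order_trans zero_le)
    qed
    let ?N = "mixed_norm p q lborel lborel G"
    have "mixed_norm p q (count_space int_lattice) (count_space int_lattice)
        (\<lambda>(j, k). INF x\<in>{x. lat_floor (R *\<^sub>R x) = j}. G (x, \<xi> k))
      \<le> Lp_norm q (count_space int_lattice) (\<lambda>k. ennreal dp * (2 * c k + ennreal \<epsilon> * ennreal (decay s k)))"
      unfolding mixed_norm_def
    proof (rule Lp_norm_mono[OF p(2)])
      fix k :: 'b assume "k \<in> space (count_space int_lattice)"
      then have "h (\<xi> k) \<le> 2 * c k + ennreal \<epsilon> * ennreal (decay s k)"
        using \<xi>(2)[of k] \<epsilon> by (simp add: ennreal_mult')
      then show "Lp_norm p (count_space int_lattice) (\<lambda>j. case (j, k) of (j, k) \<Rightarrow> INF x\<in>{x. lat_floor (R *\<^sub>R x) = j}. G (x, \<xi> k))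
        \<le> ennreal dp * (2 * c k + ennreal \<epsilon> * ennreal (decay s k))"
        using inner[of "\<xi> k"] by (simp only: prod.case) (meson mult_left_mono order_trans zero_le)
    qed
    also have "\<dots> \<le> ennreal dp * (ennreal D * (2 * Lp_norm q (count_space int_lattice) c + ennreal \<epsilon> * ennreal S))"
      unfolding Lp_norm_cmult[OF p(2)]
      using D(2)[of int_lattice "\<lambda>k. 2 * c k" "\<lambda>k. ennreal \<epsilon> * ennreal (decay s k)"]
      by (intro mult_left_mono) (auto simp: Lp_norm_cmult[OF p(2)] S)
    also have "\<dots> \<le> ennreal dp * (ennreal D * (2 * (ennreal dq * ?N) + ennreal \<epsilon> * ennreal S))"
      by (intro mult_left_mono add_mono outer) auto
    also have "\<dots> \<le> ennreal dp * (ennreal D * (ennreal (2 * dq + S) * (?N + ennreal \<epsilon>)))"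
    proof (intro mult_left_mono)
      have "2 * (ennreal dq * ?N) + ennreal \<epsilon> * ennreal S = ennreal (2 * dq) * ?N + ennreal S * ennreal \<epsilon>"
        using dq by (simp add: ennreal_mult' mult_ac)
      also have "\<dots> \<le> ennreal (2 * dq + S) * ?N + ennreal (2 * dq + S) * ennreal \<epsilon>"
        using dq S by (intro add_mono mult_right_mono ennreal_leI) auto
      finally show "2 * (ennreal dq * ?N) + ennreal \<epsilon> * ennreal S \<le> ennreal (2 * dq + S) * (?N + ennreal \<epsilon>)"
        by (simp only: distrib_left)
    qed auto
    also have "\<dots> = ennreal (dp * D * (2 * dq + S)) * (?N + ennreal \<epsilon>)"
      using dp D dq S by (simp add: ennreal_mult' mult.assoc)
    finally show "\<exists>\<xi>. (\<forall>k\<in>int_lattice. lat_floor (R *\<^sub>R \<xi> k) = k) \<and>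
      mixed_norm p q (count_space int_lattice) (count_space int_lattice)
        (\<lambda>(j, k). INF x\<in>{x. lat_floor (R *\<^sub>R x) = j}. G (x, \<xi> k))
      \<le> ennreal (dp * D * (2 * dq + S)) * (?N + ennreal \<epsilon>)"
      using \<xi>(1) by blast
  qed
qed

lemma modulation_norm_functional_of:
  "modulation_norm \<phi> p q m (functional_of f) = mixed_norm p q lborel lborel (\<lambda>z. ennreal (cmod (stf \<phi> f z) * m z))"
  unfolding modulation_norm_def stft_functional_of by (simp add: case_prod_unfold)

text \<open>On a unit cell the transform is dominated, up to a constant, by its maximal function at
  the corner, and the weight by its value there. The norm is thus at most that of a step function,
  which is a lattice norm.\<close>

lemma modulation_norm_le_lattice_norm:
  fixes m :: "'a::euclidean_space \<times> 'a \<Rightarrow> real"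
  assumes p: "0 < p" "0 < q" and m: "poly_moderate m"
  shows "\<exists>C\<ge>0. \<forall>\<phi> f. modulation_norm \<phi> p q m (functional_of f) \<le> ennreal C * lattice_norm p q m (peetre N (stf_abs \<phi> f))"
proof -
  obtain C1 N1 where C1: "0 \<le> C1" "\<And>z w. m z \<le> C1 * (1 + norm (z - w)) ^ N1 * m w"
    using poly_moderateE[OF m] by metis
  define r where "r = 1 + real DIM('a \<times> 'a)"
  define C where "C = C1 * r ^ N1 * r ^ N"
  have C: "0 \<le> C" using C1 by (simp add: C_def r_def)
  have "modulation_norm \<phi> p q m (functional_of f) \<le> ennreal C * lattice_norm p q m (peetre N (stf_abs \<phi> f))" for \<phi> and f :: "'a \<Rightarrow> complex"
  proof -
    define g where "g z = ennreal C * (peetre N (stf_abs \<phi> f) z * ennreal (m z))" for z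
    have "ennreal (cmod (stf \<phi> f z) * m z) \<le> g (lat_floor z)" for z
    proof -
      have n: "1 + norm (z - lat_floor z) \<le> r"
        using norm_diff_lat_floor[of z] by (simp add: r_def)
      have "stf_abs \<phi> f z \<le> peetre N (stf_abs \<phi> f) z" by (rule le_peetre)
      also have "\<dots> \<le> ennreal ((1 + norm (lat_floor z - z)) ^ N) * peetre N (stf_abs \<phi> f) (lat_floor z)"
        by (rule peetre_slow)
      also have "\<dots> \<le> ennreal (r ^ N) * peetre N (stf_abs \<phi> f) (lat_floor z)"
        using n by (intro mult_right_mono ennreal_leI power_mono) (auto simp: norm_minus_commute)
      finally have 1: "ennreal (cmod (stf \<phi> f z)) \<le> ennreal (r ^ N) * peetre N (stf_abs \<phi> f) (lat_floor z)"
        by (simp only: stf_abs_def)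
      have "m z \<le> C1 * (1 + norm (z - lat_floor z)) ^ N1 * m (lat_floor z)" by (rule C1)
      also have "\<dots> \<le> C1 * r ^ N1 * m (lat_floor z)"
        using n C1(1) poly_moderate_nonneg[OF m] by (intro mult_right_mono mult_left_mono power_mono) auto
      finally have 2: "ennreal (m z) \<le> ennreal (C1 * r ^ N1) * ennreal (m (lat_floor z))"
        using poly_moderate_nonneg[OF m] by (subst ennreal_mult''[symmetric]) (auto intro: ennreal_leI)
      have "ennreal (cmod (stf \<phi> f z) * m z) = ennreal (cmod (stf \<phi> f z)) * ennreal (m z)"
        by (simp add: ennreal_mult' )
      also have "\<dots> \<le> (ennreal (r ^ N) * peetre N (stf_abs \<phi> f) (lat_floor z)) * (ennreal (C1 * r ^ N1) * ennreal (m (lat_floor z)))"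
        by (intro mult_mono 1 2) auto
      also have "\<dots> = g (lat_floor z)"
        using C1 by (simp add: g_def C_def r_def ennreal_mult' mult_ac)
      finally show ?thesis .
    qed
    then have "modulation_norm \<phi> p q m (functional_of f)
      \<le> Lp_norm q lborel (\<lambda>y. Lp_norm p lborel (\<lambda>x. g (lat_floor (1 *\<^sub>R x), lat_floor (1 *\<^sub>R y))))"
      unfolding modulation_norm_functional_of mixed_norm_def
      by (intro Lp_norm_mono p) (simp add: lat_floor_Pair[symmetric])
    also have "\<dots> = Lp_norm q (count_space int_lattice) (\<lambda>y. Lp_norm p (count_space int_lattice) (\<lambda>x. g (x, y)))"
    proof -
      have one: "ennpowr (ennreal ((1 / 1) ^ n)) t = 1" for n t
        using ennpowr_ennreal[of 1 t] by simp
      show ?thesis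
        unfolding Lp_norm_lat_floor[where g = "\<lambda>x. g (x, y)" for y, OF p(1) zero_less_one]
          Lp_norm_lat_floor[where g = "\<lambda>y. c * Lp_norm p (count_space int_lattice) (\<lambda>x. g (x, y))" for c, OF p(2) zero_less_one] one
        by simp
    qed
    also have "\<dots> = ennreal C * lattice_norm p q m (peetre N (stf_abs \<phi> f))"
      unfolding lattice_norm_def mixed_norm_cmult[OF p, symmetric] by (simp add: mixed_norm_def g_def)
    finally show ?thesis .
  qed
  with C show ?thesis by blast
qed

lemma moderate_degree_shrink:
  assumes m: "moderate_degree N m" and r: "1 \<le> r"
  shows "moderate_degree N (\<lambda>z. m ((1 / r) *\<^sub>R z))"
proof -
  obtain C where C: "0 \<le> C" "\<And>z w. m z \<le> C * (1 + norm (z - w)) ^ N * m w" and nn: "\<And>z. 0 \<le> m z"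
    using m unfolding moderate_degree_def by blast
  have "m ((1 / r) *\<^sub>R z) \<le> C * (1 + norm (z - w)) ^ N * m ((1 / r) *\<^sub>R w)" for z w
  proof -
    have "norm ((1 / r) *\<^sub>R z - (1 / r) *\<^sub>R w) = norm (z - w) / r"
      using r by (simp flip: scaleR_diff_right)
    also have "\<dots> \<le> norm (z - w)"
      using r divide_left_mono[of 1 r "norm (z - w)"] by simp
    finally have "1 + norm ((1 / r) *\<^sub>R z - (1 / r) *\<^sub>R w) \<le> 1 + norm (z - w)" by simp
    then show ?thesis
      using C(1) nn by (intro order_trans[OF C(2)[of _ "(1 / r) *\<^sub>R w"]] mult_right_mono mult_left_mono power_mono) auto
  qed
  with C(1) nn show ?thesis unfolding moderate_degree_def by blast
qed

lemma norm_Pair_le_add: "norm (a, b) \<le> norm a + norm b"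
  unfolding norm_Pair by (rule sqrt_sum_squares_le_sum) auto

text \<open>One point is chosen in every cell of side \<open>1 / r\<close>, with value close to the
  infimum over the position cell. The chosen points are \<delta>-dense, so \<open>sampling\<close>
  applies to them. The frequency \<xi> depends on \<open>k\<close> alone because the inner norm of a
  mixed norm is taken at a single frequency.\<close>

lemma stf_peetre_le_lattice_samples:
  fixes \<phi> :: "'a::euclidean_space \<Rightarrow> complex"
  assumes f: "tame f" and \<phi>: "tame \<phi>" and r: "1 \<le> r"
    and \<delta>: "4 * real DIM('a) / r \<le> \<delta>"
    and sampling: "\<And>Y z. \<forall>w. \<exists>y\<in>Y. norm (y - w) \<le> \<delta> \<Longrightarrow>
      peetre N (stf_abs \<phi> f) z \<le> ennreal K * (SUP y\<in>Y. stf_abs \<phi> f y * ennreal (decay N (z - y)))" and K: "0 < K"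
    and \<xi>: "\<And>k. k \<in> int_lattice \<Longrightarrow> lat_floor (r *\<^sub>R \<xi> k) = k"
    and A: "\<And>j k. A (j, k) = (INF x\<in>{x. lat_floor (r *\<^sub>R x) = j}. stf_abs \<phi> f (x, \<xi> k))"
  shows "peetre N (stf_abs \<phi> f) z
    \<le> ennreal (K * (1 + r + 2 * real DIM('a)) ^ N) * peetre N (\<lambda>w. if w \<in> int_lattice then A w else 0) (r *\<^sub>R z)"
    (is "_ \<le> _ * ?P")
\<comment> \<open>An infimum over a cell need not be attained; the excess \<eta> is scaled by
  \<open>1 / K\<close> so that the sampling constant turns it into \<open>e\<close>.\<close>
proof (rule ennreal_le_epsilon)
  fix e :: real assume e: "0 < e"
  define \<eta> where "\<eta> = e / K"
  have \<eta>: "0 < \<eta>" using e K by (simp add: \<eta>_def)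
  define n where "n = real DIM('a)"
  have "\<exists>x. lat_floor (r *\<^sub>R x) = j \<and> stf_abs \<phi> f (x, \<xi> k) \<le> A (j, k) + ennreal \<eta>" if j: "j \<in> int_lattice" for j k
  proof -
    have "lat_floor (r *\<^sub>R ((1 / r) *\<^sub>R j)) = j"
      using r lat_floor_lattice[OF j] by simp
    then have "A (j, k) \<le> stf_abs \<phi> f ((1 / r) *\<^sub>R j, \<xi> k)"
      unfolding A by (intro INF_lower) simp
    then have "A (j, k) < \<top>"
      unfolding stf_abs_def by (rule le_less_trans) simp
    then have "A (j, k) < A (j, k) + ennreal \<eta>"
      using \<eta> by (cases "A (j, k)") (auto simp: ennreal_plus[symmetric] ennreal_less_iff simp del: ennreal_plus)
    then obtain x where "lat_floor (r *\<^sub>R x) = j" "stf_abs \<phi> f (x, \<xi> k) < A (j, k) + ennreal \<eta>"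
      unfolding A INF_less_iff by blast
    then show ?thesis by (auto intro: less_imp_le)
  qed
  then obtain X where X: "\<And>j k. j \<in> int_lattice \<Longrightarrow> lat_floor (r *\<^sub>R X j k) = j"
    "\<And>j k. j \<in> int_lattice \<Longrightarrow> stf_abs \<phi> f (X j k, \<xi> k) \<le> A (j, k) + ennreal \<eta>"
    by metis
  define Y where "Y = {(X j k, \<xi> k) | j k. j \<in> int_lattice \<and> k \<in> int_lattice}"
  have close: "norm (x - x') \<le> 2 * n / r" if "lat_floor (r *\<^sub>R x) = lat_floor (r *\<^sub>R x')" for x x' :: 'a
  proof -
    have "r * norm (x - x') = norm ((r *\<^sub>R x - lat_floor (r *\<^sub>R x)) - (r *\<^sub>R x' - lat_floor (r *\<^sub>R x')))"
      using r that by (simp flip: scaleR_diff_right)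
    also have "\<dots> \<le> n + n"
      unfolding n_def by (rule order_trans[OF norm_triangle_ineq4 add_mono[OF norm_diff_lat_floor norm_diff_lat_floor]])
    finally show ?thesis using r by (simp add: field_simps)
  qed
  have "\<forall>w. \<exists>y\<in>Y. norm (y - w) \<le> \<delta>"
  proof
    fix w :: "'a \<times> 'a"
    define j k where "j = lat_floor (r *\<^sub>R fst w)" and "k = lat_floor (r *\<^sub>R snd w)"
    have jk: "j \<in> int_lattice" "k \<in> int_lattice" by (simp_all add: j_def k_def)
    have "norm ((X j k, \<xi> k) - w) \<le> norm (X j k - fst w) + norm (\<xi> k - snd w)"
      by (metis norm_Pair_le_add diff_Pair prod.collapse)
    also have "\<dots> \<le> 2 * n / r + 2 * n / r"
      using X(1)[OF jk(1)] \<xi>[OF jk(2)] by (intro add_mono close) (auto simp: j_def k_def)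
    also have "\<dots> \<le> \<delta>" using \<delta> by (simp add: n_def)
    finally show "\<exists>y\<in>Y. norm (y - w) \<le> \<delta>"
      using jk unfolding Y_def by blast
  qed
  from sampling[OF this, of z]
  have "peetre N (stf_abs \<phi> f) z \<le> ennreal K * (SUP y\<in>Y. stf_abs \<phi> f y * ennreal (decay N (z - y)))" .
  also have "\<dots> \<le> ennreal K * (ennreal ((1 + r + 2 * n) ^ N) * ?P + ennreal \<eta>)"
  proof (intro mult_left_mono SUP_least)
    fix y assume "y \<in> Y"
    then obtain j k where jk: "j \<in> int_lattice" "k \<in> int_lattice" and y: "y = (X j k, \<xi> k)"
      by (auto simp: Y_def)
    have lat: "lat_floor (r *\<^sub>R y) = (j, k)"
      using X(1)[OF jk(1)] \<xi>[OF jk(2)] by (simp add: y lat_floor_Pair)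
    \<comment> \<open>Rescaling enlarges distances by \<open>r\<close>, and rounding in the doubled
      dimension adds at most \<open>2 * n\<close>; hence the constant.\<close>
    have dec: "decay N (z - y) \<le> (1 + r + 2 * n) ^ N * decay N (r *\<^sub>R z - (j, k))"
    proof (rule decay_le_scaled)
      have "(a - b) + (b - c) = a - c" for a b c :: "'a \<times> 'a" by simp
      from norm_triangle_ineq[of "r *\<^sub>R (z - y)" "r *\<^sub>R y - (j, k)", unfolded scaleR_diff_right this]
      have "norm (r *\<^sub>R z - (j, k)) \<le> norm (r *\<^sub>R (z - y)) + norm (r *\<^sub>R y - (j, k))"
        unfolding scaleR_diff_right .
      also have "\<dots> \<le> r * norm (z - y) + 2 * n"
        using norm_diff_lat_floor[of "r *\<^sub>R y"] r by (simp add: lat n_def)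
      finally have "norm (r *\<^sub>R z - (j, k)) \<le> r * norm (z - y) + 2 * n" .
      moreover have "(1 + r + 2 * n) * (1 + norm (z - y)) = (1 + r * norm (z - y) + 2 * n) + (r + norm (z - y) + 2 * (n * norm (z - y)))"
        by (simp add: algebra_simps)
      moreover have "0 \<le> r + norm (z - y) + 2 * (n * norm (z - y))"
        using r by (simp add: n_def)
      ultimately show "1 + norm (r *\<^sub>R z - (j, k)) \<le> (1 + r + 2 * n) * (1 + norm (z - y))"
        by linarith
    qed
    have "stf_abs \<phi> f y * ennreal (decay N (z - y)) \<le> (A (j, k) + ennreal \<eta>) * ennreal (decay N (z - y))"
      using X(2)[OF jk(1)] by (intro mult_right_mono) (auto simp: y)
    also have "\<dots> = A (j, k) * ennreal (decay N (z - y)) + ennreal \<eta> * ennreal (decay N (z - y))"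
      by (rule distrib_right)
    also have "\<dots> \<le> A (j, k) * ennreal ((1 + r + 2 * n) ^ N * decay N (r *\<^sub>R z - (j, k))) + ennreal \<eta> * 1"
      using dec by (intro add_mono mult_left_mono ennreal_leI) (auto simp: ennreal_le_1)
    also have "\<dots> = ennreal ((1 + r + 2 * n) ^ N) * (A (j, k) * ennreal (decay N (r *\<^sub>R z - (j, k)))) + ennreal \<eta>"
      using r by (simp add: ennreal_mult' n_def mult_ac)
    also have "\<dots> \<le> ennreal ((1 + r + 2 * n) ^ N) * ?P + ennreal \<eta>"
      using peetre_upper[of "\<lambda>w. if w \<in> int_lattice then A w else 0" "(j, k)" N "r *\<^sub>R z"] jk
      by (intro add_mono mult_left_mono) (auto simp: int_lattice_Times)
    finally show "stf_abs \<phi> f y * ennreal (decay N (z - y)) \<le> ennreal ((1 + r + 2 * n) ^ N) * ?P + ennreal \<eta>" .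
  qed simp
  also have "\<dots> = ennreal (K * (1 + r + 2 * n) ^ N) * ?P + ennreal e"
    using K r e by (simp add: distrib_left ennreal_mult' mult.assoc \<eta>_def n_def flip: ennreal_mult'[of K "e / K"])
  finally show "peetre N (stf_abs \<phi> f) z \<le> ennreal (K * (1 + r + 2 * real DIM('a)) ^ N) * ?P + ennreal e"
    by (simp only: n_def)
qed

text \<open>The order of choices is delicate: the weight fixes its degree and hence
  \<open>N0\<close>, then \<open>N\<close> fixes the mesh \<delta>, and \<delta> fixes the
  refinement \<open>r\<close>. On the refined lattice the weight becomes \<open>m'\<close>, of the
  same degree, so the threshold \<open>N0\<close> is still valid there.\<close>

lemma lattice_norm_le_modulation_norm:
  fixes \<phi> :: "'a::euclidean_space \<Rightarrow> complex"
  assumes p: "0 < p" "0 < q" and m: "poly_moderate m" and \<phi>: "tame \<phi>" "\<phi> \<noteq> (\<lambda>_. 0)"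
  shows "\<exists>N0. \<forall>N\<ge>N0. \<exists>C\<ge>0. \<forall>f. tame f \<longrightarrow>
    lattice_norm p q m (peetre N (stf_abs \<phi> f)) \<le> ennreal C * modulation_norm \<phi> p q m (functional_of f)"
proof -
  obtain N1 where m1: "moderate_degree N1 m" using m by (auto simp: poly_moderate_def)
  obtain C1 where C1: "0 \<le> C1" "\<And>z w. m z \<le> C1 * (1 + norm (z - w)) ^ N1 * m w" and nn: "\<And>z. 0 \<le> m z"
    using m1 unfolding moderate_degree_def by blast
  obtain N0 where N0: "\<And>N m. N0 \<le> N \<Longrightarrow> moderate_degree N1 m \<Longrightarrow> \<exists>C\<ge>0. \<forall>F.
    lattice_norm p q (m :: 'a \<times> 'a \<Rightarrow> real) (peetre N (\<lambda>z. if z \<in> int_lattice then F z else 0))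
      \<le> ennreal C * lattice_norm p q m F"
    using lattice_norm_peetre_lattice[OF p, of N1] by blast
  show ?thesis
  proof (intro exI[of _ N0] allI impI)
    fix N assume N: "N0 \<le> N"
    define n where "n = real DIM('a)"
    obtain \<delta> where \<delta>: "0 < \<delta>" and sampling: "\<And>f Y z. tame f \<Longrightarrow> \<forall>w. \<exists>y\<in>Y. norm (y - w) \<le> \<delta> \<Longrightarrow>
      peetre N (stf_abs \<phi> f) z \<le> ennreal (2 ^ (N + 1)) * (SUP y\<in>Y. stf_abs \<phi> f y * ennreal (decay N (z - y)))"
      using stf_sampling[OF \<phi>, of N] by blast
    \<comment> \<open>Two points of a cell of side \<open>1 / r\<close> differ by at most
      \<open>2 * n / r\<close> in each of the two components, so the nodes are
      \<open>4 * n / r\<close>-dense.\<close>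
    define r where "r = real (nat \<lceil>4 * n / \<delta>\<rceil> + 1)"
    have r: "1 \<le> r" "4 * n / r \<le> \<delta>"
    proof -
      show r1: "1 \<le> r" by (simp add: r_def)
      have "4 * n / \<delta> \<le> r"
        unfolding r_def by linarith
      then show "4 * n / r \<le> \<delta>" using \<delta> r1 by (simp add: field_simps)
    qed
    define m' where "m' z = m ((1 / r) *\<^sub>R z)" for z
    have m': "moderate_degree N1 m'"
      unfolding m'_def using m1 r(1) by (rule moderate_degree_shrink)
    obtain C3 where C3: "0 \<le> C3" "\<And>F. lattice_norm p q m' (peetre N (\<lambda>z. if z \<in> int_lattice then F z else 0))
      \<le> ennreal C3 * lattice_norm p q m' F"
      using N0[OF N m'] by blast
    have "linear (\<lambda>z::'a \<times> 'a. r *\<^sub>R fst z)" "linear (\<lambda>y::'a. r *\<^sub>R y)"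
      by (simp_all add: linear_iff scaleR_add_right)
    then obtain C4 where C4: "0 \<le> C4" "\<And>F. lattice_norm p q (\<lambda>(x, y). m' (r *\<^sub>R x, r *\<^sub>R y)) (\<lambda>(x, y). peetre N F (r *\<^sub>R x, r *\<^sub>R y))
      \<le> ennreal C4 * lattice_norm p q m' (peetre N F)"
      using mixed_norm_peetre_linear[OF p, of m' "\<lambda>z. r *\<^sub>R fst z" "\<lambda>y. r *\<^sub>R y" N] m' r(1)
      by (auto simp: poly_moderate_def)
    obtain C5 where C5: "0 \<le> C5" "\<And>(G :: 'a \<times> 'a \<Rightarrow> ennreal) \<epsilon>. 0 < \<epsilon> \<Longrightarrow>
      \<exists>\<xi>. (\<forall>k\<in>int_lattice. lat_floor (r *\<^sub>R \<xi> k) = k) \<and>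
        mixed_norm p q (count_space int_lattice) (count_space int_lattice)
          (\<lambda>(j, k). INF x\<in>{x. lat_floor (r *\<^sub>R x) = j}. G (x, \<xi> k))
        \<le> ennreal C5 * (mixed_norm p q lborel lborel G + ennreal \<epsilon>)"
      using mixed_norm_cell_samples[OF p, where R = r and ?'a = 'a and ?'b = 'a] r(1) by (auto simp: Bex_def)
    \<comment> \<open>The moderateness constant could be 0; the added 1 makes \<open>C6\<close>
      positive, so that it can be divided out when passing to an infimum.\<close>
    define C6 where "C6 = (C1 + 1) * (1 + 2 * n) ^ N1"
    have C6: "0 < C6" using C1(1) by (simp add: C6_def n_def add_nonneg_pos)
    define K where "K = 2 ^ (N + 1) * (1 + r + 2 * n) ^ N"
    have K: "0 \<le> K" using r(1) by (simp add: K_def n_def)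
    define D where "D = K * C4 * C3 * C6 * C5"
    have D: "0 \<le> D" using K C3(1) C4(1) C5(1) C6 by (simp add: D_def)
    have main: "lattice_norm p q m (peetre N (stf_abs \<phi> f)) \<le> ennreal D * (modulation_norm \<phi> p q m (functional_of f) + ennreal \<epsilon>)"
      if f: "tame f" and \<epsilon>: "0 < \<epsilon>" for f \<epsilon>
    proof -
      define G where "G z = ennreal (cmod (stf \<phi> f z) * m z)" for z
      obtain \<xi> where \<xi>: "\<And>k. k \<in> int_lattice \<Longrightarrow> lat_floor (r *\<^sub>R \<xi> k) = k"
        "mixed_norm p q (count_space int_lattice) (count_space int_lattice)
          (\<lambda>(j, k). INF x\<in>{x. lat_floor (r *\<^sub>R x) = j}. G (x, \<xi> k))
        \<le> ennreal C5 * (mixed_norm p q lborel lborel G + ennreal \<epsilon>)"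
        using C5(2)[OF \<epsilon>, of G] by blast
      define A where "A = (\<lambda>(j, k). INF x\<in>{x. lat_floor (r *\<^sub>R x) = j}. stf_abs \<phi> f (x, \<xi> k))"
      let ?A = "\<lambda>w. if w \<in> int_lattice then A w else 0"
      have A: "A (j, k) = (INF x\<in>{x. lat_floor (r *\<^sub>R x) = j}. stf_abs \<phi> f (x, \<xi> k))" for j k
        by (simp add: A_def)
      have point: "peetre N (stf_abs \<phi> f) z \<le> ennreal K * peetre N ?A (r *\<^sub>R z)" for z
        unfolding K_def n_def
        by (rule stf_peetre_le_lattice_samples[OF f \<phi>(1) r(1) r(2)[unfolded n_def] sampling[OF f] _ \<xi>(1) A]) auto
      have "lattice_norm p q m (peetre N (stf_abs \<phi> f))
        \<le> lattice_norm p q (\<lambda>(x, y). m' (r *\<^sub>R x, r *\<^sub>R y)) (\<lambda>z. ennreal K * (\<lambda>(x, y). peetre N ?A (r *\<^sub>R x, r *\<^sub>R y)) z)"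
        unfolding lattice_norm_def
      proof (rule mixed_norm_mono[OF p])
        fix x y :: 'a
        show "peetre N (stf_abs \<phi> f) (x, y) * ennreal (m (x, y)) \<le> ennreal K * (case (x, y) of (x, y) \<Rightarrow> peetre N ?A (r *\<^sub>R x, r *\<^sub>R y)) *
          ennreal (case (x, y) of (x, y) \<Rightarrow> m' (r *\<^sub>R x, r *\<^sub>R y))"
          using point[of "(x, y)"] r(1) by (auto simp: m'_def intro!: mult_right_mono)
      qed
      also have "\<dots> \<le> ennreal K * (ennreal C4 * (ennreal C3 * lattice_norm p q m' A))"
        unfolding lattice_norm_cmult[OF p]
        by (intro mult_left_mono order_trans[OF C4(2)] C3(2)) auto
      also have "\<dots> \<le> ennreal K * (ennreal C4 * (ennreal C3 * (ennreal C6 * (ennreal C5 * (mixed_norm p q lborel lborel G + ennreal \<epsilon>)))))"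
      proof (intro mult_left_mono)
        have "lattice_norm p q m' A \<le> mixed_norm p q (count_space int_lattice) (count_space int_lattice)
          (\<lambda>z. ennreal C6 * (\<lambda>(j, k). INF x\<in>{x. lat_floor (r *\<^sub>R x) = j}. G (x, \<xi> k)) z)"
          unfolding lattice_norm_def
        proof (rule mixed_norm_mono[OF p])
          fix j k :: 'a assume "j \<in> space (count_space int_lattice)" "k \<in> space (count_space int_lattice)"
          then have jk: "j \<in> int_lattice" "k \<in> int_lattice" by auto
          \<comment> \<open>The weight is moved inside the infimum: across one cell it changes by at
            most the factor \<open>C6\<close>.\<close>
          have "ennreal (1 / C6) * (A (j, k) * ennreal (m' (j, k))) \<le> (INF x\<in>{x. lat_floor (r *\<^sub>R x) = j}. G (x, \<xi> k))"
          proof (rule INF_greatest)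
            fix x assume "x \<in> {x. lat_floor (r *\<^sub>R x) = j}"
            then have x: "lat_floor (r *\<^sub>R (x, \<xi> k)) = (j, k)"
              using \<xi>(1)[OF jk(2)] by (simp add: lat_floor_Pair)
            have "norm ((1 / r) *\<^sub>R (j, k) - (x, \<xi> k)) = norm ((1 / r) *\<^sub>R ((j, k) - r *\<^sub>R (x, \<xi> k)))"
              using r(1) by (simp add: scaleR_diff_right)
            also have "\<dots> = norm ((j, k) - r *\<^sub>R (x, \<xi> k)) / r"
              by (subst norm_scaleR) (use r(1) in simp)
            also have "\<dots> \<le> norm ((j, k) - r *\<^sub>R (x, \<xi> k)) / 1" using r(1) by (intro divide_left_mono) auto
            also have "\<dots> \<le> 2 * n"
            proof -
              have "real DIM('a \<times> 'a) = 2 * n" by (simp add: n_def)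
              then show ?thesis
                using norm_diff_lat_floor[of "r *\<^sub>R (x, \<xi> k)", unfolded x]
                by (simp only: norm_minus_commute[of "(j, k)"] div_by_1)
            qed
            finally have d: "1 + norm ((1 / r) *\<^sub>R (j, k) - (x, \<xi> k)) \<le> 1 + 2 * n" by simp
            have "m' (j, k) \<le> C1 * (1 + norm ((1 / r) *\<^sub>R (j, k) - (x, \<xi> k))) ^ N1 * m (x, \<xi> k)"
              unfolding m'_def by (rule C1)
            also have "\<dots> \<le> (C1 + 1) * (1 + 2 * n) ^ N1 * m (x, \<xi> k)"
              using C1(1) nn d by (intro mult_right_mono mult_mono power_mono) auto
            finally have mm: "m' (j, k) \<le> C6 * m (x, \<xi> k)" by (simp only: C6_def)
            have "A (j, k) * ennreal (m' (j, k)) \<le> stf_abs \<phi> f (x, \<xi> k) * ennreal (C6 * m (x, \<xi> k))"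
              unfolding A using \<open>x \<in> _\<close> mm by (intro mult_mono INF_lower ennreal_leI) auto
            also have "\<dots> = ennreal C6 * G (x, \<xi> k)"
              using C6 nn by (simp add: G_def stf_abs_def ennreal_mult' mult_ac)
            finally have "ennreal (1 / C6) * (A (j, k) * ennreal (m' (j, k))) \<le> ennreal (1 / C6) * (ennreal C6 * G (x, \<xi> k))"
              by (rule mult_left_mono) simp
            also have "\<dots> = G (x, \<xi> k)"
              using C6 by (simp add: mult.assoc[symmetric] ennreal_mult'[symmetric])
            finally show "ennreal (1 / C6) * (A (j, k) * ennreal (m' (j, k))) \<le> G (x, \<xi> k)" .
          qed
          then have "ennreal C6 * (ennreal (1 / C6) * (A (j, k) * ennreal (m' (j, k)))) \<le> ennreal C6 * (INF x\<in>{x. lat_floor (r *\<^sub>R x) = j}. G (x, \<xi> k))"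
            by (rule mult_left_mono) simp
          moreover have "ennreal C6 * (ennreal (1 / C6) * Z) = Z" for Z
            using C6 by (simp add: mult.assoc[symmetric] ennreal_mult'[symmetric])
          ultimately show "A (j, k) * ennreal (m' (j, k)) \<le> ennreal C6 * (case (j, k) of (j, k) \<Rightarrow> INF x\<in>{x. lat_floor (r *\<^sub>R x) = j}. G (x, \<xi> k))"
            by simp
        qed
        also have "\<dots> \<le> ennreal C6 * (ennreal C5 * (mixed_norm p q lborel lborel G + ennreal \<epsilon>))"
          unfolding mixed_norm_cmult[OF p] by (intro mult_left_mono \<xi>(2)) simp
        finally show "lattice_norm p q m' A \<le> ennreal C6 * (ennreal C5 * (mixed_norm p q lborel lborel G + ennreal \<epsilon>))" .
      qed auto
      also have "\<dots> = ennreal D * (modulation_norm \<phi> p q m (functional_of f) + ennreal \<epsilon>)"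
        using K C3(1) C4(1) C5(1) C6 unfolding D_def modulation_norm_functional_of G_def[symmetric]
        by (simp add: ennreal_mult' mult.assoc)
      finally show ?thesis .
    qed
    show "\<exists>C\<ge>0. \<forall>f. tame f \<longrightarrow>
      lattice_norm p q m (peetre N (stf_abs \<phi> f)) \<le> ennreal C * modulation_norm \<phi> p q m (functional_of f)"
    proof (intro exI[of _ D] conjI allI impI D)
      fix f :: "'a \<Rightarrow> complex" assume f: "tame f"
      show "lattice_norm p q m (peetre N (stf_abs \<phi> f)) \<le> ennreal D * modulation_norm \<phi> p q m (functional_of f)"
      \<comment> \<open>The error \<epsilon> in \<open>main\<close> is arbitrary; dividing by
        \<open>D + 1\<close> rather than \<open>D\<close> covers \<open>D = 0\<close>.\<close>
      proof (rule ennreal_le_epsilon)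
        fix e :: real assume e: "0 < e"
        have "lattice_norm p q m (peetre N (stf_abs \<phi> f)) \<le> ennreal D * (modulation_norm \<phi> p q m (functional_of f) + ennreal (e / (D + 1)))"
          using D e by (intro main f) simp
        also have "\<dots> = ennreal D * modulation_norm \<phi> p q m (functional_of f) + ennreal (D * (e / (D + 1)))"
          by (simp only: distrib_left ennreal_mult'[OF D])
        also have "\<dots> \<le> ennreal D * modulation_norm \<phi> p q m (functional_of f) + ennreal e"
          using D e by (intro add_left_mono ennreal_leI) (simp add: field_simps)
        finally show "lattice_norm p q m (peetre N (stf_abs \<phi> f)) \<le> ennreal D * modulation_norm \<phi> p q m (functional_of f) + ennreal e" .
      qed
    qed
  qed
qed

section \<open>Schwartz functions\<close>

definition pd :: "'a::euclidean_space \<Rightarrow> ('a \<Rightarrow> complex) \<Rightarrow> 'a \<Rightarrow> complex" where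
  "pd b f = (\<lambda>x. frechet_derivative f (at x) b)"

lemma rapid_iff_bounded:
  "rapid f \<longleftrightarrow> (\<forall>N::nat. bounded (range (\<lambda>x. (1 + norm x) ^ N *\<^sub>R f x)))"
proof -
  have "(\<exists>C. \<forall>x. cmod (f x) \<le> C * decay N x) \<longleftrightarrow> bounded (range (\<lambda>x. (1 + norm x) ^ N *\<^sub>R f x))" for N
  proof -
    have "cmod (f x) \<le> C * decay N x \<longleftrightarrow> norm ((1 + norm x) ^ N *\<^sub>R f x) \<le> C" for x C
    proof -
      have "0 < (1 + norm x) ^ N" by (simp add: add_pos_nonneg)
      moreover have "\<bar>1 + norm x\<bar> = 1 + norm x" by simp
      ultimately show ?thesis
        by (simp add: decay_def field_simps power_abs)
    qed
    then show ?thesis by (simp add: bounded_iff)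
  qed
  then show ?thesis by (simp add: rapid_def)
qed

lemma schwartz_altdef:
  "schwartz f \<longleftrightarrow> (\<forall>bs. set bs \<subseteq> Basis \<longrightarrow> (\<forall>x. iter_pderiv bs f differentiable (at x)) \<and> rapid (iter_pderiv bs f))"
  unfolding schwartz_def rapid_iff_bounded by blast

text \<open>The last element of the list is differentiated first, so a derivative of
  \<open>f\<close> itself is peeled off at the end of the list.\<close>

lemma iter_pderiv_snoc: "iter_pderiv (bs @ [b]) f = iter_pderiv bs (pd b f)"
  by (induction bs) (auto simp: pd_def)

lemma schwartz_differentiable: "schwartz f \<Longrightarrow> f differentiable (at x)"
  unfolding schwartz_altdef by (drule spec[of _ "[]"]) simp

lemma schwartz_rapid: "schwartz f \<Longrightarrow> rapid f"
  unfolding schwartz_altdef by (drule spec[of _ "[]"]) simp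

lemma schwartz_pd: "schwartz f \<Longrightarrow> b \<in> Basis \<Longrightarrow> schwartz (pd b f)"
  unfolding schwartz_altdef iter_pderiv_snoc[symmetric] by simp

text \<open>Closure under one partial derivative iterates along the list, which avoids a Leibniz
  formula for multi-indices. In the applications \<open>X\<close> consists of all functions of the
  shape under consideration.\<close>

lemma schwartz_coinduct:
  assumes "f \<in> X"
    and diff: "\<And>g x. g \<in> X \<Longrightarrow> g differentiable (at x)" and rapid: "\<And>g. g \<in> X \<Longrightarrow> rapid g"
    and pd: "\<And>g b. g \<in> X \<Longrightarrow> b \<in> Basis \<Longrightarrow> pd b g \<in> X"
  shows "schwartz f"
proof -
  have "iter_pderiv bs f \<in> X" if "set bs \<subseteq> Basis" for bs
    using that assms(1) by (induction bs) (auto simp: pd[unfolded pd_def])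
  then show ?thesis
    unfolding schwartz_altdef using diff rapid by blast
qed

lemma schwartz_has_derivative: "schwartz f \<Longrightarrow> (f has_derivative frechet_derivative f (at x)) (at x)"
  using schwartz_differentiable frechet_derivative_works by blast

lemma pd_eqI: "(\<And>x. (f has_derivative f' x) (at x)) \<Longrightarrow> pd b f = (\<lambda>x. f' x b)"
  unfolding pd_def using frechet_derivative_at by metis

lemma schwartz_continuous: "schwartz f \<Longrightarrow> continuous_on UNIV f"
  by (auto simp: continuous_on_eq_continuous_at intro: differentiable_imp_continuous_within schwartz_differentiable)

lemma rapid_add:
  assumes "rapid f" "rapid g"
  shows "rapid (\<lambda>x. f x + g x)"
  unfolding rapid_def
proof
  fix N
  obtain C1 where C1: "\<And>x. cmod (f x) \<le> C1 * decay N x" using rapidE[OF assms(1)] by blast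
  obtain C2 where C2: "\<And>x. cmod (g x) \<le> C2 * decay N x" using rapidE[OF assms(2)] by blast
  have "cmod (f x + g x) \<le> (C1 + C2) * decay N x" for x
    unfolding distrib_right by (rule order_trans[OF norm_triangle_ineq add_mono[OF C1 C2]])
  then show "\<exists>C. \<forall>x. cmod (f x + g x) \<le> C * decay N x" by blast
qed

lemma schwartz_add:
  fixes f g :: "'a::euclidean_space \<Rightarrow> complex"
  assumes "schwartz f" "schwartz g"
  shows "schwartz (\<lambda>x. f x + g x)"
proof (rule schwartz_coinduct[where X = "{\<lambda>x. f x + g x | f g. schwartz f \<and> schwartz g}"])
  fix h :: "'a \<Rightarrow> complex" assume "h \<in> {\<lambda>x. f x + g x | f g. schwartz f \<and> schwartz g}"
  then obtain f g where h: "h = (\<lambda>x. f x + g x)" and fg: "schwartz f" "schwartz g" by blast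
  have d: "(h has_derivative (\<lambda>v. frechet_derivative f (at x) v + frechet_derivative g (at x) v)) (at x)" for x
    unfolding h by (intro derivative_intros schwartz_has_derivative fg)
  show "h differentiable at x" for x using d unfolding differentiable_def by blast
  show "rapid h" unfolding h by (intro rapid_add schwartz_rapid fg)
  fix b :: 'a assume b: "b \<in> Basis"
  have "pd b h = (\<lambda>x. pd b f x + pd b g x)" unfolding pd_eqI[OF d] by (simp add: pd_def)
  then show "pd b h \<in> {\<lambda>x. f x + g x | f g. schwartz f \<and> schwartz g}"
    using schwartz_pd[OF _ b] fg by blast
qed (use assms in blast)

lemma schwartz_cmult:
  fixes f :: "'a::euclidean_space \<Rightarrow> complex"
  assumes "schwartz f"
  shows "schwartz (\<lambda>x. c * f x)"
proof (rule schwartz_coinduct[where X = "{\<lambda>x. c * f x | f. schwartz f}"])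
  fix h :: "'a \<Rightarrow> complex" assume "h \<in> {\<lambda>x. c * f x | f. schwartz f}"
  then obtain f where h: "h = (\<lambda>x. c * f x)" and f: "schwartz f" by blast
  have d: "(h has_derivative (\<lambda>v. c * frechet_derivative f (at x) v)) (at x)" for x
    unfolding h by (intro has_derivative_mult_right schwartz_has_derivative f)
  show "h differentiable at x" for x using d unfolding differentiable_def by blast
  show "rapid h" unfolding h
    using rapid_mult_bounded[OF schwartz_rapid[OF f], of "\<lambda>_. c" "cmod c"] by (simp add: mult.commute)
  fix b :: 'a assume b: "b \<in> Basis"
  have "pd b h = (\<lambda>x. c * pd b f x)" unfolding pd_eqI[OF d] by (simp add: pd_def)
  then show "pd b h \<in> {\<lambda>x. c * f x | f. schwartz f}"
    using schwartz_pd[OF _ b] f by blast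
qed (use assms in blast)

lemma schwartz_zero: "schwartz (\<lambda>_. 0)"
proof (rule schwartz_coinduct[where X = "{\<lambda>_. 0}"])
  fix g :: "'a \<Rightarrow> complex" assume "g \<in> {\<lambda>_. 0}"
  then show "rapid g" by (auto simp: rapid_def intro: exI[of _ 0])
qed (auto simp: pd_def)

lemma schwartz_sum: "finite S \<Longrightarrow> (\<And>i. i \<in> S \<Longrightarrow> schwartz (f i)) \<Longrightarrow> schwartz (\<lambda>x. \<Sum>i\<in>S. f i x)"
  by (induction S rule: finite_induct) (auto intro: schwartz_zero schwartz_add)

lemma schwartz_translation:
  fixes f :: "'a::euclidean_space \<Rightarrow> complex"
  assumes "schwartz f"
  shows "schwartz (translation h f)"
proof (rule schwartz_coinduct[where X = "{translation h f | f. schwartz f}"])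
  fix g :: "'a \<Rightarrow> complex" assume "g \<in> {translation h f | f. schwartz f}"
  then obtain f where g: "g = (\<lambda>x. f (x - h))" and f: "schwartz f" by (auto simp: translation_def)
  have d: "(g has_derivative frechet_derivative f (at (x - h))) (at x)" for x
  proof -
    have "((\<lambda>x. x - h) has_derivative (\<lambda>v. v)) (at x)" by (auto intro!: derivative_eq_intros)
    from has_derivative_compose[OF this schwartz_has_derivative[OF f]] show ?thesis by (simp add: g)
  qed
  show "g differentiable at x" for x using d unfolding differentiable_def by blast
  show "rapid g"
    using rapid_modulation_translation[OF schwartz_rapid[OF f], of 0 h] by (simp add: g modulation_def translation_def)
  fix b :: 'a assume b: "b \<in> Basis"
  have "pd b g = translation h (pd b f)" unfolding pd_eqI[OF d] by (simp add: pd_def translation_def)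
  then show "pd b g \<in> {translation h f | f. schwartz f}"
    using schwartz_pd[OF f b] by blast
qed (use assms in blast)

lemma has_derivative_cis: "((\<lambda>x. cis (g x)) has_derivative (\<lambda>v. \<i> * cis (g x) * of_real (g' v))) (at x)"
  if g: "(g has_derivative g') (at x)"
proof -
  have *: "((\<lambda>x. \<i> * complex_of_real (g x)) has_derivative (\<lambda>v. \<i> * of_real (g' v))) (at x)"
    by (intro has_derivative_mult_right has_derivative_of_real g)
  have "(exp has_derivative (\<lambda>v. exp (\<i> * complex_of_real (g x)) * v)) (at (\<i> * complex_of_real (g x)))"
    using DERIV_exp[of "\<i> * complex_of_real (g x)"] by (simp add: has_field_derivative_def)
  from has_derivative_compose[OF * this] show ?thesis by (simp add: cis_conv_exp mult_ac)
qed

lemma schwartz_modulation: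
  fixes f :: "'a::euclidean_space \<Rightarrow> complex"
  assumes "schwartz f"
  shows "schwartz (modulation \<xi> f)"
proof (rule schwartz_coinduct[where X = "{modulation \<xi> f | f. schwartz f}"])
  fix g :: "'a \<Rightarrow> complex" assume "g \<in> {modulation \<xi> f | f. schwartz f}"
  then obtain f where g: "g = (\<lambda>t. cis (2 * pi * (t \<bullet> \<xi>)) * f t)" and f: "schwartz f"
    by (auto simp: modulation_def)
  have d: "(g has_derivative (\<lambda>v. cis (2 * pi * (x \<bullet> \<xi>)) * frechet_derivative f (at x) v
     + (\<i> * cis (2 * pi * (x \<bullet> \<xi>)) * of_real (2 * pi * (v \<bullet> \<xi>))) * f x)) (at x)" for x
    unfolding g
    by (intro has_derivative_mult has_derivative_cis schwartz_has_derivative f) (auto intro!: derivative_eq_intros)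
  show "g differentiable at x" for x using d unfolding differentiable_def by blast
  show "rapid g"
    using rapid_modulation_translation[OF schwartz_rapid[OF f], of \<xi> 0] by (simp add: g modulation_def translation_def)
  fix b :: 'a assume b: "b \<in> Basis"
  \<comment> \<open>The product rule leaves a second term without a derivative of \<open>f\<close>,
    but the sum is again a modulated Schwartz function, so the set is closed.\<close>
  have "pd b g = modulation \<xi> (\<lambda>t. pd b f t + (\<i> * of_real (2 * pi * (b \<bullet> \<xi>))) * f t)"
    unfolding pd_eqI[OF d] by (simp add: pd_def modulation_def algebra_simps)
  moreover have "schwartz (\<lambda>t. pd b f t + (\<i> * of_real (2 * pi * (b \<bullet> \<xi>))) * f t)"
    by (intro schwartz_add schwartz_cmult schwartz_pd f b)
  ultimately show "pd b g \<in> {modulation \<xi> f | f. schwartz f}" by blast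
qed (use assms in blast)

section \<open>Decay of the \<open>\<tau>\<close>-Wigner distribution\<close>

definition wigner_ker :: "real \<Rightarrow> ('a::euclidean_space \<Rightarrow> complex) \<Rightarrow> ('a \<Rightarrow> complex) \<Rightarrow> 'a \<Rightarrow> 'a \<Rightarrow> complex" where
  "wigner_ker \<tau> f1 f2 x t = f1 (x + \<tau> *\<^sub>R t) * cnj (f2 (x - (1 - \<tau>) *\<^sub>R t))"

lemma wigner_eq: "wigner \<tau> f1 f2 (x, \<xi>) = (\<integral>t. wigner_ker \<tau> f1 f2 x t * cis (- 2 * pi * (\<xi> \<bullet> t)) \<partial>lborel)"
  by (simp add: wigner_def wigner_ker_def)

text \<open>If \<open>u\<close> and \<open>v\<close> are the arguments of \<open>f1\<close> and
  \<open>f2\<close>, then \<open>x\<close> is a convex combination of them and \<open>t\<close> is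
  their difference, so both norms are at most \<open>norm u + norm v\<close>. Convexity is where
  \<tau> in the unit interval enters.\<close>

lemma wigner_ker_decay:
  assumes "rapid f1" "rapid f2" and \<tau>: "0 \<le> \<tau>" "\<tau> \<le> 1"
  shows "\<exists>C\<ge>0. \<forall>x t. cmod (wigner_ker \<tau> f1 f2 x t) \<le> C * decay N x * decay M t"
proof -
  obtain C1 where C1: "0 \<le> C1" "\<And>x. cmod (f1 x) \<le> C1 * decay (N + M) x" using rapidE[OF assms(1)] by blast
  obtain C2 where C2: "0 \<le> C2" "\<And>x. cmod (f2 x) \<le> C2 * decay (N + M) x" using rapidE[OF assms(2)] by blast
  have "cmod (wigner_ker \<tau> f1 f2 x t) \<le> (C1 * C2) * decay N x * decay M t" for x t
  proof -
    define u v where "u = x + \<tau> *\<^sub>R t" and "v = x - (1 - \<tau>) *\<^sub>R t"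
    have mono: "decay L u * decay L v \<le> decay L w" if "norm w \<le> norm u + norm v" for L and w :: 'a
    proof -
      have "norm u + norm v = norm (norm u + norm v)" by simp
      have "decay L (norm u) * decay L (norm v) \<le> decay L (norm u + norm v)" by (rule decay_mult_le)
      also have "\<dots> \<le> decay L w"
      proof -
        have "1 + norm w \<le> 1 * (1 + norm (norm u + norm v))" using that by simp
        from decay_le_scaled[OF this] show ?thesis by simp
      qed
      finally show ?thesis by (simp add: decay_def)
    qed
    have "x = (1 - \<tau>) *\<^sub>R u + \<tau> *\<^sub>R v" by (simp add: u_def v_def algebra_simps)
    then have "norm x \<le> norm ((1 - \<tau>) *\<^sub>R u) + norm (\<tau> *\<^sub>R v)" using norm_triangle_ineq by metis
    also have "\<dots> \<le> 1 * norm u + 1 * norm v"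
      using \<tau> unfolding norm_scaleR by (intro add_mono mult_right_mono) auto
    finally have x: "norm x \<le> norm u + norm v" by simp
    have "t = u - v" by (simp add: u_def v_def algebra_simps)
    then have t: "norm t \<le> norm u + norm v" using norm_triangle_ineq4 by metis
    have "cmod (wigner_ker \<tau> f1 f2 x t) = cmod (f1 u) * cmod (f2 v)"
      by (simp add: wigner_ker_def u_def v_def norm_mult)
    also have "\<dots> \<le> (C1 * decay (N + M) u) * (C2 * decay (N + M) v)"
      by (intro mult_mono C1(2) C2(2)) (use C1(1) in auto)
    also have "\<dots> = C1 * C2 * ((decay N u * decay N v) * (decay M u * decay M v))"
      by (simp add: decay_add mult_ac)
    also have "\<dots> \<le> C1 * C2 * (decay N x * decay M t)"
      using C1(1) C2(1) by (intro mult_left_mono mult_mono mono x t) auto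
    finally show ?thesis by (simp add: mult_ac)
  qed
  with C1(1) C2(1) show ?thesis by (intro exI[of _ "C1 * C2"]) simp
qed

lemma continuous_on_wigner_ker [continuous_intros]:
  assumes "continuous_on UNIV f1" "continuous_on UNIV f2" "continuous_on A g" "continuous_on A h"
  shows "continuous_on A (\<lambda>z. wigner_ker \<tau> f1 f2 (g z) (h z))"
  unfolding wigner_ker_def
  by (intro continuous_intros continuous_on_compose2[OF assms(1)] continuous_on_compose2[OF assms(2)] assms(3,4)) auto

lemma measurable_wigner_ker:
  assumes "continuous_on UNIV f1" "continuous_on UNIV f2"
  shows "(\<lambda>t. wigner_ker \<tau> f1 f2 x t) \<in> borel_measurable borel" "(\<lambda>x. wigner_ker \<tau> f1 f2 x t) \<in> borel_measurable borel"
  by (intro borel_measurable_continuous_onI continuous_intros assms)+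

text \<open>The integral of a derivative vanishes because difference quotients have integral zero.\<close>

lemma integral_derivative_zero:
  fixes h :: "'a::euclidean_space \<Rightarrow> complex"
  assumes d: "\<And>t. (h has_derivative D t) (at t)"
    and h: "\<And>t. cmod (h t) \<le> C * decay (DIM('a) + 2) t"
    and D: "\<And>t. cmod (D t b) \<le> C * decay (DIM('a) + 2) t" and b: "norm b = 1" and C: "0 \<le> C"
  shows "(\<integral>t. D t b \<partial>lborel) = 0"
proof -
  define M where "M = DIM('a) + 2"
  have ch: "continuous_on UNIV h"
    using d by (auto simp: continuous_on_eq_continuous_within intro!: has_derivative_continuous)
  have [measurable]: "h \<in> borel_measurable borel" using ch by (simp add: borel_measurable_continuous_onI)
  have ih: "integrable lborel h" by (rule integrable_of_decay[OF _ h]) measurable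
  define \<epsilon> where "\<epsilon> n = inverse (real (Suc n))" for n
  have \<epsilon>: "\<epsilon> \<longlonglongrightarrow> 0" "\<And>n. 0 < \<epsilon> n" "\<And>n. \<epsilon> n \<le> 1"
    unfolding \<epsilon>_def using LIMSEQ_inverse_real_of_nat by (auto simp: inverse_le_1_iff)
  define Q where "Q n t = (h (t + \<epsilon> n *\<^sub>R b) - h t) /\<^sub>R \<epsilon> n" for n t
  have line: "((\<lambda>s. h (t + s *\<^sub>R b)) has_derivative (\<lambda>r. D (t + s *\<^sub>R b) (r *\<^sub>R b))) (at s)" for t and s :: real
  proof -
    have "((\<lambda>s. t + s *\<^sub>R b) has_derivative (\<lambda>r. r *\<^sub>R b)) (at s)" by (auto intro!: derivative_eq_intros)
    from has_derivative_compose[OF this d] show ?thesis .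
  qed
  have lin: "D t (r *\<^sub>R b) = r *\<^sub>R D t b" for t r
    using has_derivative_bounded_linear[OF d] by (simp add: linear_scale bounded_linear.linear)
  have lim: "(\<lambda>n. Q n t) \<longlonglongrightarrow> D t b" for t
  proof -
    have "(\<lambda>s. cmod (h (t + s *\<^sub>R b) - h t - s *\<^sub>R D t b) / norm s) \<midarrow>0\<rightarrow> 0"
      using line[of t 0] unfolding has_derivative_at by (simp add: lin)
    moreover have "filterlim \<epsilon> (at 0) sequentially"
    proof -
      have "\<epsilon> n \<noteq> 0" for n using \<epsilon>(2)[of n] by simp
      then show ?thesis using \<epsilon>(1) by (simp add: filterlim_at)
    qed
    ultimately have "(\<lambda>n. cmod (h (t + \<epsilon> n *\<^sub>R b) - h t - \<epsilon> n *\<^sub>R D t b) / norm (\<epsilon> n)) \<longlonglongrightarrow> 0"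
      by (rule filterlim_compose)
    moreover have "cmod (h (t + \<epsilon> n *\<^sub>R b) - h t - \<epsilon> n *\<^sub>R D t b) / norm (\<epsilon> n) = cmod (Q n t - D t b)" for n
    proof -
      have "Q n t - D t b = (h (t + \<epsilon> n *\<^sub>R b) - h t - \<epsilon> n *\<^sub>R D t b) /\<^sub>R \<epsilon> n"
        using \<epsilon>(2)[of n] by (simp add: Q_def scaleR_diff_right)
      then show ?thesis by (simp add: divide_inverse mult.commute)
    qed
    ultimately show ?thesis
      by (simp add: tendsto_norm_zero_iff LIM_zero_iff)
  qed
  \<comment> \<open>The difference quotients are dominated through the mean value inequality; a step
    of length at most 1 changes the decay by at most \<open>2 ^ M\<close>.\<close>
  have bound: "cmod (Q n t) \<le> C * 2 ^ M * decay M t" for n t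
  proof -
    have "\<exists>x\<in>{0<..<\<epsilon> n}. cmod (h (t + \<epsilon> n *\<^sub>R b) - h (t + 0 *\<^sub>R b)) \<le> cmod (D (t + x *\<^sub>R b) ((\<epsilon> n - 0) *\<^sub>R b))"
      using \<epsilon>(2)[of n]
      by (intro mvt_general[where f = "\<lambda>s. h (t + s *\<^sub>R b)"] line continuous_intros continuous_on_compose2[OF ch]) auto
    then obtain x where x: "0 < x" "x < \<epsilon> n" and le: "cmod (h (t + \<epsilon> n *\<^sub>R b) - h t) \<le> \<epsilon> n * cmod (D (t + x *\<^sub>R b) b)"
      using \<epsilon>(2)[of n] by (auto simp: lin)
    have "cmod (Q n t) = cmod (h (t + \<epsilon> n *\<^sub>R b) - h t) / \<epsilon> n"
      using \<epsilon>(2)[of n] by (simp add: Q_def divide_inverse mult.commute)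
    also have "\<dots> \<le> cmod (D (t + x *\<^sub>R b) b)"
      using le \<epsilon>(2)[of n] by (simp add: divide_le_eq mult.commute)
    also have "\<dots> \<le> C * decay M (t + x *\<^sub>R b)" unfolding M_def by (rule D)
    also have "\<dots> \<le> C * (2 ^ M * decay M t)"
    proof (rule mult_left_mono[OF _ C])
      have "decay M (t + x *\<^sub>R b) \<le> (1 + norm (x *\<^sub>R b)) ^ M * decay M t"
        using decay_le_shift[of M "t + x *\<^sub>R b" t] by simp
      also have "\<dots> \<le> 2 ^ M * decay M t"
        using x \<epsilon>(3)[of n] b by (intro mult_right_mono power_mono) auto
      finally show "decay M (t + x *\<^sub>R b) \<le> 2 ^ M * decay M t" .
    qed
    finally show ?thesis by (simp add: mult.assoc)
  qed
  have zero: "(\<integral>t. Q n t \<partial>lborel) = 0" for n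
  proof -
    have "integrable lborel (\<lambda>t. h (t + \<epsilon> n *\<^sub>R b))"
      using lborel_integrable_affine[OF ih, of 1 "\<epsilon> n *\<^sub>R b"] by (simp add: add.commute)
    then have "(\<integral>t. Q n t \<partial>lborel) = ((\<integral>t. h (t + \<epsilon> n *\<^sub>R b) \<partial>lborel) - (\<integral>t. h t \<partial>lborel)) /\<^sub>R \<epsilon> n"
      unfolding Q_def using ih by simp
    also have "(\<integral>t. h (t + \<epsilon> n *\<^sub>R b) \<partial>lborel) = (\<integral>t. h t \<partial>lborel)"
      by (rule lborel_integral_translation) measurable
    finally show ?thesis by simp
  qed
  have "(\<lambda>n. \<integral>t. Q n t \<partial>lborel) \<longlonglongrightarrow> (\<integral>t. D t b \<partial>lborel)"
  proof (rule integral_dominated_convergence)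
    have [measurable]: "Q n \<in> borel_measurable borel" for n
      unfolding Q_def by measurable
    show "Q n \<in> borel_measurable lborel" for n by simp
    show "(\<lambda>t. D t b) \<in> borel_measurable lborel"
      using borel_measurable_LIMSEQ_metric[of Q lborel "\<lambda>t. D t b"] lim by simp
    show "integrable lborel (\<lambda>t::'a. C * 2 ^ M * decay M t)"
      by (intro integrable_mult_right integrable_decay) (simp add: M_def)
  qed (use lim bound in auto)
  then show ?thesis
    by (simp add: zero LIMSEQ_const_iff)
qed

text \<open>Integration by parts in \<open>t\<close>: the derivative of kernel times phase has
  integral zero. The chain rule produces the factors \<tau> and \<open>1 - \<tau>\<close> with
  opposite signs, and the phase produces the multiplication by a frequency coordinate.\<close>

lemma wigner_recursion:
  assumes f: "schwartz f1" "schwartz f2" and \<tau>: "0 \<le> \<tau>" "\<tau> \<le> 1" and b: "b \<in> Basis"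
  shows "of_real (2 * pi * (\<xi> \<bullet> b)) * \<i> * wigner \<tau> f1 f2 (x, \<xi>)
    = of_real \<tau> * wigner \<tau> (pd b f1) f2 (x, \<xi>) - of_real (1 - \<tau>) * wigner \<tau> f1 (pd b f2) (x, \<xi>)"
proof -
  define M where "M = DIM('a) + 2"
  define e where "e t = cis (- 2 * pi * (\<xi> \<bullet> t))" for t
  define h where "h t = wigner_ker \<tau> f1 f2 x t * e t" for t
  define D where "D t v = (frechet_derivative f1 (at (x + \<tau> *\<^sub>R t)) (\<tau> *\<^sub>R v) * cnj (f2 (x - (1 - \<tau>) *\<^sub>R t))
    - f1 (x + \<tau> *\<^sub>R t) * cnj (frechet_derivative f2 (at (x - (1 - \<tau>) *\<^sub>R t)) ((1 - \<tau>) *\<^sub>R v))) * e t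
    - wigner_ker \<tau> f1 f2 x t * (\<i> * e t * of_real (2 * pi * (\<xi> \<bullet> v)))" for t v
  note pf = schwartz_pd[OF f(1) b] schwartz_pd[OF f(2) b]
  have lin1: "frechet_derivative f1 (at y) (r *\<^sub>R v) = of_real r * frechet_derivative f1 (at y) v"
    and lin2: "frechet_derivative f2 (at y) (r *\<^sub>R v) = of_real r * frechet_derivative f2 (at y) v" for y r v
    using linear_scale[OF linear_frechet_derivative[OF schwartz_differentiable[OF f(1)]]]
      linear_scale[OF linear_frechet_derivative[OF schwartz_differentiable[OF f(2)]]] by (simp_all add: scaleR_conv_of_real)
  have d: "(h has_derivative D t) (at t)" for t
  proof -
    have a1: "((\<lambda>t. x + \<tau> *\<^sub>R t) has_derivative (\<lambda>v. \<tau> *\<^sub>R v)) (at t)" by (auto intro!: derivative_eq_intros)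
    have a2: "((\<lambda>t. x - (1 - \<tau>) *\<^sub>R t) has_derivative (\<lambda>v. - ((1 - \<tau>) *\<^sub>R v))) (at t)" by (auto intro!: derivative_eq_intros)
    have a3: "((\<lambda>t. - 2 * pi * (\<xi> \<bullet> t)) has_derivative (\<lambda>v. - 2 * pi * (\<xi> \<bullet> v))) (at t)" by (auto intro!: derivative_eq_intros)
    have 1: "((\<lambda>t. f1 (x + \<tau> *\<^sub>R t)) has_derivative (\<lambda>v. frechet_derivative f1 (at (x + \<tau> *\<^sub>R t)) (\<tau> *\<^sub>R v))) (at t)"
      by (rule has_derivative_compose[OF a1 schwartz_has_derivative[OF f(1)]])
    have 2: "((\<lambda>t. f2 (x - (1 - \<tau>) *\<^sub>R t)) has_derivative (\<lambda>v. frechet_derivative f2 (at (x - (1 - \<tau>) *\<^sub>R t)) (- ((1 - \<tau>) *\<^sub>R v)))) (at t)"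
      by (rule has_derivative_compose[OF a2 schwartz_has_derivative[OF f(2)]])
    have 3: "(e has_derivative (\<lambda>v. \<i> * e t * of_real (- 2 * pi * (\<xi> \<bullet> v)))) (at t)"
      unfolding e_def by (rule has_derivative_cis[OF a3])
    have neg: "frechet_derivative f2 (at y) (- v) = - frechet_derivative f2 (at y) v" for y v
      by (rule linear_neg[OF linear_frechet_derivative[OF schwartz_differentiable[OF f(2)]]])
    show ?thesis
      unfolding h_def wigner_ker_def
      by (rule has_derivative_eq_rhs[OF has_derivative_mult[OF has_derivative_mult[OF 1 has_derivative_cnj[OF 2]] 3]])
         (auto simp: fun_eq_iff D_def wigner_ker_def neg ring_distribs mult_ac)
  qed
  have Db: "D t b = of_real \<tau> * (wigner_ker \<tau> (pd b f1) f2 x t * e t) - of_real (1 - \<tau>) * (wigner_ker \<tau> f1 (pd b f2) x t * e t)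
     - of_real (2 * pi * (\<xi> \<bullet> b)) * \<i> * (wigner_ker \<tau> f1 f2 x t * e t)" for t
    unfolding D_def lin1 lin2 by (simp add: wigner_ker_def pd_def algebra_simps)
  have ker: "\<exists>C\<ge>0. \<forall>t. cmod (wigner_ker \<tau> g1 g2 x t * e t) \<le> C * decay M t" if g: "schwartz g1" "schwartz g2" for g1 g2
  proof -
    obtain C where "0 \<le> C" "\<And>x t. cmod (wigner_ker \<tau> g1 g2 x t) \<le> C * decay 0 x * decay M t"
      using wigner_ker_decay[OF schwartz_rapid[OF g(1)] schwartz_rapid[OF g(2)] \<tau>] by blast
    then show ?thesis by (intro exI[of _ C]) (simp add: norm_mult e_def)
  qed
  have int: "integrable lborel (\<lambda>t. wigner_ker \<tau> g1 g2 x t * e t)" if g: "schwartz g1" "schwartz g2" for g1 g2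
  proof -
    obtain C where C: "\<And>t. cmod (wigner_ker \<tau> g1 g2 x t * e t) \<le> C * decay M t" using ker[OF g] by blast
    have "(\<lambda>t. wigner_ker \<tau> g1 g2 x t * e t) \<in> borel_measurable borel"
      unfolding e_def
      by (intro borel_measurable_continuous_onI continuous_intros schwartz_continuous g)
    then show ?thesis by (rule integrable_of_decay[OF _ C[unfolded M_def]])
  qed
  obtain A1 where A1: "0 \<le> A1" "\<And>t. cmod (wigner_ker \<tau> f1 f2 x t * e t) \<le> A1 * decay M t" using ker[OF f] by blast
  obtain A2 where A2: "0 \<le> A2" "\<And>t. cmod (wigner_ker \<tau> (pd b f1) f2 x t * e t) \<le> A2 * decay M t" using ker[OF pf(1) f(2)] by blast
  obtain A3 where A3: "0 \<le> A3" "\<And>t. cmod (wigner_ker \<tau> f1 (pd b f2) x t * e t) \<le> A3 * decay M t" using ker[OF f(1) pf(2)] by blast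
  define A where "A = A1 + (\<bar>\<tau>\<bar> * A2 + \<bar>1 - \<tau>\<bar> * A3 + \<bar>2 * pi * (\<xi> \<bullet> b)\<bar> * A1)"
  have A: "0 \<le> A" using A1(1) A2(1) A3(1) by (simp add: A_def)
  have "(\<integral>t. D t b \<partial>lborel) = 0"
  proof (rule integral_derivative_zero[OF d, of A])
    fix t
    have "cmod (h t) \<le> A1 * decay M t" unfolding h_def by (rule A1(2))
    also have "\<dots> \<le> A * decay M t"
      using A1(1) A2(1) A3(1) by (intro mult_right_mono) (auto simp: A_def)
    finally show "cmod (h t) \<le> A * decay (DIM('a) + 2) t" by (simp only: M_def)
    have "cmod (D t b) \<le> \<bar>\<tau>\<bar> * (A2 * decay M t) + \<bar>1 - \<tau>\<bar> * (A3 * decay M t) + \<bar>2 * pi * (\<xi> \<bullet> b)\<bar> * (A1 * decay M t)"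
      unfolding Db
    proof (intro order_trans[OF norm_triangle_ineq4] add_mono)
      show "cmod (of_real \<tau> * (wigner_ker \<tau> (pd b f1) f2 x t * e t)) \<le> \<bar>\<tau>\<bar> * (A2 * decay M t)"
        unfolding norm_mult[of "of_real \<tau>"] norm_of_real by (intro mult_left_mono A2(2)) simp
      show "cmod (of_real (1 - \<tau>) * (wigner_ker \<tau> f1 (pd b f2) x t * e t)) \<le> \<bar>1 - \<tau>\<bar> * (A3 * decay M t)"
        unfolding norm_mult[of "of_real (1 - \<tau>)"] norm_of_real by (intro mult_left_mono A3(2)) simp
      have "cmod (of_real (2 * pi * (\<xi> \<bullet> b)) * \<i>) = \<bar>2 * pi * (\<xi> \<bullet> b)\<bar>" by (simp only: norm_mult norm_of_real norm_ii mult_1_right)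
      then show "cmod (of_real (2 * pi * (\<xi> \<bullet> b)) * \<i> * (wigner_ker \<tau> f1 f2 x t * e t)) \<le> \<bar>2 * pi * (\<xi> \<bullet> b)\<bar> * (A1 * decay M t)"
        unfolding norm_mult[of "of_real (2 * pi * (\<xi> \<bullet> b)) * \<i>"] by (simp only:) (intro mult_left_mono A1(2) abs_ge_zero)
    qed
    also have "\<dots> = (\<bar>\<tau>\<bar> * A2 + \<bar>1 - \<tau>\<bar> * A3 + \<bar>2 * pi * (\<xi> \<bullet> b)\<bar> * A1) * decay M t" by (simp only: distrib_right mult.assoc)
    also have "\<dots> \<le> A * decay M t"
      using A1(1) by (intro mult_right_mono) (auto simp: A_def)
    finally show "cmod (D t b) \<le> A * decay (DIM('a) + 2) t" by (simp only: M_def)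
  qed (use b A in auto)
  then have "of_real \<tau> * (\<integral>t. wigner_ker \<tau> (pd b f1) f2 x t * e t \<partial>lborel) - of_real (1 - \<tau>) * (\<integral>t. wigner_ker \<tau> f1 (pd b f2) x t * e t \<partial>lborel)
     - of_real (2 * pi * (\<xi> \<bullet> b)) * \<i> * (\<integral>t. wigner_ker \<tau> f1 f2 x t * e t \<partial>lborel) = 0"
    unfolding Db using int[OF f] int[OF pf(1) f(2)] int[OF f(1) pf(2)]
    by (subst (asm) Bochner_Integration.integral_diff, simp, simp)
       (subst (asm) Bochner_Integration.integral_diff, simp, simp, simp only: integral_mult_right_zero)
  then show ?thesis
    by (simp add: wigner_eq e_def)
qed

text \<open>Each factor of frequency is exchanged for a derivative of \<open>f1\<close> or
  \<open>f2\<close>, so the induction runs over all pairs of Schwartz functions. The decay in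
  \<open>x\<close> comes from the kernel in the base case.\<close>

lemma wigner_moment_decay:
  fixes f1 f2 :: "'a::euclidean_space \<Rightarrow> complex"
  assumes \<tau>: "0 \<le> \<tau>" "\<tau> \<le> 1" and b: "b \<in> Basis" and "schwartz f1" "schwartz f2"
  shows "\<exists>C\<ge>0. \<forall>x \<xi>. \<bar>\<xi> \<bullet> b\<bar> ^ n * cmod (wigner \<tau> f1 f2 (x, \<xi>)) \<le> C * decay N x"
  using assms(4,5)
proof (induction n arbitrary: f1 f2)
  case 0
  define M where "M = DIM('a) + 2"
  obtain C where C: "0 \<le> C" "\<And>x t. cmod (wigner_ker \<tau> f1 f2 x t) \<le> C * decay N x * decay M t"
    using wigner_ker_decay[OF schwartz_rapid[OF 0(1)] schwartz_rapid[OF 0(2)] \<tau>] by blast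
  have "cmod (wigner \<tau> f1 f2 (x, \<xi>)) \<le> (C * (\<integral>t. decay M (t::'a) \<partial>lborel)) * decay N x" for x \<xi>
  proof -
    have "cmod (wigner \<tau> f1 f2 (x, \<xi>)) \<le> (\<integral>t. C * decay N x * decay M (t::'a) \<partial>lborel)"
      unfolding wigner_eq
    proof (rule cmod_integral_le)
      show "integrable lborel (\<lambda>t::'a. C * decay N x * decay M t)"
        by (intro integrable_mult_right integrable_decay) (simp add: M_def)
    qed (simp add: norm_mult C(2))
    then show ?thesis by (simp add: mult_ac)
  qed
  then show ?case
    using C(1) by (intro exI[of _ "C * (\<integral>t. decay M (t::'a) \<partial>lborel)"]) simp
next
  case (Suc n)
  obtain C1 where C1: "0 \<le> C1" "\<And>x \<xi>. \<bar>\<xi> \<bullet> b\<bar> ^ n * cmod (wigner \<tau> (pd b f1) f2 (x, \<xi>)) \<le> C1 * decay N x"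
    using Suc.IH[OF schwartz_pd[OF Suc.prems(1) b] Suc.prems(2)] by blast
  obtain C2 where C2: "0 \<le> C2" "\<And>x \<xi>. \<bar>\<xi> \<bullet> b\<bar> ^ n * cmod (wigner \<tau> f1 (pd b f2) (x, \<xi>)) \<le> C2 * decay N x"
    using Suc.IH[OF Suc.prems(1) schwartz_pd[OF Suc.prems(2) b]] by blast
  have "\<bar>\<xi> \<bullet> b\<bar> ^ Suc n * cmod (wigner \<tau> f1 f2 (x, \<xi>)) \<le> (C1 + C2) * decay N x" for x \<xi>
  proof -
    let ?W = "cmod (wigner \<tau> f1 f2 (x, \<xi>))"
    have "\<bar>\<xi> \<bullet> b\<bar> * ?W \<le> 2 * pi * \<bar>\<xi> \<bullet> b\<bar> * ?W"
      using pi_gt3 by (intro mult_right_mono) (auto simp: mult_le_cancel_right1)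
    also have "\<dots> = cmod (of_real (2 * pi * (\<xi> \<bullet> b)) * \<i> * wigner \<tau> f1 f2 (x, \<xi>))"
      by (simp add: norm_mult abs_mult)
    also have "\<dots> \<le> cmod (of_real \<tau> * wigner \<tau> (pd b f1) f2 (x, \<xi>)) + cmod (of_real (1 - \<tau>) * wigner \<tau> f1 (pd b f2) (x, \<xi>))"
      unfolding wigner_recursion[OF Suc.prems \<tau> b] by (rule norm_triangle_ineq4)
    also have "\<dots> \<le> cmod (wigner \<tau> (pd b f1) f2 (x, \<xi>)) + cmod (wigner \<tau> f1 (pd b f2) (x, \<xi>))"
      using \<tau> unfolding norm_mult norm_of_real by (intro add_mono mult_left_le_one_le) auto
    finally have "\<bar>\<xi> \<bullet> b\<bar> ^ n * (\<bar>\<xi> \<bullet> b\<bar> * ?W)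
      \<le> \<bar>\<xi> \<bullet> b\<bar> ^ n * (cmod (wigner \<tau> (pd b f1) f2 (x, \<xi>)) + cmod (wigner \<tau> f1 (pd b f2) (x, \<xi>)))"
      by (rule mult_left_mono) simp
    also have "\<dots> \<le> C1 * decay N x + C2 * decay N x"
      unfolding distrib_left by (rule add_mono[OF C1(2) C2(2)])
    finally show ?thesis unfolding distrib_right power_Suc by (simp only: mult_ac)
  qed
  then show ?case using C1(1) C2(1) by (intro exI[of _ "C1 + C2"]) simp
qed

text \<open>The largest coordinate controls the norm, and its power is one of the summands; the 1
  covers the case that all coordinates are small.\<close>

lemma one_plus_norm_power_le:
  fixes \<xi> :: "'a::euclidean_space"
  shows "(1 + norm \<xi>) ^ n \<le> (1 + real DIM('a)) ^ n * (1 + (\<Sum>b\<in>Basis. \<bar>\<xi> \<bullet> b\<bar> ^ n))"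
proof -
  obtain b0 :: 'a where b0: "b0 \<in> Basis" "\<And>b. b \<in> Basis \<Longrightarrow> \<bar>\<xi> \<bullet> b\<bar> \<le> \<bar>\<xi> \<bullet> b0\<bar>"
  proof -
    have "Max ((\<lambda>b. \<bar>\<xi> \<bullet> b\<bar>) ` Basis) \<in> (\<lambda>b. \<bar>\<xi> \<bullet> b\<bar>) ` Basis" by (rule Max_in) auto
    then obtain b0 where "b0 \<in> Basis" "Max ((\<lambda>b. \<bar>\<xi> \<bullet> b\<bar>) ` Basis) = \<bar>\<xi> \<bullet> b0\<bar>" by (rule imageE)
    then show ?thesis using that[of b0] Max_ge[of "(\<lambda>b. \<bar>\<xi> \<bullet> b\<bar>) ` Basis"] by auto
  qed
  let ?m = "max 1 \<bar>\<xi> \<bullet> b0\<bar>"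
  have "norm \<xi> \<le> (\<Sum>b\<in>Basis. \<bar>\<xi> \<bullet> b\<bar>)" by (rule norm_le_l1)
  also have "\<dots> \<le> (\<Sum>b\<in>(Basis::'a set). ?m)"
    using b0 by (intro sum_mono) (auto simp: le_max_iff_disj)
  finally have "1 + norm \<xi> \<le> (1 + real DIM('a)) * ?m" by (simp add: distrib_right)
  then have "(1 + norm \<xi>) ^ n \<le> ((1 + real DIM('a)) * ?m) ^ n" by (intro power_mono) auto
  also have "\<dots> = (1 + real DIM('a)) ^ n * ?m ^ n" by (rule power_mult_distrib)
  also have "\<dots> \<le> (1 + real DIM('a)) ^ n * (1 + (\<Sum>b\<in>Basis. \<bar>\<xi> \<bullet> b\<bar> ^ n))"
  proof (rule mult_left_mono)
    have "?m ^ n \<le> 1 + \<bar>\<xi> \<bullet> b0\<bar> ^ n" by (cases "\<bar>\<xi> \<bullet> b0\<bar> \<le> 1") (auto simp: max_def)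
    also have "\<bar>\<xi> \<bullet> b0\<bar> ^ n \<le> (\<Sum>b\<in>Basis. \<bar>\<xi> \<bullet> b\<bar> ^ n)"
      using b0(1) by (intro member_le_sum) auto
    finally show "?m ^ n \<le> 1 + (\<Sum>b\<in>Basis. \<bar>\<xi> \<bullet> b\<bar> ^ n)" by simp
  qed simp
  finally show ?thesis .
qed

lemma rapid_wigner:
  fixes f1 f2 :: "'a::euclidean_space \<Rightarrow> complex"
  assumes \<tau>: "0 \<le> \<tau>" "\<tau> \<le> 1" and f: "schwartz f1" "schwartz f2"
  shows "rapid (wigner \<tau> f1 f2)"
  unfolding rapid_def
proof
  fix N
  obtain C where C: "\<And>b. b \<in> Basis \<Longrightarrow> 0 \<le> C b \<and> (\<forall>x \<xi>. \<bar>\<xi> \<bullet> b\<bar> ^ N * cmod (wigner \<tau> f1 f2 (x, \<xi>)) \<le> C b * decay N x)"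
    using wigner_moment_decay[OF \<tau> _ f, where n = N and N = N] by metis
  obtain b0 :: 'a where "b0 \<in> Basis" using nonempty_Basis by blast
  then obtain C0 where C0: "0 \<le> C0" "\<And>x \<xi>. cmod (wigner \<tau> f1 f2 (x, \<xi>)) \<le> C0 * decay N x"
    using wigner_moment_decay[OF \<tau> _ f, where n = 0 and N = N] unfolding power_0 mult_1 by blast
  define K where "K = (1 + real DIM('a)) ^ N * (C0 + (\<Sum>b\<in>Basis. C b))"
  have K: "0 \<le> K" unfolding K_def using C C0(1) by (intro mult_nonneg_nonneg add_nonneg_nonneg sum_nonneg) auto
  have "cmod (wigner \<tau> f1 f2 (x, \<xi>)) \<le> K * decay N (x, \<xi>)" for x \<xi>
  proof -
    let ?W = "cmod (wigner \<tau> f1 f2 (x, \<xi>))"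
    have "(1 + norm \<xi>) ^ N * ?W \<le> ((1 + real DIM('a)) ^ N * (1 + (\<Sum>b\<in>Basis. \<bar>\<xi> \<bullet> b\<bar> ^ N))) * ?W"
      by (intro mult_right_mono one_plus_norm_power_le) simp
    also have "\<dots> = (1 + real DIM('a)) ^ N * (?W + (\<Sum>b\<in>Basis. \<bar>\<xi> \<bullet> b\<bar> ^ N * ?W))"
      by (simp add: distrib_right sum_distrib_right mult.assoc)
    also have "\<dots> \<le> (1 + real DIM('a)) ^ N * (C0 * decay N x + (\<Sum>b\<in>Basis. C b * decay N x))"
      using C C0 by (intro mult_left_mono add_mono sum_mono) auto
    also have "\<dots> = K * decay N x" by (simp add: K_def distrib_right sum_distrib_right mult.assoc)
    finally have "decay N \<xi> * ((1 + norm \<xi>) ^ N * ?W) \<le> decay N \<xi> * (K * decay N x)"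
      by (rule mult_left_mono) simp
    then have "?W \<le> K * (decay N x * decay N \<xi>)" by (simp add: mult.assoc[symmetric]) (simp add: mult_ac)
    also have "\<dots> \<le> K * decay N (x, \<xi>)"
      using decay_Pair[of N "(x, \<xi>)"] K by (intro mult_left_mono) auto
    finally show ?thesis .
  qed
  then have "cmod (wigner \<tau> f1 f2 z) \<le> K * decay N z" for z by (cases z) simp
  then show "\<exists>C. \<forall>z. cmod (wigner \<tau> f1 f2 z) \<le> C * decay N z" by blast
qed

text \<open>\<open>W\<^sub>0(f, f)(x, \<xi>)\<close> is \<open>f x\<close> times the conjugate Fourier transform of \<open>f\<close>, up to a phase.\<close>

lemma schwartz_tame:
  assumes f: "schwartz f"
  shows "tame f"
proof -
  have [measurable]: "f \<in> borel_measurable borel"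
    using schwartz_continuous[OF f] by (simp add: borel_measurable_continuous_onI)
  have eq: "cmod (f x) * cmod (inv_fourier f \<xi>) = cmod (wigner 0 f f (x, - \<xi>))" for x \<xi>
  proof -
    have "wigner 0 f f (x, - \<xi>) = (\<integral>t. f x * cnj (f (x - t)) * cis (2 * pi * (\<xi> \<bullet> t)) \<partial>lborel)"
      by (simp add: wigner_def)
    also have "\<dots> = (\<integral>s. (f x * cis (2 * pi * (\<xi> \<bullet> x))) * cnj (f s * cis (2 * pi * (\<xi> \<bullet> s))) \<partial>lborel)"
    proof (subst lborel_integral_affine[where c = "- 1" and t = x])
      show "\<bar>- 1\<bar> ^ DIM('a) *\<^sub>R (\<integral>s. f x * cnj (f (x - (x + - 1 *\<^sub>R s))) * cis (2 * pi * (\<xi> \<bullet> (x + - 1 *\<^sub>R s))) \<partial>lborel)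
        = (\<integral>s. (f x * cis (2 * pi * (\<xi> \<bullet> x))) * cnj (f s * cis (2 * pi * (\<xi> \<bullet> s))) \<partial>lborel)"
      proof -
        have "cis (2 * pi * (\<xi> \<bullet> (x - s))) = cis (2 * pi * (\<xi> \<bullet> x)) * cnj (cis (2 * pi * (\<xi> \<bullet> s)))" for s
          unfolding cnj_cis cis_mult by (rule arg_cong[where f = cis]) (simp add: inner_diff_right algebra_simps)
        then show ?thesis by (simp add: mult_ac)
      qed
    qed auto
    also have "\<dots> = (f x * cis (2 * pi * (\<xi> \<bullet> x))) * cnj (inv_fourier f \<xi>)"
      unfolding inv_fourier_def by (simp only: integral_mult_right_zero Bochner_Integration.integral_cnj)
    finally show ?thesis by (simp add: norm_mult)
  qed
  have "rapid (inv_fourier f)"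
  proof (cases "\<exists>x. f x \<noteq> 0")
    case True
    then obtain x where x: "f x \<noteq> 0" by blast
    show ?thesis unfolding rapid_def
    proof
      fix N
      obtain C where C: "0 \<le> C" "\<And>z. cmod (wigner 0 f f z) \<le> C * decay N z"
        using rapidE[OF rapid_wigner[OF _ _ f f, of 0]] by auto
      have "cmod (inv_fourier f \<xi>) \<le> (C / cmod (f x)) * decay N \<xi>" for \<xi>
      proof -
        have "cmod (f x) * cmod (inv_fourier f \<xi>) \<le> C * decay N (x, - \<xi>)"
          unfolding eq by (rule C)
        also have "\<dots> \<le> C * decay N \<xi>"
          using C(1) by (intro mult_left_mono decay_mono_norm) (auto simp: norm_Pair)
        finally show ?thesis using x by (simp add: field_simps)
      qed
      then show "\<exists>C. \<forall>\<xi>. cmod (inv_fourier f \<xi>) \<le> C * decay N \<xi>" by blast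
    qed
  next
    case False
    then have "inv_fourier f = (\<lambda>_. 0)" by (simp add: inv_fourier_def)
    then show ?thesis by (auto simp: rapid_def intro: exI[of _ 0])
  qed
  then show ?thesis
    by (simp add: tame_def schwartz_continuous[OF f] schwartz_rapid[OF f])
qed

section \<open>The inverse Fourier transform of the \<open>\<tau>\<close>-Wigner distribution\<close>

text \<open>The cross-ambiguity function, encoded as the partial inverse Fourier transform of the
  kernel in its position variable; its argument (\<eta>, t) is dual to (x, \<xi>).\<close>

definition ambiguity :: "real \<Rightarrow> ('a::euclidean_space \<Rightarrow> complex) \<Rightarrow> ('a \<Rightarrow> complex) \<Rightarrow> 'a \<times> 'a \<Rightarrow> complex" where
  "ambiguity \<tau> f1 f2 = (\<lambda>(\<eta>, t). inv_fourier (\<lambda>x. wigner_ker \<tau> f1 f2 x t) \<eta>)"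

text \<open>Translating the integration variable by \<open>\<tau> *\<^sub>R t\<close> centres
  \<open>f1\<close>, after which \<tau> remains only in a phase. Decay and continuity of the
  ambiguity function are therefore those of an ordinary transform.\<close>

lemma ambiguity_eq_stf:
  assumes "continuous_on UNIV f1" "continuous_on UNIV f2"
  shows "ambiguity \<tau> f1 f2 (\<eta>, t) = cis (- 2 * pi * \<tau> * (t \<bullet> \<eta>)) * stf f2 f1 (t, - \<eta>)"
proof -
  note [measurable] = measurable_wigner_ker[OF assms]
  have "ambiguity \<tau> f1 f2 (\<eta>, t) = (\<integral>x. wigner_ker \<tau> f1 f2 x t * cis (2 * pi * (\<eta> \<bullet> x)) \<partial>lborel)"
    by (simp add: ambiguity_def inv_fourier_def)
  also have "\<dots> = (\<integral>x. wigner_ker \<tau> f1 f2 (x + (- \<tau> *\<^sub>R t)) t * cis (2 * pi * (\<eta> \<bullet> (x + (- \<tau> *\<^sub>R t)))) \<partial>lborel)"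
    by (rule lborel_integral_translation[symmetric]) measurable
  also have "\<dots> = (\<integral>x. cis (- 2 * pi * \<tau> * (t \<bullet> \<eta>)) * (f1 x * cnj (f2 (x - t)) * cis (- 2 * pi * (x \<bullet> (- \<eta>)))) \<partial>lborel)"
  proof (rule Bochner_Integration.integral_cong[OF refl])
    fix x
    have "cis (2 * pi * (\<eta> \<bullet> (x + (- \<tau> *\<^sub>R t)))) = cis (- 2 * pi * \<tau> * (t \<bullet> \<eta>)) * cis (- 2 * pi * (x \<bullet> (- \<eta>)))"
      unfolding cis_mult by (rule arg_cong[where f = cis]) (simp add: inner_add_right inner_commute algebra_simps)
    moreover have "wigner_ker \<tau> f1 f2 (x + (- \<tau> *\<^sub>R t)) t = f1 x * cnj (f2 (x - t))"
      by (simp add: wigner_ker_def algebra_simps)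
    ultimately show "wigner_ker \<tau> f1 f2 (x + (- \<tau> *\<^sub>R t)) t * cis (2 * pi * (\<eta> \<bullet> (x + (- \<tau> *\<^sub>R t))))
      = cis (- 2 * pi * \<tau> * (t \<bullet> \<eta>)) * (f1 x * cnj (f2 (x - t)) * cis (- 2 * pi * (x \<bullet> (- \<eta>))))"
      by (simp only: mult_ac)
  qed
  also have "\<dots> = cis (- 2 * pi * \<tau> * (t \<bullet> \<eta>)) * stf f2 f1 (t, - \<eta>)"
    by (simp add: stf_def)
  finally show ?thesis .
qed

lemma continuous_on_stf:
  fixes f \<phi> :: "'a::euclidean_space \<Rightarrow> complex"
  assumes f: "tame f" and \<phi>: "tame \<phi>"
  shows "continuous_on UNIV (stf \<phi> f)"
proof (rule continuous_on_sequentiallyI)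
  fix u :: "nat \<Rightarrow> 'a \<times> 'a" and z assume u: "u \<longlonglongrightarrow> z"
  note [measurable] = tame_measurable[OF f] tame_measurable[OF \<phi>]
  obtain B where B: "0 \<le> B" "\<And>x. cmod (\<phi> x) \<le> B" using rapid_bounded[OF tame_rapid[OF \<phi>]] by blast
  have intf: "integrable lborel f" by (rule rapid_integrable[OF tame_rapid[OF f]]) measurable
  have "continuous_on UNIV cis" by (intro continuous_intros)
  then have c: "isCont \<phi> x" "isCont cis y" for x y
    using tame_continuous[OF \<phi>] by (auto simp: continuous_on_eq_continuous_at)
  show "(\<lambda>n. stf \<phi> f (u n)) \<longlonglongrightarrow> stf \<phi> f z"
    unfolding stf_def
  proof (rule integral_dominated_convergence)
    show "integrable lborel (\<lambda>t. B * cmod (f t))" using intf by simp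
    show "AE t in lborel. (\<lambda>n. f t * cnj (\<phi> (t - fst (u n))) * cis (- 2 * pi * (t \<bullet> snd (u n))))
        \<longlonglongrightarrow> f t * cnj (\<phi> (t - fst z)) * cis (- 2 * pi * (t \<bullet> snd z))"
      by (intro AE_I2 tendsto_mult tendsto_const tendsto_cnj isCont_tendsto_compose[OF c(1)] isCont_tendsto_compose[OF c(2)]
          tendsto_diff tendsto_inner tendsto_fst tendsto_snd u)
    show "AE t in lborel. cmod (f t * cnj (\<phi> (t - fst (u n))) * cis (- 2 * pi * (t \<bullet> snd (u n)))) \<le> B * cmod (f t)" for n
      using B by (intro AE_I2) (simp add: norm_mult mult.commute[of "cmod (f _)"] mult_right_mono)
  qed measurable
qed

text \<open>These are the hypotheses of \<open>fourier_inversion\<close> and of Parseval's identity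
  for a slice at fixed \<open>t\<close>; the last one comes from the frequency decay of
  \<open>stf f2 f1\<close>.\<close>

lemma wigner_ker_slice:
  assumes f: "schwartz f1" "schwartz f2" and \<tau>: "0 \<le> \<tau>" "\<tau> \<le> 1"
  shows "integrable lborel (\<lambda>x. wigner_ker \<tau> f1 f2 x t)"
    and "\<exists>B. \<forall>x. cmod (wigner_ker \<tau> f1 f2 x t) \<le> B"
    and "continuous_on UNIV (\<lambda>x. wigner_ker \<tau> f1 f2 x t)"
    and "integrable lborel (inv_fourier (\<lambda>x. wigner_ker \<tau> f1 f2 x t))"
proof -
  note c = schwartz_continuous[OF f(1)] schwartz_continuous[OF f(2)]
  note [measurable] = measurable_wigner_ker[OF c]
  obtain C where C: "0 \<le> C" "\<And>x t. cmod (wigner_ker \<tau> f1 f2 x t) \<le> C * decay (DIM('a) + 2) x * decay 0 t"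
    using wigner_ker_decay[OF schwartz_rapid[OF f(1)] schwartz_rapid[OF f(2)] \<tau>] by blast
  show "integrable lborel (\<lambda>x. wigner_ker \<tau> f1 f2 x t)"
    by (rule integrable_of_decay[of _ C]) (use C(2)[of _ t] in \<open>auto\<close>)
  show "\<exists>B. \<forall>x. cmod (wigner_ker \<tau> f1 f2 x t) \<le> B"
  proof (intro exI allI)
    fix x show "cmod (wigner_ker \<tau> f1 f2 x t) \<le> C * 1"
      by (rule order_trans[OF C(2)[of x t]]) (simp add: C(1) mult_left_le)
  qed
  show "continuous_on UNIV (\<lambda>x. wigner_ker \<tau> f1 f2 x t)"
    by (intro continuous_intros c)
  obtain D where D: "0 \<le> D" "\<And>z. cmod (stf f2 f1 z) \<le> D * decay (DIM('a) + 2) (snd z)"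
    using stf_decay_frequency[OF schwartz_tame[OF f(1)] schwartz_tame[OF f(2)]] by blast
  show "integrable lborel (inv_fourier (\<lambda>x. wigner_ker \<tau> f1 f2 x t))"
  proof (rule integrable_of_decay)
    fix \<eta> :: 'a
    have "cmod (inv_fourier (\<lambda>x. wigner_ker \<tau> f1 f2 x t) \<eta>) = cmod (stf f2 f1 (t, - \<eta>))"
      using ambiguity_eq_stf[OF c, of \<tau> \<eta> t] by (simp add: ambiguity_def norm_mult)
    also have "\<dots> \<le> D * decay (DIM('a) + 2) \<eta>" using D(2)[of "(t, - \<eta>)"] by simp
    finally show "cmod (inv_fourier (\<lambda>x. wigner_ker \<tau> f1 f2 x t) \<eta>) \<le> D * decay (DIM('a) + 2) \<eta>" .
  qed measurable
qed

lemma rapid_ambiguity: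
  assumes f: "schwartz f1" "schwartz f2"
  shows "rapid (ambiguity \<tau> f1 f2)"
  unfolding rapid_def
proof
  fix N
  obtain C where C: "0 \<le> C" "\<And>z. cmod (stf f2 f1 z) \<le> C * decay N z"
    using rapidE[OF rapid_stf[OF schwartz_tame[OF f(1)] schwartz_tame[OF f(2)]]] by blast
  have "cmod (ambiguity \<tau> f1 f2 (\<eta>, t)) \<le> C * decay N (\<eta>, t)" for \<eta> t
  proof -
    have "cmod (ambiguity \<tau> f1 f2 (\<eta>, t)) = cmod (stf f2 f1 (t, - \<eta>))"
      by (simp add: ambiguity_eq_stf[OF schwartz_continuous[OF f(1)] schwartz_continuous[OF f(2)]] norm_mult)
    also have "\<dots> \<le> C * decay N (t, - \<eta>)" by (rule C)
    also have "decay N (t, - \<eta>) = decay N (\<eta>, t)" by (simp add: decay_def norm_Pair add.commute)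
    finally show ?thesis .
  qed
  then have "cmod (ambiguity \<tau> f1 f2 z) \<le> C * decay N z" for z by (cases z) simp
  then show "\<exists>C. \<forall>z. cmod (ambiguity \<tau> f1 f2 z) \<le> C * decay N z" by blast
qed

lemma continuous_on_ambiguity:
  assumes f: "schwartz f1" "schwartz f2"
  shows "continuous_on UNIV (ambiguity \<tau> f1 f2)"
proof -
  have "ambiguity \<tau> f1 f2 = (\<lambda>z. cis (- 2 * pi * \<tau> * (snd z \<bullet> fst z)) * stf f2 f1 (snd z, - fst z))"
    using ambiguity_eq_stf[OF schwartz_continuous[OF f(1)] schwartz_continuous[OF f(2)]] by (auto simp: fun_eq_iff)
  then show ?thesis
    by (simp only:) (intro continuous_intros continuous_on_compose2[OF continuous_on_stf[OF schwartz_tame[OF f(1)] schwartz_tame[OF f(2)]]]; simp)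
qed

text \<open>By Fubini's theorem the integral over \<eta> is inverted slice by slice, which returns
  the kernel at \<open>- x\<close>; the integral over \<open>t\<close> that remains is the one
  defining the Wigner distribution.\<close>

lemma inv_fourier_ambiguity:
  fixes f1 f2 :: "'a::euclidean_space \<Rightarrow> complex"
  assumes f: "schwartz f1" "schwartz f2" and \<tau>: "0 \<le> \<tau>" "\<tau> \<le> 1"
  shows "inv_fourier (ambiguity \<tau> f1 f2) z = wigner \<tau> f1 f2 (- z)"
proof -
  obtain x \<xi> where z: "z = (x, \<xi>)" by (cases z)
  have ca: "continuous_on UNIV (ambiguity \<tau> f1 f2)" by (rule continuous_on_ambiguity[OF f])
  then have [measurable]: "ambiguity \<tau> f1 f2 \<in> borel_measurable borel" by (simp add: borel_measurable_continuous_onI)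
  have ia: "integrable lborel (ambiguity \<tau> f1 f2)"
    by (rule rapid_integrable[OF rapid_ambiguity[OF f]]) measurable
  have int: "integrable lborel (\<lambda>p. ambiguity \<tau> f1 f2 p * cis (2 * pi * (z \<bullet> p)))"
    by (rule Bochner_Integration.integrable_bound[OF ia]) (auto simp: norm_mult)
  have "inv_fourier (ambiguity \<tau> f1 f2) z = (\<integral>\<eta>. \<integral>t. ambiguity \<tau> f1 f2 (\<eta>, t) * cis (2 * pi * (z \<bullet> (\<eta>, t))) \<partial>lborel \<partial>lborel)"
    unfolding inv_fourier_def by (rule lborel_integral_prod[OF int])
  also have "\<dots> = (\<integral>t. \<integral>\<eta>. ambiguity \<tau> f1 f2 (\<eta>, t) * cis (2 * pi * (z \<bullet> (\<eta>, t))) \<partial>lborel \<partial>lborel)"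
    by (rule lborel_integral_swap[OF int])
  also have "\<dots> = (\<integral>t. wigner_ker \<tau> f1 f2 (- x) t * cis (- 2 * pi * ((- \<xi>) \<bullet> t)) \<partial>lborel)"
  proof (rule Bochner_Integration.integral_cong[OF refl])
    fix t
    obtain B where B: "\<And>x. cmod (wigner_ker \<tau> f1 f2 x t) \<le> B" using wigner_ker_slice(2)[OF f \<tau>] by blast
    have "(\<integral>\<eta>. ambiguity \<tau> f1 f2 (\<eta>, t) * cis (2 * pi * (z \<bullet> (\<eta>, t))) \<partial>lborel)
      = (\<integral>\<eta>. cis (2 * pi * (\<xi> \<bullet> t)) * (inv_fourier (\<lambda>x. wigner_ker \<tau> f1 f2 x t) \<eta> * cis (2 * pi * (x \<bullet> \<eta>))) \<partial>lborel)"
    proof (rule Bochner_Integration.integral_cong[OF refl])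
      fix \<eta>
      have "cis (2 * pi * (z \<bullet> (\<eta>, t))) = cis (2 * pi * (x \<bullet> \<eta>)) * cis (2 * pi * (\<xi> \<bullet> t))"
        unfolding cis_mult by (rule arg_cong[where f = cis]) (simp add: z algebra_simps)
      then show "ambiguity \<tau> f1 f2 (\<eta>, t) * cis (2 * pi * (z \<bullet> (\<eta>, t)))
        = cis (2 * pi * (\<xi> \<bullet> t)) * (inv_fourier (\<lambda>x. wigner_ker \<tau> f1 f2 x t) \<eta> * cis (2 * pi * (x \<bullet> \<eta>)))"
        by (simp add: ambiguity_def)
    qed
    also have "\<dots> = cis (2 * pi * (\<xi> \<bullet> t)) * inv_fourier (inv_fourier (\<lambda>x. wigner_ker \<tau> f1 f2 x t)) x"
      by (simp add: inv_fourier_def[of "inv_fourier _"])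
    also have "inv_fourier (inv_fourier (\<lambda>x. wigner_ker \<tau> f1 f2 x t)) x = wigner_ker \<tau> f1 f2 (- x) t"
      using fourier_inversion[OF wigner_ker_slice(3)[OF f \<tau>] B wigner_ker_slice(1)[OF f \<tau>] wigner_ker_slice(4)[OF f \<tau>], of "- x"] by simp
    finally show "(\<integral>\<eta>. ambiguity \<tau> f1 f2 (\<eta>, t) * cis (2 * pi * (z \<bullet> (\<eta>, t))) \<partial>lborel)
      = wigner_ker \<tau> f1 f2 (- x) t * cis (- 2 * pi * ((- \<xi>) \<bullet> t))" by simp
  qed
  also have "\<dots> = wigner \<tau> f1 f2 (- z)"
    by (simp add: z wigner_eq)
  finally show ?thesis .
qed

lemma tame_ambiguity:
  assumes f: "schwartz f1" "schwartz f2" and \<tau>: "0 \<le> \<tau>" "\<tau> \<le> 1"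
  shows "tame (ambiguity \<tau> f1 f2)"
proof -
  have "rapid (inv_fourier (ambiguity \<tau> f1 f2))"
    unfolding rapid_def inv_fourier_ambiguity[OF f \<tau>]
    using rapidE[OF rapid_wigner[OF \<tau> f]] by (metis decay_minus)
  then show ?thesis
    by (simp add: tame_def continuous_on_ambiguity[OF f] rapid_ambiguity[OF f])
qed

text \<open>The Wigner distribution is a reflected inverse transform of the ambiguity function.
  Measurability is inherited from there, and inversion of the tame ambiguity function gives the last
  claim.\<close>

lemma wigner_properties:
  assumes f: "schwartz f1" "schwartz f2" and \<tau>: "0 \<le> \<tau>" "\<tau> \<le> 1"
  shows "wigner \<tau> f1 f2 \<in> borel_measurable borel" "integrable lborel (wigner \<tau> f1 f2)"
    and "inv_fourier (wigner \<tau> f1 f2) = ambiguity \<tau> f1 f2"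
proof -
  have eq: "wigner \<tau> f1 f2 z = inv_fourier (ambiguity \<tau> f1 f2) (- z)" for z
    by (simp add: inv_fourier_ambiguity[OF f \<tau>])
  have [measurable]: "ambiguity \<tau> f1 f2 \<in> borel_measurable borel"
    by (intro borel_measurable_continuous_onI continuous_on_ambiguity f)
  have [measurable]: "inv_fourier (ambiguity \<tau> f1 f2) \<in> borel_measurable borel" by measurable
  have "(\<lambda>z. inv_fourier (ambiguity \<tau> f1 f2) (- z)) \<in> borel_measurable borel" by measurable
  then show m: "wigner \<tau> f1 f2 \<in> borel_measurable borel" by (simp add: eq[symmetric])
  show "integrable lborel (wigner \<tau> f1 f2)" by (rule rapid_integrable[OF rapid_wigner[OF \<tau> f] m])
  show "inv_fourier (wigner \<tau> f1 f2) = ambiguity \<tau> f1 f2"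
  proof
    fix z
    have "ambiguity \<tau> f1 f2 z = (\<integral>w. inv_fourier (ambiguity \<tau> f1 f2) w * cis (- 2 * pi * (z \<bullet> w)) \<partial>lborel)"
      by (rule tame_inversion[OF tame_ambiguity[OF f \<tau>]])
    also have "\<dots> = (\<integral>w. wigner \<tau> f1 f2 w * cis (2 * pi * (z \<bullet> w)) \<partial>lborel)"
      by (subst lborel_integral_affine[where c = "- 1" and t = 0]) (auto simp: eq)
    finally show "inv_fourier (wigner \<tau> f1 f2) z = ambiguity \<tau> f1 f2 z" by (simp add: inv_fourier_def)
  qed
qed

section \<open>Duality, Parseval's identity and the factorised transform of an ambiguity
  function\<close>

lemma inv_fourier_multiplication:
  fixes f g :: "'a::euclidean_space \<Rightarrow> complex"
  assumes "integrable lborel f" "integrable lborel g"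
  shows "(\<integral>x. f x * inv_fourier g x \<partial>lborel) = (\<integral>x. inv_fourier f x * g x \<partial>lborel)"
proof -
  have [measurable]: "f \<in> borel_measurable borel" "g \<in> borel_measurable borel"
    using assms by (auto simp: integrable_iff_bounded)
  define F where "F p = (f (fst p) * g (snd p)) * cis (2 * pi * (fst p \<bullet> snd p))" for p
  have F: "integrable lborel F"
  proof (rule Bochner_Integration.integrable_bound[OF integrable_product[OF assms]])
    have "F \<in> borel_measurable (borel \<Otimes>\<^sub>M borel)" unfolding F_def by measurable
    then show "F \<in> borel_measurable lborel" by (simp add: borel_prod)
  qed (auto simp: F_def norm_mult)
  have "(\<integral>x. f x * inv_fourier g x \<partial>lborel) = (\<integral>x. \<integral>y. F (x, y) \<partial>lborel \<partial>lborel)"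
    unfolding inv_fourier_def F_def by (simp add: mult.assoc flip: integral_mult_right_zero)
  also have "\<dots> = (\<integral>y. \<integral>x. F (x, y) \<partial>lborel \<partial>lborel)" by (rule lborel_integral_swap[OF F])
  also have "\<dots> = (\<integral>y. inv_fourier f y * g y \<partial>lborel)"
    unfolding inv_fourier_def F_def by (simp add: mult_ac inner_commute flip: integral_mult_right_zero)
  finally show ?thesis .
qed

text \<open>The inverse transform of a functional is defined by duality; the multiplication formula
  moves it from the test function onto the integrable Wigner distribution.\<close>

lemma stft_inv_fourier_wigner:
  assumes f: "schwartz f1" "schwartz f2" and \<tau>: "0 \<le> \<tau>" "\<tau> \<le> 1" and \<Psi>: "schwartz \<Psi>"
  shows "stft \<Psi> (inv_fourier_functional (functional_of (wigner \<tau> f1 f2))) x \<xi> = stft \<Psi> (functional_of (ambiguity \<tau> f1 f2)) x \<xi>"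
proof -
  define g where "g t = cnj (modulation \<xi> (translation x \<Psi>) t)" for t
  have "integrable lborel (modulation \<xi> (translation x \<Psi>))"
    by (intro rapid_integrable rapid_modulation_translation schwartz_rapid \<Psi> borel_measurable_continuous_onI
        continuous_modulation_translation schwartz_continuous)
  then have g: "integrable lborel g" unfolding g_def by simp
  show ?thesis
    unfolding stft_def bracket_def inv_fourier_functional_def functional_of_def g_def[symmetric] wigner_properties(3)[OF f \<tau>, symmetric]
    by (rule inv_fourier_multiplication[OF wigner_properties(2)[OF f \<tau>] g])
qed

lemma amalgam_norm_wigner:
  assumes f: "schwartz f1" "schwartz f2" and \<tau>: "0 \<le> \<tau>" "\<tau> \<le> 1" and \<Psi>: "schwartz \<Psi>"
  shows "amalgam_norm \<Psi> p q m (functional_of (wigner \<tau> f1 f2)) = modulation_norm \<Psi> p q (one_tensor m) (functional_of (ambiguity \<tau> f1 f2))"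
  unfolding amalgam_norm_def modulation_norm_def stft_inv_fourier_wigner[OF assms] ..

text \<open>The conjugate of \<open>inv_fourier v\<close> is the inverse transform of the reflected
  conjugate \<open>w\<close>, so the multiplication formula leaves a double inverse transform on
  \<open>u\<close>, to which inversion applies.\<close>

lemma inv_fourier_parseval:
  fixes u v :: "'a::euclidean_space \<Rightarrow> complex"
  assumes u: "continuous_on UNIV u" "\<And>x. cmod (u x) \<le> B" "integrable lborel u" "integrable lborel (inv_fourier u)"
    and v: "integrable lborel v"
  shows "(\<integral>\<eta>. inv_fourier u \<eta> * cnj (inv_fourier v \<eta>) \<partial>lborel) = (\<integral>x. u x * cnj (v x) \<partial>lborel)"
proof -
  define w where "w x = cnj (v (- x))" for x
  have [measurable]: "v \<in> borel_measurable borel" using v by (simp add: integrable_iff_bounded)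
  have w: "integrable lborel w"
    using lborel_integrable_affine[OF v, of "- 1" 0] unfolding w_def by simp
  have "cnj (inv_fourier v \<eta>) = inv_fourier w \<eta>" for \<eta>
  proof -
    have "inv_fourier w \<eta> = (\<integral>x. cnj (v x * cis (2 * pi * (\<eta> \<bullet> x))) \<partial>lborel)"
      unfolding inv_fourier_def w_def by (subst lborel_integral_affine[where c = "- 1" and t = 0]) (auto simp: cnj_cis)
    then show ?thesis by (simp only: inv_fourier_def Bochner_Integration.integral_cnj)
  qed
  then have "(\<integral>\<eta>. inv_fourier u \<eta> * cnj (inv_fourier v \<eta>) \<partial>lborel) = (\<integral>\<eta>. inv_fourier u \<eta> * inv_fourier w \<eta> \<partial>lborel)"
    by simp
  also have "\<dots> = (\<integral>x. inv_fourier (inv_fourier u) x * w x \<partial>lborel)"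
    by (rule inv_fourier_multiplication[OF u(4) w])
  also have "\<dots> = (\<integral>x. inv_fourier (inv_fourier u) (- x) * w (- x) \<partial>lborel)"
    by (subst lborel_integral_affine[where c = "- 1" and t = 0])
       (use u(4) w in \<open>auto intro!: borel_measurable_times measurable_inv_fourier simp: integrable_iff_bounded\<close>)
  also have "\<dots> = (\<integral>x. u x * cnj (v x) \<partial>lborel)"
    by (simp add: fourier_inversion[OF u] w_def)
  finally show ?thesis .
qed

text \<open>Parseval in \<eta> at fixed \<open>t\<close> replaces the two ambiguity functions by
  their kernels. A shear of the remaining variable puts \<open>f1\<close> at \<open>s\<close> and
  \<open>f2\<close> at \<open>s - t\<close>, so that the double integral splits into a product. The
  two evaluation points collect the translations and phases that are left over.\<close>

lemma cmod_stf_ambiguity: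
  fixes f1 f2 \<phi> :: "'a::euclidean_space \<Rightarrow> complex"
  assumes f: "schwartz f1" "schwartz f2" and \<phi>: "schwartz \<phi>" and \<tau>: "0 \<le> \<tau>" "\<tau> \<le> 1"
  shows "cmod (stf (ambiguity \<tau> \<phi> \<phi>) (ambiguity \<tau> f1 f2) ((x1, x2), (\<xi>1, \<xi>2)))
    = cmod (stf \<phi> f1 (\<xi>1 + \<tau> *\<^sub>R x2, \<xi>2 - (1 - \<tau>) *\<^sub>R x1)) * cmod (stf \<phi> f2 (\<xi>1 - (1 - \<tau>) *\<^sub>R x2, \<xi>2 + \<tau> *\<^sub>R x1))"
proof -
  let ?Af = "ambiguity \<tau> f1 f2" and ?A\<phi> = "ambiguity \<tau> \<phi> \<phi>"
  note tf = tame_ambiguity[OF f \<tau>] and t\<phi> = tame_ambiguity[OF \<phi> \<phi> \<tau>]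
  note cf = schwartz_continuous[OF f(1)] schwartz_continuous[OF f(2)] and c\<phi> = schwartz_continuous[OF \<phi>]
  have mf [measurable]: "f1 \<in> borel_measurable borel" "f2 \<in> borel_measurable borel" "\<phi> \<in> borel_measurable borel"
    using cf c\<phi> by (simp_all add: borel_measurable_continuous_onI)
  define e1 e2 y1 y2 where "e1 = \<xi>2 - (1 - \<tau>) *\<^sub>R x1" and "e2 = \<xi>2 + \<tau> *\<^sub>R x1"
    and "y1 = \<xi>1 + \<tau> *\<^sub>R x2" and "y2 = \<xi>1 - (1 - \<tau>) *\<^sub>R x2"
  define P where "P p = ?Af p * cnj (?A\<phi> (p - (x1, x2))) * cis (- 2 * pi * (p \<bullet> (\<xi>1, \<xi>2)))" for p
  \<comment> \<open>The translation of the window by \<open>x1\<close> and the phase in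
    \<open>\<xi>1\<close> become, on the kernel side, a phase and a translation; \<open>v\<close>
    carries both.\<close>
  define v where "v t y = cis (- 2 * pi * ((y - \<xi>1) \<bullet> x1)) * wigner_ker \<tau> \<phi> \<phi> (y - \<xi>1) (t - x2)" for t y
  define A where "A s = f1 s * cnj (\<phi> (s - y1)) * cis (- 2 * pi * (s \<bullet> e1))" for s
  define B where "B r = f2 r * cnj (\<phi> (r - y2)) * cis (- 2 * pi * (r \<bullet> e2))" for r
  define k where "k = cis (- 2 * pi * (\<xi>1 \<bullet> x1))"
  have intP: "integrable lborel P"
  proof -
    obtain D where D: "0 \<le> D" "\<And>x. cmod (?A\<phi> x) \<le> D" using rapid_bounded[OF tame_rapid[OF t\<phi>]] by blast
    note [measurable] = tame_measurable[OF tf] tame_measurable[OF t\<phi>]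
    have "rapid (\<lambda>p. ?Af p * (cnj (?A\<phi> (p - (x1, x2))) * cis (- 2 * pi * (p \<bullet> (\<xi>1, \<xi>2)))))"
      by (rule rapid_mult_bounded[OF tame_rapid[OF tf], of _ D]) (simp add: norm_mult D(2))
    from rapid_integrable[OF this] show ?thesis by (simp add: P_def[abs_def] mult.assoc)
  qed
  have iv: "integrable lborel (v t)" for t
  proof (rule Bochner_Integration.integrable_bound)
    show "integrable lborel (\<lambda>y. cmod (wigner_ker \<tau> \<phi> \<phi> (y - \<xi>1) (t - x2)))"
      using lborel_integrable_affine[OF wigner_ker_slice(1)[OF \<phi> \<phi> \<tau>, of "t - x2"], of 1 "- \<xi>1"] by simp
    have "v t \<in> borel_measurable borel"
      unfolding v_def by (intro borel_measurable_continuous_onI continuous_intros c\<phi>)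
    then show "v t \<in> borel_measurable lborel" by simp
  qed (simp add: v_def norm_mult)
  have [measurable]: "v t \<in> borel_measurable borel" for t
    using iv by (simp add: integrable_iff_bounded)
  note [measurable] = measurable_wigner_ker(2)[OF cf]
  have slice: "(\<integral>\<eta>. P (\<eta>, t) \<partial>lborel) = cis (- 2 * pi * (t \<bullet> \<xi>2)) * (\<integral>y. wigner_ker \<tau> f1 f2 y t * cnj (v t y) \<partial>lborel)" for t
  proof -
    obtain D where D: "\<And>x. cmod (wigner_ker \<tau> f1 f2 x t) \<le> D" using wigner_ker_slice(2)[OF f \<tau>] by blast
    have hat: "inv_fourier (v t) \<eta> = cis (2 * pi * (\<xi>1 \<bullet> \<eta>)) * ?A\<phi> (\<eta> - x1, t - x2)" for \<eta>
    proof -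
      have "inv_fourier (v t) \<eta> = (\<integral>y. v t (y + \<xi>1) * cis (2 * pi * (\<eta> \<bullet> (y + \<xi>1))) \<partial>lborel)"
        unfolding inv_fourier_def
        by (rule lborel_integral_translation[symmetric]) (use iv in \<open>auto intro!: borel_measurable_times simp: integrable_iff_bounded\<close>)
      also have "\<dots> = (\<integral>y. cis (2 * pi * (\<xi>1 \<bullet> \<eta>)) * (wigner_ker \<tau> \<phi> \<phi> y (t - x2) * cis (2 * pi * ((\<eta> - x1) \<bullet> y))) \<partial>lborel)"
      proof (rule Bochner_Integration.integral_cong[OF refl])
        fix y
        have "cis (- 2 * pi * (y \<bullet> x1)) * cis (2 * pi * (\<eta> \<bullet> (y + \<xi>1))) = cis (2 * pi * (\<xi>1 \<bullet> \<eta>)) * cis (2 * pi * ((\<eta> - x1) \<bullet> y))"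
          unfolding cis_mult by (rule arg_cong[where f = cis]) (simp add: inner_add_right inner_diff_left inner_commute algebra_simps)
        moreover have "X * K * Y = Z * (K * W)" if "X * Y = Z * W" for X Y Z W K :: complex
          using that by (metis mult.assoc mult.commute)
        ultimately show "v t (y + \<xi>1) * cis (2 * pi * (\<eta> \<bullet> (y + \<xi>1)))
          = cis (2 * pi * (\<xi>1 \<bullet> \<eta>)) * (wigner_ker \<tau> \<phi> \<phi> y (t - x2) * cis (2 * pi * ((\<eta> - x1) \<bullet> y)))"
          unfolding v_def add_diff_cancel_right' by blast
      qed
      finally show ?thesis by (simp add: ambiguity_def inv_fourier_def)
    qed
    have "(\<integral>\<eta>. P (\<eta>, t) \<partial>lborel)
      = (\<integral>\<eta>. cis (- 2 * pi * (t \<bullet> \<xi>2)) * (inv_fourier (\<lambda>x. wigner_ker \<tau> f1 f2 x t) \<eta> * cnj (inv_fourier (v t) \<eta>)) \<partial>lborel)"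
    proof (rule Bochner_Integration.integral_cong[OF refl])
      fix \<eta>
      have "cis (- 2 * pi * ((\<eta>, t) \<bullet> (\<xi>1, \<xi>2))) = cis (- 2 * pi * (t \<bullet> \<xi>2)) * cnj (cis (2 * pi * (\<xi>1 \<bullet> \<eta>)))"
        unfolding cnj_cis cis_mult by (rule arg_cong[where f = cis]) (simp add: inner_commute algebra_simps)
      then show "P (\<eta>, t) = cis (- 2 * pi * (t \<bullet> \<xi>2)) * (inv_fourier (\<lambda>x. wigner_ker \<tau> f1 f2 x t) \<eta> * cnj (inv_fourier (v t) \<eta>))"
        unfolding P_def hat complex_cnj_mult by (simp add: ambiguity_def mult_ac)
    qed
    then show ?thesis
      by (simp add: inv_fourier_parseval[OF wigner_ker_slice(3)[OF f \<tau>] D wigner_ker_slice(1)[OF f \<tau>] wigner_ker_slice(4)[OF f \<tau>] iv])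
  qed
  \<comment> \<open>Substituting \<open>y = s - \<tau> *\<^sub>R t\<close> removes \<tau> from the
    arguments of \<open>f1\<close> and \<open>f2\<close>; it survives only in the frequencies
    \<open>e1\<close>, \<open>e2\<close> and the positions \<open>y1\<close>,
    \<open>y2\<close>.\<close>
  have shear: "cis (- 2 * pi * (t \<bullet> \<xi>2)) * (\<integral>y. wigner_ker \<tau> f1 f2 y t * cnj (v t y) \<partial>lborel) = (\<integral>s. k * (A s * cnj (B (s - t))) \<partial>lborel)" for t
  proof -
    have "(\<integral>y. wigner_ker \<tau> f1 f2 y t * cnj (v t y) \<partial>lborel) = (\<integral>s. wigner_ker \<tau> f1 f2 (s + (- \<tau> *\<^sub>R t)) t * cnj (v t (s + (- \<tau> *\<^sub>R t))) \<partial>lborel)"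
      by (rule lborel_integral_translation[symmetric])
         measurable
    then have "cis (- 2 * pi * (t \<bullet> \<xi>2)) * (\<integral>y. wigner_ker \<tau> f1 f2 y t * cnj (v t y) \<partial>lborel)
       = (\<integral>s. cis (- 2 * pi * (t \<bullet> \<xi>2)) * (wigner_ker \<tau> f1 f2 (s + (- \<tau> *\<^sub>R t)) t * cnj (v t (s + (- \<tau> *\<^sub>R t)))) \<partial>lborel)"
      by simp
    also have "\<dots> = (\<integral>s. k * (A s * cnj (B (s - t))) \<partial>lborel)"
    proof (rule Bochner_Integration.integral_cong[OF refl])
      fix s
      have ph: "cis (- 2 * pi * (t \<bullet> \<xi>2)) * cnj (cis (- 2 * pi * ((s + (- \<tau> *\<^sub>R t) - \<xi>1) \<bullet> x1)))
        = k * (cis (- 2 * pi * (s \<bullet> e1)) * cnj (cis (- 2 * pi * ((s - t) \<bullet> e2))))"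
        unfolding k_def cnj_cis cis_mult e1_def e2_def
        by (rule arg_cong[where f = cis]) (simp add: inner_add_left inner_diff_left inner_add_right inner_diff_right algebra_simps)
      have w1: "wigner_ker \<tau> f1 f2 (s + (- \<tau> *\<^sub>R t)) t = f1 s * cnj (f2 (s - t))"
        by (simp add: wigner_ker_def algebra_simps)
      have w2: "wigner_ker \<tau> \<phi> \<phi> (s + (- \<tau> *\<^sub>R t) - \<xi>1) (t - x2) = \<phi> (s - y1) * cnj (\<phi> (s - t - y2))"
        by (simp add: wigner_ker_def y1_def y2_def algebra_simps)
      have "X * ((F * G) * (Y * (Q * R))) = K * ((F * Q * C) * (G * R * E))" if "X * Y = K * (C * E)" for X Y K C E F G Q R :: complex
      proof -
        have "X * ((F * G) * (Y * (Q * R))) = (X * Y) * (F * G * Q * R)" by (simp only: mult_ac)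
        then show ?thesis unfolding that by (simp only: mult_ac)
      qed
      from this[OF ph] show "cis (- 2 * pi * (t \<bullet> \<xi>2)) * (wigner_ker \<tau> f1 f2 (s + (- \<tau> *\<^sub>R t)) t * cnj (v t (s + (- \<tau> *\<^sub>R t)))) = k * (A s * cnj (B (s - t)))"
        unfolding w1 v_def w2 A_def B_def complex_cnj_mult complex_cnj_cnj by blast
    qed
    finally show ?thesis .
  qed
  have iAB: "integrable lborel A" "integrable lborel B"
  proof -
    have i: "integrable lborel (\<lambda>s. g s * cnj (\<phi> (s - y)) * cis (- 2 * pi * (s \<bullet> e)))" if g: "schwartz g" for g y e
    proof -
      have [measurable]: "g \<in> borel_measurable borel" using schwartz_continuous[OF g] by (simp add: borel_measurable_continuous_onI)
      obtain D where D: "0 \<le> D" "\<And>x. cmod (\<phi> x) \<le> D" using rapid_bounded[OF schwartz_rapid[OF \<phi>]] by blast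
      have "rapid (\<lambda>s. g s * (cnj (\<phi> (s - y)) * cis (- 2 * pi * (s \<bullet> e))))"
        by (rule rapid_mult_bounded[OF schwartz_rapid[OF g], of _ D]) (simp add: norm_mult D(2))
      from rapid_integrable[OF this] show ?thesis by (simp add: mult.assoc)
    qed
    show "integrable lborel A" "integrable lborel B" unfolding A_def B_def by (intro i f)+
  qed
  have [measurable]: "A \<in> borel_measurable borel" "B \<in> borel_measurable borel"
    using iAB by (simp_all add: integrable_iff_bounded)
  \<comment> \<open>Integrability is verified with \<open>s\<close> outside, where the inner
    integral of the modulus is a constant times \<open>cmod (A s)\<close>, and is then transferred
    by exchanging the factors.\<close>
  have swap: "(\<integral>t. \<integral>s. k * (A s * cnj (B (s - t))) \<partial>lborel \<partial>lborel) = (\<integral>s. \<integral>t. k * (A s * cnj (B (s - t))) \<partial>lborel \<partial>lborel)"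
  proof -
    define F where "F p = k * (A (snd p) * cnj (B (snd p - fst p)))" for p
    have "integrable lborel F"
    proof -
      have "F \<in> borel_measurable (borel \<Otimes>\<^sub>M borel)" unfolding F_def by measurable
      then have mF: "F \<in> borel_measurable (lborel \<Otimes>\<^sub>M lborel)" by (simp add: borel_prod lborel_prod)
      have "integrable (lborel \<Otimes>\<^sub>M lborel) (\<lambda>(s, t). F (t, s))"
      proof (rule lborel_pair.Fubini_integrable)
        show "(\<lambda>(s, t). F (t, s)) \<in> borel_measurable (lborel \<Otimes>\<^sub>M lborel)"
          using measurable_pair_swap[OF mF] by simp
        have r: "integrable lborel (\<lambda>t. cnj (B (s - t)))" for s
          using lborel_integrable_affine[OF iAB(2), of "- 1" s] by simp
        have "(\<integral>t. cmod (F (t, s)) \<partial>lborel) = cmod (A s) * (\<integral>t. cmod (B t) \<partial>lborel)" for s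
        proof -
          have "(\<integral>t. cmod (F (t, s)) \<partial>lborel) = cmod (A s) * (\<integral>t. cmod (B (s - t)) \<partial>lborel)"
            by (simp add: F_def norm_mult k_def)
          also have "(\<integral>t. cmod (B (s - t)) \<partial>lborel) = (\<integral>t. cmod (B t) \<partial>lborel)"
            by (subst lborel_integral_affine[of "\<lambda>t. cmod (B t)" "- 1" s]) auto
          finally show ?thesis .
        qed
        then show "integrable lborel (\<lambda>s. \<integral>t. norm (case (s, t) of (s, t) \<Rightarrow> F (t, s)) \<partial>lborel)"
          using iAB(1) by simp
        show "AE s in lborel. integrable lborel (\<lambda>t. case (s, t) of (s, t) \<Rightarrow> F (t, s))"
          using r by (intro AE_I2) (simp add: F_def)
      qed
      then show ?thesis
        using lborel_pair.integrable_product_swap_iff[of F] by (simp add: lborel_prod)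
    qed
    from lborel_integral_swap[OF this] show ?thesis by (simp add: F_def)
  qed
  have "stf ?A\<phi> ?Af ((x1, x2), (\<xi>1, \<xi>2)) = (\<integral>p. P p \<partial>lborel)"
    by (simp add: stf_def P_def)
  also have "\<dots> = (\<integral>t. \<integral>\<eta>. P (\<eta>, t) \<partial>lborel \<partial>lborel)"
    unfolding lborel_integral_prod[OF intP] by (rule lborel_integral_swap[OF intP])
  also have "\<dots> = (\<integral>s. \<integral>t. k * (A s * cnj (B (s - t))) \<partial>lborel \<partial>lborel)"
    unfolding slice shear by (rule swap)
  also have "\<dots> = (\<integral>s. k * A s * cnj (\<integral>r. B r \<partial>lborel) \<partial>lborel)"
  proof (rule Bochner_Integration.integral_cong[OF refl])
    fix s
    have "(\<integral>t. cnj (B (s - t)) \<partial>lborel) = (\<integral>t. cnj (B t) \<partial>lborel)"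
      by (subst lborel_integral_affine[of "\<lambda>t. cnj (B t)" "- 1" s]) auto
    then show "(\<integral>t. k * (A s * cnj (B (s - t))) \<partial>lborel) = k * A s * cnj (\<integral>r. B r \<partial>lborel)"
      by (simp only: integral_mult_right_zero Bochner_Integration.integral_cnj mult.assoc)
  qed
  also have "\<dots> = k * (\<integral>s. A s \<partial>lborel) * cnj (\<integral>r. B r \<partial>lborel)"
    by (simp only: integral_mult_right_zero integral_mult_left_zero)
  also have "(\<integral>s. A s \<partial>lborel) = stf \<phi> f1 (y1, e1)" by (simp add: A_def stf_def)
  also have "(\<integral>r. B r \<partial>lborel) = stf \<phi> f2 (y2, e2)" by (simp add: B_def stf_def)
  finally show ?thesis
    by (simp add: norm_mult k_def y1_def y2_def e1_def e2_def)
qed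

section \<open>Synthesis of functions with prescribed short-time Fourier transform\<close>

text \<open>Translation by \<open>K0\<close> maps the lattice to itself, so every such sum is
  bounded by the full sum centred at the origin.\<close>

lemma lattice_sum_bound:
  "\<exists>C\<ge>0. \<forall>S (K0 :: 'a::euclidean_space). finite S \<longrightarrow> S \<subseteq> int_lattice \<longrightarrow> K0 \<in> int_lattice \<longrightarrow>
    (\<Sum>K\<in>S. decay (DIM('a) + 2) (K - K0)) \<le> C"
proof -
  define M where "M = DIM('a) + 2"
  define C where "C = enn2real (\<integral>\<^sup>+j. ennreal (decay M (j :: 'a)) \<partial>count_space int_lattice)"
  have C: "(\<integral>\<^sup>+j. ennreal (decay M (j :: 'a)) \<partial>count_space int_lattice) = ennreal C"
    unfolding C_def using lattice_sum_decay_finite[where 'a = 'a, OF order_refl] by (simp add: M_def ennreal_enn2real)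
  have "(\<Sum>K\<in>S. decay M (K - K0)) \<le> C" if S: "finite S" "S \<subseteq> int_lattice" and K0: "K0 \<in> int_lattice" for S and K0 :: 'a
  proof -
    let ?T = "(\<lambda>K. K - K0) ` S"
    have T: "finite ?T" "?T \<subseteq> int_lattice" using S K0 int_lattice_diff by auto
    have "ennreal (\<Sum>K\<in>S. decay M (K - K0)) = ennreal (\<Sum>j\<in>?T. decay M j)"
      by (subst sum.reindex) (auto simp: inj_on_def)
    also have "\<dots> = (\<Sum>j\<in>?T. ennreal (decay M j))" by simp
    also have "\<dots> = (\<integral>\<^sup>+j. ennreal (decay M j) * indicator ?T j \<partial>count_space int_lattice)"
    proof -
      have "(\<integral>\<^sup>+j. ennreal (decay M j) * indicator ?T j \<partial>count_space int_lattice)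
        = (\<Sum>j\<in>?T. ennreal (decay M j) * emeasure (count_space int_lattice) {j})"
        using T by (intro nn_integral_indicator_finite) auto
      also have "\<dots> = (\<Sum>j\<in>?T. ennreal (decay M j))"
        using T by (intro sum.cong refl) auto
      finally show ?thesis by simp
    qed
    also have "\<dots> \<le> (\<integral>\<^sup>+j. ennreal (decay M (j::'a)) \<partial>count_space int_lattice)"
      by (intro nn_integral_mono) (auto split: split_indicator)
    also have "\<dots> = ennreal C" by (rule C)
    finally show ?thesis by (subst (asm) ennreal_le_iff) (simp_all add: C_def)
  qed
  then show ?thesis unfolding M_def by (intro exI[of _ C]) (simp add: C_def)
qed

lemma stf_sum:
  assumes \<phi>: "schwartz \<phi>" and g: "\<And>K. K \<in> S \<Longrightarrow> schwartz (g K)"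
  shows "stf \<phi> (\<lambda>t. \<Sum>K\<in>S. c K * g K t) z = (\<Sum>K\<in>S. c K * stf \<phi> (g K) z)"
proof -
  have [measurable]: "\<phi> \<in> borel_measurable borel"
    using schwartz_continuous[OF \<phi>] by (simp add: borel_measurable_continuous_onI)
  obtain D where D: "0 \<le> D" "\<And>x. cmod (\<phi> x) \<le> D" using rapid_bounded[OF schwartz_rapid[OF \<phi>]] by blast
  have i: "integrable lborel (\<lambda>t. c K * (g K t * cnj (\<phi> (t - fst z)) * cis (- 2 * pi * (t \<bullet> snd z))))" if K: "K \<in> S" for K
  proof -
    have [measurable]: "g K \<in> borel_measurable borel"
      using schwartz_continuous[OF g[OF K]] by (simp add: borel_measurable_continuous_onI)
    have "rapid (\<lambda>t. g K t * (cnj (\<phi> (t - fst z)) * cis (- 2 * pi * (t \<bullet> snd z))))"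
      by (rule rapid_mult_bounded[OF schwartz_rapid[OF g[OF K]], of _ D]) (simp add: norm_mult D(2))
    from rapid_integrable[OF this] show ?thesis by (simp add: mult.assoc)
  qed
  have "stf \<phi> (\<lambda>t. \<Sum>K\<in>S. c K * g K t) z = (\<integral>t. (\<Sum>K\<in>S. c K * (g K t * cnj (\<phi> (t - fst z)) * cis (- 2 * pi * (t \<bullet> snd z)))) \<partial>lborel)"
    unfolding stf_def by (simp add: sum_distrib_right mult.assoc)
  also have "\<dots> = (\<Sum>K\<in>S. \<integral>t. c K * (g K t * cnj (\<phi> (t - fst z)) * cis (- 2 * pi * (t \<bullet> snd z))) \<partial>lborel)"
    by (rule Bochner_Integration.integral_sum[OF i])
  also have "\<dots> = (\<Sum>K\<in>S. c K * stf \<phi> (g K) z)"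
    by (simp only: stf_def integral_mult_right_zero)
  finally show ?thesis .
qed

lemma cmod_stf_0: "cmod (stf \<phi> \<phi> 0) = energy \<phi>"
proof -
  have "stf \<phi> \<phi> 0 = (\<integral>t. complex_of_real ((cmod (\<phi> t))\<^sup>2) \<partial>lborel)"
    unfolding stf_def complex_norm_square by simp
  also have "\<dots> = of_real (energy \<phi>)"
    unfolding energy_def by (rule integral_complex_of_real)
  finally show ?thesis by (simp add: energy_def)
qed

text \<open>Placing time-frequency shifts of \<open>\<phi>\<close> on the sparse lattice \<open>T (R \<int>)\<close> with the slowly varying
  coefficients \<open>peetre N a\<close> makes the diagonal term dominate at every node.\<close>

lemma synthesis:
  fixes \<phi> :: "'a::euclidean_space \<Rightarrow> complex" and T Ti :: "'a \<times> 'a \<Rightarrow> 'a \<times> 'a"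
  assumes \<phi>: "schwartz \<phi>" "\<phi> \<noteq> (\<lambda>_. 0)" and T: "linear T" "\<And>x. Ti (T x) = x" "\<And>x. T (Ti x) = x"
  shows "\<exists>C\<ge>0. \<forall>a. finite {y. a y \<noteq> 0} \<longrightarrow> (\<forall>y. a y < \<top>) \<longrightarrow> (\<exists>f. schwartz f \<and>
    (\<forall>z. stf_abs \<phi> f z \<le> ennreal C * peetre N a (Ti z)) \<and>
    (\<forall>y. \<exists>y'. norm (y - y') \<le> C \<and> a y \<le> ennreal C * stf_abs \<phi> f (T y')))"
proof -
  note t\<phi> = schwartz_tame[OF \<phi>(1)]
  define n where "n = real DIM('a \<times> 'a)"
  define M where "M = DIM('a \<times> 'a) + 2"
  \<comment> \<open>Three shares of decay: \<open>N\<close> compares the coefficients at different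
    nodes, \<open>M\<close> makes the sums over nodes converge, and the last order yields the factor
    \<open>1 / R\<close> for distinct nodes.\<close>
  define L where "L = N + (M + 1)"
  obtain c where c: "0 < c" "\<And>y. c * norm y \<le> norm (T y)"
  proof -
    have "inj T" using T(2) by (rule inj_on_inverseI)
    then show ?thesis using linear_inj_bounded_below_pos[OF T(1)] that by blast
  qed
  obtain C\<phi> where C\<phi>: "0 \<le> C\<phi>" "\<And>z. cmod (stf \<phi> \<phi> z) \<le> C\<phi> * decay L z"
    using rapidE[OF rapid_stf[OF t\<phi> t\<phi>]] by blast
  define c1 where "c1 = C\<phi> * (1 + 1 / c) ^ L"
  have c1: "0 \<le> c1" using C\<phi>(1) c(1) by (simp add: c1_def)
  have offdiag: "cmod (stf \<phi> \<phi> (T x - T y)) \<le> c1 * decay L (x - y)" for x y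
  proof -
    have "cmod (stf \<phi> \<phi> (T x - T y)) \<le> C\<phi> * decay L (T (x - y))"
      unfolding linear_diff[OF T(1)] by (rule C\<phi>(2))
    also have "\<dots> \<le> C\<phi> * ((1 + 1 / c) ^ L * decay L (x - y))"
      by (intro mult_left_mono decay_linear_le c C\<phi>(1))
    finally show ?thesis by (simp add: c1_def mult.assoc)
  qed
  obtain Sg where Sg: "0 \<le> Sg" "\<And>S K0. finite S \<Longrightarrow> S \<subseteq> int_lattice \<Longrightarrow> K0 \<in> int_lattice \<Longrightarrow> (\<Sum>K\<in>S. decay M (K - K0 :: 'a \<times> 'a)) \<le> Sg"
    using lattice_sum_bound[where 'a = "'a \<times> 'a"] unfolding M_def by blast
  define E where "E = energy \<phi>"
  have E: "0 < E" unfolding E_def by (rule energy_pos[OF t\<phi> \<phi>(2)])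
  \<comment> \<open>The lattice is made so sparse that the off-diagonal terms at a node add up to at
    most half of the diagonal term, which is \<open>E\<close> times the coefficient.\<close>
  define R where "R = real (nat \<lceil>2 * c1 * Sg / E\<rceil> + 1)"
  have R: "1 \<le> R" by (simp add: R_def)
  have RE: "c1 * Sg / R \<le> E / 2"
  proof -
    have "2 * c1 * Sg / E \<le> R" unfolding R_def by linarith
    then show ?thesis using E R by (simp add: field_simps)
  qed
  have scale: "decay k (R *\<^sub>R v) \<le> decay k v" for k and v :: "'a \<times> 'a"
    using R by (intro decay_mono_norm) (simp add: mult_le_cancel_right1)
  define C where "C = c1 * ((1 + n) ^ M * Sg) + R * n + (1 + R * n) ^ N * (2 / E)"
  have Cpos: "0 \<le> C" "c1 * ((1 + n) ^ M * Sg) \<le> C" "R * n \<le> C" "(1 + R * n) ^ N * (2 / E) \<le> C"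
    using c1 Sg(1) R E by (simp_all add: C_def n_def)
  have main: "\<exists>f. schwartz f \<and> (\<forall>z. stf_abs \<phi> f z \<le> ennreal C * peetre N a (Ti z)) \<and>
    (\<forall>y. \<exists>y'. norm (y - y') \<le> C \<and> a y \<le> ennreal C * stf_abs \<phi> f (T y'))"
    if fin: "finite {y. a y \<noteq> 0}" and top: "\<forall>y. a y < \<top>" for a
  proof -
    have ptop: "peetre N a z < \<top>" for z
    proof -
      obtain B where B: "\<And>y. a y \<le> ennreal B"
      proof -
        have "a y \<le> ennreal (\<Sum>y\<in>{y. a y \<noteq> 0}. enn2real (a y))" for y
        proof (cases "a y = 0")
          case False
          have "a y = ennreal (enn2real (a y))" using top[rule_format, of y] by (simp add: ennreal_enn2real)
          also have "\<dots> \<le> ennreal (\<Sum>y\<in>{y. a y \<noteq> 0}. enn2real (a y))"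
            using fin False by (intro ennreal_leI member_le_sum) auto
          finally show ?thesis .
        qed simp
        then show ?thesis by (rule that)
      qed
      then show ?thesis using peetre_finite[of a B N z] by simp
    qed
    define A where "A K = enn2real (peetre N a (R *\<^sub>R K))" for K
    have A: "ennreal (A K) = peetre N a (R *\<^sub>R K)" "0 \<le> A K" for K
      using ptop by (simp_all add: A_def ennreal_enn2real)
    \<comment> \<open>Only cells meeting the support of \<open>a\<close> receive a node. The maximal
      function does not vanish elsewhere, but restricting the nodes keeps \<open>f\<close> a finite
      sum.\<close>
    define S where "S = (\<lambda>y. lat_floor ((1 / R) *\<^sub>R y)) ` {y. a y \<noteq> 0}"
    have S: "finite S" "S \<subseteq> int_lattice" using fin by (auto simp: S_def)
    define w where "w K = T (R *\<^sub>R K)" for K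
    define g where "g K = modulation (snd (w K)) (translation (fst (w K)) \<phi>)" for K
    have g: "schwartz (g K)" for K unfolding g_def by (intro schwartz_modulation schwartz_translation \<phi>)
    define f where "f t = (\<Sum>K\<in>S. of_real (A K) * g K t)" for t
    have sf: "schwartz f" unfolding f_def by (intro schwartz_sum S schwartz_cmult g)
    have stf_f: "stf \<phi> f z = (\<Sum>K\<in>S. of_real (A K) * stf \<phi> (g K) z)" for z
      unfolding f_def[abs_def] by (rule stf_sum[OF \<phi>(1) g])
    have gz: "cmod (stf \<phi> (g K) z) = cmod (stf \<phi> \<phi> (w K - z))" for K z
      unfolding g_def using schwartz_continuous[OF \<phi>(1)] by (intro cmod_stf_shifted) (simp_all add: borel_measurable_continuous_onI)
    have upper: "stf_abs \<phi> f z \<le> ennreal C * peetre N a (Ti z)" for z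
    proof -
      define u where "u = Ti z"
      have z: "z = T u" by (simp add: u_def T(3))
      define p where "p = enn2real (peetre N a u)"
      have p: "peetre N a u = ennreal p" "0 \<le> p" using ptop by (simp_all add: p_def ennreal_enn2real)
      define K0 where "K0 = lat_floor ((1 / R) *\<^sub>R u)"
      have "cmod (stf \<phi> f z) \<le> (\<Sum>K\<in>S. cmod (of_real (A K) * stf \<phi> (g K) z))"
        unfolding stf_f by (rule norm_sum)
      also have "\<dots> \<le> (\<Sum>K\<in>S. p * (c1 * ((1 + n) ^ M * decay M (K - K0))))"
      proof (rule sum_mono)
        fix K assume "K \<in> S"
        have 1: "A K * decay N (u - R *\<^sub>R K) \<le> p"
        proof -
          have "ennreal (A K * decay N (u - R *\<^sub>R K)) \<le> ennreal p"
            using peetre_decay[of N a "R *\<^sub>R K" u] A p by (simp add: ennreal_mult')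
          then show ?thesis using p(2) by (simp add: ennreal_le_iff)
        qed
        have 2: "decay M (u - R *\<^sub>R K) \<le> (1 + n) ^ M * decay M (K - K0)"
        proof -
          have eq: "u - R *\<^sub>R K = R *\<^sub>R ((1 / R) *\<^sub>R u - K)" using R by (simp add: scaleR_diff_right)
          have "decay M (u - R *\<^sub>R K) \<le> decay M ((1 / R) *\<^sub>R u - K)" unfolding eq by (rule scale)
          also have "\<dots> \<le> (1 + norm (((1 / R) *\<^sub>R u - K) - (K0 - K))) ^ M * decay M (K0 - K)" by (rule decay_le_shift)
          also have "\<dots> \<le> (1 + n) ^ M * decay M (K0 - K)"
            using norm_diff_lat_floor[of "(1 / R) *\<^sub>R u"] unfolding n_def K0_def[symmetric]
            by (intro mult_right_mono power_mono) auto
          finally show ?thesis by (simp only: decay_commute[of M K0])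
        qed
        have "cmod (of_real (A K) * stf \<phi> (g K) z) = A K * cmod (stf \<phi> \<phi> (T (R *\<^sub>R K) - T u))"
          using A(2) by (simp add: norm_mult gz w_def z)
        also have "\<dots> \<le> A K * (c1 * decay L (R *\<^sub>R K - u))"
          by (intro mult_left_mono offdiag A)
        also have "\<dots> = c1 * (A K * decay N (u - R *\<^sub>R K)) * decay M (u - R *\<^sub>R K) * decay 1 (u - R *\<^sub>R K)"
          by (simp only: L_def decay_add decay_commute[of _ _ u] mult_ac)
        also have "\<dots> \<le> c1 * p * ((1 + n) ^ M * decay M (K - K0)) * 1"
          using c1 p(2) A(2) by (intro mult_mono 1 2) (auto simp: n_def)
        finally show "cmod (of_real (A K) * stf \<phi> (g K) z) \<le> p * (c1 * ((1 + n) ^ M * decay M (K - K0)))" by (simp only: mult_ac mult_1_right)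
      qed
      also have "\<dots> = p * (c1 * ((1 + n) ^ M * (\<Sum>K\<in>S. decay M (K - K0))))" by (simp only: sum_distrib_left)
      also have "\<dots> \<le> p * (c1 * ((1 + n) ^ M * Sg))"
        using p(2) c1 S by (intro mult_left_mono Sg(2)) (auto simp: K0_def n_def)
      also have "\<dots> \<le> p * C" using p(2) Cpos(2) by (rule mult_left_mono[rotated])
      finally have "ennreal (cmod (stf \<phi> f z)) \<le> ennreal (C * p)" by (simp add: ennreal_leI mult.commute)
      then show ?thesis using Cpos(1) p by (simp add: stf_abs_def u_def[symmetric] ennreal_mult')
    qed
    have node: "A K0 * (E / 2) \<le> cmod (stf \<phi> f (w K0))" if K0: "K0 \<in> S" for K0
    proof -
      have diag: "cmod (of_real (A K0) * stf \<phi> (g K0) (w K0)) = A K0 * E"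
        using A(2) by (simp add: norm_mult gz cmod_stf_0 E_def)
      have "cmod (\<Sum>K\<in>S - {K0}. of_real (A K) * stf \<phi> (g K) (w K0)) \<le> (\<Sum>K\<in>S - {K0}. cmod (of_real (A K) * stf \<phi> (g K) (w K0)))"
        by (rule norm_sum)
      also have "\<dots> \<le> (\<Sum>K\<in>S - {K0}. A K0 * (c1 / R) * decay M (K - K0))"
      proof (rule sum_mono)
        fix K assume K: "K \<in> S - {K0}"
        have 1: "A K * decay N (R *\<^sub>R K0 - R *\<^sub>R K) \<le> A K0"
        proof -
          have "ennreal (A K * decay N (R *\<^sub>R K0 - R *\<^sub>R K)) \<le> ennreal (A K0)"
            using peetre_decay[of N a "R *\<^sub>R K" "R *\<^sub>R K0"] A by (simp add: ennreal_mult')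
          then show ?thesis using A(2) by (simp add: ennreal_le_iff)
        qed
        have eq: "R *\<^sub>R K0 - R *\<^sub>R K = R *\<^sub>R (K0 - K)" by (simp add: scaleR_diff_right)
        have 2: "decay 1 (R *\<^sub>R K0 - R *\<^sub>R K) \<le> 1 / R"
        proof -
          have "1 \<le> norm (K0 - K)"
            using K K0 S by (intro int_lattice_norm_ge_1 int_lattice_diff) auto
          then have "R * 1 \<le> R * norm (K0 - K)" using R by (intro mult_left_mono) auto
          moreover have "norm (R *\<^sub>R (K0 - K)) = R * norm (K0 - K)" using R by simp
          ultimately have "R \<le> 1 + norm (R *\<^sub>R (K0 - K))" by linarith
          then show ?thesis unfolding eq decay_def power_one_right inverse_eq_divide
            using R by (intro divide_left_mono) auto
        qed
        have 3: "decay M (R *\<^sub>R K0 - R *\<^sub>R K) \<le> decay M (K - K0)"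
          unfolding eq decay_commute[of M K] by (rule scale)
        have "cmod (of_real (A K) * stf \<phi> (g K) (w K0)) = A K * cmod (stf \<phi> \<phi> (T (R *\<^sub>R K) - T (R *\<^sub>R K0)))"
          using A(2) by (simp add: norm_mult gz w_def)
        also have "\<dots> \<le> A K * (c1 * decay L (R *\<^sub>R K - R *\<^sub>R K0))"
          by (intro mult_left_mono offdiag A)
        also have "\<dots> = c1 * (A K * decay N (R *\<^sub>R K0 - R *\<^sub>R K)) * decay 1 (R *\<^sub>R K0 - R *\<^sub>R K) * decay M (R *\<^sub>R K0 - R *\<^sub>R K)"
          by (simp only: L_def decay_add decay_commute[of _ _ "R *\<^sub>R K0"] mult_ac)
        also have "\<dots> \<le> c1 * A K0 * (1 / R) * decay M (K - K0)"
          using c1 A(2) R by (intro mult_mono 1 2 3) auto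
        finally show "cmod (of_real (A K) * stf \<phi> (g K) (w K0)) \<le> A K0 * (c1 / R) * decay M (K - K0)" by (simp add: mult_ac)
      qed
      also have "\<dots> = A K0 * (c1 / R) * (\<Sum>K\<in>S - {K0}. decay M (K - K0))" by (simp only: sum_distrib_left)
      also have "\<dots> \<le> A K0 * (c1 / R) * Sg"
        using A(2) c1 R S K0 by (intro mult_left_mono Sg(2)) auto
      also have "\<dots> \<le> A K0 * (E / 2)"
        using mult_left_mono[OF RE A(2)[of K0]] by simp
      finally have off: "cmod (\<Sum>K\<in>S - {K0}. of_real (A K) * stf \<phi> (g K) (w K0)) \<le> A K0 * (E / 2)" .
      have "stf \<phi> f (w K0) = of_real (A K0) * stf \<phi> (g K0) (w K0) + (\<Sum>K\<in>S - {K0}. of_real (A K) * stf \<phi> (g K) (w K0))"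
        unfolding stf_f by (rule sum.remove[OF S(1) K0])
      then have "cmod (of_real (A K0) * stf \<phi> (g K0) (w K0)) \<le> cmod (stf \<phi> f (w K0)) + cmod (\<Sum>K\<in>S - {K0}. of_real (A K) * stf \<phi> (g K) (w K0))"
      proof (simp only:)
        have "cmod X \<le> cmod (X + Y) + cmod Y" for X Y :: complex
          using norm_triangle_ineq4[of "X + Y" Y] by simp
        then show "cmod (of_real (A K0) * stf \<phi> (g K0) (w K0))
            \<le> cmod (of_real (A K0) * stf \<phi> (g K0) (w K0) + (\<Sum>K\<in>S - {K0}. of_real (A K) * stf \<phi> (g K) (w K0)))
              + cmod (\<Sum>K\<in>S - {K0}. of_real (A K) * stf \<phi> (g K) (w K0))" .
      qed
      then show ?thesis using off unfolding diag by simp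
    qed
    have "\<exists>y'. norm (y - y') \<le> C \<and> a y \<le> ennreal C * stf_abs \<phi> f (T y')" for y
    proof (cases "a y = 0")
      case True
      then show ?thesis using Cpos(1) by (intro exI[of _ y]) simp
    next
      case False
      define K0 where "K0 = lat_floor ((1 / R) *\<^sub>R y)"
      have K0: "K0 \<in> S" using False by (auto simp: S_def K0_def)
      have "y - R *\<^sub>R K0 = R *\<^sub>R ((1 / R) *\<^sub>R y - K0)" using R by (simp add: scaleR_diff_right)
      then have "norm (y - R *\<^sub>R K0) = R * norm ((1 / R) *\<^sub>R y - K0)" using R by simp
      also have "\<dots> \<le> R * n"
        using R norm_diff_lat_floor[of "(1 / R) *\<^sub>R y"] by (intro mult_left_mono) (auto simp: n_def K0_def)
      finally have d: "norm (y - R *\<^sub>R K0) \<le> R * n" .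
      have "a y \<le> peetre N a y" by (rule le_peetre)
      also have "\<dots> \<le> ennreal ((1 + norm (R *\<^sub>R K0 - y)) ^ N) * peetre N a (R *\<^sub>R K0)" by (rule peetre_slow)
      also have "\<dots> \<le> ennreal ((1 + R * n) ^ N) * ennreal (A K0)"
        unfolding A using d by (intro mult_right_mono ennreal_leI power_mono) (auto simp: norm_minus_commute)
      also have "\<dots> \<le> ennreal ((1 + R * n) ^ N) * ennreal ((2 / E) * cmod (stf \<phi> f (w K0)))"
        using node[OF K0] E by (intro mult_left_mono ennreal_leI) (auto simp: field_simps)
      also have "\<dots> = ennreal ((1 + R * n) ^ N * (2 / E)) * stf_abs \<phi> f (w K0)"
        using E R by (simp add: stf_abs_def ennreal_mult'[symmetric] n_def mult.assoc)
      also have "\<dots> \<le> ennreal C * stf_abs \<phi> f (T (R *\<^sub>R K0))"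
        unfolding w_def using Cpos(4) by (intro mult_right_mono ennreal_leI) auto
      finally show ?thesis using d Cpos(3) by (intro exI[of _ "R *\<^sub>R K0"]) auto
    qed
    with sf upper show ?thesis by blast
  qed
  show ?thesis using Cpos(1) main by blast
qed

section \<open>Sequences indexed by the integer lattice\<close>

lemma Lp_norm_bij:
  assumes "bij_betw g A B" "0 < p"
  shows "Lp_norm p (count_space A) (\<lambda>x. f (g x)) = Lp_norm p (count_space B) f"
proof (cases "p = \<top>")
  case True
  have "(SUP x\<in>A. f (g x)) = (SUP x\<in>B. f x)"
    using bij_betw_imp_surj_on[OF assms(1)] by (metis image_image)
  then show ?thesis by (simp add: True Lp_norm_top_count_space)
next
  case False
  then show ?thesis
    using nn_integral_bij_count_space[OF assms(1), of "\<lambda>x. ennpowr (f x) (enn2real p)"] by (simp add: Lp_norm_count_space)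
qed

definition int_vec :: "int ^ 'd \<Rightarrow> real ^ 'd" where
  "int_vec k = (\<chi> i. real_of_int (k $ i))"

lemma lattice_point_eq: "lattice_point (k, n) = (int_vec k, int_vec n)"
  by (simp add: lattice_point_def int_vec_def)

lemma int_vec_diff: "int_vec (k - n) = int_vec k - int_vec n"
  by (simp add: int_vec_def vec_eq_iff)

lemma bij_int_vec: "bij_betw int_vec UNIV int_lattice"
proof (rule bij_betw_imageI)
  show "inj int_vec" by (auto simp: inj_def int_vec_def vec_eq_iff)
  have lat: "x \<in> int_lattice \<longleftrightarrow> (\<forall>i. x $ i \<in> \<int>)" for x :: "real ^ 'd"
    by (auto simp: int_lattice_def Basis_vec_def inner_axis)
  show "range int_vec = (int_lattice :: (real ^ 'd) set)"
  proof safe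
    fix k :: "int ^ 'd" show "int_vec k \<in> int_lattice" by (simp add: lat int_vec_def)
  next
    fix x :: "real ^ 'd" assume "x \<in> int_lattice"
    then have "x = int_vec (\<chi> i. \<lfloor>x $ i\<rfloor>)" by (auto simp: lat int_vec_def vec_eq_iff elim!: Ints_cases dest!: spec)
    then show "x \<in> range int_vec" by blast
  qed
qed

lemma bij_lattice_point: "bij_betw (lattice_point :: (int ^ 'd) \<times> (int ^ 'd) \<Rightarrow> _) UNIV int_lattice"
proof -
  have "(lattice_point :: (int ^ 'd) \<times> (int ^ 'd) \<Rightarrow> _) = map_prod int_vec int_vec"
    by (auto simp: fun_eq_iff lattice_point_eq)
  moreover have "bij_betw (map_prod int_vec int_vec) UNIV (int_lattice :: ((real ^ 'd) \<times> (real ^ 'd)) set)"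
    unfolding int_lattice_Times UNIV_Times_UNIV[symmetric] by (rule bij_betw_map_prod[OF bij_int_vec bij_int_vec])
  ultimately show ?thesis by simp
qed

lemma mixed_norm_bij:
  assumes "bij_betw g A A'" "bij_betw h B B'" "0 < p" "0 < q"
  shows "mixed_norm p q (count_space A) (count_space B) (\<lambda>(x, y). F (g x, h y)) = mixed_norm p q (count_space A') (count_space B') F"
  unfolding mixed_norm_def prod.case
  using assms by (simp add: Lp_norm_bij[where g = g and f = "\<lambda>x. F (x, h y)" for y]
      Lp_norm_bij[where g = h and f = "\<lambda>y. Lp_norm p (count_space A') (\<lambda>x. F (x, y))"])

definition lattice_index :: "(real ^ 'd) \<times> (real ^ 'd) \<Rightarrow> (int ^ 'd) \<times> (int ^ 'd)" where
  "lattice_index = inv_into UNIV lattice_point"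

lemma lattice_index_point [simp]: "lattice_index (lattice_point k) = k"
  unfolding lattice_index_def by (rule inv_into_f_f[OF bij_betw_imp_inj_on[OF bij_lattice_point]]) simp

lemma lattice_point_index: "z \<in> int_lattice \<Longrightarrow> lattice_point (lattice_index z) = z"
  unfolding lattice_index_def by (rule f_inv_into_f) (simp only: bij_betw_imp_surj_on[OF bij_lattice_point])

lemma lattice_point_in_lattice [simp]: "lattice_point k \<in> int_lattice"
  using bij_betwE[OF bij_lattice_point] by blast

lemma lpq_norm_eq_lattice_norm:
  assumes "0 < p" "0 < q"
  shows "lpq_norm p q (m \<circ> lattice_point) (a :: (int ^ 'd) \<times> (int ^ 'd) \<Rightarrow> complex)
    = lattice_norm p q m (\<lambda>z. ennreal (cmod (a (lattice_index z))))"
proof -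
  have "lpq_norm p q (m \<circ> lattice_point) a
    = mixed_norm p q (count_space UNIV) (count_space UNIV)
       (\<lambda>(k, n). (\<lambda>z. ennreal (cmod (a (lattice_index z))) * ennreal (m z)) (int_vec k, int_vec n))"
    unfolding lpq_norm_def
    by (intro mixed_norm_cong assms) (simp add: lattice_point_eq[symmetric] ennreal_mult')
  also have "\<dots> = lattice_norm p q m (\<lambda>z. ennreal (cmod (a (lattice_index z))))"
    unfolding lattice_norm_def by (subst mixed_norm_bij[OF bij_int_vec bij_int_vec assms]) simp
  finally show ?thesis .
qed

lemma lpq_norm_one_tensor_eq:
  assumes "0 < p" "0 < q"
  shows "lpq_norm p q (one_tensor (w \<circ> lattice_point)) (c :: ((int ^ 'd) \<times> (int ^ 'd)) \<times> ((int ^ 'd) \<times> (int ^ 'd)) \<Rightarrow> complex)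
    = lattice_norm p q (one_tensor w) (\<lambda>(x, \<xi>). ennreal (cmod (c (lattice_index x, lattice_index \<xi>))))"
proof -
  have "lpq_norm p q (one_tensor (w \<circ> lattice_point)) c
    = mixed_norm p q (count_space UNIV) (count_space UNIV)
       (\<lambda>(k, n). (\<lambda>(x, \<xi>). ennreal (cmod (c (lattice_index x, lattice_index \<xi>))) * ennreal (w \<xi>)) (lattice_point k, lattice_point n))"
    unfolding lpq_norm_def by (intro mixed_norm_cong assms) (simp add: one_tensor_def ennreal_mult')
  also have "\<dots> = lattice_norm p q (one_tensor w) (\<lambda>(x, \<xi>). ennreal (cmod (c (lattice_index x, lattice_index \<xi>))))"
    unfolding lattice_norm_def
    by (subst mixed_norm_bij[OF bij_lattice_point bij_lattice_point assms]) (simp add: case_prod_unfold one_tensor_def)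
  finally show ?thesis .
qed

section \<open>Boundedness in terms of sequences\<close>

definition dil :: "real \<Rightarrow> real \<Rightarrow> 'a::real_vector \<times> 'a \<Rightarrow> 'a \<times> 'a" where
  "dil s t z = (s *\<^sub>R fst z, t *\<^sub>R snd z)"

text \<open>\<open>arg1\<close> and \<open>arg2\<close> are the two evaluation points in
  \<open>cmod_stf_ambiguity\<close>, with \<open>w\<close> read as ((x1, x2), (\<xi>1,
  \<xi>2)).\<close>

definition arg1 :: "real \<Rightarrow> ('a::real_vector \<times> 'a) \<times> ('a \<times> 'a) \<Rightarrow> 'a \<times> 'a" where
  "arg1 \<tau> w = (fst (snd w) + \<tau> *\<^sub>R snd (fst w), snd (snd w) - (1 - \<tau>) *\<^sub>R fst (fst w))"

definition arg2 :: "real \<Rightarrow> ('a::real_vector \<times> 'a) \<times> ('a \<times> 'a) \<Rightarrow> 'a \<times> 'a" where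
  "arg2 \<tau> w = (fst (snd w) - (1 - \<tau>) *\<^sub>R snd (fst w), snd (snd w) + \<tau> *\<^sub>R fst (fst w))"

text \<open>The two evaluation points determine \<open>w\<close> for every \<tau>: their difference
  is (x2, - x1), after which \<xi> is found from the first point.\<close>

definition args_inv :: "real \<Rightarrow> ('a::real_vector \<times> 'a) \<times> ('a \<times> 'a) \<Rightarrow> ('a \<times> 'a) \<times> ('a \<times> 'a)" where
  "args_inv \<tau> p = ((snd (snd p) - snd (fst p), fst (fst p) - fst (snd p)),
     (fst (fst p) - \<tau> *\<^sub>R (fst (fst p) - fst (snd p)), snd (fst p) + (1 - \<tau>) *\<^sub>R (snd (snd p) - snd (fst p))))"

lemma args_inv: "arg1 \<tau> (args_inv \<tau> (y, y')) = y" "arg2 \<tau> (args_inv \<tau> (y, y')) = y'"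
  by (simp_all add: arg1_def arg2_def args_inv_def prod_eq_iff algebra_simps)

lemma linear_args_inv: "linear (args_inv \<tau>)"
  by (rule linearI) (simp_all add: args_inv_def prod_eq_iff algebra_simps)

lemma linear_dil: "linear (dil s t)"
  by (rule linearI) (simp_all add: dil_def prod_eq_iff algebra_simps)

lemma dil_inverse:
  assumes "s \<noteq> 0" "t \<noteq> 0"
  shows "dil (1 / s) (1 / t) (dil s t z) = z" "dil s t (dil (1 / s) (1 / t) z) = z"
  using assms by (simp_all add: dil_def)

text \<open>A linear change of the variables \<open>(x, \<xi>)\<close> of the transform on \<open>R\<^sup>2\<^sup>d\<close> to lattice coordinates
  \<open>(k, n)\<close>: \<open>T1, T2\<close> maps to the new coordinates, \<open>X, Y\<close> maps back, and in the new coordinates the two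
  short-time Fourier transforms of the factorization are evaluated at \<open>j1 (k, n)\<close> and, up to the
  dilation, at \<open>j2 (k, n)\<close>; \<open>J1\<close> and \<open>J2\<close> are the restrictions of \<open>j1\<close> and \<open>j2\<close> to integer points.\<close>

definition adapted_coordinates where
  "adapted_coordinates \<tau> s t j1 j2 X Y T1 T2
     (J1 :: ((int ^ 'd) \<times> (int ^ 'd)) \<times> ((int ^ 'd) \<times> (int ^ 'd)) \<Rightarrow> (int ^ 'd) \<times> (int ^ 'd)) J2 \<longleftrightarrow>
   0 \<le> (\<tau>::real) \<and> \<tau> \<le> 1 \<and> s \<noteq> 0 \<and> t \<noteq> 0 \<and>
   linear j1 \<and> linear j2 \<and> linear X \<and> linear Y \<and> linear T1 \<and> linear T2 \<and>
   (\<forall>k n. lattice_point (J1 (k, n)) = j1 (lattice_point k, lattice_point n)) \<and>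
   (\<forall>k n. lattice_point (J2 (k, n)) = j2 (lattice_point k, lattice_point n)) \<and>
   (\<forall>w. arg1 \<tau> w = j1 (T1 w, T2 (snd w))) \<and> (\<forall>w. arg2 \<tau> w = dil s t (j2 (T1 w, T2 (snd w)))) \<and>
   (\<forall>k n. args_inv \<tau> (j1 (k, n), dil s t (j2 (k, n))) = (X (k, n), Y n)) \<and>
   (\<forall>\<xi>. Y (T2 \<xi>) = \<xi>) \<and>
   (\<forall>k. X (k, 0) = 0 \<longrightarrow> k = 0) \<and> (\<forall>n. Y n = 0 \<longrightarrow> n = 0) \<and>
   (\<forall>x. T1 (x, 0) = 0 \<longrightarrow> x = 0) \<and> (\<forall>\<xi>. T2 \<xi> = 0 \<longrightarrow> \<xi> = 0)"

lemma stf_abs_ambiguity: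
  assumes "schwartz f1" "schwartz f2" "schwartz \<phi>" "0 \<le> \<tau>" "\<tau> \<le> 1"
  shows "stf_abs (ambiguity \<tau> \<phi> \<phi>) (ambiguity \<tau> f1 f2) w = stf_abs \<phi> f1 (arg1 \<tau> w) * stf_abs \<phi> f2 (arg2 \<tau> w)"
proof -
  obtain x1 x2 \<xi>1 \<xi>2 where "w = ((x1, x2), (\<xi>1, \<xi>2))" by (metis prod.collapse)
  then show ?thesis
    using cmod_stf_ambiguity[OF assms] by (simp add: stf_abs_def arg1_def arg2_def ennreal_mult')
qed

text \<open>Its transform with itself as window takes the squared energy of \<phi> as value at the
  origin.\<close>

lemma ambiguity_nonzero:
  assumes \<phi>: "schwartz \<phi>" "\<phi> \<noteq> (\<lambda>_. 0)" and \<tau>: "0 \<le> \<tau>" "\<tau> \<le> 1"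
  shows "ambiguity \<tau> \<phi> \<phi> \<noteq> (\<lambda>_. 0)"
proof
  assume z: "ambiguity \<tau> \<phi> \<phi> = (\<lambda>_. 0)"
  have "stf_abs (ambiguity \<tau> \<phi> \<phi>) (ambiguity \<tau> \<phi> \<phi>) 0 = ennreal (energy \<phi>) * ennreal (energy \<phi>)"
    unfolding stf_abs_ambiguity[OF \<phi>(1) \<phi>(1) \<phi>(1) \<tau>] by (simp add: arg1_def arg2_def stf_abs_def cmod_stf_0 flip: zero_prod_def)
  moreover have "stf_abs (ambiguity \<tau> \<phi> \<phi>) (ambiguity \<tau> \<phi> \<phi>) 0 = 0" by (simp add: z stf_abs_def stf_def)
  ultimately show False using energy_pos[OF schwartz_tame[OF \<phi>(1)] \<phi>(2)] by simp
qed

lemma lattice_norm_dil: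
  fixes m :: "'a::euclidean_space \<times> 'a \<Rightarrow> real"
  assumes p: "0 < p" "0 < q" and m: "poly_moderate m" and st: "s \<noteq> 0" "t \<noteq> 0"
  shows "\<exists>C\<ge>0. \<forall>F. lattice_norm p q (\<lambda>z. m (dil s t z)) (\<lambda>z. peetre N F (dil s t z)) \<le> ennreal C * lattice_norm p q m (peetre N F)"
proof -
  have "linear (\<lambda>z::'a\<times>'a. s *\<^sub>R fst z)" "linear (\<lambda>y::'a. t *\<^sub>R y)" by (simp_all add: linear_iff scaleR_add_right)
  from mixed_norm_peetre_linear[OF p m this, of N] show ?thesis
    using st by (simp add: dil_def[abs_def] case_prod_unfold)
qed

lemma poly_moderate_one_tensor:
  assumes "poly_moderate (m :: 'b::euclidean_space \<Rightarrow> real)"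
  shows "poly_moderate (one_tensor m :: 'a::euclidean_space \<times> 'b \<Rightarrow> real)"
proof -
  have "linear (snd :: 'a \<times> 'b \<Rightarrow> 'b)" by (simp add: linear_iff)
  from poly_moderate_linear[OF assms this] show ?thesis by (simp add: one_tensor_def case_prod_unfold)
qed

text \<open>Passing from a point to the corner of its cell moves the discount by at most the
  dimension, so a bound by cells reduces a maximal function to one over the lattice.\<close>

lemma peetre_le_cells:
  fixes P :: "'a::euclidean_space \<Rightarrow> ennreal"
  assumes "\<And>w. P w \<le> Q (lat_floor w)"
  shows "peetre N P z \<le> ennreal ((1 + real DIM('a)) ^ N) * peetre N (\<lambda>w. if w \<in> int_lattice then Q w else 0) z"
proof (rule peetre_least)
  fix w
  have "decay N (z - w) \<le> (1 + norm ((z - w) - (z - lat_floor w))) ^ N * decay N (z - lat_floor w)" by (rule decay_le_shift)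
  also have "\<dots> \<le> (1 + real DIM('a)) ^ N * decay N (z - lat_floor w)"
    using norm_diff_lat_floor[of w] by (intro mult_right_mono power_mono) (auto simp: norm_minus_commute)
  finally have "P w * ennreal (decay N (z - w)) \<le> Q (lat_floor w) * ennreal ((1 + real DIM('a)) ^ N * decay N (z - lat_floor w))"
    by (intro mult_mono assms ennreal_leI) auto
  also have "\<dots> = ennreal ((1 + real DIM('a)) ^ N) * (Q (lat_floor w) * ennreal (decay N (z - lat_floor w)))"
    by (simp add: ennreal_mult' mult_ac)
  also have "\<dots> \<le> ennreal ((1 + real DIM('a)) ^ N) * peetre N (\<lambda>w. if w \<in> int_lattice then Q w else 0) z"
    using peetre_upper[of "\<lambda>w. if w \<in> int_lattice then Q w else 0" "lat_floor w" N z] by (intro mult_left_mono) auto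
  finally show "P w * ennreal (decay N (z - w)) \<le> \<dots>" .
qed

lemma peetre_near:
  assumes "norm (z - w) \<le> d"
  shows "peetre N F w \<le> ennreal ((1 + d) ^ N) * peetre N F z"
  using assms by (intro order_trans[OF peetre_slow[of N F w z]] mult_right_mono ennreal_leI power_mono) auto

lemma linear_bound:
  fixes T :: "'a::euclidean_space \<Rightarrow> 'b::real_normed_vector"
  assumes "linear T"
  obtains B where "0 \<le> B" "\<And>x y. norm (T x - T y) \<le> B * norm (x - y)"
  using linear_bounded_pos[OF assms] by (metis linear_diff[OF assms] less_imp_le)

text \<open>The discrete inequality is applied to lattice samples of the maximal functions of the
  two transforms. A sample of a maximal function bounds the transform on a whole neighbourhood, so
  the product at any \<open>w\<close> is dominated by the product of samples at a rounded
  point.\<close>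

lemma wigner_bounded_of_discrete:
  fixes m m1 m2 :: "(real ^ 'd) \<times> (real ^ 'd) \<Rightarrow> real" and \<phi> :: "real ^ 'd \<Rightarrow> complex"
  assumes ac: "adapted_coordinates \<tau> s t j1 j2 X Y T1 T2 J1 J2"
    and p: "0 < p1" "0 < p2" "0 < q1" "0 < q2" "0 < p" "0 < q"
    and m: "poly_moderate m" "poly_moderate m1" "poly_moderate m2"
    and \<phi>: "schwartz \<phi>" "\<phi> \<noteq> (\<lambda>_. 0)" and \<Phi>: "schwartz \<Phi>"
    and C: "0 \<le> C" and discrete: "\<And>a b. lpq_norm p q (one_tensor ((\<lambda>z. m (Y z)) \<circ> lattice_point))
            (\<lambda>(k, n). a (J1 (k, n)) * b (J2 (k, n)))
          \<le> ennreal C * lpq_norm p1 q1 (m1 \<circ> lattice_point) a * lpq_norm p2 q2 ((\<lambda>z. m2 (dil s t z)) \<circ> lattice_point) b"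
  shows "wigner_bounded \<tau> (modulation_norm \<phi> p1 q1 m1) (modulation_norm \<phi> p2 q2 m2) (amalgam_norm \<Phi> p q m)"
proof -
  let ?D = "real DIM(((real ^ 'd) \<times> (real ^ 'd)) \<times> ((real ^ 'd) \<times> (real ^ 'd)))"
  have \<tau>: "0 \<le> \<tau>" "\<tau> \<le> 1" and st: "s \<noteq> 0" "t \<noteq> 0" and lin: "linear j1" "linear j2" "linear Y" "linear T1" "linear T2"
    and J: "\<And>k n. lattice_point (J1 (k, n)) = j1 (lattice_point k, lattice_point n)"
      "\<And>k n. lattice_point (J2 (k, n)) = j2 (lattice_point k, lattice_point n)"
    and args: "\<And>w. arg1 \<tau> w = j1 (T1 w, T2 (snd w))" "\<And>w. arg2 \<tau> w = dil s t (j2 (T1 w, T2 (snd w)))"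
    and YT: "\<And>\<xi>. Y (T2 \<xi>) = \<xi>" and inj: "\<And>x. T1 (x, 0) = 0 \<Longrightarrow> x = 0" "\<And>\<xi>. T2 \<xi> = 0 \<Longrightarrow> \<xi> = 0"
    using ac unfolding adapted_coordinates_def by (elim conjE, fast)+
  note t\<phi> = schwartz_tame[OF \<phi>(1)]
  define \<Phi>0 where "\<Phi>0 = ambiguity \<tau> \<phi> \<phi>"
  have \<Phi>0: "tame \<Phi>0" "\<Phi>0 \<noteq> (\<lambda>_. 0)"
    unfolding \<Phi>0_def by (rule tame_ambiguity[OF \<phi>(1) \<phi>(1) \<tau>], rule ambiguity_nonzero[OF \<phi> \<tau>])
  let ?m = "one_tensor m :: ((real ^ 'd) \<times> (real ^ 'd)) \<times> ((real ^ 'd) \<times> (real ^ 'd)) \<Rightarrow> real"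
  have pm: "poly_moderate ?m" by (rule poly_moderate_one_tensor[OF m(1)])
  then obtain N3 where N3: "moderate_degree N3 ?m" by (auto simp: poly_moderate_def)
  obtain M1 where M1: "\<And>N. M1 \<le> N \<Longrightarrow> \<exists>C\<ge>0. \<forall>f. tame f \<longrightarrow>
    lattice_norm p1 q1 m1 (peetre N (stf_abs \<phi> f)) \<le> ennreal C * modulation_norm \<phi> p1 q1 m1 (functional_of f)"
    using lattice_norm_le_modulation_norm[OF p(1) p(3) m(2) t\<phi> \<phi>(2)] by blast
  obtain M2 where M2: "\<And>N. M2 \<le> N \<Longrightarrow> \<exists>C\<ge>0. \<forall>f. tame f \<longrightarrow>
    lattice_norm p2 q2 m2 (peetre N (stf_abs \<phi> f)) \<le> ennreal C * modulation_norm \<phi> p2 q2 m2 (functional_of f)"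
    using lattice_norm_le_modulation_norm[OF p(2) p(4) m(3) t\<phi> \<phi>(2)] by blast
  obtain M3 where M3: "\<And>N. M3 \<le> N \<Longrightarrow> \<exists>C\<ge>0. \<forall>F.
    lattice_norm p q ?m (peetre N (\<lambda>z. if z \<in> int_lattice then F z else 0)) \<le> ennreal C * lattice_norm p q ?m F"
    using lattice_norm_peetre_lattice[OF p(5,6), of N3] N3 by blast
  \<comment> \<open>One common order above all thresholds, so that the maximal functions in the
    chain of estimates match.\<close>
  define N where "N = M1 + M2 + M3"
  have NM: "M1 \<le> N" "M2 \<le> N" "M3 \<le> N" by (simp_all add: N_def)
  obtain A1 where A1: "0 \<le> A1" "\<And>f. tame f \<Longrightarrow>
    lattice_norm p1 q1 m1 (peetre N (stf_abs \<phi> f)) \<le> ennreal A1 * modulation_norm \<phi> p1 q1 m1 (functional_of f)"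
    using M1[OF NM(1)] by blast
  obtain A2 where A2: "0 \<le> A2" "\<And>f. tame f \<Longrightarrow>
    lattice_norm p2 q2 m2 (peetre N (stf_abs \<phi> f)) \<le> ennreal A2 * modulation_norm \<phi> p2 q2 m2 (functional_of f)"
    using M2[OF NM(2)] by blast
  obtain A3 where A3: "0 \<le> A3" "\<And>F. lattice_norm p q ?m (peetre N (\<lambda>z. if z \<in> int_lattice then F z else 0)) \<le> ennreal A3 * lattice_norm p q ?m F"
    using M3[OF NM(3)] by blast
  obtain A4 where A4: "0 \<le> A4" "\<And>f. modulation_norm \<Phi> p q ?m (functional_of f) \<le> ennreal A4 * lattice_norm p q ?m (peetre N (stf_abs \<Phi> f))"
    using modulation_norm_le_lattice_norm[OF p(5,6) pm, of N] by blast
  obtain A5 where A5: "0 \<le> A5" "\<And>f z. tame f \<Longrightarrow> peetre N (stf_abs \<Phi> f) z \<le> ennreal A5 * peetre N (stf_abs \<Phi>0 f) z"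
    using peetre_stf_window_change[OF \<Phi>0 schwartz_tame[OF \<Phi>], of N] by blast
  obtain A6 where A6: "0 \<le> A6" "\<And>F. lattice_norm p2 q2 (\<lambda>z. m2 (dil s t z)) (\<lambda>z. peetre N F (dil s t z)) \<le> ennreal A6 * lattice_norm p2 q2 m2 (peetre N F)"
    using lattice_norm_dil[OF p(2,4) m(3) st, of N] by blast
  obtain A7 where A7: "0 \<le> A7" "\<And>G. mixed_norm p q (count_space int_lattice) (count_space int_lattice) (\<lambda>(x, y). G (lat_floor (T1 (x, y)), lat_floor (T2 y)))
    \<le> ennreal A7 * mixed_norm p q (count_space int_lattice) (count_space int_lattice) G"
    using mixed_norm_lat_floor_linear[OF p(5,6) lin(4,5) inj] by blast
  obtain C1 N1 where C1: "0 \<le> C1" "\<And>z w. m z \<le> C1 * (1 + norm (z - w)) ^ N1 * m w"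
    using poly_moderateE[OF m(1)] by metis
  obtain bY where bY: "0 \<le> bY" "\<And>x y. norm (Y x - Y y) \<le> bY * norm (x - y)" using linear_bound[OF lin(3)] by blast
  define Cm where "Cm = C1 * (1 + bY * ?D) ^ N1"
  have Cm: "0 \<le> Cm" using C1 bY by (simp add: Cm_def)
  \<comment> \<open>Rounding the coordinate \<open>T2 \<xi>\<close> and mapping back by
    \<open>Y\<close> displaces \<xi> by a bounded amount, since \<open>Y\<close> undoes
    \<open>T2\<close>.\<close>
  have weight: "m \<xi> \<le> Cm * m (Y (lat_floor (T2 \<xi>)))" for \<xi>
  proof -
    have "norm (\<xi> - Y (lat_floor (T2 \<xi>))) \<le> bY * norm (T2 \<xi> - lat_floor (T2 \<xi>))"
      using bY(2)[of "T2 \<xi>" "lat_floor (T2 \<xi>)"] by (simp add: YT)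
    also have "\<dots> \<le> bY * ?D"
      using bY(1) norm_diff_lat_floor[of "T2 \<xi>"] by (intro mult_left_mono) auto
    finally show ?thesis
      unfolding Cm_def using C1(1) poly_moderate_nonneg[OF m(1)]
      by (intro order_trans[OF C1(2)[of \<xi> "Y (lat_floor (T2 \<xi>))"]] mult_right_mono mult_left_mono power_mono) auto
  qed
  have linT: "linear (\<lambda>w. (T1 w, T2 (snd w)))"
    by (rule linearI) (simp_all add: linear_add[OF lin(4)] linear_add[OF lin(5)] linear_scale[OF lin(4)] linear_scale[OF lin(5)])
  obtain bT where bT: "0 \<le> bT" "\<And>x y. norm ((T1 x, T2 (snd x)) - (T1 y, T2 (snd y))) \<le> bT * norm (x - y)"
    using linear_bound[OF linT] by metis
  obtain b1 where b1: "0 \<le> b1" "\<And>x y. norm (j1 x - j1 y) \<le> b1 * norm (x - y)" using linear_bound[OF lin(1)] by blast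
  have "linear (\<lambda>z. dil s t (j2 z))" using linear_compose[OF lin(2) linear_dil] by (simp add: o_def)
  then obtain b2 where b2: "0 \<le> b2" "\<And>x y. norm (dil s t (j2 x) - dil s t (j2 y)) \<le> b2 * norm (x - y)" using linear_bound by metis
  \<comment> \<open>Two roundings occur, one before and one after the change of coordinates; the
    first is magnified by \<open>bT\<close>.\<close>
  define d where "d = bT * ?D + ?D"
  have d: "0 \<le> d" using bT by (simp add: d_def)
  have near: "norm ((lat_floor (T1 (lat_floor w)), lat_floor (T2 (snd (lat_floor w)))) - (T1 w, T2 (snd w))) \<le> d" for w
  proof -
    define v where "v = lat_floor w"
    have "norm ((T1 w, T2 (snd w)) - lat_floor (T1 v, T2 (snd v)))
      \<le> norm ((T1 w, T2 (snd w)) - (T1 v, T2 (snd v))) + norm ((T1 v, T2 (snd v)) - lat_floor (T1 v, T2 (snd v)))"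
      by (rule norm_diff_triangle_le[OF order_refl order_refl])
    also have "\<dots> \<le> bT * norm (w - v) + ?D" by (intro add_mono bT norm_diff_lat_floor)
    also have "\<dots> \<le> d" unfolding d_def v_def
      using bT(1) norm_diff_lat_floor[of w] by (intro add_mono mult_left_mono) auto
    finally show ?thesis by (simp only: norm_minus_commute v_def lat_floor_Pair)
  qed
  define C0 where "C0 = (1 + b1 * d) ^ N * (1 + b2 * d) ^ N"
  have C0: "0 \<le> C0" using b1 b2 d by (simp add: C0_def)
  define K where "K = A4 * A5 * (1 + ?D) ^ N * A3 * C0 * Cm * A7 * C * A1 * A6 * A2"
  have K: "0 \<le> K" using A1(1) A2(1) A3(1) A4(1) A5(1) A6(1) A7(1) C0 Cm C by (simp add: K_def)
  have "amalgam_norm \<Phi> p q m (functional_of (wigner \<tau> f1 f2))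
    \<le> ennreal K * modulation_norm \<phi> p1 q1 m1 (functional_of f1) * modulation_norm \<phi> p2 q2 m2 (functional_of f2)"
    if f: "schwartz f1" "schwartz f2" for f1 f2
  proof -
    note tf = schwartz_tame[OF f(1)] schwartz_tame[OF f(2)]
    define G where "G = ambiguity \<tau> f1 f2"
    have G: "tame G" unfolding G_def by (rule tame_ambiguity[OF f \<tau>])
    define F1 F2 where "F1 = peetre N (stf_abs \<phi> f1)" and "F2 = peetre N (stf_abs \<phi> f2)"
    define H where "H = (\<lambda>(k, n). F1 (j1 (k, n)) * F2 (dil s t (j2 (k, n))))"
    define Q where "Q v = ennreal C0 * H (lat_floor (T1 v), lat_floor (T2 (snd v)))" for v
    have PQ: "stf_abs \<Phi>0 G w \<le> Q (lat_floor w)" for w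
    proof -
      let ?v = "(lat_floor (T1 (lat_floor w)), lat_floor (T2 (snd (lat_floor w))))"
      have "stf_abs \<phi> f1 (arg1 \<tau> w) \<le> F1 (arg1 \<tau> w)" unfolding F1_def by (rule le_peetre)
      also have "\<dots> \<le> ennreal ((1 + b1 * d) ^ N) * F1 (j1 ?v)"
        unfolding F1_def args by (intro peetre_near order_trans[OF b1(2)] mult_left_mono near b1(1))
      finally have 1: "stf_abs \<phi> f1 (arg1 \<tau> w) \<le> ennreal ((1 + b1 * d) ^ N) * F1 (j1 ?v)" .
      have "stf_abs \<phi> f2 (arg2 \<tau> w) \<le> F2 (arg2 \<tau> w)" unfolding F2_def by (rule le_peetre)
      also have "\<dots> \<le> ennreal ((1 + b2 * d) ^ N) * F2 (dil s t (j2 ?v))"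
        unfolding F2_def args by (intro peetre_near order_trans[OF b2(2)] mult_left_mono near b2(1))
      finally have 2: "stf_abs \<phi> f2 (arg2 \<tau> w) \<le> ennreal ((1 + b2 * d) ^ N) * F2 (dil s t (j2 ?v))" .
      have "stf_abs \<Phi>0 G w = stf_abs \<phi> f1 (arg1 \<tau> w) * stf_abs \<phi> f2 (arg2 \<tau> w)"
        unfolding \<Phi>0_def G_def by (rule stf_abs_ambiguity[OF f \<phi>(1) \<tau>])
      also have "\<dots> \<le> (ennreal ((1 + b1 * d) ^ N) * F1 (j1 ?v)) * (ennreal ((1 + b2 * d) ^ N) * F2 (dil s t (j2 ?v)))"
        by (rule mult_mono[OF 1 2]) auto
      also have "\<dots> = Q (lat_floor w)"
        using b1(1) b2(1) d by (simp add: Q_def H_def C0_def ennreal_mult' mult_ac)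
      finally show ?thesis .
    qed
    \<comment> \<open>Maximal functions of the transforms are finite, so their samples form complex
      sequences and \<open>enn2real\<close> loses nothing.\<close>
    define a b where "a k = complex_of_real (enn2real (F1 (lattice_point k)))" and "b k = complex_of_real (enn2real (F2 (dil s t (lattice_point k))))" for k
    have fin: "F1 z < \<top>" "F2 z < \<top>" for z
      unfolding F1_def F2_def using peetre_stf_finite[OF tf(1) t\<phi>] peetre_stf_finite[OF tf(2) t\<phi>] by auto
    have ab: "ennreal (cmod (a k)) = F1 (lattice_point k)" "ennreal (cmod (b k)) = F2 (dil s t (lattice_point k))" for k
      using fin by (simp_all add: a_def b_def ennreal_enn2real)
    have disc: "lattice_norm p q (one_tensor (\<lambda>z. m (Y z))) H = lpq_norm p q (one_tensor ((\<lambda>z. m (Y z)) \<circ> lattice_point)) (\<lambda>(k, n). a (J1 (k, n)) * b (J2 (k, n)))"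
      unfolding lpq_norm_one_tensor_eq[OF p(5,6)] lattice_norm_def
    proof (rule mixed_norm_cong[OF p(5,6)])
      fix x \<xi> :: "(real ^ 'd) \<times> (real ^ 'd)"
      assume "x \<in> space (count_space int_lattice)" "\<xi> \<in> space (count_space int_lattice)"
      then show "H (x, \<xi>) * ennreal (one_tensor (\<lambda>z. m (Y z)) (x, \<xi>)) = (case (x, \<xi>) of (x, \<xi>) \<Rightarrow>
         ennreal (cmod (case (lattice_index x, lattice_index \<xi>) of (k, n) \<Rightarrow> a (J1 (k, n)) * b (J2 (k, n))))) * ennreal (one_tensor (\<lambda>z. m (Y z)) (x, \<xi>))"
        by (simp add: H_def norm_mult ennreal_mult' ab J lattice_point_index)
    qed
    have na: "lpq_norm p1 q1 (m1 \<circ> lattice_point) a = lattice_norm p1 q1 m1 F1"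
      unfolding lpq_norm_eq_lattice_norm[OF p(1,3)] lattice_norm_def
      by (rule mixed_norm_cong[OF p(1,3)]) (simp add: ab lattice_point_index int_lattice_Times)
    have nb: "lpq_norm p2 q2 ((\<lambda>z. m2 (dil s t z)) \<circ> lattice_point) b = lattice_norm p2 q2 (\<lambda>z. m2 (dil s t z)) (\<lambda>z. F2 (dil s t z))"
      unfolding lpq_norm_eq_lattice_norm[OF p(2,4)] lattice_norm_def
      by (rule mixed_norm_cong[OF p(2,4)]) (simp add: ab lattice_point_index int_lattice_Times)
    have Qn: "lattice_norm p q ?m Q \<le> ennreal (C0 * Cm) * (ennreal A7 * lattice_norm p q (one_tensor (\<lambda>z. m (Y z))) H)"
    proof -
      define W where "W z = H z * ennreal (one_tensor (\<lambda>z. m (Y z)) z)" for z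
      have "lattice_norm p q ?m Q \<le> mixed_norm p q (count_space int_lattice) (count_space int_lattice)
        (\<lambda>z. ennreal (C0 * Cm) * (\<lambda>(x, y). W (lat_floor (T1 (x, y)), lat_floor (T2 y))) z)"
        unfolding lattice_norm_def
      proof (rule mixed_norm_mono[OF p(5,6)])
        fix x \<xi> :: "(real ^ 'd) \<times> (real ^ 'd)"
        have "Q (x, \<xi>) * ennreal (?m (x, \<xi>)) \<le> Q (x, \<xi>) * ennreal (Cm * m (Y (lat_floor (T2 \<xi>))))"
          by (intro mult_left_mono ennreal_leI) (simp_all add: one_tensor_def weight)
        also have "\<dots> = ennreal (C0 * Cm) * W (lat_floor (T1 (x, \<xi>)), lat_floor (T2 \<xi>))"
          using C0 Cm by (simp add: Q_def W_def one_tensor_def ennreal_mult' mult_ac)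
        finally show "Q (x, \<xi>) * ennreal (?m (x, \<xi>)) \<le> ennreal (C0 * Cm) * (case (x, \<xi>) of (x, y) \<Rightarrow> W (lat_floor (T1 (x, y)), lat_floor (T2 y)))"
          by simp
      qed
      also have "\<dots> \<le> ennreal (C0 * Cm) * (ennreal A7 * mixed_norm p q (count_space int_lattice) (count_space int_lattice) W)"
        unfolding mixed_norm_cmult[OF p(5,6)] by (intro mult_left_mono A7(2)) simp
      finally show ?thesis by (simp add: lattice_norm_def W_def[abs_def])
    qed
    have "amalgam_norm \<Phi> p q m (functional_of (wigner \<tau> f1 f2)) = modulation_norm \<Phi> p q ?m (functional_of G)"
      unfolding G_def by (rule amalgam_norm_wigner[OF f \<tau> \<Phi>])
    also have "\<dots> \<le> ennreal A4 * lattice_norm p q ?m (peetre N (stf_abs \<Phi> G))" by (rule A4(2))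
    also have "\<dots> \<le> ennreal A4 * lattice_norm p q ?m (\<lambda>z. ennreal (A5 * (1 + ?D) ^ N) * peetre N (\<lambda>w. if w \<in> int_lattice then Q w else 0) z)"
    proof (intro mult_left_mono lattice_norm_mono[OF p(5,6)])
      fix z
      have "peetre N (stf_abs \<Phi> G) z \<le> ennreal A5 * peetre N (stf_abs \<Phi>0 G) z" by (rule A5(2)[OF G])
      also have "\<dots> \<le> ennreal A5 * (ennreal ((1 + ?D) ^ N) * peetre N (\<lambda>w. if w \<in> int_lattice then Q w else 0) z)"
        by (intro mult_left_mono peetre_le_cells PQ) simp
      finally show "peetre N (stf_abs \<Phi> G) z \<le> ennreal (A5 * (1 + ?D) ^ N) * peetre N (\<lambda>w. if w \<in> int_lattice then Q w else 0) z"
        by (simp add: ennreal_mult'[OF A5(1)] mult.assoc)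
    qed simp
    also have "\<dots> \<le> ennreal A4 * (ennreal (A5 * (1 + ?D) ^ N) * (ennreal A3 * (ennreal (C0 * Cm) * (ennreal A7 * (ennreal C
      * (ennreal A1 * modulation_norm \<phi> p1 q1 m1 (functional_of f1))
      * (ennreal A6 * (ennreal A2 * modulation_norm \<phi> p2 q2 m2 (functional_of f2))))))))"
      unfolding lattice_norm_cmult[OF p(5,6)]
    proof (intro mult_left_mono order_trans[OF A3(2)] order_trans[OF Qn])
      have "lattice_norm p q (one_tensor (\<lambda>z. m (Y z))) H \<le> ennreal C * lattice_norm p1 q1 m1 F1 * lattice_norm p2 q2 (\<lambda>z. m2 (dil s t z)) (\<lambda>z. F2 (dil s t z))"
        unfolding disc using discrete[of a b] unfolding na nb .
      also have "\<dots> \<le> ennreal C * (ennreal A1 * modulation_norm \<phi> p1 q1 m1 (functional_of f1)) * (ennreal A6 * (ennreal A2 * modulation_norm \<phi> p2 q2 m2 (functional_of f2)))"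
        unfolding F1_def F2_def
        by (intro mult_mono mult_left_mono A1(2) tf order_trans[OF A6(2)] A2(2)) auto
      finally show "lattice_norm p q (one_tensor (\<lambda>z. m (Y z))) H \<le> \<dots>" .
    qed auto
    also have "\<dots> = ennreal K * modulation_norm \<phi> p1 q1 m1 (functional_of f1) * modulation_norm \<phi> p2 q2 m2 (functional_of f2)"
      using A1(1) A2(1) A3(1) A4(1) A5(1) A6(1) A7(1) C0 Cm C by (simp add: K_def ennreal_mult' mult_ac)
    finally show ?thesis .
  qed
  \<comment> \<open>\<open>wigner_bounded\<close> demands a positive constant, whereas
    \<open>K\<close> may be 0.\<close>
  then have "amalgam_norm \<Phi> p q m (functional_of (wigner \<tau> f1 f2))
    \<le> ennreal (K + 1) * modulation_norm \<phi> p1 q1 m1 (functional_of f1) * modulation_norm \<phi> p2 q2 m2 (functional_of f2)"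
    if f: "schwartz f1" "schwartz f2" for f1 f2
    using f by (meson ennreal_leI le_add_same_cancel1 mult_right_mono order_trans zero_le zero_le_one)
  then show ?thesis
    unfolding wigner_bounded_def using K by (intro exI[of _ "K + 1"]) auto
qed

text \<open>The functions synthesised from \<open>a\<close> and \<open>b\<close> have maximal
  functions bounded by those of the sequences, hence controlled norms, while their transforms
  dominate the sequences near the nodes. Finite support keeps the functions Schwartz, and the
  constants do not depend on the support.\<close>

lemma discrete_of_wigner_bounded_finite:
  fixes m m1 m2 :: "(real ^ 'd) \<times> (real ^ 'd) \<Rightarrow> real" and \<phi> :: "real ^ 'd \<Rightarrow> complex"
  assumes ac: "adapted_coordinates \<tau> s t j1 j2 X Y T1 T2 J1 J2"
    and p: "0 < p1" "0 < p2" "0 < q1" "0 < q2" "0 < p" "0 < q"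
    and m: "poly_moderate m" "poly_moderate m1" "poly_moderate m2"
    and \<phi>: "schwartz \<phi>" "\<phi> \<noteq> (\<lambda>_. 0)" and \<Phi>: "schwartz \<Phi>" "\<Phi> \<noteq> (\<lambda>_. 0)"
    and bounded: "wigner_bounded \<tau> (modulation_norm \<phi> p1 q1 m1) (modulation_norm \<phi> p2 q2 m2) (amalgam_norm \<Phi> p q m)"
  shows "\<exists>C\<ge>0. \<forall>a b. finite {k. a k \<noteq> 0} \<longrightarrow> finite {k. b k \<noteq> 0} \<longrightarrow>
    lpq_norm p q (one_tensor ((\<lambda>z. m (Y z)) \<circ> lattice_point)) (\<lambda>(k, n). a (J1 (k, n)) * b (J2 (k, n)))
      \<le> ennreal C * lpq_norm p1 q1 (m1 \<circ> lattice_point) a * lpq_norm p2 q2 ((\<lambda>z. m2 (dil s t z)) \<circ> lattice_point) b"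
proof -
  have \<tau>: "0 \<le> \<tau>" "\<tau> \<le> 1" and st: "s \<noteq> 0" "t \<noteq> 0" and lin: "linear X" "linear Y"
    and J: "\<And>k n. lattice_point (J1 (k, n)) = j1 (lattice_point k, lattice_point n)"
      "\<And>k n. lattice_point (J2 (k, n)) = j2 (lattice_point k, lattice_point n)"
    and inv: "\<And>k n. args_inv \<tau> (j1 (k, n), dil s t (j2 (k, n))) = (X (k, n), Y n)"
    and inj: "\<And>k. X (k, 0) = 0 \<Longrightarrow> k = 0" "\<And>n. Y n = 0 \<Longrightarrow> n = 0"
    using ac unfolding adapted_coordinates_def by (elim conjE, fast)+
  note t\<phi> = schwartz_tame[OF \<phi>(1)] and t\<Phi> = schwartz_tame[OF \<Phi>(1)]
  define \<Phi>0 where "\<Phi>0 = ambiguity \<tau> \<phi> \<phi>"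
  have \<Phi>0: "tame \<Phi>0" unfolding \<Phi>0_def by (rule tame_ambiguity[OF \<phi>(1) \<phi>(1) \<tau>])
  let ?m = "one_tensor m :: ((real ^ 'd) \<times> (real ^ 'd)) \<times> ((real ^ 'd) \<times> (real ^ 'd)) \<Rightarrow> real"
  let ?m2 = "\<lambda>z. m2 (dil s t z)" and ?inv = "dil (1 / s) (1 / t) :: (real ^ 'd) \<times> (real ^ 'd) \<Rightarrow> _"
  have pm: "poly_moderate ?m" by (rule poly_moderate_one_tensor[OF m(1)])
  have pm2: "poly_moderate ?m2" by (rule poly_moderate_linear[OF m(3) linear_dil])
  obtain N1 where N1: "moderate_degree N1 m1" using m(2) by (auto simp: poly_moderate_def)
  obtain N2 where N2: "moderate_degree N2 ?m2" using pm2 by (auto simp: poly_moderate_def)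
  obtain M1 where M1: "\<And>N. M1 \<le> N \<Longrightarrow> \<exists>C\<ge>0. \<forall>F.
    lattice_norm p1 q1 m1 (peetre N (\<lambda>z. if z \<in> int_lattice then F z else 0)) \<le> ennreal C * lattice_norm p1 q1 m1 F"
    using lattice_norm_peetre_lattice[OF p(1,3), of N1] N1 by blast
  obtain M2 where M2: "\<And>N. M2 \<le> N \<Longrightarrow> \<exists>C\<ge>0. \<forall>F.
    lattice_norm p2 q2 ?m2 (peetre N (\<lambda>z. if z \<in> int_lattice then F z else 0)) \<le> ennreal C * lattice_norm p2 q2 ?m2 F"
    using lattice_norm_peetre_lattice[OF p(2,4), of N2] N2 by blast
  obtain M3 where M3: "\<And>N. M3 \<le> N \<Longrightarrow> \<exists>C\<ge>0. \<forall>f. tame f \<longrightarrow>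
    lattice_norm p q ?m (peetre N (stf_abs \<Phi> f)) \<le> ennreal C * modulation_norm \<Phi> p q ?m (functional_of f)"
    using lattice_norm_le_modulation_norm[OF p(5,6) pm t\<Phi> \<Phi>(2)] by blast
  define N where "N = M1 + M2 + M3"
  have NM: "M1 \<le> N" "M2 \<le> N" "M3 \<le> N" by (simp_all add: N_def)
  obtain A1 where A1: "0 \<le> A1" "\<And>F. lattice_norm p1 q1 m1 (peetre N (\<lambda>z. if z \<in> int_lattice then F z else 0)) \<le> ennreal A1 * lattice_norm p1 q1 m1 F"
    using M1[OF NM(1)] by blast
  obtain A2 where A2: "0 \<le> A2" "\<And>F. lattice_norm p2 q2 ?m2 (peetre N (\<lambda>z. if z \<in> int_lattice then F z else 0)) \<le> ennreal A2 * lattice_norm p2 q2 ?m2 F"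
    using M2[OF NM(2)] by blast
  obtain A3 where A3: "0 \<le> A3" "\<And>f. tame f \<Longrightarrow> lattice_norm p q ?m (peetre N (stf_abs \<Phi> f)) \<le> ennreal A3 * modulation_norm \<Phi> p q ?m (functional_of f)"
    using M3[OF NM(3)] by blast
  obtain A4 where A4: "0 \<le> A4" "\<And>f z. tame f \<Longrightarrow> peetre N (stf_abs \<Phi>0 f) z \<le> ennreal A4 * peetre N (stf_abs \<Phi> f) z"
    using peetre_stf_window_change[OF t\<Phi> \<Phi>(2) \<Phi>0, of N] by blast
  obtain A5 where A5: "0 \<le> A5" "\<And>f. modulation_norm \<phi> p1 q1 m1 (functional_of f) \<le> ennreal A5 * lattice_norm p1 q1 m1 (peetre N (stf_abs \<phi> f))"
    using modulation_norm_le_lattice_norm[OF p(1,3) m(2), of N] by blast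
  obtain A6 where A6: "0 \<le> A6" "\<And>f. modulation_norm \<phi> p2 q2 m2 (functional_of f) \<le> ennreal A6 * lattice_norm p2 q2 m2 (peetre N (stf_abs \<phi> f))"
    using modulation_norm_le_lattice_norm[OF p(2,4) m(3), of N] by blast
  obtain A7 where A7: "0 \<le> A7" "\<And>F. lattice_norm p q (\<lambda>(x, y). ?m (X (x, y), Y y)) (\<lambda>(x, y). peetre N F (X (x, y), Y y)) \<le> ennreal A7 * lattice_norm p q ?m (peetre N F)"
    using mixed_norm_peetre_linear[OF p(5,6) pm lin inj, of N] by blast
  obtain A8 where A8: "0 \<le> A8" "\<And>F. lattice_norm p2 q2 m2 (\<lambda>z. peetre N F (?inv z)) \<le> ennreal A8 * lattice_norm p2 q2 ?m2 (peetre N F)"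
    using lattice_norm_dil[OF p(2,4) pm2, of "1 / s" "1 / t" N] st by (auto simp: dil_inverse)
  obtain S1 where S1: "0 \<le> S1" "\<And>\<alpha>. finite {y. \<alpha> y \<noteq> 0} \<Longrightarrow> \<forall>y. \<alpha> y < \<top> \<Longrightarrow> \<exists>f. schwartz f \<and>
    (\<forall>z. stf_abs \<phi> f z \<le> ennreal S1 * peetre N \<alpha> z) \<and> (\<forall>y. \<exists>y'. norm (y - y') \<le> S1 \<and> \<alpha> y \<le> ennreal S1 * stf_abs \<phi> f y')"
    using synthesis[OF \<phi>, of "\<lambda>z. z" "\<lambda>z. z" N] by (auto simp: linear_iff)
  \<comment> \<open>The second function is built on the dilated lattice, since its transform is
    evaluated near the points \<open>dil s t (j2 (k, n))\<close>.\<close>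
  obtain S2 where S2: "0 \<le> S2" "\<And>\<alpha>. finite {y. \<alpha> y \<noteq> 0} \<Longrightarrow> \<forall>y. \<alpha> y < \<top> \<Longrightarrow> \<exists>f. schwartz f \<and>
    (\<forall>z. stf_abs \<phi> f z \<le> ennreal S2 * peetre N \<alpha> (?inv z)) \<and> (\<forall>y. \<exists>y'. norm (y - y') \<le> S2 \<and> \<alpha> y \<le> ennreal S2 * stf_abs \<phi> f (dil s t y'))"
    using synthesis[OF \<phi> linear_dil dil_inverse[OF st], of N] by blast
  obtain bU where bU: "0 \<le> bU" "\<And>x y. norm (args_inv \<tau> x - args_inv \<tau> y) \<le> bU * norm (x - y :: ((real ^ 'd) \<times> (real ^ 'd)) \<times> ((real ^ 'd) \<times> (real ^ 'd)))"
    using linear_bound[OF linear_args_inv] by blast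
  obtain bB where bB: "0 \<le> bB" "\<And>x y. norm (dil s t x - dil s t y) \<le> bB * norm (x - y :: (real ^ 'd) \<times> (real ^ 'd))" using linear_bound[OF linear_dil] by blast
  obtain bi where bi: "0 \<le> bi" "\<And>x y. norm (?inv x - ?inv y) \<le> bi * norm (x - y)" using linear_bound[OF linear_dil] by blast
  obtain C0 where C0: "0 < C0" "\<And>f1 f2. schwartz f1 \<Longrightarrow> schwartz f2 \<Longrightarrow> amalgam_norm \<Phi> p q m (functional_of (wigner \<tau> f1 f2))
      \<le> ennreal C0 * modulation_norm \<phi> p1 q1 m1 (functional_of f1) * modulation_norm \<phi> p2 q2 m2 (functional_of f2)"
    using bounded unfolding wigner_bounded_def by blast
  define d where "d = bU * (S1 + bB * S2)"
  have d: "0 \<le> d" using bU(1) bB(1) S1(1) S2(1) by (simp add: d_def)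
  define Kp where "Kp = S1 * S2 * (1 + d) ^ N"
  have Kp: "0 \<le> Kp" using S1(1) S2(1) d by (simp add: Kp_def)
  define K1 where "K1 = A5 * S1 * A1"
  define K2 where "K2 = A6 * (S2 * (1 + bi) ^ N) * A8 * A2"
  define K where "K = Kp * A7 * A4 * A3 * C0 * K1 * K2"
  have K12: "0 \<le> K1" "0 \<le> K2" using A1(1) A2(1) A5(1) A6(1) A8(1) S1(1) S2(1) bi(1) by (simp_all add: K1_def K2_def)
  have K: "0 \<le> K" using K12 Kp A3(1) A4(1) A7(1) C0(1) by (simp add: K_def)
  have "lpq_norm p q (one_tensor ((\<lambda>z. m (Y z)) \<circ> lattice_point)) (\<lambda>(k, n). a (J1 (k, n)) * b (J2 (k, n)))
      \<le> ennreal K * lpq_norm p1 q1 (m1 \<circ> lattice_point) a * lpq_norm p2 q2 (?m2 \<circ> lattice_point) b"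
    if fin: "finite {k. a k \<noteq> 0}" "finite {k. b k \<noteq> 0}" for a b
  proof -
    define \<alpha> \<beta> where "\<alpha> z = (if z \<in> int_lattice then ennreal (cmod (a (lattice_index z))) else 0)"
      and "\<beta> z = (if z \<in> int_lattice then ennreal (cmod (b (lattice_index z))) else 0)" for z
    have fin\<alpha>: "finite {z. \<alpha> z \<noteq> 0}" "finite {z. \<beta> z \<noteq> 0}"
    proof -
      have "{z. (if z \<in> int_lattice then ennreal (cmod (c (lattice_index z))) else 0) \<noteq> 0} \<subseteq> lattice_point ` {k. c k \<noteq> 0}" for c
      proof
        fix z assume "z \<in> {z. (if z \<in> int_lattice then ennreal (cmod (c (lattice_index z))) else 0) \<noteq> 0}"
        then have "z \<in> int_lattice" "c (lattice_index z) \<noteq> 0" by (simp_all split: if_splits)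
        then show "z \<in> lattice_point ` {k. c k \<noteq> 0}"
          by (intro image_eqI[where x = "lattice_index z"]) (simp_all only: lattice_point_index mem_Collect_eq not_False_eq_True)
      qed
      note this[of a, folded \<alpha>_def] this[of b, folded \<beta>_def]
      then show "finite {z. \<alpha> z \<noteq> 0}" "finite {z. \<beta> z \<noteq> 0}" using fin by (auto intro: finite_subset)
    qed
    have top: "\<forall>z. \<alpha> z < \<top>" "\<forall>z. \<beta> z < \<top>" by (simp_all add: \<alpha>_def \<beta>_def)
    obtain f1 where f1: "schwartz f1" "\<And>z. stf_abs \<phi> f1 z \<le> ennreal S1 * peetre N \<alpha> z"
      "\<And>y. \<exists>y'. norm (y - y') \<le> S1 \<and> \<alpha> y \<le> ennreal S1 * stf_abs \<phi> f1 y'"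
      using S1(2)[OF fin\<alpha>(1) top(1)] by blast
    obtain f2 where f2: "schwartz f2" "\<And>z. stf_abs \<phi> f2 z \<le> ennreal S2 * peetre N \<beta> (?inv z)"
      "\<And>y. \<exists>y'. norm (y - y') \<le> S2 \<and> \<beta> y \<le> ennreal S2 * stf_abs \<phi> f2 (dil s t y')"
      using S2(2)[OF fin\<alpha>(2) top(2)] by blast
    define G where "G = ambiguity \<tau> f1 f2"
    have G: "tame G" unfolding G_def by (rule tame_ambiguity[OF f1(1) f2(1) \<tau>])
    define P where "P = stf_abs \<Phi>0 G"
    have point: "\<alpha> (j1 (x, \<xi>)) * \<beta> (j2 (x, \<xi>)) \<le> ennreal Kp * peetre N P (X (x, \<xi>), Y \<xi>)" for x \<xi>
    proof -
      obtain y where y: "norm (j1 (x, \<xi>) - y) \<le> S1" "\<alpha> (j1 (x, \<xi>)) \<le> ennreal S1 * stf_abs \<phi> f1 y" using f1(3) by blast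
      obtain y' where y': "norm (j2 (x, \<xi>) - y') \<le> S2" "\<beta> (j2 (x, \<xi>)) \<le> ennreal S2 * stf_abs \<phi> f2 (dil s t y')" using f2(3) by blast
      \<comment> \<open>The synthesis dominates each sequence only at a point near its node.
        \<open>args_inv\<close> turns the two displaced points into one point \<open>w\<close>, and
        the maximal function of the ambiguity transform absorbs the bounded displacement.\<close>
      define w where "w = args_inv \<tau> (y, dil s t y')"
      have Pw: "P w = stf_abs \<phi> f1 y * stf_abs \<phi> f2 (dil s t y')"
        unfolding P_def \<Phi>0_def G_def stf_abs_ambiguity[OF f1(1) f2(1) \<phi>(1) \<tau>] by (simp add: w_def args_inv)
      have "norm ((X (x, \<xi>), Y \<xi>) - w) \<le> bU * norm ((j1 (x, \<xi>), dil s t (j2 (x, \<xi>))) - (y, dil s t y'))"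
        unfolding inv[symmetric] w_def by (rule bU(2))
      also have "\<dots> \<le> bU * (norm (j1 (x, \<xi>) - y) + norm (dil s t (j2 (x, \<xi>)) - dil s t y'))"
        unfolding diff_Pair by (intro mult_left_mono norm_Pair_le_add bU(1))
      also have "\<dots> \<le> bU * (S1 + bB * S2)"
        using y(1) y'(1) bU(1) bB(1) by (intro mult_left_mono add_mono order_trans[OF bB(2)]) auto
      finally have near: "norm ((X (x, \<xi>), Y \<xi>) - w) \<le> d" by (simp only: d_def)
      have "\<alpha> (j1 (x, \<xi>)) * \<beta> (j2 (x, \<xi>)) \<le> (ennreal S1 * stf_abs \<phi> f1 y) * (ennreal S2 * stf_abs \<phi> f2 (dil s t y'))"
        by (intro mult_mono y(2) y'(2)) auto
      also have "\<dots> = ennreal (S1 * S2) * P w"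
        using S1(1) S2(1) by (simp add: Pw ennreal_mult' mult_ac)
      also have "\<dots> \<le> ennreal (S1 * S2) * (ennreal ((1 + d) ^ N) * peetre N P (X (x, \<xi>), Y \<xi>))"
        by (intro mult_left_mono order_trans[OF le_peetre peetre_near] near) simp
      also have "\<dots> = ennreal Kp * peetre N P (X (x, \<xi>), Y \<xi>)"
        using S1(1) S2(1) by (simp add: Kp_def ennreal_mult' mult.assoc)
      finally show ?thesis .
    qed
    have norm1: "modulation_norm \<phi> p1 q1 m1 (functional_of f1) \<le> ennreal K1 * lpq_norm p1 q1 (m1 \<circ> lattice_point) a"
    proof -
      have "peetre N (stf_abs \<phi> f1) z \<le> ennreal S1 * peetre N \<alpha> z" for z
        using peetre_mono[of "stf_abs \<phi> f1" "\<lambda>z. ennreal S1 * peetre N \<alpha> z" N z] f1(2) by (simp add: peetre_cmult peetre_peetre)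
      then have "lattice_norm p1 q1 m1 (peetre N (stf_abs \<phi> f1)) \<le> ennreal S1 * lattice_norm p1 q1 m1 (peetre N \<alpha>)"
        unfolding lattice_norm_cmult[OF p(1,3), symmetric] by (intro lattice_norm_mono[OF p(1,3)])
      also have "\<dots> \<le> ennreal S1 * (ennreal A1 * lpq_norm p1 q1 (m1 \<circ> lattice_point) a)"
        unfolding \<alpha>_def[abs_def] lpq_norm_eq_lattice_norm[OF p(1,3)] by (intro mult_left_mono A1(2)) simp
      finally have "ennreal A5 * lattice_norm p1 q1 m1 (peetre N (stf_abs \<phi> f1))
        \<le> ennreal A5 * (ennreal S1 * (ennreal A1 * lpq_norm p1 q1 (m1 \<circ> lattice_point) a))" by (rule mult_left_mono) simp
      also have "\<dots> = ennreal K1 * lpq_norm p1 q1 (m1 \<circ> lattice_point) a"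
        using A5(1) S1(1) A1(1) by (simp add: K1_def ennreal_mult' mult.assoc)
      finally show ?thesis using A5(2)[of f1] by (rule order_trans[rotated])
    qed
    have norm2: "modulation_norm \<phi> p2 q2 m2 (functional_of f2) \<le> ennreal K2 * lpq_norm p2 q2 (?m2 \<circ> lattice_point) b"
    proof -
      \<comment> \<open>The bound for \<open>f2\<close> is expressed in dilated coordinates and the
        maximal function in the original ones; as the inverse dilation is Lipschitz, only a constant
        is lost.\<close>
      have "peetre N (stf_abs \<phi> f2) z \<le> ennreal (S2 * (1 + bi) ^ N) * peetre N \<beta> (?inv z)" for z
      proof (rule peetre_least)
        fix w
        have "decay N (z - w) \<le> (1 + bi) ^ N * decay N (?inv z - ?inv w)"
        proof (rule decay_le_scaled)
          have "1 + norm (?inv z - ?inv w) \<le> 1 + bi * norm (z - w)" using bi(2)[of z w] by simp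
          also have "\<dots> \<le> (1 + bi) * (1 + norm (z - w))" using bi(1) by (simp add: algebra_simps)
          finally show "1 + norm (?inv z - ?inv w) \<le> (1 + bi) * (1 + norm (z - w))" .
        qed
        then have "stf_abs \<phi> f2 w * ennreal (decay N (z - w)) \<le> (ennreal S2 * peetre N \<beta> (?inv w)) * ennreal ((1 + bi) ^ N * decay N (?inv z - ?inv w))"
          by (intro mult_mono f2(2) ennreal_leI) auto
        also have "\<dots> = ennreal (S2 * (1 + bi) ^ N) * (peetre N \<beta> (?inv w) * ennreal (decay N (?inv z - ?inv w)))"
          using S2(1) bi(1) by (simp add: ennreal_mult' mult_ac)
        also have "\<dots> \<le> ennreal (S2 * (1 + bi) ^ N) * peetre N \<beta> (?inv z)"
          by (intro mult_left_mono peetre_decay) simp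
        finally show "stf_abs \<phi> f2 w * ennreal (decay N (z - w)) \<le> ennreal (S2 * (1 + bi) ^ N) * peetre N \<beta> (?inv z)" .
      qed
      then have "lattice_norm p2 q2 m2 (peetre N (stf_abs \<phi> f2)) \<le> ennreal (S2 * (1 + bi) ^ N) * lattice_norm p2 q2 m2 (\<lambda>z. peetre N \<beta> (?inv z))"
        unfolding lattice_norm_cmult[OF p(2,4), symmetric] by (intro lattice_norm_mono[OF p(2,4)])
      also have "\<dots> \<le> ennreal (S2 * (1 + bi) ^ N) * (ennreal A8 * (ennreal A2 * lpq_norm p2 q2 (?m2 \<circ> lattice_point) b))"
        unfolding \<beta>_def[abs_def] lpq_norm_eq_lattice_norm[OF p(2,4)] by (intro mult_left_mono order_trans[OF A8(2)] A2(2)) auto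
      finally have "ennreal A6 * lattice_norm p2 q2 m2 (peetre N (stf_abs \<phi> f2))
        \<le> ennreal A6 * (ennreal (S2 * (1 + bi) ^ N) * (ennreal A8 * (ennreal A2 * lpq_norm p2 q2 (?m2 \<circ> lattice_point) b)))" by (rule mult_left_mono) simp
      also have "\<dots> = ennreal K2 * lpq_norm p2 q2 (?m2 \<circ> lattice_point) b"
        using A6(1) S2(1) A8(1) A2(1) bi(1) by (simp add: K2_def ennreal_mult' mult.assoc)
      finally show ?thesis using A6(2)[of f2] by (rule order_trans[rotated])
    qed
    have "lpq_norm p q (one_tensor ((\<lambda>z. m (Y z)) \<circ> lattice_point)) (\<lambda>(k, n). a (J1 (k, n)) * b (J2 (k, n)))
      \<le> lattice_norm p q (\<lambda>(x, y). ?m (X (x, y), Y y)) (\<lambda>z. ennreal Kp * (\<lambda>(x, y). peetre N P (X (x, y), Y y)) z)"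
      unfolding lpq_norm_one_tensor_eq[OF p(5,6)] lattice_norm_def
    proof (rule mixed_norm_mono[OF p(5,6)])
      fix x \<xi> :: "(real ^ 'd) \<times> (real ^ 'd)"
      assume "x \<in> space (count_space int_lattice)" "\<xi> \<in> space (count_space int_lattice)"
      then have x: "x \<in> int_lattice" "\<xi> \<in> int_lattice" by auto
      define k n where "k = lattice_index x" and "n = lattice_index \<xi>"
      have kn: "lattice_point k = x" "lattice_point n = \<xi>" using x by (simp_all add: k_def n_def lattice_point_index)
      have "\<alpha> (lattice_point (J1 (k, n))) = ennreal (cmod (a (J1 (k, n))))" "\<beta> (lattice_point (J2 (k, n))) = ennreal (cmod (b (J2 (k, n))))"
        by (simp_all add: \<alpha>_def \<beta>_def)
      then have "ennreal (cmod (a (J1 (k, n)) * b (J2 (k, n)))) = \<alpha> (j1 (x, \<xi>)) * \<beta> (j2 (x, \<xi>))"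
        unfolding J kn by (simp add: norm_mult ennreal_mult')
      then have "ennreal (cmod (a (J1 (k, n)) * b (J2 (k, n)))) * ennreal (m (Y \<xi>)) \<le> (ennreal Kp * peetre N P (X (x, \<xi>), Y \<xi>)) * ennreal (m (Y \<xi>))"
        using point[of x \<xi>] by (intro mult_right_mono) auto
      then show "(case (x, \<xi>) of (x, \<xi>) \<Rightarrow> ennreal (cmod (case (lattice_index x, lattice_index \<xi>) of (k, n) \<Rightarrow> a (J1 (k, n)) * b (J2 (k, n))))) *
         ennreal (one_tensor (\<lambda>z. m (Y z)) (x, \<xi>))
        \<le> ennreal Kp * (case (x, \<xi>) of (x, y) \<Rightarrow> peetre N P (X (x, y), Y y)) * ennreal (case (x, \<xi>) of (x, y) \<Rightarrow> ?m (X (x, y), Y y))"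
        by (simp add: one_tensor_def k_def n_def)
    qed
    also have "\<dots> \<le> ennreal Kp * (ennreal A7 * (ennreal A4 * (ennreal A3 * (ennreal C0 * (ennreal K1 * lpq_norm p1 q1 (m1 \<circ> lattice_point) a)
        * (ennreal K2 * lpq_norm p2 q2 (?m2 \<circ> lattice_point) b)))))"
      unfolding lattice_norm_cmult[OF p(5,6)]
    proof (intro mult_left_mono order_trans[OF A7(2)])
      have "lattice_norm p q ?m (peetre N P) \<le> ennreal A4 * lattice_norm p q ?m (peetre N (stf_abs \<Phi> G))"
        unfolding lattice_norm_cmult[OF p(5,6), symmetric] P_def by (intro lattice_norm_mono[OF p(5,6)] A4(2) G)
      also have "\<dots> \<le> ennreal A4 * (ennreal A3 * modulation_norm \<Phi> p q ?m (functional_of G))"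
        by (intro mult_left_mono A3(2) G) simp
      also have "modulation_norm \<Phi> p q ?m (functional_of G) = amalgam_norm \<Phi> p q m (functional_of (wigner \<tau> f1 f2))"
        unfolding G_def by (rule amalgam_norm_wigner[OF f1(1) f2(1) \<tau> \<Phi>(1), symmetric])
      also have "ennreal A4 * (ennreal A3 * amalgam_norm \<Phi> p q m (functional_of (wigner \<tau> f1 f2)))
        \<le> ennreal A4 * (ennreal A3 * (ennreal C0 * (ennreal K1 * lpq_norm p1 q1 (m1 \<circ> lattice_point) a) * (ennreal K2 * lpq_norm p2 q2 (?m2 \<circ> lattice_point) b)))"
        by (intro mult_left_mono order_trans[OF C0(2)[OF f1(1) f2(1)]] mult_mono norm1 norm2) auto
      finally show "lattice_norm p q ?m (peetre N P) \<le> \<dots>" .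
    qed auto
    also have "\<dots> = ennreal K * lpq_norm p1 q1 (m1 \<circ> lattice_point) a * lpq_norm p2 q2 (?m2 \<circ> lattice_point) b"
      using K12 Kp A3(1) A4(1) A7(1) C0(1) by (simp add: K_def ennreal_mult' mult_ac)
    finally show ?thesis .
  qed
  with K show ?thesis by blast
qed

lemma lpq_norm_mono:
  assumes "0 < p" "0 < q" "\<And>i. 0 \<le> w i" "\<And>i. cmod (a i) \<le> cmod (b i)"
  shows "lpq_norm p q w a \<le> lpq_norm p q w b"
  unfolding lpq_norm_def using assms by (intro mixed_norm_mono ennreal_leI mult_right_mono) auto

lemma wigner_bounded_iff_discrete:
  fixes m m1 m2 :: "(real ^ 'd) \<times> (real ^ 'd) \<Rightarrow> real" and \<phi> :: "real ^ 'd \<Rightarrow> complex"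
  assumes ac: "adapted_coordinates \<tau> s t j1 j2 X Y T1 T2 J1 J2"
    and p: "0 < p1" "0 < p2" "0 < q1" "0 < q2" "0 < p" "0 < q"
    and m: "poly_moderate m" "poly_moderate m1" "poly_moderate m2"
    and \<phi>: "schwartz \<phi>" "\<phi> \<noteq> (\<lambda>_. 0)" and \<Phi>: "schwartz \<Phi>" "\<Phi> \<noteq> (\<lambda>_. 0)"
  shows "wigner_bounded \<tau> (modulation_norm \<phi> p1 q1 m1) (modulation_norm \<phi> p2 q2 m2) (amalgam_norm \<Phi> p q m) \<longleftrightarrow>
    (\<exists>C::real. C > 0 \<and> (\<forall>a b.
      lpq_norm p q (one_tensor ((\<lambda>z. m (Y z)) \<circ> lattice_point)) (\<lambda>(k, n). a (J1 (k, n)) * b (J2 (k, n)))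
      \<le> ennreal C * lpq_norm p1 q1 (m1 \<circ> lattice_point) a * lpq_norm p2 q2 ((\<lambda>z. m2 (dil s t z)) \<circ> lattice_point) b))"
    (is "?bounded \<longleftrightarrow> (\<exists>C. C > 0 \<and> (\<forall>a b. ?L a b \<le> ennreal C * ?A a * ?B b))")
proof
  assume "\<exists>C. C > 0 \<and> (\<forall>a b. ?L a b \<le> ennreal C * ?A a * ?B b)"
  then obtain C where C: "0 < C" "\<And>a b. ?L a b \<le> ennreal C * ?A a * ?B b" by blast
  show ?bounded
    by (rule wigner_bounded_of_discrete[OF ac p m \<phi> \<Phi>(1) less_imp_le[OF C(1)] C(2)])
next
  assume ?bounded
  then obtain C where C: "0 \<le> C" "\<And>a b. finite {k. a k \<noteq> 0} \<Longrightarrow> finite {k. b k \<noteq> 0} \<Longrightarrow> ?L a b \<le> ennreal C * ?A a * ?B b"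
    using discrete_of_wigner_bounded_finite[OF ac p m \<phi> \<Phi>] by blast
  have "?L a b \<le> ennreal (C + 1) * ?A a * ?B b" for a b
  proof -
    \<comment> \<open>Truncations along an enumeration of the index set. Both factors are truncated
      at the same stage, so the moduli of the products increase to those of the full
      sequences.\<close>
    define cut where "cut i c k = (if to_nat k < i then c k else 0)" for i and c :: "(int ^ 'd) \<times> (int ^ 'd) \<Rightarrow> complex" and k
    have fin: "finite {k. cut i c k \<noteq> 0}" for i c
    proof (rule finite_subset)
      show "{k. cut i c k \<noteq> 0} \<subseteq> to_nat -` {..<i}" by (auto simp: cut_def split: if_splits)
      show "finite (to_nat -` {..<i} :: ((int ^ 'd) \<times> (int ^ 'd)) set)" by (intro finite_vimageI) auto
    qed
    define w :: "((int ^ 'd) \<times> (int ^ 'd)) \<times> ((int ^ 'd) \<times> (int ^ 'd)) \<Rightarrow> real" where "w = one_tensor ((\<lambda>z. m (Y z)) \<circ> lattice_point)"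
    define g where "g i = (\<lambda>(k, n). ennreal (cmod (cut i a (J1 (k, n)) * cut i b (J2 (k, n))) * w (k, n)))" for i
    have w: "0 \<le> w z" for z
      using poly_moderate_nonneg[OF m(1)] by (simp add: w_def one_tensor_def case_prod_unfold)
    have "incseq g"
      using w by (auto simp: mono_def le_fun_def g_def cut_def intro!: ennreal_leI mult_right_mono)
    have sup: "(SUP i. g i z) = ennreal (cmod (case z of (k, n) \<Rightarrow> a (J1 (k, n)) * b (J2 (k, n))) * w z)" for z
    proof -
      obtain k n where z: "z = (k, n)" by (cases z)
      \<comment> \<open>From this stage on both factors are untruncated at the given index; the
        added 1 answers the strict inequality in \<open>cut\<close>.\<close>
      define i0 where "i0 = to_nat (J1 (k, n)) + to_nat (J2 (k, n)) + 1"
      show ?thesis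
      proof (rule antisym)
        show "(SUP i. g i z) \<le> ennreal (cmod (case z of (k, n) \<Rightarrow> a (J1 (k, n)) * b (J2 (k, n))) * w z)"
          using w by (intro SUP_least) (auto simp: g_def cut_def z intro!: ennreal_leI mult_right_mono)
        have "g i0 z = ennreal (cmod (case z of (k, n) \<Rightarrow> a (J1 (k, n)) * b (J2 (k, n))) * w z)"
          by (simp add: g_def cut_def z i0_def)
        then show "ennreal (cmod (case z of (k, n) \<Rightarrow> a (J1 (k, n)) * b (J2 (k, n))) * w z) \<le> (SUP i. g i z)"
          by (metis SUP_upper UNIV_I)
      qed
    qed
    have "?L a b = mixed_norm p q (count_space UNIV) (count_space UNIV) (\<lambda>z. SUP i. g i z)"
      unfolding lpq_norm_def sup w_def ..
    also have "\<dots> = (SUP i. mixed_norm p q (count_space UNIV) (count_space UNIV) (g i))"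
      by (rule mixed_norm_incseq[OF p(5,6) \<open>incseq g\<close>])
    also have "\<dots> \<le> ennreal (C + 1) * ?A a * ?B b"
    proof (rule SUP_least)
      fix i
      have "mixed_norm p q (count_space UNIV) (count_space UNIV) (g i) = ?L (cut i a) (cut i b)"
        unfolding lpq_norm_def w_def[symmetric] by (rule arg_cong[where f = "mixed_norm _ _ _ _"]) (auto simp: g_def fun_eq_iff)
      also have "\<dots> \<le> ennreal C * ?A (cut i a) * ?B (cut i b)" by (rule C(2)[OF fin fin])
      also have "\<dots> \<le> ennreal (C + 1) * ?A a * ?B b"
        by (intro mult_mono ennreal_leI lpq_norm_mono p) (auto simp: cut_def poly_moderate_nonneg[OF m(2)] poly_moderate_nonneg[OF m(3)])
      finally show "mixed_norm p q (count_space UNIV) (count_space UNIV) (g i) \<le> ennreal (C + 1) * ?A a * ?B b" .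
    qed
    finally show ?thesis .
  qed
  with C(1) show "\<exists>C. C > 0 \<and> (\<forall>a b. ?L a b \<le> ennreal C * ?A a * ?B b)" by (intro exI[of _ "C + 1"]) auto
qed

section \<open>Convolution form of the discrete condition\<close>

lemma Lp_norm_powr:
  assumes "0 < r" "0 < p" "p < \<top>"
  shows "Lp_norm (r / p) (count_space A) (\<lambda>x. ennpowr (f x) (enn2real p)) = ennpowr (Lp_norm r (count_space A) f) (enn2real p)"
proof (cases "r = \<top>")
  case True
  then show ?thesis
    using assms exponent_pos[of p] less_imp_neq[OF assms(3)] by (simp add: ennreal_top_divide Lp_norm_top_count_space ennpowr_SUP)
next
  case False
  then obtain a b where "r = ennreal a" "0 < a" "p = ennreal b" "0 < b"
    using assms by (cases r; cases p) auto
  then show ?thesis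
    by (simp add: divide_ennreal Lp_norm_count_space ennpowr_ennpowr)
qed

lemma lpq_norm_powr:
  assumes "0 < r" "0 < s" "0 < p" "p < \<top>" "\<And>i. 0 \<le> w i" "\<And>i. cmod (a' i) = cmod (a i) powr enn2real p"
  shows "lpq_norm (r / p) (s / p) (\<lambda>i. w i powr enn2real p) a' = ennpowr (lpq_norm r s w a) (enn2real p)"
proof -
  have "ennreal (cmod (a' i) * w i powr enn2real p) = ennpowr (ennreal (cmod (a i) * w i)) (enn2real p)" for i
    using assms(5)[of i] by (simp add: assms(6) ennpowr_ennreal powr_mult)
  then show ?thesis
    using assms(1-4) by (simp add: lpq_norm_def mixed_norm_def Lp_norm_powr)
qed

lemma mixed_norm_same_exponent:
  "0 < r \<Longrightarrow> mixed_norm r r (count_space UNIV) (count_space UNIV) F = Lp_norm r (count_space UNIV) F"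
proof (cases "r = \<top>")
  case True
  then show ?thesis
    by (auto simp: mixed_norm_def Lp_norm_top_count_space intro!: antisym SUP_least intro: SUP_upper2 SUP_upper)
next
  case False
  assume "0 < r"
  with False show ?thesis
    using exponent_pos[of r] nn_integral_snd_count_space[of "\<lambda>z. ennpowr (F z) (enn2real r)"]
    by (simp add: mixed_norm_def Lp_norm_count_space ennpowr_ennpowr)
qed

lemma Lp_norm_ge_point: "0 < r \<Longrightarrow> f x \<le> Lp_norm r (count_space UNIV) f"
proof (cases "r = \<top>")
  case True
  then show ?thesis by (simp add: Lp_norm_top_count_space SUP_upper)
next
  case False
  assume "0 < r"
  with False have r: "0 < enn2real r" by (simp add: exponent_pos)
  have "ennpowr (f x) (enn2real r) \<le> (\<integral>\<^sup>+x. ennpowr (f x) (enn2real r) \<partial>count_space UNIV)"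
    by (rule nn_integral_ge_point) simp
  with r False show ?thesis by (simp add: Lp_norm_count_space ennpowr_le_iff)
qed

lemma Lp_norm_delta:
  assumes "0 < r"
  shows "Lp_norm r (count_space UNIV) (\<lambda>x. if x = x0 then c else 0) = c"
proof (cases "r = \<top>")
  case True
  then show ?thesis
    by (auto simp: Lp_norm_top_count_space intro!: antisym SUP_least intro: SUP_upper2[of x0])
next
  case False
  have "(\<integral>\<^sup>+x. ennpowr (if x = x0 then c else 0) (enn2real r) \<partial>count_space UNIV) = ennpowr c (enn2real r)"
    by (subst nn_integral_count_space'[where A = "{x0}"]) auto
  then show ?thesis using False exponent_pos[OF assms] by (simp add: Lp_norm_count_space ennpowr_ennpowr)
qed

lemma lpq_norm_delta:
  assumes "0 < r" "0 < s" "\<And>i. 0 \<le> w i"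
  shows "lpq_norm r s w (\<lambda>k. if k = k0 then 1 else 0) = ennreal (w k0)"
proof (cases k0)
  case (Pair x0 y0)
  have "(\<lambda>x. ennreal (cmod (if (x, y) = (x0, y0) then 1 else 0) * w (x, y)))
      = (\<lambda>x. if x = x0 then (if y = y0 then ennreal (w (x0, y0)) else 0) else 0)" for y
    by (auto simp: fun_eq_iff)
  then show ?thesis
    using assms by (simp add: lpq_norm_def mixed_norm_def Lp_norm_delta Pair)
qed

lemma lpq_norm_eq_0D:
  assumes "lpq_norm r s w a = 0" "0 < r" "0 < s" "\<And>i. 0 < w i"
  shows "a k = 0"
proof (cases k)
  case (Pair x y)
  have "ennreal (cmod (a (x, y)) * w (x, y)) \<le> Lp_norm r (count_space UNIV) (\<lambda>x. ennreal (cmod (a (x, y)) * w (x, y)))"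
    by (rule Lp_norm_ge_point[OF assms(2)])
  also have "\<dots> \<le> lpq_norm r s w a"
    unfolding lpq_norm_def mixed_norm_def by (rule Lp_norm_ge_point[OF assms(3)])
  finally show ?thesis
    using assms(1) assms(4)[of "(x, y)"] by (simp add: Pair ennreal_eq_0_iff mult_le_0_iff)
qed

text \<open>The discrete norms are integrals over counting measure, whereas \<open>seq_conv\<close>
  is an unconditional sum; this is the passage from the former to the latter.\<close>

lemma summable_on_of_nn_integral:
  assumes "(\<integral>\<^sup>+k. ennreal (norm (f k)) \<partial>count_space UNIV) < \<top>"
  shows "(\<lambda>k. norm (f k :: 'b::{banach, second_countable_topology})) summable_on UNIV"
    and "ennreal (norm (\<Sum>\<^sub>\<infinity>k. f k)) \<le> (\<integral>\<^sup>+k. ennreal (norm (f k)) \<partial>count_space UNIV)"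
proof -
  have int: "integrable (count_space UNIV) f" using assms by (simp add: integrable_iff_bounded)
  then have abs: "Infinite_Set_Sum.abs_summable_on f UNIV" by (simp add: Infinite_Set_Sum.abs_summable_on_def)
  then show "(\<lambda>k. norm (f k)) summable_on UNIV" by (simp add: abs_summable_equivalent)
  have "(\<Sum>\<^sub>\<infinity>k. f k) = integral\<^sup>L (count_space UNIV) f"
    using infsetsum_infsum[OF abs] by (simp add: infsetsum_def)
  moreover have "norm (integral\<^sup>L (count_space UNIV) f) \<le> integral\<^sup>L (count_space UNIV) (\<lambda>k. norm (f k))"
    by (rule integral_norm_bound)
  ultimately have "ennreal (norm (\<Sum>\<^sub>\<infinity>k. f k)) \<le> ennreal (integral\<^sup>L (count_space UNIV) (\<lambda>k. norm (f k)))"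
    by (simp add: ennreal_leI)
  also have "\<dots> = (\<integral>\<^sup>+k. ennreal (norm (f k)) \<partial>count_space UNIV)"
    using int by (subst nn_integral_eq_integral) auto
  finally show "ennreal (norm (\<Sum>\<^sub>\<infinity>k. f k)) \<le> (\<integral>\<^sup>+k. ennreal (norm (f k)) \<partial>count_space UNIV)" .
qed

lemma nn_integral_eq_infsum:
  assumes "f summable_on UNIV" "\<And>k. 0 \<le> f k"
  shows "(\<integral>\<^sup>+k. ennreal (f k) \<partial>count_space UNIV) = ennreal (\<Sum>\<^sub>\<infinity>k. f k)"
proof -
  have "Infinite_Set_Sum.abs_summable_on f UNIV"
    using assms abs_summable_equivalent[of f UNIV] by simp
  then have "integrable (count_space UNIV) f" "(\<Sum>\<^sub>\<infinity>k. f k) = integral\<^sup>L (count_space UNIV) f"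
    using infsetsum_infsum[of f UNIV] by (simp_all add: Infinite_Set_Sum.abs_summable_on_def infsetsum_def)
  then show ?thesis using assms(2) by (subst nn_integral_eq_integral) auto
qed

text \<open>Taking \<open>p\<close>-th powers turns the discrete inequality into one for the convolution of the
  sequences \<open>\<bar>a\<bar>\<^sup>p\<close> and \<open>\<bar>b\<bar>\<^sup>p\<close>.\<close>

lemma ennpowr_lpq_norm_products:
  fixes a b :: "'k::ab_group_add \<Rightarrow> complex" and w :: "'k \<Rightarrow> real"
  assumes "0 < p" "0 < q" "p < \<top>" "\<And>n. 0 \<le> w n"
  shows "ennpowr (lpq_norm p q (one_tensor w) (\<lambda>(k, n). a k * b (n - k))) (enn2real p)
    = Lp_norm (q / p) (count_space UNIV)
        (\<lambda>n. (\<integral>\<^sup>+k. ennreal (cmod (a k * b (n - k)) powr enn2real p) \<partial>count_space UNIV) * ennreal (w n powr enn2real p))"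
proof -
  have p: "0 < enn2real p" using assms by (simp add: exponent_pos)
  have "ennpowr (Lp_norm p (count_space UNIV) (\<lambda>k. ennreal (cmod (a k * b (n - k)) * w n))) (enn2real p)
    = (\<integral>\<^sup>+k. ennreal (cmod (a k * b (n - k)) powr enn2real p) \<partial>count_space UNIV) * ennreal (w n powr enn2real p)" for n
    using p assms(3,4) by (simp add: Lp_norm_count_space ennpowr_ennpowr ennreal_mult' ennpowr_mult nn_integral_multc) (simp add: ennpowr_ennreal ennreal_mult' nn_integral_multc)
  then show ?thesis
    using assms(1-3) by (simp add: lpq_norm_def mixed_norm_def one_tensor_def flip: Lp_norm_powr)
qed

text \<open>For sequences of moduli the inner sum of p-th powers is itself a convolution, so the two
  sides differ by taking powers. Two discrepancies have to be bridged: \<open>conv_embeds\<close>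
  also asserts absolute convergence, and it speaks only about sequences of finite norm.\<close>

lemma conv_embeds_iff:
  fixes w1 w2 w :: "'k::ab_group_add \<times> 'k \<Rightarrow> real"
  assumes pos: "0 < p1" "0 < p2" "0 < q1" "0 < q2" "0 < p" "0 < q" and fin: "p < \<top>"
    and w1: "\<And>i. 0 \<le> w1 i" "0 < w1 0 \<Longrightarrow> \<forall>i. 0 < w1 i"
    and w2: "\<And>i. 0 \<le> w2 i" "0 < w2 0 \<Longrightarrow> \<forall>i. 0 < w2 i" and w: "\<And>i. 0 < w i"
  shows "(\<exists>C::real. C > 0 \<and> (\<forall>a b. lpq_norm p q (one_tensor w) (\<lambda>(k, n). a k * b (n - k))
        \<le> ennreal C * lpq_norm p1 q1 w1 a * lpq_norm p2 q2 w2 b)) \<longleftrightarrow>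
    conv_embeds (lpq_norm (p1 / p) (q1 / p) (\<lambda>i. w1 i powr enn2real p))
      (lpq_norm (p2 / p) (q2 / p) (\<lambda>i. w2 i powr enn2real p))
      (lpq_norm (q / p) (q / p) (\<lambda>i. w i powr enn2real p))"
    (is "(\<exists>C. C > 0 \<and> (\<forall>a b. ?L a b \<le> ennreal C * ?A a * ?B b)) \<longleftrightarrow> conv_embeds ?NX ?NY ?NZ")
proof -
  define r where "r = enn2real p"
  have r: "0 < r" using pos fin by (simp add: r_def exponent_pos)
  have quot: "0 < s / p" if "0 < s" for s using that pos fin by (simp add: ennreal_zero_less_divide)
  define S where "S a b n = (\<integral>\<^sup>+k. ennreal (cmod (a k * b (n - k))) \<partial>count_space UNIV)" for a b :: "'k \<times> 'k \<Rightarrow> complex" and n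
  have L: "ennpowr (?L a b) r = Lp_norm (q / p) (count_space UNIV) (\<lambda>n. S a' b' n * ennreal (w n powr r))"
    if "\<And>k. cmod (a' k) = cmod (a k) powr r" "\<And>k. cmod (b' k) = cmod (b k) powr r" for a b a' b'
    using pos fin less_imp_le[OF w] that
    by (subst r_def, subst ennpowr_lpq_norm_products) (auto simp: S_def norm_mult powr_mult r_def)
  have A: "?NX a' = ennpowr (?A a) r" if "\<And>k. cmod (a' k) = cmod (a k) powr r" for a a'
    unfolding r_def using pos fin w1 that by (intro lpq_norm_powr) (auto simp: r_def)
  have B: "?NY a' = ennpowr (?B a) r" if "\<And>k. cmod (a' k) = cmod (a k) powr r" for a a'
    unfolding r_def using pos fin w2 that by (intro lpq_norm_powr) (auto simp: r_def)
  have Z: "?NZ c = Lp_norm (q / p) (count_space UNIV) (\<lambda>n. ennreal (cmod (c n)) * ennreal (w n powr r))" for c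
    using quot[OF pos(6)] by (simp add: lpq_norm_def mixed_norm_same_exponent ennreal_mult' r_def)
  show ?thesis
  proof
    assume "\<exists>C. C > 0 \<and> (\<forall>a b. ?L a b \<le> ennreal C * ?A a * ?B b)"
    then obtain C where C: "0 < C" "\<And>a b. ?L a b \<le> ennreal C * ?A a * ?B b" by blast
    have main: "Lp_norm (q / p) (count_space UNIV) (\<lambda>n. S a b n * ennreal (w n powr r)) \<le> ennreal (C powr r) * ?NX a * ?NY b" for a b
    proof -
      define a1 b1 where "a1 k = complex_of_real (cmod (a k) powr (1 / r))" and "b1 k = complex_of_real (cmod (b k) powr (1 / r))" for k
      have ab: "cmod (a k) = cmod (a1 k) powr r" "cmod (b k) = cmod (b1 k) powr r" for k
        using r by (simp_all add: a1_def b1_def powr_powr)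
      have "Lp_norm (q / p) (count_space UNIV) (\<lambda>n. S a b n * ennreal (w n powr r)) = ennpowr (?L a1 b1) r"
        by (rule L[OF ab, symmetric])
      also have "\<dots> \<le> ennpowr (ennreal C * ?A a1 * ?B b1) r"
        using r C by (intro ennpowr_mono) auto
      also have "\<dots> = ennreal (C powr r) * ?NX a * ?NY b"
        using C(1) by (simp add: ennpowr_mult ennpowr_ennreal A[OF ab(1)] B[OF ab(2)])
      finally show ?thesis .
    qed
    show "conv_embeds ?NX ?NY ?NZ"
      unfolding conv_embeds_def
    proof (intro exI[of _ "C powr r"] conjI allI impI)
      show "0 < C powr r" using C(1) by simp
      fix a b :: "'k \<times> 'k \<Rightarrow> complex" assume ab: "?NX a < \<infinity>" "?NY b < \<infinity>"
      \<comment> \<open>Absolute convergence at each \<open>n\<close> follows from the norm bound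
        because the target weight is positive there.\<close>
      have S: "S a b n < \<top>" for n
      proof -
        have "S a b n * ennreal (w n powr r) \<le> Lp_norm (q / p) (count_space UNIV) (\<lambda>n. S a b n * ennreal (w n powr r))"
          by (rule Lp_norm_ge_point[OF quot[OF pos(6)]])
        also have "\<dots> < \<top>" using ab by (intro le_less_trans[OF main]) (auto intro!: ennreal_mult_less_top[THEN iffD2])
        finally show ?thesis using w[of n] by (auto simp: ennreal_mult_less_top)
      qed
      then show "(\<lambda>k. cmod (a k * b (n - k))) summable_on UNIV" for n
        unfolding S_def by (rule summable_on_of_nn_integral)
      have "?NZ (seq_conv a b) \<le> Lp_norm (q / p) (count_space UNIV) (\<lambda>n. S a b n * ennreal (w n powr r))"
        unfolding Z seq_conv_def using S unfolding S_def
        by (intro Lp_norm_mono quot pos mult_right_mono summable_on_of_nn_integral) auto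
      also have "\<dots> \<le> ennreal (C powr r) * ?NX a * ?NY b" by (rule main)
      finally show "?NZ (seq_conv a b) \<le> ennreal (C powr r) * ?NX a * ?NY b" .
    qed
  next
    assume "conv_embeds ?NX ?NY ?NZ"
    then obtain C where C: "0 < C" and summ: "\<And>a b n. ?NX a < \<infinity> \<Longrightarrow> ?NY b < \<infinity> \<Longrightarrow> (\<lambda>k. cmod (a k * b (n - k))) summable_on UNIV"
      and le: "\<And>a b. ?NX a < \<infinity> \<Longrightarrow> ?NY b < \<infinity> \<Longrightarrow> ?NZ (seq_conv a b) \<le> ennreal C * ?NX a * ?NY b"
      unfolding conv_embeds_def by blast
    \<comment> \<open>Testing with unit masses at the origin shows that neither domain weight
      vanishes there, since otherwise a positive number would be bounded by 0. Hence both are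
      positive everywhere.\<close>
    let ?\<delta> = "\<lambda>k::'k \<times> 'k. if k = 0 then 1 else (0 :: complex)"
    have NX\<delta>: "?NX ?\<delta> = ennreal (w1 0 powr r)" and NY\<delta>: "?NY ?\<delta> = ennreal (w2 0 powr r)"
      using pos quot by (simp_all add: lpq_norm_delta r_def)
    have "?\<delta> k * ?\<delta> (0 - k) = ?\<delta> k" for k by simp
    then have "seq_conv ?\<delta> ?\<delta> 0 = (\<Sum>\<^sub>\<infinity>k. ?\<delta> k)"
      unfolding seq_conv_def by presburger
    also have "\<dots> = (\<Sum>\<^sub>\<infinity>k\<in>{0::'k \<times> 'k}. 1)"
      by (rule infsum_cong_neutral) auto
    finally have "seq_conv ?\<delta> ?\<delta> 0 = 1" by simp
    then have "ennreal (w 0 powr r) \<le> ?NZ (seq_conv ?\<delta> ?\<delta>)"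
      unfolding Z using Lp_norm_ge_point[OF quot[OF pos(6)], of "\<lambda>n. ennreal (cmod (seq_conv ?\<delta> ?\<delta> n)) * ennreal (w n powr r)" 0] by simp
    also have "\<dots> \<le> ennreal C * ennreal (w1 0 powr r) * ennreal (w2 0 powr r)"
      using le[of ?\<delta> ?\<delta>] unfolding NX\<delta> NY\<delta> by simp
    finally have "w1 0 \<noteq> 0" "w2 0 \<noteq> 0" using w[of 0] by auto
    then have w12: "0 < w1 i" "0 < w2 i" for i using w1 w2 by (metis order_le_less)+
    have "?L a b \<le> ennreal (C powr (1 / r)) * ?A a * ?B b" for a b
    \<comment> \<open>In the extended reals 0 times infinity is 0, so a vanishing norm makes the
      right side 0 even if the other norm is infinite, a case the embedding does not address.
      Positive weights force the sequence of norm 0 to vanish.\<close>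
    proof (cases "?A a = 0 \<or> ?B b = 0")
      case True
      then have "(\<forall>k. a k = 0) \<or> (\<forall>k. b k = 0)"
        using lpq_norm_eq_0D[of p1 q1 w1 a] lpq_norm_eq_0D[of p2 q2 w2 b] pos w12 by blast
      then have "(\<lambda>(k, n). a k * b (n - k)) = (\<lambda>_. 0)" by (auto simp: fun_eq_iff)
      moreover have "Lp_norm p (count_space UNIV) (\<lambda>k::'k \<times> 'k. 0) = 0" "Lp_norm q (count_space UNIV) (\<lambda>k::'k \<times> 'k. 0) = 0"
        using Lp_norm_delta[OF pos(5), of undefined 0] Lp_norm_delta[OF pos(6), of undefined 0] by simp_all
      ultimately show ?thesis by (simp add: lpq_norm_def mixed_norm_def)
    next
      case nz: False
      show ?thesis
      proof (cases "?A a = \<top> \<or> ?B b = \<top>")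
        case True
        with nz C show ?thesis by (auto simp: ennreal_mult_top ennreal_top_mult ennreal_mult_eq_top_iff)
      next
        case False
        define a1 b1 where "a1 k = complex_of_real (cmod (a k) powr r)" and "b1 k = complex_of_real (cmod (b k) powr r)" for k
        have ab: "cmod (a1 k) = cmod (a k) powr r" "cmod (b1 k) = cmod (b k) powr r" for k
          by (simp_all add: a1_def b1_def)
        have lt: "?NX a1 < \<infinity>" "?NY b1 < \<infinity>" using False by (simp_all add: A[OF ab(1)] B[OF ab(2)] less_top)
        \<comment> \<open>The terms are nonnegative reals, so no cancellation occurs in the
          convolution.\<close>
        have eq: "S a1 b1 n = ennreal (cmod (seq_conv a1 b1 n))" for n
        proof -
          have re: "a1 k * b1 (n - k) = complex_of_real (cmod (a1 k * b1 (n - k)))" for k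
            by (simp add: a1_def b1_def norm_mult)
          have "((\<lambda>k. complex_of_real (cmod (a1 k * b1 (n - k)))) has_sum complex_of_real (\<Sum>\<^sub>\<infinity>k. cmod (a1 k * b1 (n - k)))) UNIV"
            by (intro has_sum_of_real has_sum_infsum summ lt)
          then have "seq_conv a1 b1 n = complex_of_real (\<Sum>\<^sub>\<infinity>k. cmod (a1 k * b1 (n - k)))"
            unfolding seq_conv_def by (subst re) (rule infsumI)
          moreover have "0 \<le> (\<Sum>\<^sub>\<infinity>k. cmod (a1 k * b1 (n - k)))" by (rule infsum_nonneg) simp
          ultimately show ?thesis
            unfolding S_def by (subst nn_integral_eq_infsum[OF summ[OF lt]]) auto
        qed
        have "ennpowr (?L a b) r = Lp_norm (q / p) (count_space UNIV) (\<lambda>n. S a1 b1 n * ennreal (w n powr r))"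
          by (rule L[OF ab])
        also have "\<dots> = ?NZ (seq_conv a1 b1)" by (simp add: Z eq)
        also have "\<dots> \<le> ennreal C * ?NX a1 * ?NY b1" by (rule le[OF lt])
        finally have "?L a b \<le> ennpowr (ennreal C * ?NX a1 * ?NY b1) (1 / r)"
          using r by (simp only: ennpowr_le_iff)
        also have "\<dots> = ennreal (C powr (1 / r)) * ?A a * ?B b"
          using C r by (simp add: A[OF ab(1)] B[OF ab(2)] ennpowr_mult ennpowr_ennpowr ennpowr_ennreal)
        finally show ?thesis .
      qed
    qed
    moreover have "0 < C powr (1 / r)" using C by simp
    ultimately show "\<exists>C. C > 0 \<and> (\<forall>a b. ?L a b \<le> ennreal C * ?A a * ?B b)" by blast
  qed
qed

section \<open>Adapted coordinates and the three cases of \<tau>\<close>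

text \<open>Moderateness compares any two points, so a weight that vanishes somewhere vanishes
  everywhere.\<close>

lemma poly_moderate_pos:
  assumes "poly_moderate m" "0 < m z"
  shows "0 < m w"
proof -
  obtain C N where "0 \<le> C" "m z \<le> C * (1 + norm (z - w)) ^ N * m w" using poly_moderateE[OF assms(1)] by metis
  with assms show ?thesis
    using poly_moderate_nonneg[OF assms(1), of w] by (metis order_le_less mult_zero_right not_less)
qed

lemma lattice_point_diff: "lattice_point (k - n) = lattice_point k - lattice_point n"
  by (cases k; cases n) (simp add: lattice_point_eq int_vec_diff)

lemma dilate_weight_eq: "dilate_weight s t m = (\<lambda>z. m (dil s t z))"
  by (simp add: dilate_weight_def dil_def case_prod_unfold)

lemma dil_1: "dil 1 1 z = z"
  by (simp add: dil_def)

text \<open>Here \<open>k\<close> is \<open>arg1 \<tau> w\<close>. The average of the two points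
  with weights \<open>1 - \<tau>\<close> and \<tau> has first component \<open>\<xi>1\<close>, the
  average with weights \<tau> and \<open>1 - \<tau>\<close> has second component
  \<open>\<xi>2\<close>. Dividing these by \<open>1 - \<tau>\<close> and by \<tau> writes
  \<open>n\<close> as \<open>k\<close> plus a dilate of \<open>arg2 \<tau> w\<close>; this is the
  origin of the dilations in both modified weights.\<close>

lemma adapted_coordinates_interior:
  fixes \<tau> :: real
  assumes "0 < \<tau>" "\<tau> < 1"
  shows "adapted_coordinates \<tau> ((1 - \<tau>) / \<tau>) (\<tau> / (1 - \<tau>)) fst (\<lambda>(k, n). n - k)
    (\<lambda>(k, n). ((1 / (1 - \<tau>)) *\<^sub>R (\<tau> *\<^sub>R snd n - snd k), (1 / \<tau>) *\<^sub>R (fst k - (1 - \<tau>) *\<^sub>R fst n)))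
    (dil (1 - \<tau>) \<tau>) (arg1 \<tau>) (dil (1 / (1 - \<tau>)) (1 / \<tau>))
    fst (\<lambda>(k, n). n - k :: (int ^ 'd) \<times> (int ^ 'd))"
  unfolding adapted_coordinates_def
proof (intro conjI allI impI)
  show "0 \<le> \<tau>" "\<tau> \<le> 1" "(1 - \<tau>) / \<tau> \<noteq> 0" "\<tau> / (1 - \<tau>) \<noteq> 0" using assms by auto
  show "linear (fst :: ((real ^ 'd) \<times> (real ^ 'd)) \<times> ((real ^ 'd) \<times> (real ^ 'd)) \<Rightarrow> _)" by (rule linear_fst)
  show "linear (\<lambda>(k, n). n - k :: (real ^ 'd) \<times> (real ^ 'd))"
    by (rule linearI) (auto simp: algebra_simps)
  show "linear (\<lambda>(k, n). ((1 / (1 - \<tau>)) *\<^sub>R (\<tau> *\<^sub>R snd n - snd k), (1 / \<tau>) *\<^sub>R (fst k - (1 - \<tau>) *\<^sub>R fst n)) :: (real ^ 'd) \<times> (real ^ 'd))"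
    by (rule linearI) (auto simp: algebra_simps)
  show "linear (arg1 \<tau> :: _ \<Rightarrow> (real ^ 'd) \<times> (real ^ 'd))"
    by (rule linearI) (auto simp: arg1_def algebra_simps)
  show "linear (dil (1 - \<tau>) \<tau> :: _ \<Rightarrow> (real ^ 'd) \<times> (real ^ 'd))" by (rule linear_dil)
  show "linear (dil (1 / (1 - \<tau>)) (1 / \<tau>) :: _ \<Rightarrow> (real ^ 'd) \<times> (real ^ 'd))" by (rule linear_dil)
next
  fix w :: "((real ^ 'd) \<times> (real ^ 'd)) \<times> ((real ^ 'd) \<times> (real ^ 'd))"
  show "arg2 \<tau> w = dil ((1 - \<tau>) / \<tau>) (\<tau> / (1 - \<tau>)) (case (arg1 \<tau> w, dil (1 / (1 - \<tau>)) (1 / \<tau>) (snd w)) of (k, n) \<Rightarrow> n - k)"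
    using assms by (auto simp: arg1_def arg2_def dil_def prod_eq_iff vec_eq_iff divide_simps) (simp_all add: algebra_simps)
next
  fix k n :: "(real ^ 'd) \<times> (real ^ 'd)"
  show "args_inv \<tau> (fst (k, n), dil ((1 - \<tau>) / \<tau>) (\<tau> / (1 - \<tau>)) (case (k, n) of (k, n) \<Rightarrow> n - k))
    = (case (k, n) of (k, n) \<Rightarrow> ((1 / (1 - \<tau>)) *\<^sub>R (\<tau> *\<^sub>R snd n - snd k), (1 / \<tau>) *\<^sub>R (fst k - (1 - \<tau>) *\<^sub>R fst n)), dil (1 - \<tau>) \<tau> n)"
    using assms by (auto simp: args_inv_def dil_def prod_eq_iff vec_eq_iff divide_simps) (simp_all add: algebra_simps)
qed (use assms in \<open>auto simp: lattice_point_diff dil_def arg1_def prod_eq_iff vec_eq_iff\<close>)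

text \<open>One coordinate of each evaluation point is already a component of \<xi>: the points are
  \<open>(\<xi>1, \<xi>2 - x1)\<close> and \<open>(\<xi>1 - x2, \<xi>2)\<close>. The two other
  coordinates vary independently and serve as \<open>k\<close>, so no dilation arises.\<close>

lemma adapted_coordinates_0:
  "adapted_coordinates 0 1 1 (\<lambda>((k1, k2), (n1, n2)). (n1, k1)) (\<lambda>((k1, k2), (n1, n2)). (k2, n2))
    (\<lambda>((k1, k2), (n1, n2)). (n2 - k1, n1 - k2)) (\<lambda>n. n)
    (\<lambda>((x1, x2), (\<xi>1, \<xi>2)). (\<xi>2 - x1, \<xi>1 - x2)) (\<lambda>\<xi>. \<xi>)
    (\<lambda>((k1, k2), (n1, n2)). (n1, k1)) (\<lambda>((k1, k2), (n1, n2)). (k2 :: int ^ 'd, n2))"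
  unfolding adapted_coordinates_def
  by (auto intro!: linearI simp: lattice_point_eq arg1_def arg2_def args_inv_def dil_1 algebra_simps zero_prod_def)

text \<open>The points are now \<open>(\<xi>1 + x2, \<xi>2)\<close> and
  \<open>(\<xi>1, \<xi>2 + x1)\<close>. Compared with \<tau> = 0 the index patterns of the two
  factors are exchanged, which is why the sequences change places in the condition.\<close>

lemma adapted_coordinates_1:
  "adapted_coordinates 1 1 1 (\<lambda>((k1, k2), (n1, n2)). (k2, n2)) (\<lambda>((k1, k2), (n1, n2)). (n1, k1))
    (\<lambda>((k1, k2), (n1, n2)). (k1 - n2, k2 - n1)) (\<lambda>n. n)
    (\<lambda>((x1, x2), (\<xi>1, \<xi>2)). (\<xi>2 + x1, \<xi>1 + x2)) (\<lambda>\<xi>. \<xi>)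
    (\<lambda>((k1, k2), (n1, n2)). (k2, n2)) (\<lambda>((k1, k2), (n1, n2)). (n1 :: int ^ 'd, k1))"
  unfolding adapted_coordinates_def
  by (auto intro!: linearI simp: lattice_point_eq arg1_def arg2_def args_inv_def dil_1 algebra_simps zero_prod_def)

theorem theorem1p4:
  fixes p1 p2 q1 q2 p q :: ennreal and \<tau> :: real
    and m m1 m2 :: "(real ^ 'd) \<times> (real ^ 'd) \<Rightarrow> real"
    and \<phi> :: "real ^ 'd \<Rightarrow> complex" and \<Phi> :: "(real ^ 'd) \<times> (real ^ 'd) \<Rightarrow> complex"
  assumes "0 < p1" "0 < p2" "0 < q1" "0 < q2" "0 < p" "0 < q"
    and "0 \<le> \<tau>" "\<tau> \<le> 1"
    and "m \<in> poly_moderate_weights" "m1 \<in> poly_moderate_weights" "m2 \<in> poly_moderate_weights"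
    and "schwartz \<phi>" "\<phi> \<noteq> (\<lambda>_. 0)" "schwartz \<Phi>" "\<Phi> \<noteq> (\<lambda>_. 0)"
  shows "let
      bounded_W = wigner_bounded \<tau> (modulation_norm \<phi> p1 q1 m1) (modulation_norm \<phi> p2 q2 m2)
                    (amalgam_norm \<Phi> p q m);
      mt = dilate_weight (1 - \<tau>) \<tau> m;
      m2t = dilate_weight ((1 - \<tau>) / \<tau>) (\<tau> / (1 - \<tau>)) m2;
      cond = (\<exists>C::real. C > 0 \<and> (\<forall>a b.
        lpq_norm p q (one_tensor (mt \<circ> lattice_point))
            (\<lambda>((k1, k2), (n1, n2)). a (k1, k2) * b (n1 - k1, n2 - k2))
          \<le> ennreal C * lpq_norm p1 q1 (m1 \<circ> lattice_point) a
                       * lpq_norm p2 q2 (m2t \<circ> lattice_point) b))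
    in
      (0 < \<tau> \<and> \<tau> < 1 \<longrightarrow> (bounded_W \<longleftrightarrow> cond)) \<and>
      (\<tau> = 0 \<longrightarrow> (bounded_W \<longleftrightarrow> (\<exists>C::real. C > 0 \<and> (\<forall>a b.
        lpq_norm p q (one_tensor (m \<circ> lattice_point))
            (\<lambda>((k1, k2), (n1, n2)). a (n1, k1) * b (k2, n2))
          \<le> ennreal C * lpq_norm p1 q1 (m1 \<circ> lattice_point) a
                       * lpq_norm p2 q2 (m2 \<circ> lattice_point) b)))) \<and>
      (\<tau> = 1 \<longrightarrow> (bounded_W \<longleftrightarrow> (\<exists>C::real. C > 0 \<and> (\<forall>a b.
        lpq_norm p q (one_tensor (m \<circ> lattice_point))
            (\<lambda>((k1, k2), (n1, n2)). a (n1, k1) * b (k2, n2))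
          \<le> ennreal C * lpq_norm p1 q1 (m1 \<circ> lattice_point) b
                       * lpq_norm p2 q2 (m2 \<circ> lattice_point) a)))) \<and>
      (0 < \<tau> \<and> \<tau> < 1 \<and> p < \<infinity> \<and> m \<noteq> (\<lambda>_. 0) \<longrightarrow>
        (cond \<longleftrightarrow> conv_embeds
          (lpq_norm (p1 / p) (q1 / p) (weight_power m1 p \<circ> lattice_point))
          (lpq_norm (p2 / p) (q2 / p) (weight_power m2t p \<circ> lattice_point))
          (lpq_norm (q / p) (q / p) (weight_power mt p \<circ> lattice_point))))"
proof -
  have pm: "poly_moderate m" "poly_moderate m1" "poly_moderate m2"
    by (rule poly_moderate_weights_imp, fact)+
  note char = wigner_bounded_iff_discrete[OF _ assms(1-6) pm assms(12-15)]
  let ?bounded = "wigner_bounded \<tau> (modulation_norm \<phi> p1 q1 m1) (modulation_norm \<phi> p2 q2 m2) (amalgam_norm \<Phi> p q m)"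
  let ?mt = "dilate_weight (1 - \<tau>) \<tau> m" and ?m2t = "dilate_weight ((1 - \<tau>) / \<tau>) (\<tau> / (1 - \<tau>)) m2"
  let ?cond = "\<exists>C::real. C > 0 \<and> (\<forall>a b.
    lpq_norm p q (one_tensor (?mt \<circ> lattice_point)) (\<lambda>((k1, k2), (n1, n2)). a (k1, k2) * b (n1 - k1, n2 - k2))
      \<le> ennreal C * lpq_norm p1 q1 (m1 \<circ> lattice_point) a * lpq_norm p2 q2 (?m2t \<circ> lattice_point) b)"
  have shift: "(\<lambda>((k1, k2), (n1, n2)). a (k1, k2) * b (n1 - k1, n2 - k2)) = (\<lambda>(k, n). a k * b (n - k))"
    for a b :: "(int ^ 'd) \<times> (int ^ 'd) \<Rightarrow> complex"
    by (auto simp: fun_eq_iff)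
  have interior: "?bounded \<longleftrightarrow> ?cond" if "0 < \<tau>" "\<tau> < 1"
    using char[OF adapted_coordinates_interior[OF that]] by (simp add: shift dilate_weight_eq)
  have zero: "?bounded \<longleftrightarrow> (\<exists>C::real. C > 0 \<and> (\<forall>a b.
        lpq_norm p q (one_tensor (m \<circ> lattice_point)) (\<lambda>((k1, k2), (n1, n2)). a (n1, k1) * b (k2, n2))
          \<le> ennreal C * lpq_norm p1 q1 (m1 \<circ> lattice_point) a * lpq_norm p2 q2 (m2 \<circ> lattice_point) b))"
    if "\<tau> = 0"
    using char[of 0, OF adapted_coordinates_0] unfolding that by (simp add: dil_1 case_prod_unfold)
  have one: "?bounded \<longleftrightarrow> (\<exists>C::real. C > 0 \<and> (\<forall>a b.
        lpq_norm p q (one_tensor (m \<circ> lattice_point)) (\<lambda>((k1, k2), (n1, n2)). a (n1, k1) * b (k2, n2))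
          \<le> ennreal C * lpq_norm p1 q1 (m1 \<circ> lattice_point) b * lpq_norm p2 q2 (m2 \<circ> lattice_point) a))"
    if "\<tau> = 1"
  proof -
    have "(\<lambda>(k, n). a ((\<lambda>((k1, k2), (n1, n2)). (k2, n2)) (k, n)) * b ((\<lambda>((k1, k2), (n1, n2)). (n1, k1)) (k, n)))
      = (\<lambda>((k1, k2), (n1, n2)). b (n1, k1) * a (k2, n2))" for a b :: "(int ^ 'd) \<times> (int ^ 'd) \<Rightarrow> complex"
      by (auto simp: fun_eq_iff)
    \<comment> \<open>The sequence belonging to \<open>f1\<close> carries the indices
      \<open>(k2, n2)\<close> and is therefore the one called \<open>b\<close>.\<close>
    then have "?bounded \<longleftrightarrow> (\<exists>C::real. C > 0 \<and> (\<forall>b a.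
        lpq_norm p q (one_tensor (m \<circ> lattice_point)) (\<lambda>((k1, k2), (n1, n2)). a (n1, k1) * b (k2, n2))
          \<le> ennreal C * lpq_norm p1 q1 (m1 \<circ> lattice_point) b * lpq_norm p2 q2 (m2 \<circ> lattice_point) a))"
      using char[of 1, OF adapted_coordinates_1] unfolding that dil_1 by simp
    then show ?thesis by blast
  qed
  have conv: "?cond \<longleftrightarrow> conv_embeds (lpq_norm (p1 / p) (q1 / p) (weight_power m1 p \<circ> lattice_point))
      (lpq_norm (p2 / p) (q2 / p) (weight_power ?m2t p \<circ> lattice_point))
      (lpq_norm (q / p) (q / p) (weight_power ?mt p \<circ> lattice_point))"
    if \<tau>: "0 < \<tau>" "\<tau> < 1" and p: "p < \<infinity>" and m: "m \<noteq> (\<lambda>_. 0)"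
  proof -
    \<comment> \<open>A nonzero moderate weight is positive everywhere, which yields absolute
      convergence. For \<open>m = 0\<close> the sequence inequality holds trivially, while
      convolutions of sequences from the two domain spaces may diverge.\<close>
    obtain z where "m z \<noteq> 0" using m unfolding fun_eq_iff by blast
    then have "0 < m z" using poly_moderate_nonneg[OF pm(1), of z] by simp
    then have pos: "0 < (?mt \<circ> lattice_point) i" for i :: "(int ^ 'd) \<times> (int ^ 'd)"
      using poly_moderate_pos[OF pm(1)] by (simp add: dilate_weight_eq)
    have power: "weight_power u p \<circ> lattice_point = (\<lambda>i. (u \<circ> lattice_point) i powr enn2real p)"
      for u :: "(real ^ 'd) \<times> (real ^ 'd) \<Rightarrow> real"
      by (simp add: weight_power_def fun_eq_iff)
    show ?thesis
      unfolding shift power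
      by (rule conv_embeds_iff[OF assms(1-6) _ _ _ _ _ pos])
        (use p poly_moderate_nonneg[OF pm(2)] poly_moderate_nonneg[OF pm(3)] poly_moderate_pos[OF pm(2)] poly_moderate_pos[OF pm(3)]
          in \<open>auto simp: dilate_weight_eq\<close>)
  qed
  show ?thesis
    unfolding Let_def using interior zero one conv by blast
qed

end
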